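(* Let $\mathcal F$ be a saturated fusion system on a finite $p$-group $S$, and let $\mathcal H,\mathcal K$ be saturated fusion subsystems of $\mathcal F$ on subgroups $R,T\le S$ respectively. Suppose that $\mathcal K$ is weakly normal in $\mathcal F$, i.e. $\mathcal K$ is saturated and $\mathcal F$-invariant. Then $\mathcal F$ is the weak composition product of $\mathcal H$ and $\mathcal K$ if and only if the characteristic idempotents satisfy $$[R,\mathrm{id}]_S^R\circ\omega_{\mathcal F}\circ[T,\mathrm{id}]_T^S=\omega_{\mathcal H}\circ[R\cap T,\mathrm{id}]_T^R\circ\omega_{\mathcal K}.$$
   Context: Here $p$ is a prime and $p$-groups are finite. A fusion system $\mathcal F$ on a $p$-group $S$ is a category whose objects are the subgroups of $S$, whose morphism sets $\mathcal F(P,Q)=\mathrm{Hom}_{\mathcal F}(P,Q)$ consist of injective group homomorphisms $P\to Q$ (composed as homomorphisms) and contain all homomorphisms $P\to Q$ induced by conjugation by elements of $S$, and such that for each $\varphi\in\mathcal F(P,Q)$ the isomorphism $\varphi\colon P\to\varphi P$ and its inverse are morphisms of $\mathcal F$. Write $\mathrm{Aut}_{\mathcal F}(P)=\mathcal F(P,P)$. Subgroups $P,Q$ are $\mathcal F$-conjugate if they are isomorphic in $\mathcal F$; $[P]_{\mathcal F}$ is the set of $\mathcal F$-conjugates of $P$. $P$ is fully $\mathcal F$-normalized (resp. fully $\mathcal F$-centralized) if $|N_SP|\ge|N_SQ|$ (resp. $|C_SP|\ge|C_SQ|$) for all $Q\in[P]_{\mathcal F}$. $\mathcal F$ is saturated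 if for all $P\le S$: (1) if $P$ is fully $\mathcal F$-normalized, then $P$ is fully $\mathcal F$-centralized and $\mathrm{Aut}_S(P)$ is a Sylow $p$-subgroup of $\mathrm{Aut}_{\mathcal F}(P)$; (2) every $\varphi\in\mathcal F(P,S)$ with $\varphi(P)$ fully $\mathcal F$-centralized extends to a morphism in $\mathcal F(N_\varphi,S)$, where $N_\varphi=\{x\in N_S(P)\mid \exists y\in S:\varphi\circ c_x=c_y\circ\varphi\}$. A fusion subsystem of $\mathcal F$ on $R\le S$ is a subcategory of $\mathcal F$ that is a fusion system on $R$. $\mathcal F$-invariance (Aschbacher): a fusion subsystem $\mathcal K$ of $\mathcal F$ on $T\le S$ is $\mathcal F$-invariant if $T$ is strongly closed in $\mathcal F$ (i.e. $\varphi(P)\le T$ for all $P\le T$ and $\varphi\in\mathcal F(P,S)$), and whenever $A,B\le P\le T$ and $\varphi\in\mathcal F(P,T)$, conjugation by $\varphi$, $\kappa\mapsto\varphi\kappa\varphi^{-1}$, induces a bijection $\mathcal K(A,B)\to\mathcal K(\varphi A,\varphi B)$. Weak composition product (written $\mathcal F\approx\mathcal H\mathcal K$): $S=RT$, and for all $P\le T$ every morphism $\varphi\in\mathcal F(P,R)$ can be written as a composition $\varphi=\psi\rho$ where $\psi$ is a morphism of $\mathcal H$ and $\rho$ is a morphism of $\mathcal K$. Bisets: for finite groups $G,H$, a $(G,H)$-biset is a finite set with commuting right $G$-action and left $H$-action, regarded as a left $(H\times G)$-set via $(h,g).x=hxg^{-1}$. $A(G,H)$ is the Grothendieck group of isomorphism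 classes of $(G,H)$-bisets under disjoint union. Composition $\circ\colon A(H,K)\times A(G,H)\to A(G,K)$ is induced by $Y\circ X=Y\times_HX$. For $U\le G$ and a homomorphism $\varphi\colon U\to H$, $\Delta(U,\varphi)=\{(\varphi(u),u)\mid u\in U\}\le H\times G$ and $[U,\varphi]_G^H=[(H\times G)/\Delta(U,\varphi)]\in A(G,H)$. The subscript $(p)$ denotes tensoring with $\mathbb Z_{(p)}$. The displayed equation takes place in $A(T,R)_{(p)}$. Characteristic idempotent: for a fusion system $\mathcal F$ on $S$, $X\in A(S,S)_{(p)}$ is $\mathcal F$-generated if it is a $\mathbb Z_{(p)}$-linear combination of elements $[P,\varphi]_S^S$ with $P\le S$, $\varphi\in\mathcal F(P,S)$. It is right $\mathcal F$-stable if $X\circ[P,\varphi]_P^S=X\circ[P,\mathrm{id}]_P^S$, and left $\mathcal F$-stable if $[\varphi P,\varphi^{-1}]_S^P\circ X=[P,\mathrm{id}]_S^P\circ X$, for all $P\le S$, $\varphi\in\mathcal F(P,S)$. It is $\mathcal F$-characteristic if it is $\mathcal F$-generated, left and right $\mathcal F$-stable, and $\varepsilon(X)$ is invertible in $\mathbb Z_{(p)}$, where $\varepsilon$ is the $\mathbb Z_{(p)}$-linear extension of $X\mapsto|X|/|S|$ to the span of left-free bisets. For each saturated $\mathcal F$ there is exactly one idempotent (with respect to $\circ$) in $A(S,S)_{(p)}$ that is $\mathcal F$-characteristic; it is the characteristic idempotent $\omega_{\mathcal F}$. Thus $\omega_{\mathcal H}\in A(R,R)_{(p)}$ and $\omega_{\mathcal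 K}\in A(T,T)_{(p)}$. *)

theory Defs
  imports Complex_Main "HOL-Algebra.Group_Action" "HOL-Computational_Algebra.Primes" "HOL-Library.Poly_Mapping"
begin

section \<open>Fusion systems\<close>

definition p_group :: "nat \<Rightarrow> ('a, 'm) monoid_scheme \<Rightarrow> bool" where
  "p_group p S \<longleftrightarrow> prime p \<and> group S \<and> (\<exists>n. order S = p ^ n)"

definition conj_by :: "('a, 'm) monoid_scheme \<Rightarrow> 'a \<Rightarrow> 'a \<Rightarrow> 'a" where
  "conj_by S x u = x \<otimes>\<^bsub>S\<^esub> u \<otimes>\<^bsub>S\<^esub> inv\<^bsub>S\<^esub> x"

text \<open>
  A fusion system is given by its morphism sets \<open>F P Q\<close>; the values on sets that are not
  subgroups of \<open>S\<close> are irrelevant.  A homomorphism with domain \<open>P\<close> is represented by the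
  function that is \<open>undefined\<close> outside \<open>P\<close>, so that equality of homomorphisms is
  equality of functions, and composition is \<^const>\<open>compose\<close>.  Identities and
  inclusions are the case \<open>x = \<one>\<close> of \<open>conj_mem\<close>.
\<close>

type_synonym 'a hom_sets = "'a set \<Rightarrow> 'a set \<Rightarrow> ('a \<Rightarrow> 'a) set"

locale fusion_system = group S for S (structure) +
  fixes F :: "'a hom_sets"
  assumes mor_mono: "\<lbrakk>subgroup P S; subgroup Q S; \<phi> \<in> F P Q\<rbrakk>
      \<Longrightarrow> \<phi> \<in> mon (S\<lparr>carrier := P\<rparr>) (S\<lparr>carrier := Q\<rparr>) \<inter> extensional P"
    and comp_mem: "\<lbrakk>subgroup P S; subgroup Q S; subgroup U S; \<phi> \<in> F P Q; \<psi> \<in> F Q U\<rbrakk>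
      \<Longrightarrow> compose P \<psi> \<phi> \<in> F P U"
    and conj_mem: "\<lbrakk>subgroup P S; subgroup Q S; x \<in> carrier S; conj_by S x ` P \<subseteq> Q\<rbrakk>
      \<Longrightarrow> restrict (conj_by S x) P \<in> F P Q"
    and iso_mem: "\<lbrakk>subgroup P S; subgroup Q S; \<phi> \<in> F P Q\<rbrakk> \<Longrightarrow> \<phi> \<in> F P (\<phi> ` P)"
    and inv_mem: "\<lbrakk>subgroup P S; subgroup Q S; \<phi> \<in> F P Q\<rbrakk>
      \<Longrightarrow> restrict (inv_into P \<phi>) (\<phi> ` P) \<in> F (\<phi> ` P) P"

definition F_conjugate :: "'a hom_sets \<Rightarrow> 'a set \<Rightarrow> 'a set \<Rightarrow> bool" where
  "F_conjugate F P Q \<longleftrightarrow> (\<exists>\<phi>\<in>F P Q. \<exists>\<psi>\<in>F Q P.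
     compose P \<psi> \<phi> = (\<lambda>x\<in>P. x) \<and> compose Q \<phi> \<psi> = (\<lambda>x\<in>Q. x))"

definition centralizer :: "('a, 'm) monoid_scheme \<Rightarrow> 'a set \<Rightarrow> 'a set" where
  "centralizer S P = {x \<in> carrier S. \<forall>u\<in>P. x \<otimes>\<^bsub>S\<^esub> u = u \<otimes>\<^bsub>S\<^esub> x}"

definition fully_normalized :: "('a, 'm) monoid_scheme \<Rightarrow> 'a hom_sets \<Rightarrow> 'a set \<Rightarrow> bool" where
  "fully_normalized S F P \<longleftrightarrow>
     (\<forall>Q. subgroup Q S \<and> F_conjugate F P Q \<longrightarrow> card (normalizer S P) \<ge> card (normalizer S Q))"

definition fully_centralized :: "('a, 'm) monoid_scheme \<Rightarrow> 'a hom_sets \<Rightarrow> 'a set \<Rightarrow> bool" where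
  "fully_centralized S F P \<longleftrightarrow>
     (\<forall>Q. subgroup Q S \<and> F_conjugate F P Q \<longrightarrow> card (centralizer S P) \<ge> card (centralizer S Q))"

definition Aut_F :: "('a, 'm) monoid_scheme \<Rightarrow> 'a hom_sets \<Rightarrow> 'a set \<Rightarrow> ('a \<Rightarrow> 'a) monoid" where
  "Aut_F S F P = AutoGroup (S\<lparr>carrier := P\<rparr>)\<lparr>carrier := F P P\<rparr>"

definition Aut_S :: "('a, 'm) monoid_scheme \<Rightarrow> 'a set \<Rightarrow> ('a \<Rightarrow> 'a) set" where
  "Aut_S S P = (\<lambda>x. restrict (conj_by S x) P) ` normalizer S P"

definition sylow_subgroup :: "nat \<Rightarrow> 'b set \<Rightarrow> ('b, 'n) monoid_scheme \<Rightarrow> bool" where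
  "sylow_subgroup p Q A \<longleftrightarrow> subgroup Q A \<and> card Q = p ^ multiplicity p (order A)"

definition N_ext :: "('a, 'm) monoid_scheme \<Rightarrow> 'a set \<Rightarrow> ('a \<Rightarrow> 'a) \<Rightarrow> 'a set" where
  "N_ext S P \<phi> = {x \<in> normalizer S P.
     \<exists>y\<in>carrier S. \<forall>u\<in>P. \<phi> (conj_by S x u) = conj_by S y (\<phi> u)}"

definition saturated :: "nat \<Rightarrow> ('a, 'm) monoid_scheme \<Rightarrow> 'a hom_sets \<Rightarrow> bool" where
  "saturated p S F \<longleftrightarrow> (\<forall>P. subgroup P S \<longrightarrow>
     (fully_normalized S F P \<longrightarrow>
        fully_centralized S F P \<and> sylow_subgroup p (Aut_S S P) (Aut_F S F P)) \<and>
     (\<forall>\<phi>\<in>F P (carrier S). fully_centralized S F (\<phi> ` P) \<longrightarrow>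
        (\<exists>\<psi>\<in>F (N_ext S P \<phi>) (carrier S). \<forall>u\<in>P. \<psi> u = \<phi> u)))"

definition saturated_fusion_system ::
    "nat \<Rightarrow> ('a, 'm) monoid_scheme \<Rightarrow> 'a hom_sets \<Rightarrow> bool" where
  "saturated_fusion_system p S F \<longleftrightarrow> p_group p S \<and> fusion_system S F \<and> saturated p S F"

definition fusion_subsystem ::
    "('a, 'm) monoid_scheme \<Rightarrow> 'a hom_sets \<Rightarrow> 'a set \<Rightarrow> 'a hom_sets \<Rightarrow> bool" where
  "fusion_subsystem S F R H \<longleftrightarrow> subgroup R S \<and> fusion_system (S\<lparr>carrier := R\<rparr>) H \<and>
     (\<forall>P Q. subgroup P S \<and> P \<subseteq> R \<and> subgroup Q S \<and> Q \<subseteq> R \<longrightarrow> H P Q \<subseteq> F P Q)"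

definition strongly_closed :: "('a, 'm) monoid_scheme \<Rightarrow> 'a hom_sets \<Rightarrow> 'a set \<Rightarrow> bool" where
  "strongly_closed S F T \<longleftrightarrow>
     (\<forall>P. subgroup P S \<and> P \<subseteq> T \<longrightarrow> (\<forall>\<phi>\<in>F P (carrier S). \<phi> ` P \<subseteq> T))"

definition F_invariant ::
    "('a, 'm) monoid_scheme \<Rightarrow> 'a hom_sets \<Rightarrow> 'a set \<Rightarrow> 'a hom_sets \<Rightarrow> bool" where
  "F_invariant S F T K \<longleftrightarrow> fusion_subsystem S F T K \<and> strongly_closed S F T \<and>
     (\<forall>A B P. subgroup A S \<and> subgroup B S \<and> subgroup P S \<and> A \<subseteq> P \<and> B \<subseteq> P \<and> P \<subseteq> T \<longrightarrow>
        (\<forall>\<phi>\<in>F P T. bij_betw (\<lambda>\<kappa>. \<lambda>x\<in>\<phi> ` A. \<phi> (\<kappa> (inv_into P \<phi> x)))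
           (K A B) (K (\<phi> ` A) (\<phi> ` B))))"

definition weakly_normal ::
    "nat \<Rightarrow> ('a, 'm) monoid_scheme \<Rightarrow> 'a hom_sets \<Rightarrow> 'a set \<Rightarrow> 'a hom_sets \<Rightarrow> bool" where
  "weakly_normal p S F T K \<longleftrightarrow>
     saturated_fusion_system p (S\<lparr>carrier := T\<rparr>) K \<and> F_invariant S F T K"

text \<open>The composite of a morphism of \<open>K\<close> and a morphism of \<open>H\<close> passes through an object
  of both, that is, a subgroup of \<open>R \<inter> T\<close>.\<close>

definition weak_composition_product ::
    "('a, 'm) monoid_scheme \<Rightarrow> 'a hom_sets \<Rightarrow> 'a set \<Rightarrow> 'a hom_sets \<Rightarrow>
     'a set \<Rightarrow> 'a hom_sets \<Rightarrow> bool" where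
  "weak_composition_product S F R H T K \<longleftrightarrow> carrier S = R <#>\<^bsub>S\<^esub> T \<and>
     (\<forall>P. subgroup P S \<and> P \<subseteq> T \<longrightarrow> (\<forall>\<phi>\<in>F P R.
        \<exists>Q. subgroup Q S \<and> Q \<subseteq> R \<inter> T \<and> (\<exists>\<rho>\<in>K P Q. \<exists>\<psi>\<in>H Q R. \<phi> = compose P \<psi> \<rho>)))"


section \<open>Bisets\<close>

record ('x, 'g, 'h) biset =
  points :: "'x set"
  lact :: "'h \<Rightarrow> 'x \<Rightarrow> 'x"
  ract :: "'x \<Rightarrow> 'g \<Rightarrow> 'x"

locale is_biset = G: group G + H: group H
  for G :: "('g, 'm) monoid_scheme" and H :: "('h, 'n) monoid_scheme" +
  fixes X :: "('x, 'g, 'h) biset"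
  assumes finite_points: "finite (points X)"
    and lact_closed: "\<lbrakk>h \<in> carrier H; x \<in> points X\<rbrakk> \<Longrightarrow> lact X h x \<in> points X"
    and lact_one: "x \<in> points X \<Longrightarrow> lact X \<one>\<^bsub>H\<^esub> x = x"
    and lact_mult: "\<lbrakk>h \<in> carrier H; h' \<in> carrier H; x \<in> points X\<rbrakk>
      \<Longrightarrow> lact X (h \<otimes>\<^bsub>H\<^esub> h') x = lact X h (lact X h' x)"
    and ract_closed: "\<lbrakk>g \<in> carrier G; x \<in> points X\<rbrakk> \<Longrightarrow> ract X x g \<in> points X"
    and ract_one: "x \<in> points X \<Longrightarrow> ract X x \<one>\<^bsub>G\<^esub> = x"
    and ract_mult: "\<lbrakk>g \<in> carrier G; g' \<in> carrier G; x \<in> points X\<rbrakk>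
      \<Longrightarrow> ract X x (g \<otimes>\<^bsub>G\<^esub> g') = ract X (ract X x g) g'"
    and acts_commute: "\<lbrakk>h \<in> carrier H; g \<in> carrier G; x \<in> points X\<rbrakk>
      \<Longrightarrow> lact X h (ract X x g) = ract X (lact X h x) g"

definition biset_iso :: "('g, 'm) monoid_scheme \<Rightarrow> ('h, 'n) monoid_scheme \<Rightarrow>
    ('x, 'g, 'h) biset \<Rightarrow> ('y, 'g, 'h) biset \<Rightarrow> bool" where
  "biset_iso G H X Y \<longleftrightarrow> (\<exists>f. bij_betw f (points X) (points Y) \<and>
     (\<forall>x\<in>points X. (\<forall>h\<in>carrier H. f (lact X h x) = lact Y h (f x)) \<and>
                   (\<forall>g\<in>carrier G. f (ract X x g) = ract Y (f x) g)))"

definition biset_sum ::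
    "('x, 'g, 'h) biset \<Rightarrow> ('y, 'g, 'h) biset \<Rightarrow> ('x + 'y, 'g, 'h) biset" where
  "biset_sum X Y = \<lparr>points = points X <+> points Y,
     lact = (\<lambda>h. map_sum (lact X h) (lact Y h)),
     ract = (\<lambda>z g. map_sum (\<lambda>x. ract X x g) (\<lambda>y. ract Y y g) z)\<rparr>"

text \<open>\<open>Y \<times>\<^bsub>H\<^esub> X\<close>, for a \<open>(G, H)\<close>-biset \<open>X\<close> and an \<open>(H, K)\<close>-biset \<open>Y\<close>.\<close>

definition biset_prod :: "('h, 'n) monoid_scheme \<Rightarrow> ('y, 'h, 'k) biset \<Rightarrow> ('x, 'g, 'h) biset \<Rightarrow>
    (('y \<times> 'x) set, 'g, 'k) biset" where
  "biset_prod H Y X = \<lparr>points = (points Y \<times> points X) //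
       {((ract Y y h, x), (y, lact X h x)) | y h x. y \<in> points Y \<and> h \<in> carrier H \<and> x \<in> points X},
     lact = (\<lambda>k C. (\<lambda>(y, x). (lact Y k y, x)) ` C),
     ract = (\<lambda>C g. (\<lambda>(y, x). (y, ract X x g)) ` C)\<rparr>"

definition graph_subgroup :: "'g set \<Rightarrow> ('g \<Rightarrow> 'h) \<Rightarrow> ('h \<times> 'g) set" where
  "graph_subgroup U \<phi> = {(\<phi> u, u) | u. u \<in> U}"

text \<open>The left \<open>(H \<times> G)\<close>-set \<open>(H \<times> G)/\<Delta>(U, \<phi>)\<close>; under \<open>(h, g).x = h x g\<^sup>-\<^sup>1\<close> an element
  \<open>g\<close> acts from the right as \<open>(\<one>, g\<^sup>-\<^sup>1)\<close>.\<close>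

definition coset_biset :: "('g, 'm) monoid_scheme \<Rightarrow> ('h, 'n) monoid_scheme \<Rightarrow> 'g set \<Rightarrow>
    ('g \<Rightarrow> 'h) \<Rightarrow> (('h \<times> 'g) set, 'g, 'h) biset" where
  "coset_biset G H U \<phi> =
     \<lparr>points = (\<lambda>a. a <#\<^bsub>H \<times>\<times> G\<^esub> graph_subgroup U \<phi>) ` carrier (H \<times>\<times> G),
      lact = (\<lambda>h C. (h, \<one>\<^bsub>G\<^esub>) <#\<^bsub>H \<times>\<times> G\<^esub> C),
      ract = (\<lambda>C g. (\<one>\<^bsub>H\<^esub>, inv\<^bsub>G\<^esub> g) <#\<^bsub>H \<times>\<times> G\<^esub> C)\<rparr>"


section \<open>The localized Burnside modules\<close>

definition Z_loc :: "nat \<Rightarrow> rat set" where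
  "Z_loc p = {of_int a / of_int b | a b. \<not> int p dvd b}"

text \<open>
  Every finite biset, over whatever type of points, has an isomorphic copy on a set of natural
  numbers; its isomorphism class is represented by the set of all these copies.
\<close>

type_synonym ('g, 'h) biset_class = "(nat, 'g, 'h) biset set"

definition iso_class :: "('g, 'm) monoid_scheme \<Rightarrow> ('h, 'n) monoid_scheme \<Rightarrow>
    ('x, 'g, 'h) biset \<Rightarrow> ('g, 'h) biset_class" where
  "iso_class G H X = {Z. is_biset G H Z \<and> biset_iso G H X Z}"

definition biset_classes :: "('g, 'm) monoid_scheme \<Rightarrow> ('h, 'n) monoid_scheme \<Rightarrow>
    ('g, 'h) biset_class set" where
  "biset_classes G H = iso_class G H ` {X :: (nat, 'g, 'h) biset. is_biset G H X}"

text \<open>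
  \<open>A(G, H)\<^sub>(\<^sub>p\<^sub>)\<close> is the free \<open>\<int>\<^sub>(\<^sub>p\<^sub>)\<close>-module on the isomorphism classes of \<open>(G, H)\<close>-bisets
  modulo the \<open>\<int>\<^sub>(\<^sub>p\<^sub>)\<close>-span of the elements \<open>[X + Y] - [X] - [Y]\<close>.  Since tensoring is right
  exact, this is \<open>\<int>\<^sub>(\<^sub>p\<^sub>)\<close> tensored with the Grothendieck group.
\<close>

type_synonym ('g, 'h) formal_sum = "('g, 'h) biset_class \<Rightarrow>\<^sub>0 rat"
type_synonym ('g, 'h) burnside = "('g, 'h) formal_sum set"

definition formal_sums :: "nat \<Rightarrow> ('g, 'm) monoid_scheme \<Rightarrow> ('h, 'n) monoid_scheme \<Rightarrow>
    ('g, 'h) formal_sum set" where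
  "formal_sums p G H = {x. Poly_Mapping.keys x \<subseteq> biset_classes G H \<and>
     (\<forall>c. Poly_Mapping.lookup x c \<in> Z_loc p)}"

inductive_set sum_relations :: "nat \<Rightarrow> ('g, 'm) monoid_scheme \<Rightarrow> ('h, 'n) monoid_scheme \<Rightarrow>
    ('g, 'h) formal_sum set"
  for p :: nat and G :: "('g, 'm) monoid_scheme" and H :: "('h, 'n) monoid_scheme" where
  zero: "0 \<in> sum_relations p G H"
| add: "\<lbrakk>z \<in> sum_relations p G H; a \<in> Z_loc p;
         is_biset G H (X :: (nat, 'g, 'h) biset); is_biset G H (Y :: (nat, 'g, 'h) biset)\<rbrakk>
    \<Longrightarrow> z + (Poly_Mapping.single (iso_class G H (biset_sum X Y)) a
            - Poly_Mapping.single (iso_class G H X) a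
            - Poly_Mapping.single (iso_class G H Y) a) \<in> sum_relations p G H"

definition burnside_rel :: "nat \<Rightarrow> ('g, 'm) monoid_scheme \<Rightarrow> ('h, 'n) monoid_scheme \<Rightarrow>
    ('g, 'h) formal_sum rel" where
  "burnside_rel p G H = {(x, y). x \<in> formal_sums p G H \<and> y \<in> formal_sums p G H \<and>
     x - y \<in> sum_relations p G H}"

definition burnside_module :: "nat \<Rightarrow> ('g, 'm) monoid_scheme \<Rightarrow> ('h, 'n) monoid_scheme \<Rightarrow>
    ('g, 'h) burnside set" where
  "burnside_module p G H = formal_sums p G H // burnside_rel p G H"

definition burnside_of :: "nat \<Rightarrow> ('g, 'm) monoid_scheme \<Rightarrow> ('h, 'n) monoid_scheme \<Rightarrow>
    ('g, 'h) formal_sum \<Rightarrow> ('g, 'h) burnside" where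
  "burnside_of p G H x = burnside_rel p G H `` {x}"

text \<open>The bilinear extension of \<open>(Y, X) \<mapsto> Y \<times>\<^bsub>H\<^esub> X\<close>, first on formal sums and then on their
  classes (the union is over equal sets, as the product respects the relations).\<close>

definition formal_comp :: "('g, 'm) monoid_scheme \<Rightarrow> ('h, 'n) monoid_scheme \<Rightarrow>
    ('k, 'l) monoid_scheme \<Rightarrow> ('h, 'k) formal_sum \<Rightarrow> ('g, 'h) formal_sum \<Rightarrow>
    ('g, 'k) formal_sum" where
  "formal_comp G H K y x = (\<Sum>c\<in>Poly_Mapping.keys y. \<Sum>d\<in>Poly_Mapping.keys x.
     Poly_Mapping.single
       (iso_class G K (biset_prod H (SOME Y. Y \<in> c) (SOME X. X \<in> d)))
       (Poly_Mapping.lookup y c * Poly_Mapping.lookup x d))"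

definition burnside_comp :: "nat \<Rightarrow> ('g, 'm) monoid_scheme \<Rightarrow> ('h, 'n) monoid_scheme \<Rightarrow>
    ('k, 'l) monoid_scheme \<Rightarrow> ('h, 'k) burnside \<Rightarrow> ('g, 'h) burnside \<Rightarrow>
    ('g, 'k) burnside" where
  "burnside_comp p G H K Y X =
     (\<Union>y\<in>Y. \<Union>x\<in>X. burnside_of p G K (formal_comp G H K y x))"

text \<open>\<open>basic p G H U \<phi>\<close> is \<open>[U, \<phi>]\<close> with subscript \<open>G\<close> and superscript \<open>H\<close>.\<close>

definition basic_formal :: "('g, 'm) monoid_scheme \<Rightarrow> ('h, 'n) monoid_scheme \<Rightarrow>
    'g set \<Rightarrow> ('g \<Rightarrow> 'h) \<Rightarrow> ('g, 'h) formal_sum" where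
  "basic_formal G H U \<phi> = Poly_Mapping.single (iso_class G H (coset_biset G H U \<phi>)) 1"

definition basic :: "nat \<Rightarrow> ('g, 'm) monoid_scheme \<Rightarrow> ('h, 'n) monoid_scheme \<Rightarrow>
    'g set \<Rightarrow> ('g \<Rightarrow> 'h) \<Rightarrow> ('g, 'h) burnside" where
  "basic p G H U \<phi> = burnside_of p G H (basic_formal G H U \<phi>)"


section \<open>Characteristic idempotents\<close>

definition F_generated :: "nat \<Rightarrow> ('a, 'm) monoid_scheme \<Rightarrow> 'a hom_sets \<Rightarrow>
    ('a, 'a) burnside \<Rightarrow> bool" where
  "F_generated p S F X \<longleftrightarrow>
     (\<exists>I a. finite I \<and> (\<forall>(P, \<phi>)\<in>I. subgroup P S \<and> \<phi> \<in> F P (carrier S) \<and> a (P, \<phi>) \<in> Z_loc p) \<and>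
        X = burnside_of p S S (\<Sum>(P, \<phi>)\<in>I.
              Poly_Mapping.map ((*) (a (P, \<phi>))) (basic_formal S S P \<phi>)))"

definition right_stable :: "nat \<Rightarrow> ('a, 'm) monoid_scheme \<Rightarrow> 'a hom_sets \<Rightarrow>
    ('a, 'a) burnside \<Rightarrow> bool" where
  "right_stable p S F X \<longleftrightarrow> (\<forall>P. subgroup P S \<longrightarrow> (\<forall>\<phi>\<in>F P (carrier S).
     burnside_comp p (S\<lparr>carrier := P\<rparr>) S S X (basic p (S\<lparr>carrier := P\<rparr>) S P \<phi>) =
     burnside_comp p (S\<lparr>carrier := P\<rparr>) S S X (basic p (S\<lparr>carrier := P\<rparr>) S P id)))"

definition left_stable :: "nat \<Rightarrow> ('a, 'm) monoid_scheme \<Rightarrow> 'a hom_sets \<Rightarrow>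
    ('a, 'a) burnside \<Rightarrow> bool" where
  "left_stable p S F X \<longleftrightarrow> (\<forall>P. subgroup P S \<longrightarrow> (\<forall>\<phi>\<in>F P (carrier S).
     burnside_comp p S S (S\<lparr>carrier := P\<rparr>)
       (basic p S (S\<lparr>carrier := P\<rparr>) (\<phi> ` P) (inv_into P \<phi>)) X =
     burnside_comp p S S (S\<lparr>carrier := P\<rparr>) (basic p S (S\<lparr>carrier := P\<rparr>) P id) X))"

text \<open>
  The linear extension of \<open>X \<mapsto> |X| / |S|\<close>.  It makes sense on all of \<open>A(S, S)\<^sub>(\<^sub>p\<^sub>)\<close> with
  rational values; on the span of the left-free bisets, which contains every \<open>F\<close>-generated
  element, the values lie in \<open>\<int>\<^sub>(\<^sub>p\<^sub>)\<close>.
\<close>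

definition formal_augmentation :: "('a, 'm) monoid_scheme \<Rightarrow> ('a, 'a) formal_sum \<Rightarrow> rat" where
  "formal_augmentation S x = (\<Sum>c\<in>Poly_Mapping.keys x. Poly_Mapping.lookup x c *
     (of_nat (card (points (SOME X. X \<in> c))) / of_nat (order S)))"

definition augmentation :: "('a, 'm) monoid_scheme \<Rightarrow> ('a, 'a) burnside \<Rightarrow> rat" where
  "augmentation S X = the_elem (formal_augmentation S ` X)"

definition F_characteristic :: "nat \<Rightarrow> ('a, 'm) monoid_scheme \<Rightarrow> 'a hom_sets \<Rightarrow>
    ('a, 'a) burnside \<Rightarrow> bool" where
  "F_characteristic p S F X \<longleftrightarrow> X \<in> burnside_module p S S \<and> F_generated p S F X \<and>
     left_stable p S F X \<and> right_stable p S F X \<and>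
     (\<exists>b\<in>Z_loc p. augmentation S X \<in> Z_loc p \<and> augmentation S X * b = 1)"

definition characteristic_idempotent :: "nat \<Rightarrow> ('a, 'm) monoid_scheme \<Rightarrow> 'a hom_sets \<Rightarrow>
    ('a, 'a) burnside \<Rightarrow> bool" where
  "characteristic_idempotent p S F X \<longleftrightarrow>
     F_characteristic p S F X \<and> burnside_comp p S S S X X = X"

end

theory Submission
  imports Defs "HOL-Algebra.Zassenhaus"
begin

text \<open>
  Elements of the localized Burnside module are compared through their marks.  For a group \<open>M\<close>
  with homomorphisms \<open>\<alpha> : M \<rightarrow> G\<close> and \<open>\<beta> : M \<rightarrow> H\<close>, the mark of a \<open>(G, H)\<close>-biset \<open>X\<close> at
  \<open>(\<alpha>, \<beta>)\<close> is the number of \<open>x\<close> with \<open>\<beta>(u) x = x \<alpha>(u)\<close> for all \<open>u\<close>.  Marks at the subgroups of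
  \<open>H \<times> G\<close> separate the elements of the module (\<open>marks_separate\<close>), and composition with a
  right-free biset is matrix multiplication: \<open>|H|\<close> times the mark of \<open>Y \<circ> X\<close> at \<open>(\<alpha>, \<beta>)\<close> is the
  sum over all homomorphisms \<open>\<gamma> : M \<rightarrow> H\<close> of the mark of \<open>X\<close> at \<open>(\<alpha>, \<gamma>)\<close> times that of \<open>Y\<close> at
  \<open>(\<gamma>, \<beta>)\<close> (\<open>card_fixp_prod\<close>, \<open>mark_formal_comp\<close>).

  For the characteristic idempotent of a fusion system on \<open>S\<close>, generation and stability say that
  its mark at \<open>(id, \<phi>)\<close> on \<open>P\<close> vanishes unless \<open>\<phi>\<close> is a morphism, and then depends on \<open>P\<close> alone.
  Idempotency becomes the quadratic equation \<open>|S| m = |F(P, S)| m\<^sup>2\<close>, and \<open>m = 0\<close> is excluded by a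
  congruence modulo \<open>p\<close> with the augmentation.  So \<open>m = |S| / |F(P, S)|\<close>
  (\<open>characteristic_mark\<close>).

  Put \<open>U = R \<inter> T\<close>.  For \<open>P \<le> T\<close> and \<open>\<phi> \<in> F(P, R)\<close>, the mark of the left-hand side of the
  equation at \<open>(id, \<phi>)\<close> is therefore \<open>|S| / |F(P, S)|\<close>, while the right-hand side has mark
  \<open>|T| |R| / (|U| |K(P, T)| |H(\<phi> P, R)|)\<close> times the number of factorizations of \<open>\<phi>\<close> as a morphism of
  \<open>K\<close> into \<open>U\<close> followed by a morphism of \<open>H\<close>; all other marks vanish on both sides.  If the marks
  agree, the trivial subgroup yields \<open>|S| |U| = |R| |T|\<close>, hence \<open>S = R T\<close>, and the other marks say
  that every \<open>\<phi>\<close> has a factorization.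

  Conversely the number of factorizations has to be \<open>|K(P, T)| |H(\<phi> P, R)| / |F(P, S)|\<close>
  (\<open>count_factorizations\<close>).  This is a count of composites, which works once the number of
  \<open>K\<close>-morphisms out of a subgroup is constant on \<open>F\<close>-conjugacy classes and the number of
  \<open>(H \<inter> K)\<close>-morphisms is constant on \<open>H\<close>-conjugacy classes.  Both follow from a Frattini
  argument: a saturated fusion system factors as \<open>Aut(U)\<close> times any invariant subsystem on a
  strongly closed subgroup \<open>U\<close> (\<open>frattini\<close>).  It is applied to the subsystem \<open>K\<close> of \<open>F\<close> and to
  the subsystem \<open>H \<inter> K\<close> of \<open>H\<close>.
\<close>

section \<open>Actions of finite \<open>p\<close>-groups\<close>

lemma p_group_fixed_points:
  fixes M :: "('g, 'm) monoid_scheme" and act :: "'g \<Rightarrow> 'x \<Rightarrow> 'x"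
  assumes p: "prime p" and M: "group M" and ord: "order M = p ^ n" and fin: "finite E"
    and closed: "\<And>m e. m \<in> carrier M \<Longrightarrow> e \<in> E \<Longrightarrow> act m e \<in> E"
    and one: "\<And>e. e \<in> E \<Longrightarrow> act \<one>\<^bsub>M\<^esub> e = e"
    and mult: "\<And>m m' e. m \<in> carrier M \<Longrightarrow> m' \<in> carrier M \<Longrightarrow> e \<in> E \<Longrightarrow>
      act (m \<otimes>\<^bsub>M\<^esub> m') e = act m (act m' e)"
  shows "card E mod p = card {e\<in>E. \<forall>m\<in>carrier M. act m e = e} mod p"
proof -
  interpret M: group M by fact
  define \<phi> where "\<phi> m = restrict (act m) E" for m
  have bij: "\<phi> m \<in> Bij E" if m: "m \<in> carrier M" for m
  proof -
    have "bij_betw (\<phi> m) E E"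
      unfolding \<phi>_def
      by (rule bij_betw_byWitness[where f' = "act (inv\<^bsub>M\<^esub> m)"])
        (use m mult[symmetric] one closed in auto)
    then show ?thesis by (simp add: Bij_def \<phi>_def)
  qed
  have hom: "\<phi> \<in> hom M (BijGroup E)"
  proof (rule homI)
    show "\<phi> m \<in> carrier (BijGroup E)" if "m \<in> carrier M" for m
      using bij[OF that] by (simp add: BijGroup_def)
    show "\<phi> (m \<otimes>\<^bsub>M\<^esub> m') = \<phi> m \<otimes>\<^bsub>BijGroup E\<^esub> \<phi> m'"
      if "m \<in> carrier M" "m' \<in> carrier M" for m m'
      using that bij by (auto simp: BijGroup_def compose_def \<phi>_def mult closed)
  qed
  interpret group_action M E \<phi>
    by (intro group_action.intro group_hom.intro group_hom_axioms.intro M.is_group group_BijGroup hom)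
  let ?fix = "{e\<in>E. \<forall>m\<in>carrier M. act m e = e}"
  have fin_orb: "finite (orbits M E \<phi>)" unfolding orbits_def using fin by simp
  have orb1: "orb \<in> (\<lambda>e. {e}) ` ?fix \<or> p dvd card orb" if orb: "orb \<in> orbits M E \<phi>" for orb
  proof -
    obtain x where x: "x \<in> E" "orb = orbit M \<phi> x" using orb by (auto simp: orbits_def)
    have "card orb dvd p ^ n" using orbit_stabilizer_theorem[OF x(1)] ord x(2) by (metis dvd_triv_left)
    then obtain i where i: "card orb = p ^ i" using divides_primepow_nat[OF p] by blast
    show ?thesis
    proof (cases "i = 0")
      case True
      then have "card orb = 1" using i by simp
      moreover have "x \<in> orb" using orbit_refl x by simp
      ultimately have orbx: "orb = {x}" by (metis card_1_singletonE singletonD)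
      have "act m x = x" if "m \<in> carrier M" for m
        using orbx x that unfolding orbit_def \<phi>_def by auto
      then show ?thesis using orbx x by auto
    qed (use i in auto)
  qed
  have fix_orb: "(\<lambda>e. {e}) ` ?fix \<subseteq> orbits M E \<phi>"
  proof
    fix A assume "A \<in> (\<lambda>e. {e}) ` ?fix"
    then obtain e where e: "e \<in> E" "\<forall>m\<in>carrier M. act m e = e" "A = {e}" by auto
    then have "orbit M \<phi> e = {e}" using orbit_refl[OF e(1)] by (auto simp: orbit_def \<phi>_def)
    then show "A \<in> orbits M E \<phi>" using e unfolding orbits_def by auto
  qed
  have "card E = (\<Sum>orb\<in>orbits M E \<phi>. card orb)"
    using disjoint_sum[OF fin, of "\<lambda>_. 1::nat"] by simp
  also have "\<dots> = (\<Sum>orb\<in>(\<lambda>e. {e}) ` ?fix. card orb)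
      + (\<Sum>orb\<in>orbits M E \<phi> - (\<lambda>e. {e}) ` ?fix. card orb)"
    using sum.subset_diff[OF fix_orb fin_orb, of card] by simp
  also have "(\<Sum>orb\<in>(\<lambda>e. {e}) ` ?fix. card orb) = card ?fix"
    by (subst sum.reindex) (auto simp: inj_on_def)
  finally have "card E = card ?fix + (\<Sum>orb\<in>orbits M E \<phi> - (\<lambda>e. {e}) ` ?fix. card orb)" .
  moreover have "p dvd (\<Sum>orb\<in>orbits M E \<phi> - (\<lambda>e. {e}) ` ?fix. card orb)"
    by (rule dvd_sum) (use orb1 in auto)
  ultimately show ?thesis by (simp add: dvd_eq_mod_eq_0 mod_add_eq flip: mod_add_right_eq)
qed

lemma subgroup_order_p_power:
  assumes "prime p" "group G" "order G = p ^ n" "subgroup P G"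
  shows "\<exists>k. card P = p ^ k"
proof -
  have "card P dvd p ^ n"
    using group.lagrange[OF assms(2,4)] assms(3) by (metis dvd_triv_right)
  then show ?thesis using divides_primepow_nat[OF assms(1)] by blast
qed

lemma (in group) normalizer_eq:
  assumes "subgroup P G"
  shows "normalizer G P = {x \<in> carrier G. conj_by G x ` P = P}"
proof -
  have "x <#\<^bsub>G\<^esub> P #>\<^bsub>G\<^esub> inv x = conj_by G x ` P" for x
    by (auto simp: l_coset_def r_coset_def conj_by_def)
  then show ?thesis
    using subgroup.subset[OF assms] unfolding normalizer_def stabilizer_def by auto
qed

lemma (in group) l_coset_eq_iff:
  assumes "subgroup P G" "x \<in> carrier G" "y \<in> carrier G"
  shows "x <# P = y <# P \<longleftrightarrow> inv x \<otimes> y \<in> P"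
proof
  interpret P: subgroup P G by fact
  assume "x <# P = y <# P"
  moreover have "y \<in> y <# P" using assms(3) P.one_closed r_one unfolding l_coset_def by force
  ultimately obtain u where "u \<in> P" "y = x \<otimes> u" by (auto simp: l_coset_def)
  then show "inv x \<otimes> y \<in> P" using assms(2) by (simp add: m_assoc[symmetric])
next
  assume *: "inv x \<otimes> y \<in> P"
  have "y = x \<otimes> (inv x \<otimes> y)" using assms by (simp add: m_assoc[symmetric])
  with * have "y \<in> x <# P" unfolding l_coset_def by blast
  then show "x <# P = y <# P" using assms l_repr_independence by blast
qed

lemma (in group) card_l_cosets:
  assumes P: "subgroup P G" and B: "B \<subseteq> carrier G" and fin: "finite (carrier G)"
  shows "card P * card ((\<lambda>x. x <# P) ` B) = card (B <#> P)"
proof -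
  interpret P: subgroup P G by fact
  have UE: "\<Union>((\<lambda>x. x <# P) ` B) = B <#> P" by (auto simp: set_mult_def l_coset_def)
  have "card P * card ((\<lambda>x. x <# P) ` B) = card (\<Union>((\<lambda>x. x <# P) ` B))"
  proof (rule card_partition)
    show "finite ((\<lambda>x. x <# P) ` B)" using B fin finite_subset by blast
    show "finite (\<Union>((\<lambda>x. x <# P) ` B))" unfolding UE
      using set_mult_closed[OF B P.subset] fin finite_subset by blast
    show "card c = card P" if c: "c \<in> (\<lambda>x. x <# P) ` B" for c
    proof -
      obtain x where x: "x \<in> B" "c = x <# P" using c by blast
      have "c = (\<lambda>u. x \<otimes> u) ` P" unfolding x l_coset_def by auto
      moreover have "inj_on (\<lambda>u. x \<otimes> u) P"
        using x B P.subset by (intro inj_onI) (metis Units_eq Units_l_cancel subsetD)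
      ultimately show ?thesis by (simp add: card_image)
    qed
    show "c1 \<inter> c2 = {}" if c: "c1 \<in> (\<lambda>x. x <# P) ` B" "c2 \<in> (\<lambda>x. x <# P) ` B" "c1 \<noteq> c2" for c1 c2
    proof (rule ccontr)
      assume ne: "c1 \<inter> c2 \<noteq> {}"
      obtain x y where xy: "x \<in> B" "c1 = x <# P" "y \<in> B" "c2 = y <# P" using c by blast
      obtain z where "z \<in> c1" "z \<in> c2" using ne by blast
      then have "z <# P = c1" "z <# P = c2" using xy B P l_repr_independence by (metis subsetD)+
      then show False using c(3) by simp
    qed
  qed
  then show ?thesis using UE by simp
qed

text \<open>Sylow conjugacy and the Frattini argument in one statement: a \<open>p\<close>-group mapping into a normal
  subgroup \<open>N\<close> is moved into the Sylow subgroup \<open>\<Sigma>\<close> by conjugation with an element of \<open>N\<close>.  The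
  \<open>p\<close>-group acts on the cosets of \<open>\<Sigma>\<close> inside \<open>N \<Sigma>\<close>; their number divides the index of \<open>\<Sigma>\<close>, so it is
  prime to \<open>p\<close> and some coset is fixed.\<close>

lemma (in group) sylow_absorbs:
  fixes M :: "('g, 'n) monoid_scheme"
  assumes p: "prime p" and fin: "finite (carrier G)"
    and \<Sigma>: "subgroup \<Sigma> G" and index: "order G = card \<Sigma> * r" "\<not> p dvd r"
    and N: "N \<lhd> G"
    and M: "group M" "order M = p ^ k" and f: "f \<in> hom M G" "f ` carrier M \<subseteq> N"
  shows "\<exists>n\<in>N. \<forall>m\<in>carrier M. inv n \<otimes> f m \<otimes> n \<in> \<Sigma>"
proof -
  interpret M: group M by fact
  interpret \<Sigma>: subgroup \<Sigma> G by fact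
  interpret N: normal N G by fact
  define E where "E = (\<lambda>n. n <# \<Sigma>) ` N"
  have Nc: "N \<subseteq> carrier G" by (rule N.subset)
  have finE: "finite E" unfolding E_def using fin Nc finite_subset by blast
  have fN: "f m \<in> N" if "m \<in> carrier M" for m using f(2) that by auto
  then have fc: "f m \<in> carrier G" if "m \<in> carrier M" for m using Nc that by auto
  have "subgroup (N <#> \<Sigma>) G" using N \<Sigma> by (rule mult_norm_subgroup)
  then have "card (N <#> \<Sigma>) dvd order G" using lagrange by (metis dvd_triv_right)
  then have "card \<Sigma> * card E dvd card \<Sigma> * r"
    using card_l_cosets[OF \<Sigma> Nc fin] index unfolding E_def by simp
  moreover have "card \<Sigma> > 0"
    using fin \<Sigma>.subset \<Sigma>.one_closed by (metis card_gt_0_iff empty_iff finite_subset)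
  ultimately have "card E dvd r" by simp
  then have pE: "\<not> p dvd card E" using index(2) dvd_trans by blast
  have assoc: "f m <# (n <# \<Sigma>) = (f m \<otimes> n) <# \<Sigma>" if "m \<in> carrier M" "n \<in> N" for m n
    using lcos_m_assoc[OF \<Sigma>.subset fc[OF that(1)]] that(2) Nc by auto
  have "card E mod p = card {C\<in>E. \<forall>m\<in>carrier M. f m <# C = C} mod p"
  proof (rule p_group_fixed_points[OF p M finE])
    show "f m <# C \<in> E" if "m \<in> carrier M" "C \<in> E" for m C
      using that assoc fN unfolding E_def by auto
    show "f \<one>\<^bsub>M\<^esub> <# C = C" if "C \<in> E" for C
      using that assoc[OF M.one_closed] hom_one[OF f(1) M(1) is_group] Nc unfolding E_def by auto
    show "f (m \<otimes>\<^bsub>M\<^esub> m') <# C = f m <# (f m' <# C)" 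
      if "m \<in> carrier M" "m' \<in> carrier M" "C \<in> E" for m m' C
    proof -
      have "C \<subseteq> carrier G" using that(3) Nc \<Sigma>.subset l_coset_subset_G unfolding E_def by blast
      then show ?thesis using that hom_mult[OF f(1)] lcos_m_assoc fc by simp
    qed
  qed
  then have "card {C\<in>E. \<forall>m\<in>carrier M. f m <# C = C} \<noteq> 0"
    using pE by (intro notI) (simp add: dvd_eq_mod_eq_0)
  then have "{C\<in>E. \<forall>m\<in>carrier M. f m <# C = C} \<noteq> {}"
    by (intro notI) (simp only: card.empty)
  then obtain n where n: "n \<in> N" "\<forall>m\<in>carrier M. f m <# (n <# \<Sigma>) = n <# \<Sigma>"
    unfolding E_def by blast
  have "inv n \<otimes> f m \<otimes> n \<in> \<Sigma>" if m: "m \<in> carrier M" for m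
  proof -
    have "n <# \<Sigma> = (f m \<otimes> n) <# \<Sigma>" using n m assoc by simp
    then show ?thesis using l_coset_eq_iff[OF \<Sigma>] n(1) fc[OF m] Nc by (simp add: m_assoc subset_iff)
  qed
  then show ?thesis using n(1) by blast
qed

text \<open>\<open>P\<close> acts on the cosets \<open>U / P\<close>, whose number is divisible by \<open>p\<close>.  The coset of the identity is
  fixed, so there is a second fixed coset, and its elements normalize \<open>P\<close>.\<close>

lemma (in group) normalizer_grows:
  assumes p: "prime p" and ord: "order G = p ^ k"
    and P: "subgroup P G" and U: "subgroup U G" and PU: "P \<subset> U"
  shows "\<exists>x\<in>U - P. conj_by G x ` P = P"
proof -
  interpret P: subgroup P G by fact
  interpret U: subgroup U G by fact
  have fin: "finite (carrier G)" using ord p by (metis card.infinite order_def power_not_zero not_prime_0)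
  define E where "E = (\<lambda>n. n <# P) ` U"
  have finE: "finite E" unfolding E_def using fin U.subset finite_subset by blast
  have "U <#> P = U"
    using PU U.m_closed P.one_closed U.subset r_one unfolding set_mult_def by (force simp: subset_iff)
  then have cardE: "card P * card E = card U"
    using card_l_cosets[OF P U.subset fin] unfolding E_def by simp
  obtain i where i: "card U = p ^ i"
    using subgroup_order_p_power[OF p is_group ord U] by blast
  have finU: "finite U" using fin U.subset finite_subset by blast
  have "card P < card U" using PU finU psubset_card_mono by blast
  then have "card E \<noteq> 1" using cardE by auto
  moreover have "card E dvd p ^ i" using cardE i by (metis dvd_triv_right)
  ultimately have pE: "p dvd card E"
    using divides_primepow_nat[OF p] by (metis dvd_power gr0I power_0)
  have ordP: "\<exists>j. order (G\<lparr>carrier := P\<rparr>) = p ^ j"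
    using subgroup_order_p_power[OF p is_group ord P] by (simp add: order_def)
  then obtain j where ordP: "order (G\<lparr>carrier := P\<rparr>) = p ^ j" by blast
  have assoc: "m <# (n <# P) = (m \<otimes> n) <# P" if "m \<in> P" "n \<in> U" for m n
    using lcos_m_assoc[OF P.subset] that P.subset U.subset by auto
  have "card E mod p = card {C\<in>E. \<forall>m\<in>carrier (G\<lparr>carrier := P\<rparr>). m <# C = C} mod p"
  proof (rule p_group_fixed_points[OF p P.subgroup_is_group[OF is_group] ordP finE])
    show "m <# C \<in> E" if "m \<in> carrier (G\<lparr>carrier := P\<rparr>)" "C \<in> E" for m C
      using that assoc PU U.m_closed unfolding E_def by auto
    show "\<one>\<^bsub>G\<lparr>carrier := P\<rparr>\<^esub> <# C = C" if "C \<in> E" for C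
      using that assoc[OF P.one_closed] U.subset unfolding E_def by auto
    show "(m \<otimes>\<^bsub>G\<lparr>carrier := P\<rparr>\<^esub> m') <# C = m <# (m' <# C)"
      if "m \<in> carrier (G\<lparr>carrier := P\<rparr>)" "m' \<in> carrier (G\<lparr>carrier := P\<rparr>)" "C \<in> E" for m m' C
    proof -
      have "C \<subseteq> carrier G" using that(3) U.subset P.subset l_coset_subset_G unfolding E_def by blast
      then show ?thesis using that lcos_m_assoc P.subset by auto
    qed
  qed
  then have pF: "p dvd card {C\<in>E. \<forall>m\<in>P. m <# C = C}" (is "p dvd card ?F")
    using pE by (simp add: dvd_eq_mod_eq_0)
  have PF: "\<one> <# P \<in> ?F"
    using assoc[OF _ U.one_closed] l_coset_eq_iff[OF P] P.subset unfolding E_def by (force simp: subset_iff)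
  have "?F \<noteq> {\<one> <# P}"
  proof
    assume "?F = {\<one> <# P}"
    then have "p dvd 1" using pF by simp
    then show False using p by simp
  qed
  then obtain u where u: "u \<in> U" "u <# P \<noteq> \<one> <# P" "\<forall>m\<in>P. m <# (u <# P) = u <# P"
    using PF unfolding E_def by blast
  have uc: "u \<in> carrier G" using u U.subset by blast
  have "u \<notin> P" using u(2) l_coset_eq_iff[OF P one_closed uc] uc by auto
  have fixed: "inv u \<otimes> m \<otimes> u \<in> P" if m: "m \<in> P" for m
  proof -
    have "u <# P = (m \<otimes> u) <# P" using u m assoc by simp
    then show ?thesis using l_coset_eq_iff[OF P] uc m P.subset by (simp add: m_assoc subset_iff)
  qed
  have "conj_by G (inv u) ` P \<subseteq> P" using fixed uc by (auto simp: conj_by_def)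
  moreover have "inj_on (conj_by G (inv u)) P"
    using uc P.subset by (intro inj_onI) (simp add: conj_by_def subset_iff)
  ultimately have "conj_by G (inv u) ` P = P"
    using fin P.subset by (metis endo_inj_surj finite_subset)
  moreover have "inv u \<in> U - P"
  proof -
    have "inv u \<notin> P" using \<open>u \<notin> P\<close> uc P.m_inv_closed by (metis inv_inv)
    then show ?thesis using u(1) U.m_inv_closed by blast
  qed
  ultimately show ?thesis by blast
qed

section \<open>Bisets and their marks\<close>

text \<open>The fixed points of the twisted diagonal \<open>{(\<beta> u, \<alpha> u)}\<close>.  Indexing by an arbitrary set with two
  maps, rather than by a subgroup and one map, makes the mark of a composite a matrix product and
  lets a mark be reindexed along any map.\<close>

definition fixp :: "('x, 'g, 'h) biset \<Rightarrow> 'u set \<Rightarrow> ('u \<Rightarrow> 'g) \<Rightarrow> ('u \<Rightarrow> 'h) \<Rightarrow> 'x set" where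
  "fixp X L \<alpha> \<beta> = {x \<in> points X. \<forall>u\<in>L. lact X (\<beta> u) x = ract X x (\<alpha> u)}"

definition left_free :: "('h, 'n) monoid_scheme \<Rightarrow> ('x, 'g, 'h) biset \<Rightarrow> bool" where
  "left_free H X \<longleftrightarrow> (\<forall>x\<in>points X. \<forall>h\<in>carrier H. lact X h x = x \<longrightarrow> h = \<one>\<^bsub>H\<^esub>)"

definition right_free :: "('g, 'm) monoid_scheme \<Rightarrow> ('x, 'g, 'h) biset \<Rightarrow> bool" where
  "right_free G X \<longleftrightarrow> (\<forall>x\<in>points X. \<forall>g\<in>carrier G. ract X x g = x \<longrightarrow> g = \<one>\<^bsub>G\<^esub>)"

lemma fixp_image: "fixp X L (\<alpha> \<circ> f) (\<beta> \<circ> f) = fixp X (f ` L) \<alpha> \<beta>"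
  by (auto simp: fixp_def)

lemma fixp_cong:
  assumes "\<And>u. u \<in> L \<Longrightarrow> \<alpha> u = \<alpha>' u" "\<And>u. u \<in> L \<Longrightarrow> \<beta> u = \<beta>' u"
  shows "fixp X L \<alpha> \<beta> = fixp X L \<alpha>' \<beta>'"
  using assms by (auto simp: fixp_def)

lemma biset_isoE:
  assumes "biset_iso G H X Y"
  obtains f where "bij_betw f (points X) (points Y)"
    "\<And>x h. x \<in> points X \<Longrightarrow> h \<in> carrier H \<Longrightarrow> f (lact X h x) = lact Y h (f x)"
    "\<And>x g. x \<in> points X \<Longrightarrow> g \<in> carrier G \<Longrightarrow> f (ract X x g) = ract Y (f x) g"
  using assms unfolding biset_iso_def by metis

lemma biset_iso_refl: "biset_iso G H X X"
  unfolding biset_iso_def by (intro exI[of _ id]) auto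

lemma biset_iso_sym:
  assumes "is_biset G H X" "biset_iso G H X Y"
  shows "biset_iso G H Y X"
proof -
  interpret is_biset G H X by fact
  obtain f where f: "bij_betw f (points X) (points Y)"
    "\<And>x h. x \<in> points X \<Longrightarrow> h \<in> carrier H \<Longrightarrow> f (lact X h x) = lact Y h (f x)"
    "\<And>x g. x \<in> points X \<Longrightarrow> g \<in> carrier G \<Longrightarrow> f (ract X x g) = ract Y (f x) g"
    by (rule biset_isoE[OF assms(2)]) (erule that)
  let ?i = "inv_into (points X) f"
  have i: "?i y \<in> points X" "f (?i y) = y" if "y \<in> points Y" for y
    using that f(1) by (auto simp: bij_betw_def inv_into_into f_inv_into_f)
  have fi: "?i (f x) = x" if "x \<in> points X" for x
    using that f(1) by (auto simp: bij_betw_def inv_into_f_f)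
  have l: "?i (lact Y h y) = lact X h (?i y)" if "y \<in> points Y" "h \<in> carrier H" for h y
    using f(2)[OF i(1)[OF that(1)] that(2)] i(2)[OF that(1)] fi[OF lact_closed[OF that(2) i(1)[OF that(1)]]]
    by simp
  have r: "?i (ract Y y g) = ract X (?i y) g" if "y \<in> points Y" "g \<in> carrier G" for g y
    using f(3)[OF i(1)[OF that(1)] that(2)] i(2)[OF that(1)] fi[OF ract_closed[OF that(2) i(1)[OF that(1)]]]
    by simp
  show ?thesis unfolding biset_iso_def
    by (intro exI[of _ ?i] conjI ballI) (use bij_betw_inv_into[OF f(1)] l r in auto)
qed

lemma biset_iso_trans:
  assumes "biset_iso G H X Y" "biset_iso G H Y Z"
  shows "biset_iso G H X Z"
proof -
  obtain f where f: "bij_betw f (points X) (points Y)"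
    "\<And>x h. x \<in> points X \<Longrightarrow> h \<in> carrier H \<Longrightarrow> f (lact X h x) = lact Y h (f x)"
    "\<And>x g. x \<in> points X \<Longrightarrow> g \<in> carrier G \<Longrightarrow> f (ract X x g) = ract Y (f x) g"
    by (rule biset_isoE[OF assms(1)]) (erule that)
  obtain f' where f': "bij_betw f' (points Y) (points Z)"
    "\<And>x h. x \<in> points Y \<Longrightarrow> h \<in> carrier H \<Longrightarrow> f' (lact Y h x) = lact Z h (f' x)"
    "\<And>x g. x \<in> points Y \<Longrightarrow> g \<in> carrier G \<Longrightarrow> f' (ract Y x g) = ract Z (f' x) g"
    by (rule biset_isoE[OF assms(2)]) (erule that)
  have "f x \<in> points Y" if "x \<in> points X" for x using that f(1) by (auto simp: bij_betw_def)
  then show ?thesis unfolding biset_iso_def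
    by (intro exI[of _ "f' \<circ> f"]) (use f f' bij_betw_trans[OF f(1) f'(1)] in auto)
qed

lemma fixp_iso:
  assumes "biset_iso G H X Y" "\<alpha> ` L \<subseteq> carrier G" "\<beta> ` L \<subseteq> carrier H" "is_biset G H X"
  shows "card (fixp X L \<alpha> \<beta>) = card (fixp Y L \<alpha> \<beta>)"
proof -
  interpret is_biset G H X by fact
  obtain f where f: "bij_betw f (points X) (points Y)"
    "\<And>x h. x \<in> points X \<Longrightarrow> h \<in> carrier H \<Longrightarrow> f (lact X h x) = lact Y h (f x)"
    "\<And>x g. x \<in> points X \<Longrightarrow> g \<in> carrier G \<Longrightarrow> f (ract X x g) = ract Y (f x) g"
    by (rule biset_isoE[OF assms(1)]) (erule that)
  have inj: "inj_on f (points X)" and im: "f ` points X = points Y" using f(1) by (auto simp: bij_betw_def)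
  have iff: "lact X (\<beta> u) x = ract X x (\<alpha> u) \<longleftrightarrow> lact Y (\<beta> u) (f x) = ract Y (f x) (\<alpha> u)"
    if "x \<in> points X" "u \<in> L" for x u
  proof -
    have "\<beta> u \<in> carrier H" "\<alpha> u \<in> carrier G" using that assms by auto
    then show ?thesis
      using that f(2,3) inj_onD[OF inj] lact_closed ract_closed by metis
  qed
  have "bij_betw f (fixp X L \<alpha> \<beta>) (fixp Y L \<alpha> \<beta>)"
  proof -
    have "f ` fixp X L \<alpha> \<beta> = fixp Y L \<alpha> \<beta>"
      unfolding fixp_def im[symmetric] using iff by auto
    then show ?thesis using inj inj_on_subset[of f "points X" "fixp X L \<alpha> \<beta>"]
      by (auto simp: bij_betw_def fixp_def)
  qed
  then show ?thesis by (rule bij_betw_same_card)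
qed

lemma left_free_iso:
  assumes "biset_iso G H X Y" "is_biset G H X" "left_free H X"
  shows "left_free H Y"
proof -
  interpret is_biset G H X by fact
  obtain f where f: "bij_betw f (points X) (points Y)"
    "\<And>x h. x \<in> points X \<Longrightarrow> h \<in> carrier H \<Longrightarrow> f (lact X h x) = lact Y h (f x)"
    "\<And>x g. x \<in> points X \<Longrightarrow> g \<in> carrier G \<Longrightarrow> f (ract X x g) = ract Y (f x) g"
    by (rule biset_isoE[OF assms(1)]) (erule that)
  have "h = \<one>\<^bsub>H\<^esub>" if y: "y \<in> points Y" "h \<in> carrier H" "lact Y h y = y" for y h
  proof -
    obtain x where x: "x \<in> points X" "y = f x" using y f(1) by (auto simp: bij_betw_def)
    then have "f (lact X h x) = f x" using f(2) y by simp
    then have "lact X h x = x" using f(1) x lact_closed[OF y(2) x(1)] by (auto simp: bij_betw_def inj_on_def)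
    then show ?thesis using assms(3) x y by (auto simp: left_free_def)
  qed
  then show ?thesis by (auto simp: left_free_def)
qed

lemma right_free_iso:
  assumes "biset_iso G H X Y" "is_biset G H X" "right_free G X"
  shows "right_free G Y"
proof -
  interpret is_biset G H X by fact
  obtain f where f: "bij_betw f (points X) (points Y)"
    "\<And>x h. x \<in> points X \<Longrightarrow> h \<in> carrier H \<Longrightarrow> f (lact X h x) = lact Y h (f x)"
    "\<And>x g. x \<in> points X \<Longrightarrow> g \<in> carrier G \<Longrightarrow> f (ract X x g) = ract Y (f x) g"
    by (rule biset_isoE[OF assms(1)]) (erule that)
  have "h = \<one>\<^bsub>G\<^esub>" if y: "y \<in> points Y" "h \<in> carrier G" "ract Y y h = y" for y h
  proof -
    obtain x where x: "x \<in> points X" "y = f x" using y f(1) by (auto simp: bij_betw_def)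
    then have "f (ract X x h) = f x" using f(3) y by simp
    then have "ract X x h = x" using f(1) x ract_closed[OF y(2) x(1)] by (auto simp: bij_betw_def inj_on_def)
    then show ?thesis using assms(3) x y by (auto simp: right_free_def)
  qed
  then show ?thesis by (auto simp: right_free_def)
qed

text \<open>The classes in the Burnside module consist of bisets on sets of natural numbers, whereas sums
  and products of bisets live on other types; this copy is the bridge between the two.\<close>

lemma nat_copy:
  fixes X :: "('x, 'g, 'h) biset"
  assumes "is_biset G H X"
  shows "\<exists>Z :: (nat, 'g, 'h) biset. is_biset G H Z \<and> biset_iso G H X Z"
proof -
  interpret is_biset G H X by fact
  obtain f :: "'x \<Rightarrow> nat" where f: "inj_on f (points X)"
    using finite_imp_inj_to_nat_seg[OF finite_points] by blast
  define i where "i = inv_into (points X) f"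
  have i: "i (f x) = x" if "x \<in> points X" for x using f that by (simp add: i_def)
  define Z where "Z = \<lparr>points = f ` points X, lact = (\<lambda>h z. f (lact X h (i z))),
    ract = (\<lambda>z g. f (ract X (i z) g))\<rparr>"
  have "is_biset G H Z"
    by unfold_locales
      (auto simp: Z_def i finite_points lact_closed lact_one lact_mult ract_closed ract_one ract_mult acts_commute)
  moreover have "biset_iso G H X Z"
    unfolding biset_iso_def by (intro exI[of _ f]) (use f in \<open>auto simp: Z_def i bij_betw_def\<close>)
  ultimately show ?thesis by blast
qed

lemma iso_class_eq_iff:
  fixes X :: "('x, 'g, 'h) biset" and Y :: "('y, 'g, 'h) biset"
  assumes "is_biset G H X" "is_biset G H Y"
  shows "iso_class G H X = iso_class G H Y \<longleftrightarrow> biset_iso G H X Y"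
proof
  assume eq: "iso_class G H X = iso_class G H Y"
  obtain Z :: "(nat, 'g, 'h) biset" where Z: "is_biset G H Z" "biset_iso G H X Z"
    using nat_copy[OF assms(1)] by blast
  then have "Z \<in> iso_class G H X" by (simp add: iso_class_def)
  then have "Z \<in> iso_class G H Y" by (simp only: eq)
  then have "biset_iso G H Y Z" by (simp add: iso_class_def)
  then show "biset_iso G H X Y" by (rule biset_iso_trans[OF Z(2) biset_iso_sym[OF assms(2)]])
next
  assume "biset_iso G H X Y"
  then show "iso_class G H X = iso_class G H Y"
    unfolding iso_class_def by (metis biset_iso_sym[OF assms(1)] biset_iso_trans)
qed

definition rep :: "('g, 'h) biset_class \<Rightarrow> (nat, 'g, 'h) biset" where
  "rep c = (SOME X. X \<in> c)"

lemma rep_iso_class: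
  fixes X :: "('x, 'g, 'h) biset"
  assumes "is_biset G H X"
  shows "is_biset G H (rep (iso_class G H X))" "biset_iso G H X (rep (iso_class G H X))"
proof -
  have "\<exists>Z. Z \<in> iso_class G H X" using nat_copy[OF assms] by (auto simp: iso_class_def)
  then have "rep (iso_class G H X) \<in> iso_class G H X" unfolding rep_def by (rule someI_ex)
  then show "is_biset G H (rep (iso_class G H X))" "biset_iso G H X (rep (iso_class G H X))"
    by (auto simp: iso_class_def)
qed

lemma iso_class_in_biset_classes:
  fixes X :: "('x, 'g, 'h) biset"
  assumes "is_biset G H X"
  shows "iso_class G H X \<in> biset_classes G H"
proof -
  note r = rep_iso_class[OF assms]
  then have "iso_class G H X = iso_class G H (rep (iso_class G H X))"
    using iso_class_eq_iff[OF assms r(1)] by simp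
  then show ?thesis unfolding biset_classes_def using r(1) by blast
qed

lemma biset_classes_rep:
  fixes c :: "('g, 'h) biset_class"
  assumes "c \<in> biset_classes G H"
  shows "is_biset G H (rep c)" "iso_class G H (rep c) = c"
proof -
  obtain X :: "(nat, 'g, 'h) biset" where X: "is_biset G H X" "c = iso_class G H X"
    using assms by (auto simp: biset_classes_def)
  show "is_biset G H (rep c)" using rep_iso_class[OF X(1)] X(2) by simp
  then show "iso_class G H (rep c) = c"
    using rep_iso_class[OF X(1)] X iso_class_eq_iff by metis
qed

lemma is_biset_sum:
  assumes "is_biset G H X" "is_biset G H Y"
  shows "is_biset G H (biset_sum X Y)"
proof -
  interpret X: is_biset G H X by fact
  interpret Y: is_biset G H Y by fact
  show ?thesis
    by unfold_locales
      (auto simp: biset_sum_def X.finite_points Y.finite_points X.lact_closed Y.lact_closed X.lact_one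
        Y.lact_one X.lact_mult Y.lact_mult X.ract_closed Y.ract_closed X.ract_one Y.ract_one
        X.ract_mult Y.ract_mult X.acts_commute Y.acts_commute)
qed

lemma card_fixp_sum:
  assumes "finite (points X)" "finite (points Y)"
  shows "card (fixp (biset_sum X Y) L \<alpha> \<beta>) = card (fixp X L \<alpha> \<beta>) + card (fixp Y L \<alpha> \<beta>)"
proof -
  have "fixp (biset_sum X Y) L \<alpha> \<beta> = fixp X L \<alpha> \<beta> <+> fixp Y L \<alpha> \<beta>"
    by (auto simp: fixp_def biset_sum_def)
  then show ?thesis using assms by (simp add: card_Plus fixp_def)
qed

lemma biset_sum_cong:
  assumes "biset_iso G H X X'" "biset_iso G H Y Y'"
  shows "biset_iso G H (biset_sum X Y) (biset_sum X' Y')"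
proof -
  obtain f where f: "bij_betw f (points X) (points X')"
    "\<And>x h. x \<in> points X \<Longrightarrow> h \<in> carrier H \<Longrightarrow> f (lact X h x) = lact X' h (f x)"
    "\<And>x g. x \<in> points X \<Longrightarrow> g \<in> carrier G \<Longrightarrow> f (ract X x g) = ract X' (f x) g"
    by (rule biset_isoE[OF assms(1)]) (erule that)
  obtain f' where f': "bij_betw f' (points Y) (points Y')"
    "\<And>x h. x \<in> points Y \<Longrightarrow> h \<in> carrier H \<Longrightarrow> f' (lact Y h x) = lact Y' h (f' x)"
    "\<And>x g. x \<in> points Y \<Longrightarrow> g \<in> carrier G \<Longrightarrow> f' (ract Y x g) = ract Y' (f' x) g"
    by (rule biset_isoE[OF assms(2)]) (erule that)
  have "bij_betw (map_sum f f') (points X <+> points Y) (points X' <+> points Y')"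
  proof (rule bij_betw_imageI)
    show "inj_on (map_sum f f') (points X <+> points Y)"
      using bij_betw_imp_inj_on[OF f(1)] bij_betw_imp_inj_on[OF f'(1)]
      by (auto intro!: inj_onI dest: inj_onD)
    have "map_sum f f' ` (A <+> B) = f ` A <+> f' ` B" for A B
      by (simp add: Plus_def image_Un image_image)
    then show "map_sum f f' ` (points X <+> points Y) = points X' <+> points Y'"
      using f(1) f'(1) by (simp add: bij_betw_def)
  qed
  then show ?thesis unfolding biset_iso_def
    by (intro exI[of _ "map_sum f f'"]) (use f f' in \<open>auto simp: biset_sum_def\<close>)
qed

section \<open>Products of bisets\<close>

definition prodrel :: "('h, 'n) monoid_scheme \<Rightarrow> ('y, 'h, 'k) biset \<Rightarrow> ('x, 'g, 'h) biset \<Rightarrow> ('y \<times> 'x) rel"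
  where "prodrel H Y X = {((ract Y y h, x), (y, lact X h x)) | y h x.
    y \<in> points Y \<and> h \<in> carrier H \<and> x \<in> points X}"

locale biset_pair = X: is_biset G H X + Y: is_biset H K Y
  for G :: "('g, 'm) monoid_scheme" and H :: "('h, 'n) monoid_scheme"
    and K :: "('k, 'l) monoid_scheme"
    and X :: "('x, 'g, 'h) biset" and Y :: "('y, 'h, 'k) biset"
begin

abbreviation "rel \<equiv> prodrel H Y X"
abbreviation "cl y x \<equiv> rel `` {(y, x)}"

lemma rel_iff: "((y, x), (y', x')) \<in> rel \<longleftrightarrow>
  y' \<in> points Y \<and> x \<in> points X \<and> (\<exists>h\<in>carrier H. y = ract Y y' h \<and> x' = lact X h x)"
  unfolding prodrel_def by auto

lemma rel_sub: "rel \<subseteq> (points Y \<times> points X) \<times> (points Y \<times> points X)"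
  unfolding prodrel_def using X.lact_closed Y.ract_closed by auto

lemma equiv_rel: "equiv (points Y \<times> points X) rel"
proof (rule equivI)
  show "rel \<subseteq> (points Y \<times> points X) \<times> points Y \<times> points X" by (rule rel_sub)
  show "refl_on (points Y \<times> points X) rel"
  proof (rule refl_onI)
    fix z assume "z \<in> points Y \<times> points X"
    then obtain y x where z: "z = (y, x)" "y \<in> points Y" "x \<in> points X" by auto
    then show "(z, z) \<in> rel" unfolding z(1) rel_iff
      using X.H.one_closed X.lact_one Y.ract_one by (intro conjI bexI[of _ "\<one>\<^bsub>H\<^esub>"]) auto
  qed 
  show "sym rel"
  proof (rule symI)
    fix a b assume ab: "(a, b) \<in> rel"
    obtain y x y' x' where e: "a = (y, x)" "b = (y', x')" by (metis surj_pair)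
    then obtain h where h: "h \<in> carrier H" "y' \<in> points Y" "x \<in> points X" "y = ract Y y' h" "x' = lact X h x"
      using ab by (auto simp: rel_iff)
    have "y' = ract Y y (inv\<^bsub>H\<^esub> h)"
      using h Y.ract_mult[of h "inv\<^bsub>H\<^esub> h" y'] Y.ract_one by simp
    moreover have "x = lact X (inv\<^bsub>H\<^esub> h) x'"
      using h X.lact_mult[of "inv\<^bsub>H\<^esub> h" h x] X.lact_one by simp
    moreover have "y \<in> points Y" "x' \<in> points X" using h X.lact_closed Y.ract_closed by auto
    ultimately show "(b, a) \<in> rel" unfolding e rel_iff using h by blast
  qed
  show "trans rel"
  proof (rule transI)
    fix a b c assume ab: "(a, b) \<in> rel" "(b, c) \<in> rel"
    obtain y x y' x' y'' x'' where e: "a = (y, x)" "b = (y', x')" "c = (y'', x'')" by (metis surj_pair)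
    then obtain h k where h: "h \<in> carrier H" "y' \<in> points Y" "x \<in> points X" "y = ract Y y' h" "x' = lact X h x"
      and k: "k \<in> carrier H" "y'' \<in> points Y" "x' \<in> points X" "y' = ract Y y'' k" "x'' = lact X k x'"
      using ab by (auto simp: rel_iff)
    have "y = ract Y y'' (k \<otimes>\<^bsub>H\<^esub> h)" "x'' = lact X (k \<otimes>\<^bsub>H\<^esub> h) x"
      using h k Y.ract_mult X.lact_mult by auto
    then show "(a, c) \<in> rel" unfolding e rel_iff using h k by blast
  qed
qed

lemma points_prod: "points (biset_prod H Y X) = (\<lambda>(y, x). cl y x) ` (points Y \<times> points X)"
  unfolding biset_prod_def quotient_def by (auto simp flip: prodrel_def)

lemma cl_eq_iff:
  assumes "y \<in> points Y" "x \<in> points X" "y' \<in> points Y" "x' \<in> points X"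
  shows "cl y x = cl y' x' \<longleftrightarrow> (\<exists>h\<in>carrier H. y = ract Y y' h \<and> x' = lact X h x)"
  using eq_equiv_class_iff[OF equiv_rel, of "(y, x)" "(y', x')"] assms by (auto simp: rel_iff)

lemma lact_cl:
  assumes "k \<in> carrier K" "y \<in> points Y" "x \<in> points X"
  shows "lact (biset_prod H Y X) k (cl y x) = cl (lact Y k y) x"
proof -
  have "(\<lambda>(y, x). (lact Y k y, x)) ` cl y x = cl (lact Y k y) x"
  proof safe
    fix y' x' assume r: "((y, x), (y', x')) \<in> rel"
    then obtain h where "h \<in> carrier H" "y' \<in> points Y" "y = ract Y y' h" "x' = lact X h x"
      by (auto simp: rel_iff)
    then show "((lact Y k y, x), (lact Y k y', x')) \<in> rel"
      using assms Y.acts_commute Y.lact_closed by (auto simp: rel_iff)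
  next
    fix y' x' assume r: "((lact Y k y, x), (y', x')) \<in> rel"
    then obtain h where h: "h \<in> carrier H" "y' \<in> points Y" "lact Y k y = ract Y y' h" "x' = lact X h x"
      by (auto simp: rel_iff)
    let ?y = "lact Y (inv\<^bsub>K\<^esub> k) y'"
    have "lact Y k ?y = y'" using assms h Y.lact_mult[of k "inv\<^bsub>K\<^esub> k" y'] Y.lact_one by simp
    moreover have "y = ract Y ?y h"
    proof -
      have "y = lact Y (inv\<^bsub>K\<^esub> k) (lact Y k y)"
        using assms Y.lact_mult[of "inv\<^bsub>K\<^esub> k" k y] Y.lact_one by simp
      then show ?thesis using h Y.acts_commute assms by simp
    qed
    ultimately show "(y', x') \<in> (\<lambda>(y, x). (lact Y k y, x)) ` cl y x"
      using assms h Y.lact_closed by (intro image_eqI[of _ _ "(?y, x')"]) (auto simp: rel_iff)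
  qed
  then show ?thesis by (simp add: biset_prod_def)
qed

lemma ract_cl:
  assumes "g \<in> carrier G" "y \<in> points Y" "x \<in> points X"
  shows "ract (biset_prod H Y X) (cl y x) g = cl y (ract X x g)"
proof -
  have "(\<lambda>(y, x). (y, ract X x g)) ` cl y x = cl y (ract X x g)"
  proof safe
    fix y' x' assume r: "((y, x), (y', x')) \<in> rel"
    then obtain h where "h \<in> carrier H" "y' \<in> points Y" "y = ract Y y' h" "x' = lact X h x"
      by (auto simp: rel_iff)
    then show "((y, ract X x g), (y', ract X x' g)) \<in> rel"
      using assms X.acts_commute X.ract_closed by (auto simp: rel_iff)
  next
    fix y' x' assume r: "((y, ract X x g), (y', x')) \<in> rel"
    then obtain h where h: "h \<in> carrier H" "y' \<in> points Y" "y = ract Y y' h" "x' = lact X h (ract X x g)"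
      by (auto simp: rel_iff)
    then have "x' = ract X (lact X h x) g" using X.acts_commute assms by simp
    then show "(y', x') \<in> (\<lambda>(y, x). (y, ract X x g)) ` cl y x"
      using assms h by (intro image_eqI[of _ _ "(y', lact X h x)"]) (auto simp: rel_iff)
  qed
  then show ?thesis by (simp add: biset_prod_def)
qed

lemma is_biset_prod: "is_biset G K (biset_prod H Y X)"
proof -
  let ?P = "biset_prod H Y X"
  have el: "\<exists>y x. y \<in> points Y \<and> x \<in> points X \<and> C = cl y x" if "C \<in> points ?P" for C
    using that points_prod by auto
  have cl_in: "cl y x \<in> points ?P" if "y \<in> points Y" "x \<in> points X" for y x
    using that points_prod by auto
  show ?thesis
  proof (intro is_biset.intro is_biset_axioms.intro X.G.is_group Y.H.is_group)
    show "finite (points ?P)" unfolding points_prod using X.finite_points Y.finite_points by simp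
  qed (use el in \<open>fastforce simp: lact_cl ract_cl cl_in X.ract_closed Y.lact_closed X.ract_one Y.lact_one
     X.ract_mult Y.lact_mult\<close>)+
qed

text \<open>A balanced map on pairs that is equivariant, surjective and injective up to the identifications
  induces an isomorphism out of the product, so that equivalence classes need to be handled only
  here.\<close>

lemma prod_isoI:
  fixes Z :: "('z, 'g, 'k) biset"
  assumes closed: "\<And>y x. y \<in> points Y \<Longrightarrow> x \<in> points X \<Longrightarrow> f y x \<in> points Z"
    and bal: "\<And>y x h. y \<in> points Y \<Longrightarrow> x \<in> points X \<Longrightarrow> h \<in> carrier H \<Longrightarrow>
        f (ract Y y h) x = f y (lact X h x)"
    and inj: "\<And>y x y' x'. y \<in> points Y \<Longrightarrow> x \<in> points X \<Longrightarrow> y' \<in> points Y \<Longrightarrow> x' \<in> points X \<Longrightarrow>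
        f y x = f y' x' \<Longrightarrow> \<exists>h\<in>carrier H. y = ract Y y' h \<and> x' = lact X h x"
    and surj: "\<And>z. z \<in> points Z \<Longrightarrow> \<exists>y\<in>points Y. \<exists>x\<in>points X. z = f y x"
    and l: "\<And>y x k. y \<in> points Y \<Longrightarrow> x \<in> points X \<Longrightarrow> k \<in> carrier K \<Longrightarrow>
        f (lact Y k y) x = lact Z k (f y x)"
    and r: "\<And>y x g. y \<in> points Y \<Longrightarrow> x \<in> points X \<Longrightarrow> g \<in> carrier G \<Longrightarrow>
        f y (ract X x g) = ract Z (f y x) g"
  shows "biset_iso G K (biset_prod H Y X) Z"
proof -
  define F where "F C = (case (SOME z. z \<in> C) of (y, x) \<Rightarrow> f y x)" for C
  have F: "F (cl y x) = f y x" if yx: "y \<in> points Y" "x \<in> points X" for y x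
  proof -
    have "(y, x) \<in> cl y x" using equiv_class_self[OF equiv_rel, of "(y, x)"] yx by simp
    then have "(SOME z. z \<in> cl y x) \<in> cl y x" by (rule someI)
    then obtain y' x' where e: "(SOME z. z \<in> cl y x) = (y', x')" "((y, x), (y', x')) \<in> rel"
      by (metis Image_singleton_iff surj_pair)
    then show ?thesis using bal by (auto simp: F_def rel_iff)
  qed
  have "bij_betw F (points (biset_prod H Y X)) (points Z)"
  proof (rule bij_betw_imageI)
    show "inj_on F (points (biset_prod H Y X))"
    proof (rule inj_onI)
      fix C C' assume C: "C \<in> points (biset_prod H Y X)" "C' \<in> points (biset_prod H Y X)" "F C = F C'"
      then obtain y x y' x' where yx: "y \<in> points Y" "x \<in> points X" "C = cl y x"
        "y' \<in> points Y" "x' \<in> points X" "C' = cl y' x'" unfolding points_prod by auto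
      then have "f y x = f y' x'" using C(3) F by simp
      then have "\<exists>h\<in>carrier H. y = ract Y y' h \<and> x' = lact X h x" by (intro inj yx)
      then show "C = C'" unfolding yx using cl_eq_iff yx by blast
    qed
    show "F ` points (biset_prod H Y X) = points Z"
      using F closed surj by (fastforce simp: points_prod image_iff)
  qed
  moreover have "F (lact (biset_prod H Y X) k C) = lact Z k (F C)"
    if "C \<in> points (biset_prod H Y X)" "k \<in> carrier K" for C k
    using that F l Y.lact_closed by (auto simp: points_prod lact_cl)
  moreover have "F (ract (biset_prod H Y X) C g) = ract Z (F C) g"
    if "C \<in> points (biset_prod H Y X)" "g \<in> carrier G" for C g
    using that F r X.ract_closed by (auto simp: points_prod ract_cl)
  ultimately show ?thesis unfolding biset_iso_def by blast
qed

text \<open>The class of \<open>(y, x)\<close> is fixed iff for each \<open>u\<close> some \<open>h\<close> satisfies \<open>\<beta>(u) y = y h\<close> and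
  \<open>x \<alpha>(u) = h x\<close>.  As \<open>Y\<close> is right-free, \<open>h\<close> is unique, so \<open>u \<mapsto> h\<close> is a homomorphism \<open>\<gamma>\<close>, and the
  fixed pairs are counted according to \<open>\<gamma>\<close>.  Freeness also gives every class exactly \<open>|H|\<close> elements.\<close>

lemma card_fixp_prod:
  fixes M :: "('u, 'b) monoid_scheme"
  assumes M: "group M" and finM: "finite (carrier M)" and finH: "finite (carrier H)"
    and \<alpha>: "\<alpha> \<in> hom M G" and \<beta>: "\<beta> \<in> hom M K" and free: "right_free H Y"
  shows "card (carrier H) * card (fixp (biset_prod H Y X) (carrier M) \<alpha> \<beta>)
    = (\<Sum>\<gamma>\<in>hom M H \<inter> extensional (carrier M).
         card (fixp X (carrier M) \<alpha> \<gamma>) * card (fixp Y (carrier M) \<gamma> \<beta>))"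
proof -
  interpret M: group M by fact
  let ?L = "carrier M"
  let ?P = "biset_prod H Y X"
  let ?Hom = "hom M H \<inter> extensional ?L"
  define Q where "Q = {(y, x). y \<in> points Y \<and> x \<in> points X \<and> cl y x \<in> fixp ?P ?L \<alpha> \<beta>}"
  have a: "\<alpha> u \<in> carrier G" "\<beta> u \<in> carrier K" if "u \<in> ?L" for u
    using that \<alpha> \<beta> by (auto simp: hom_def)
  have cancel: "h = h'" if "y \<in> points Y" "h \<in> carrier H" "h' \<in> carrier H" "ract Y y h = ract Y y h'" for y h h'
  proof -
    have "ract Y y (h \<otimes>\<^bsub>H\<^esub> inv\<^bsub>H\<^esub> h') = y"
      using that Y.ract_mult[of h "inv\<^bsub>H\<^esub> h'" y] Y.ract_mult[of h' "inv\<^bsub>H\<^esub> h'" y] Y.ract_one by simp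
    then have "h \<otimes>\<^bsub>H\<^esub> inv\<^bsub>H\<^esub> h' = \<one>\<^bsub>H\<^esub>" using free that by (auto simp: right_free_def)
    then show ?thesis using that X.H.inv_equality by (metis X.H.inv_closed X.H.inv_inv)
  qed
  have finQ: "finite Q" using X.finite_points Y.finite_points
    by (rule_tac finite_subset[of _ "points Y \<times> points X"]) (auto simp: Q_def)
  have clQ: "\<Union>(fixp ?P ?L \<alpha> \<beta>) = Q"
  proof -
    have "(y, x) \<in> \<Union>(fixp ?P ?L \<alpha> \<beta>) \<longleftrightarrow> (y, x) \<in> Q" for y x
    proof
      assume "(y, x) \<in> \<Union>(fixp ?P ?L \<alpha> \<beta>)"
      then obtain y' x' where "cl y' x' \<in> fixp ?P ?L \<alpha> \<beta>" "(y, x) \<in> cl y' x'" "y' \<in> points Y" "x' \<in> points X"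
        by (auto simp: fixp_def points_prod)
      moreover from this have "cl y' x' = cl y x" "(y, x) \<in> points Y \<times> points X"
        using equiv_class_eq[OF equiv_rel] rel_sub by auto
      ultimately show "(y, x) \<in> Q" by (auto simp: Q_def)
    next
      assume "(y, x) \<in> Q"
      moreover from this have "(y, x) \<in> cl y x" 
        using equiv_class_self[OF equiv_rel, of "(y, x)"] by (simp add: Q_def)
      ultimately show "(y, x) \<in> \<Union>(fixp ?P ?L \<alpha> \<beta>)" by (auto simp: Q_def)
    qed
    then show ?thesis by auto
  qed
  have card_cl: "card (cl y x) = card (carrier H)" if yx: "y \<in> points Y" "x \<in> points X" for y x
  proof -
    let ?f = "\<lambda>h. (ract Y y (inv\<^bsub>H\<^esub> h), lact X h x)"
    have "inj_on ?f (carrier H)"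
      using cancel[OF yx(1)] by (auto simp: inj_on_def) (metis X.H.inv_closed X.H.inv_inv)
    moreover have "?f ` carrier H = cl y x"
    proof safe
      fix h assume h: "h \<in> carrier H"
      have "y = ract Y (ract Y y (inv\<^bsub>H\<^esub> h)) h"
        using h yx Y.ract_mult[of "inv\<^bsub>H\<^esub> h" h y] Y.ract_one by simp
      then show "((y, x), ?f h) \<in> rel" using h yx Y.ract_closed by (auto simp: rel_iff)
    next
      fix y' x' assume "((y, x), (y', x')) \<in> rel"
      then obtain h where h: "h \<in> carrier H" "y' \<in> points Y" "y = ract Y y' h" "x' = lact X h x"
        by (auto simp: rel_iff)
      then have "y' = ract Y y (inv\<^bsub>H\<^esub> h)" using Y.ract_mult[of h "inv\<^bsub>H\<^esub> h" y'] Y.ract_one by simp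
      then show "(y', x') \<in> ?f ` carrier H" using h by auto
    qed
    ultimately show ?thesis using card_image by fastforce
  qed
  have "card (carrier H) * card (fixp ?P ?L \<alpha> \<beta>) = card Q"
    unfolding clQ[symmetric]
  proof (rule card_partition)
    show "finite (fixp ?P ?L \<alpha> \<beta>)" using is_biset.finite_points[OF is_biset_prod] by (simp add: fixp_def)
    show "finite (\<Union>(fixp ?P ?L \<alpha> \<beta>))" using clQ finQ by simp
    show "card c = card (carrier H)" if "c \<in> fixp ?P ?L \<alpha> \<beta>" for c
      using that card_cl by (auto simp: fixp_def points_prod)
    show "c1 \<inter> c2 = {}" if "c1 \<in> fixp ?P ?L \<alpha> \<beta>" "c2 \<in> fixp ?P ?L \<alpha> \<beta>" "c1 \<noteq> c2" for c1 c2
    proof -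
      have "c1 \<in> (points Y \<times> points X) // rel" "c2 \<in> (points Y \<times> points X) // rel"
        using that by (auto simp: fixp_def biset_prod_def prodrel_def)
      then show ?thesis using quotient_disj[OF equiv_rel] that(3) by blast
    qed
  qed
  also have "Q = (\<Union>\<gamma>\<in>?Hom. fixp Y ?L \<gamma> \<beta> \<times> fixp X ?L \<alpha> \<gamma>)"
  proof -
    have iff: "cl y x \<in> fixp ?P ?L \<alpha> \<beta> \<longleftrightarrow>
      (\<forall>u\<in>?L. \<exists>h\<in>carrier H. lact Y (\<beta> u) y = ract Y y h \<and> ract X x (\<alpha> u) = lact X h x)"
      if "y \<in> points Y" "x \<in> points X" for y x
      using that by (auto simp: fixp_def points_prod lact_cl ract_cl a cl_eq_iff Y.lact_closed X.ract_closed)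
    have fwd: "\<exists>\<gamma>\<in>?Hom. y \<in> fixp Y ?L \<gamma> \<beta> \<and> x \<in> fixp X ?L \<alpha> \<gamma>" if "(y, x) \<in> Q" for y x
    proof -
      have yx: "y \<in> points Y" "x \<in> points X"
        "\<forall>u\<in>?L. \<exists>h\<in>carrier H. lact Y (\<beta> u) y = ract Y y h \<and> ract X x (\<alpha> u) = lact X h x"
        using that iff by (auto simp: Q_def)
      then obtain \<gamma>0 where g0: "\<And>u. u \<in> ?L \<Longrightarrow> \<gamma>0 u \<in> carrier H \<and> lact Y (\<beta> u) y = ract Y y (\<gamma>0 u) \<and>
          ract X x (\<alpha> u) = lact X (\<gamma>0 u) x" by metis
      have "\<gamma>0 (u \<otimes>\<^bsub>M\<^esub> v) = \<gamma>0 u \<otimes>\<^bsub>H\<^esub> \<gamma>0 v" if uv: "u \<in> ?L" "v \<in> ?L" for u v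
      proof -
        have "ract Y y (\<gamma>0 (u \<otimes>\<^bsub>M\<^esub> v)) = lact Y (\<beta> (u \<otimes>\<^bsub>M\<^esub> v)) y" using g0 uv by simp
        also have "\<dots> = lact Y (\<beta> u) (lact Y (\<beta> v) y)"
          using hom_mult[OF \<beta>] uv a yx Y.lact_mult by simp
        also have "\<dots> = ract Y (lact Y (\<beta> u) y) (\<gamma>0 v)" using g0 uv a yx Y.acts_commute by simp
        also have "\<dots> = ract Y y (\<gamma>0 u \<otimes>\<^bsub>H\<^esub> \<gamma>0 v)" using g0 uv yx Y.ract_mult by simp
        finally show ?thesis using cancel[OF yx(1)] g0 uv by simp
      qed
      then have "restrict \<gamma>0 ?L \<in> ?Hom" using g0 by (auto intro!: homI)
      moreover have "y \<in> fixp Y ?L (restrict \<gamma>0 ?L) \<beta>" "x \<in> fixp X ?L \<alpha> (restrict \<gamma>0 ?L)"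
        using g0 yx by (auto simp: fixp_def)
      ultimately show ?thesis by blast
    qed
    have bwd: "(y, x) \<in> Q" if "\<gamma> \<in> ?Hom" "y \<in> fixp Y ?L \<gamma> \<beta>" "x \<in> fixp X ?L \<alpha> \<gamma>" for y x \<gamma>
    proof -
      have "y \<in> points Y" "x \<in> points X" "\<And>u. u \<in> ?L \<Longrightarrow> \<gamma> u \<in> carrier H"
        using that by (auto simp: fixp_def hom_def)
      moreover have "\<forall>u\<in>?L. \<gamma> u \<in> carrier H \<and> lact Y (\<beta> u) y = ract Y y (\<gamma> u)
          \<and> ract X x (\<alpha> u) = lact X (\<gamma> u) x"
        using that calculation by (auto simp: fixp_def)
      ultimately have "cl y x \<in> fixp ?P ?L \<alpha> \<beta>" using iff by blast
      then show ?thesis using \<open>y \<in> points Y\<close> \<open>x \<in> points X\<close> by (simp add: Q_def)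
    qed
    show ?thesis
    proof (intro equalityI subsetI)
      fix z assume z: "z \<in> Q"
      obtain y x where yx: "z = (y, x)" by (cases z)
      show "z \<in> (\<Union>\<gamma>\<in>?Hom. fixp Y ?L \<gamma> \<beta> \<times> fixp X ?L \<alpha> \<gamma>)"
        using fwd[OF z[unfolded yx]] unfolding yx by (simp only: UN_iff mem_Times_iff fst_conv snd_conv)
    next
      fix z assume "z \<in> (\<Union>\<gamma>\<in>?Hom. fixp Y ?L \<gamma> \<beta> \<times> fixp X ?L \<alpha> \<gamma>)"
      then obtain \<gamma> where g: "\<gamma> \<in> ?Hom" "z \<in> fixp Y ?L \<gamma> \<beta> \<times> fixp X ?L \<alpha> \<gamma>" by (rule UN_E)
      then show "z \<in> Q" using bwd[OF g(1), of "fst z" "snd z"] by (simp only: mem_Times_iff prod.collapse)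
    qed
  qed
  also have "card \<dots> = (\<Sum>\<gamma>\<in>?Hom. card (fixp Y ?L \<gamma> \<beta> \<times> fixp X ?L \<alpha> \<gamma>))"
  proof (rule card_UN_disjoint)
    have "?Hom \<subseteq> ?L \<rightarrow>\<^sub>E carrier H" by (auto simp: hom_def PiE_def)
    then show "finite ?Hom" using finite_PiE[OF finM, of "\<lambda>_. carrier H"] finH finite_subset by blast
    show "\<forall>\<gamma>\<in>?Hom. finite (fixp Y ?L \<gamma> \<beta> \<times> fixp X ?L \<alpha> \<gamma>)"
      using X.finite_points Y.finite_points by (auto simp: fixp_def)
    show "\<forall>\<gamma>\<in>?Hom. \<forall>\<gamma>'\<in>?Hom. \<gamma> \<noteq> \<gamma>' \<longrightarrow>
      (fixp Y ?L \<gamma> \<beta> \<times> fixp X ?L \<alpha> \<gamma>) \<inter> (fixp Y ?L \<gamma>' \<beta> \<times> fixp X ?L \<alpha> \<gamma>') = {}"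
    proof (intro ballI impI, rule ccontr)
      fix \<gamma> \<gamma>' assume g: "\<gamma> \<in> ?Hom" "\<gamma>' \<in> ?Hom" "\<gamma> \<noteq> \<gamma>'"
        "(fixp Y ?L \<gamma> \<beta> \<times> fixp X ?L \<alpha> \<gamma>) \<inter> (fixp Y ?L \<gamma>' \<beta> \<times> fixp X ?L \<alpha> \<gamma>') \<noteq> {}"
      then obtain y where y: "y \<in> fixp Y ?L \<gamma> \<beta>" "y \<in> fixp Y ?L \<gamma>' \<beta>" by blast
      have "\<gamma> u = \<gamma>' u" if "u \<in> ?L" for u
        using that y g(1,2) by (intro cancel[of y]) (auto simp: fixp_def hom_def)
      then have "\<gamma> = \<gamma>'" using g(1,2) by (intro extensionalityI[of _ ?L]) auto
      then show False using g by simp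
    qed
  qed
  finally show ?thesis by (simp add: card_cartesian_product mult.commute)
qed

end

lemma biset_prod_cong:
  assumes "is_biset G H X" "is_biset H K Y" "is_biset G H X'" "is_biset H K Y'"
    and "biset_iso G H X X'" "biset_iso H K Y Y'"
  shows "biset_iso G K (biset_prod H Y X) (biset_prod H Y' X')"
proof -
  interpret A: biset_pair G H K X Y using assms by (simp add: biset_pair_def)
  interpret B: biset_pair G H K X' Y' using assms by (simp add: biset_pair_def)
  obtain f where f: "bij_betw f (points X) (points X')"
    "\<And>x h. x \<in> points X \<Longrightarrow> h \<in> carrier H \<Longrightarrow> f (lact X h x) = lact X' h (f x)"
    "\<And>x g. x \<in> points X \<Longrightarrow> g \<in> carrier G \<Longrightarrow> f (ract X x g) = ract X' (f x) g"
    by (rule biset_isoE[OF assms(5)]) (erule that)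
  obtain f' where f': "bij_betw f' (points Y) (points Y')"
    "\<And>x h. x \<in> points Y \<Longrightarrow> h \<in> carrier K \<Longrightarrow> f' (lact Y h x) = lact Y' h (f' x)"
    "\<And>x g. x \<in> points Y \<Longrightarrow> g \<in> carrier H \<Longrightarrow> f' (ract Y x g) = ract Y' (f' x) g"
    by (rule biset_isoE[OF assms(6)]) (erule that)
  have im: "f x \<in> points X'" "f' y \<in> points Y'" if "x \<in> points X" "y \<in> points Y" for x y
    by (rule bij_betw_apply[OF f(1) that(1)], rule bij_betw_apply[OF f'(1) that(2)])
  have inj: "f x = f x2 \<longleftrightarrow> x = x2" if "x \<in> points X" "x2 \<in> points X" for x x2
    using inj_on_eq_iff[OF bij_betw_imp_inj_on[OF f(1)]] that by blast
  have inj': "f' x = f' x2 \<longleftrightarrow> x = x2" if "x \<in> points Y" "x2 \<in> points Y" for x x2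
    using inj_on_eq_iff[OF bij_betw_imp_inj_on[OF f'(1)]] that by blast
  show ?thesis
  proof (rule A.prod_isoI[where f = "\<lambda>y x. B.cl (f' y) (f x)"])
    fix y x h assume a: "y \<in> points Y" "x \<in> points X" "h \<in> carrier H"
    show "B.cl (f' (ract Y y h)) (f x) = B.cl (f' y) (f (lact X h x))"
      using a im f f' by (subst B.cl_eq_iff) (auto simp: B.Y.ract_closed B.X.lact_closed)
  next
    fix y x y' x' assume a: "y \<in> points Y" "x \<in> points X" "y' \<in> points Y" "x' \<in> points X"
      "B.cl (f' y) (f x) = B.cl (f' y') (f x')"
    then obtain h where h: "h \<in> carrier H" "f' y = ract Y' (f' y') h" "f x' = lact X' h (f x)"
      using B.cl_eq_iff[OF im(2)[OF a(2,1)] im(1)[OF a(2,1)] im(2)[OF a(4,3)] im(1)[OF a(4,3)]] by auto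
    then have "f' y = f' (ract Y y' h)" "f x' = f (lact X h x)"
      using f'(3)[OF a(3) h(1)] f(2)[OF a(2) h(1)] by simp_all
    then have "y = ract Y y' h" "x' = lact X h x"
      using inj'[OF a(1) A.Y.ract_closed[OF h(1) a(3)]] inj[OF a(4) A.X.lact_closed[OF h(1) a(2)]]
      by simp_all
    then show "\<exists>h\<in>carrier H. y = ract Y y' h \<and> x' = lact X h x" using h by blast
  next
    fix z assume "z \<in> points (biset_prod H Y' X')"
    then obtain y' x' where z: "y' \<in> points Y'" "x' \<in> points X'" "z = B.cl y' x'"
      by (auto simp: B.points_prod)
    moreover obtain y where "y \<in> points Y" "y' = f' y"
      using bij_betw_imp_surj_on[OF f'(1)] z(1) by blast
    moreover obtain x where "x \<in> points X" "x' = f x"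
      using bij_betw_imp_surj_on[OF f(1)] z(2) by blast
    ultimately show "\<exists>y\<in>points Y. \<exists>x\<in>points X. z = B.cl (f' y) (f x)" by blast
  next
    show "B.cl (f' y) (f x) \<in> points (biset_prod H Y' X')" if "y \<in> points Y" "x \<in> points X" for y x
      using im[OF that(2,1)] by (auto simp: B.points_prod)
  qed (simp_all add: f f' im B.lact_cl B.ract_cl)
qed

lemma biset_prod_sum_left:
  assumes X: "is_biset G H X" and Y: "is_biset H K Y" "is_biset H K Y'"
  shows "biset_iso G K (biset_prod H (biset_sum Y Y') X)
    (biset_sum (biset_prod H Y X) (biset_prod H Y' X))"
proof -
  interpret A: biset_pair G H K X Y using assms by (simp add: biset_pair_def)
  interpret B: biset_pair G H K X Y' using assms by (simp add: biset_pair_def)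
  interpret C: biset_pair G H K X "biset_sum Y Y'" using assms is_biset_sum by (simp add: biset_pair_def)
  show ?thesis
  proof (rule C.prod_isoI[where f = "\<lambda>y x. map_sum (\<lambda>y. A.cl y x) (\<lambda>y. B.cl y x) y"])
    fix y x h assume "y \<in> points (biset_sum Y Y')" "x \<in> points X" "h \<in> carrier H"
    then show "map_sum (\<lambda>y. A.cl y x) (\<lambda>y. B.cl y x) (ract (biset_sum Y Y') y h) =
       map_sum (\<lambda>y. A.cl y (lact X h x)) (\<lambda>y. B.cl y (lact X h x)) y"
      by (auto simp: biset_sum_def A.cl_eq_iff B.cl_eq_iff A.Y.ract_closed B.Y.ract_closed A.X.lact_closed)
  qed (auto simp: biset_sum_def A.cl_eq_iff B.cl_eq_iff A.points_prod B.points_prod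
      A.lact_cl B.lact_cl A.ract_cl B.ract_cl Plus_def bex_Un)
qed

lemma biset_prod_sum_right:
  assumes X: "is_biset G H X" "is_biset G H X'" and Y: "is_biset H K Y"
  shows "biset_iso G K (biset_prod H Y (biset_sum X X'))
    (biset_sum (biset_prod H Y X) (biset_prod H Y X'))"
proof -
  interpret A: biset_pair G H K X Y using assms by (simp add: biset_pair_def)
  interpret B: biset_pair G H K X' Y using assms by (simp add: biset_pair_def)
  interpret C: biset_pair G H K "biset_sum X X'" Y using assms is_biset_sum by (simp add: biset_pair_def)
  show ?thesis
  proof (rule C.prod_isoI[where f = "\<lambda>y x. map_sum (\<lambda>x. A.cl y x) (\<lambda>x. B.cl y x) x"])
    fix y x h assume "x \<in> points (biset_sum X X')" "y \<in> points Y" "h \<in> carrier H"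
    then show "map_sum (A.cl (ract Y y h)) (B.cl (ract Y y h)) x =
       map_sum (A.cl y) (B.cl y) (lact (biset_sum X X') h x)"
      by (auto simp: biset_sum_def A.cl_eq_iff B.cl_eq_iff A.Y.ract_closed B.X.lact_closed A.X.lact_closed)
  qed (auto simp: biset_sum_def A.cl_eq_iff B.cl_eq_iff A.points_prod B.points_prod
      A.lact_cl B.lact_cl A.ract_cl B.ract_cl Plus_def bex_Un)
qed

section \<open>Transitive bisets\<close>

lemma graph_subgroup_mem: "(b, u) \<in> graph_subgroup U \<phi> \<longleftrightarrow> u \<in> U \<and> b = \<phi> u"
  by (auto simp: graph_subgroup_def)

locale coset_data = G: group G + H: group H
  for G :: "('g, 'm) monoid_scheme" and H :: "('h, 'n) monoid_scheme" +
  fixes U :: "'g set" and \<phi> :: "'g \<Rightarrow> 'h"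
  assumes finG: "finite (carrier G)" and finH: "finite (carrier H)"
    and U: "subgroup U G" and \<phi>: "\<phi> \<in> hom (G\<lparr>carrier := U\<rparr>) H"
begin

sublocale U: subgroup U G by (rule U)

abbreviation "D \<equiv> graph_subgroup U \<phi>"
abbreviation "HG \<equiv> H \<times>\<times> G"

sublocale HG: group HG by (rule DirProd_group[OF H.is_group G.is_group])

lemma phi_closed: "u \<in> U \<Longrightarrow> \<phi> u \<in> carrier H"
  using \<phi> by (auto simp: hom_def)

lemma phi_mult: "u \<in> U \<Longrightarrow> v \<in> U \<Longrightarrow> \<phi> (u \<otimes>\<^bsub>G\<^esub> v) = \<phi> u \<otimes>\<^bsub>H\<^esub> \<phi> v"
  using \<phi> by (auto simp: hom_def)

lemma phi_one: "\<phi> \<one>\<^bsub>G\<^esub> = \<one>\<^bsub>H\<^esub>"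
  using hom_one[OF \<phi> U.subgroup_is_group[OF G.is_group] H.is_group] by simp

lemma phi_inv: "u \<in> U \<Longrightarrow> \<phi> (inv\<^bsub>G\<^esub> u) = inv\<^bsub>H\<^esub> \<phi> u"
  using phi_mult[of "inv\<^bsub>G\<^esub> u" u] phi_one phi_closed U.m_inv_closed
  by (metis G.l_inv H.inv_equality U.mem_carrier)

lemma finHG: "finite (carrier HG)"
  using finG finH by simp

lemma subgroup_D: "subgroup D HG"
  by (rule HG.subgroupI)
    (auto simp: graph_subgroup_def phi_closed phi_mult phi_one phi_inv inv_DirProd[OF H.is_group G.is_group] intro: U.one_closed)

lemma card_D: "card D = card U"
proof -
  have "D = (\<lambda>u. (\<phi> u, u)) ` U" by (auto simp: graph_subgroup_def)
  then show ?thesis by (simp add: card_image inj_on_def)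
qed

lemma coset_eq:
  assumes "a \<in> carrier H" "b \<in> carrier G" "a' \<in> carrier H" "b' \<in> carrier G"
  shows "(a, b) <#\<^bsub>HG\<^esub> D = (a', b') <#\<^bsub>HG\<^esub> D \<longleftrightarrow>
    inv\<^bsub>G\<^esub> b \<otimes>\<^bsub>G\<^esub> b' \<in> U \<and> inv\<^bsub>H\<^esub> a \<otimes>\<^bsub>H\<^esub> a' = \<phi> (inv\<^bsub>G\<^esub> b \<otimes>\<^bsub>G\<^esub> b')"
  using HG.l_coset_eq_iff[OF subgroup_D, of "(a, b)" "(a', b')"] assms
  by (simp add: inv_DirProd[OF H.is_group G.is_group] graph_subgroup_mem)

lemma coset_mult:
  assumes "a \<in> carrier H" "b \<in> carrier G" "a' \<in> carrier H" "b' \<in> carrier G"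
  shows "(a, b) <#\<^bsub>HG\<^esub> ((a', b') <#\<^bsub>HG\<^esub> D) = (a \<otimes>\<^bsub>H\<^esub> a', b \<otimes>\<^bsub>G\<^esub> b') <#\<^bsub>HG\<^esub> D"
  using HG.lcos_m_assoc[OF subgroup.subset[OF subgroup_D], of "(a, b)" "(a', b')"] assms by simp

abbreviation "X \<equiv> coset_biset G H U \<phi>"

lemma points_X: "points X = (\<lambda>(a, b). (a, b) <#\<^bsub>HG\<^esub> D) ` (carrier H \<times> carrier G)"
  by (simp add: coset_biset_def)

lemma lact_X: "\<lbrakk>h \<in> carrier H; a \<in> carrier H; b \<in> carrier G\<rbrakk> \<Longrightarrow>
    lact X h ((a, b) <#\<^bsub>HG\<^esub> D) = (h \<otimes>\<^bsub>H\<^esub> a, b) <#\<^bsub>HG\<^esub> D"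
  by (simp add: coset_biset_def coset_mult)

lemma ract_X: "\<lbrakk>g \<in> carrier G; a \<in> carrier H; b \<in> carrier G\<rbrakk> \<Longrightarrow>
    ract X ((a, b) <#\<^bsub>HG\<^esub> D) g = (a, inv\<^bsub>G\<^esub> g \<otimes>\<^bsub>G\<^esub> b) <#\<^bsub>HG\<^esub> D"
  by (simp add: coset_biset_def coset_mult)

lemma is_biset: "is_biset G H X"
proof (intro is_biset.intro is_biset_axioms.intro G.is_group H.is_group)
  show "finite (points X)" unfolding points_X using finG finH by simp
qed (auto simp: points_X lact_X ract_X H.m_assoc G.inv_mult_group G.m_assoc)

lemma left_free: "left_free H X"
proof -
  have "h = \<one>\<^bsub>H\<^esub>" if h: "h \<in> carrier H" and ab: "a \<in> carrier H" "b \<in> carrier G"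
    and e: "(h \<otimes>\<^bsub>H\<^esub> a, b) <#\<^bsub>HG\<^esub> D = (a, b) <#\<^bsub>HG\<^esub> D" for h a b
  proof -
    have "inv\<^bsub>H\<^esub> (h \<otimes>\<^bsub>H\<^esub> a) \<otimes>\<^bsub>H\<^esub> a = \<one>\<^bsub>H\<^esub>"
      using e h ab coset_eq[of "h \<otimes>\<^bsub>H\<^esub> a" b a b] phi_one by simp
    then have "inv\<^bsub>H\<^esub> (h \<otimes>\<^bsub>H\<^esub> a) = inv\<^bsub>H\<^esub> a"
      using h ab by (metis H.inv_closed H.inv_equality H.m_closed H.inv_inv)
    then have "h \<otimes>\<^bsub>H\<^esub> a = a" using h ab by (metis H.inv_inv H.m_closed)
    then show ?thesis using h ab by (simp add: H.r_cancel_one')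
  qed
  then show ?thesis by (auto simp: left_free_def points_X lact_X)
qed

lemma right_free: "inj_on \<phi> U \<Longrightarrow> right_free G X"
proof -
  assume inj: "inj_on \<phi> U"
  have "g = \<one>\<^bsub>G\<^esub>" if g: "g \<in> carrier G" and ab: "a \<in> carrier H" "b \<in> carrier G"
    and e: "(a, inv\<^bsub>G\<^esub> g \<otimes>\<^bsub>G\<^esub> b) <#\<^bsub>HG\<^esub> D = (a, b) <#\<^bsub>HG\<^esub> D" for g a b
  proof -
    let ?u = "inv\<^bsub>G\<^esub> (inv\<^bsub>G\<^esub> g \<otimes>\<^bsub>G\<^esub> b) \<otimes>\<^bsub>G\<^esub> b"
    have "?u \<in> U" "\<phi> ?u = \<one>\<^bsub>H\<^esub>" using e g ab coset_eq[of a "inv\<^bsub>G\<^esub> g \<otimes>\<^bsub>G\<^esub> b" a b] by auto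
    then have "?u = \<one>\<^bsub>G\<^esub>" using inj phi_one U.one_closed by (auto simp: inj_on_def)
    then have "inv\<^bsub>G\<^esub> b \<otimes>\<^bsub>G\<^esub> (g \<otimes>\<^bsub>G\<^esub> b) = \<one>\<^bsub>G\<^esub>"
      using g ab by (simp add: G.inv_mult_group G.m_assoc)
    then have "g \<otimes>\<^bsub>G\<^esub> b = b" using g ab
      by (metis G.inv_closed G.inv_inv G.inv_unique' G.m_closed G.l_inv G.r_inv G.inv_equality)
    then show ?thesis using g ab by (simp add: G.r_cancel_one')
  qed
  then show ?thesis by (auto simp: right_free_def points_X ract_X)
qed

text \<open>The coset of \<open>(a, b)\<close> is fixed iff conjugation by \<open>(a, b)\<close> carries the twisted diagonal into
  \<open>\<Delta>(U, \<phi>)\<close>.  The set of these pairs is a union of cosets of \<open>\<Delta>(U, \<phi>)\<close>, each of size \<open>|U|\<close>.\<close>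

lemma card_fixp:
  assumes \<alpha>: "\<alpha> ` L \<subseteq> carrier G" and \<beta>: "\<beta> ` L \<subseteq> carrier H"
  shows "card U * card (fixp X L \<alpha> \<beta>) = card {(a, b) \<in> carrier H \<times> carrier G. \<forall>u\<in>L.
     inv\<^bsub>G\<^esub> b \<otimes>\<^bsub>G\<^esub> \<alpha> u \<otimes>\<^bsub>G\<^esub> b \<in> U \<and>
     \<phi> (inv\<^bsub>G\<^esub> b \<otimes>\<^bsub>G\<^esub> \<alpha> u \<otimes>\<^bsub>G\<^esub> b) = inv\<^bsub>H\<^esub> a \<otimes>\<^bsub>H\<^esub> \<beta> u \<otimes>\<^bsub>H\<^esub> a}" (is "_ = card ?B")
proof -
  have closed: "\<alpha> u \<in> carrier G" "\<beta> u \<in> carrier H" if "u \<in> L" for u using that \<alpha> \<beta> by auto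
  have fix_iff: "(a, b) <#\<^bsub>HG\<^esub> D \<in> fixp X L \<alpha> \<beta> \<longleftrightarrow> (a, b) \<in> ?B"
    if ab: "a \<in> carrier H" "b \<in> carrier G" for a b
  proof -
    have "lact X (\<beta> u) ((a, b) <#\<^bsub>HG\<^esub> D) = ract X ((a, b) <#\<^bsub>HG\<^esub> D) (\<alpha> u) \<longleftrightarrow>
      inv\<^bsub>G\<^esub> b \<otimes>\<^bsub>G\<^esub> \<alpha> u \<otimes>\<^bsub>G\<^esub> b \<in> U \<and>
      \<phi> (inv\<^bsub>G\<^esub> b \<otimes>\<^bsub>G\<^esub> \<alpha> u \<otimes>\<^bsub>G\<^esub> b) = inv\<^bsub>H\<^esub> a \<otimes>\<^bsub>H\<^esub> \<beta> u \<otimes>\<^bsub>H\<^esub> a" if u: "u \<in> L" for u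
    proof -
      have "lact X (\<beta> u) ((a, b) <#\<^bsub>HG\<^esub> D) = ract X ((a, b) <#\<^bsub>HG\<^esub> D) (\<alpha> u) \<longleftrightarrow>
         (a, inv\<^bsub>G\<^esub> \<alpha> u \<otimes>\<^bsub>G\<^esub> b) <#\<^bsub>HG\<^esub> D = (\<beta> u \<otimes>\<^bsub>H\<^esub> a, b) <#\<^bsub>HG\<^esub> D"
        using ab closed[OF u] by (auto simp: lact_X ract_X)
      also have "\<dots> \<longleftrightarrow> inv\<^bsub>G\<^esub> (inv\<^bsub>G\<^esub> \<alpha> u \<otimes>\<^bsub>G\<^esub> b) \<otimes>\<^bsub>G\<^esub> b \<in> U \<and>
          inv\<^bsub>H\<^esub> a \<otimes>\<^bsub>H\<^esub> (\<beta> u \<otimes>\<^bsub>H\<^esub> a) = \<phi> (inv\<^bsub>G\<^esub> (inv\<^bsub>G\<^esub> \<alpha> u \<otimes>\<^bsub>G\<^esub> b) \<otimes>\<^bsub>G\<^esub> b)"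
        using ab closed[OF u] by (intro coset_eq) auto
      finally show ?thesis using ab closed[OF u] by (auto simp: G.inv_mult_group H.m_assoc)
    qed
    then show ?thesis using ab by (auto simp: fixp_def points_X)
  qed
  have fix_im: "fixp X L \<alpha> \<beta> = (\<lambda>x. x <#\<^bsub>HG\<^esub> D) ` ?B"
  proof (intro equalityI subsetI)
    fix C assume C: "C \<in> fixp X L \<alpha> \<beta>"
    then obtain a b where "a \<in> carrier H" "b \<in> carrier G" "C = (a, b) <#\<^bsub>HG\<^esub> D"
      by (auto simp: fixp_def points_X)
    then show "C \<in> (\<lambda>x. x <#\<^bsub>HG\<^esub> D) ` ?B" using fix_iff C by blast
  next
    fix C assume "C \<in> (\<lambda>x. x <#\<^bsub>HG\<^esub> D) ` ?B"
    then obtain a b where "(a, b) \<in> ?B" "C = (a, b) <#\<^bsub>HG\<^esub> D" by auto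
    then show "C \<in> fixp X L \<alpha> \<beta>" using fix_iff[of a b] by blast
  qed
  have B: "?B \<subseteq> carrier HG" by auto
  have "?B <#>\<^bsub>HG\<^esub> D = ?B"
  proof (intro equalityI subsetI)
    fix z assume "z \<in> ?B <#>\<^bsub>HG\<^esub> D"
    then obtain x d where xd: "x \<in> ?B" "d \<in> D" "z = x \<otimes>\<^bsub>HG\<^esub> d" by (auto simp: set_mult_def)
    then have c: "x \<in> carrier HG" "d \<in> carrier HG" using subgroup.subset[OF subgroup_D] by auto
    have "inv\<^bsub>HG\<^esub> x \<otimes>\<^bsub>HG\<^esub> z = d" unfolding xd(3)
      using HG.m_assoc[OF HG.inv_closed[OF c(1)] c] HG.l_inv[OF c(1)] HG.l_one[OF c(2)] by metis
    then have "inv\<^bsub>HG\<^esub> x \<otimes>\<^bsub>HG\<^esub> z \<in> D" using xd(2) by simp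
    then have e: "x <#\<^bsub>HG\<^esub> D = z <#\<^bsub>HG\<^esub> D"
      using HG.l_coset_eq_iff[OF subgroup_D c(1), of z] c xd(3) HG.m_closed by blast
    obtain a b where ab: "z = (a, b)" by (cases z)
    have "a \<in> carrier H" "b \<in> carrier G" using ab c xd(3) HG.m_closed[OF c] by auto
    then show "z \<in> ?B" using fix_iff[of a b] e fix_im xd(1) unfolding ab by blast
  next
    fix z assume z: "z \<in> ?B"
    then have "z \<in> carrier HG" using B by blast
    then have "z = z \<otimes>\<^bsub>HG\<^esub> \<one>\<^bsub>HG\<^esub>" by (rule HG.r_one[symmetric])
    then show "z \<in> ?B <#>\<^bsub>HG\<^esub> D" using z subgroup.one_closed[OF subgroup_D]
      unfolding set_mult_def by blast
  qed
  then have "card D * card ((\<lambda>x. x <#\<^bsub>HG\<^esub> D) ` ?B) = card ?B"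
    using HG.card_l_cosets[OF subgroup_D B finHG] by simp
  then show ?thesis using fix_im card_D by simp
qed

end

section \<open>Marks determine a biset\<close>

definition stab :: "('g, 'm) monoid_scheme \<Rightarrow> ('h, 'n) monoid_scheme \<Rightarrow> ('x, 'g, 'h) biset \<Rightarrow> 'x \<Rightarrow>
    ('h \<times> 'g) set" where
  "stab G H X x = {(h, g) \<in> carrier H \<times> carrier G. lact X h x = ract X x g}"

lemma fixp_stab_iff:
  assumes "L \<subseteq> carrier H \<times> carrier G"
  shows "x \<in> fixp X L snd fst \<longleftrightarrow> x \<in> points X \<and> L \<subseteq> stab G H X x"
  using assms by (auto simp: fixp_def stab_def)

context is_biset
begin

lemma subgroup_stab:
  assumes x: "x \<in> points X"
  shows "subgroup (stab G H X x) (H \<times>\<times> G)"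
proof -
  interpret HG: group "H \<times>\<times> G" by (rule DirProd_group[OF H.is_group G.is_group])
  have inv: "lact X (inv\<^bsub>H\<^esub> h) x = ract X x (inv\<^bsub>G\<^esub> g)"
    if hg: "h \<in> carrier H" "g \<in> carrier G" "lact X h x = ract X x g" for h g
  proof -
    have "x = lact X (inv\<^bsub>H\<^esub> h) (lact X h x)"
      using x hg lact_mult[of "inv\<^bsub>H\<^esub> h" h x] lact_one by simp
    also have "\<dots> = ract X (lact X (inv\<^bsub>H\<^esub> h) x) g" using x hg acts_commute by simp
    finally have "ract X x (inv\<^bsub>G\<^esub> g) = ract X (ract X (lact X (inv\<^bsub>H\<^esub> h) x) g) (inv\<^bsub>G\<^esub> g)" by simp
    also have "\<dots> = lact X (inv\<^bsub>H\<^esub> h) x"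
      using x hg ract_mult[of g "inv\<^bsub>G\<^esub> g" "lact X (inv\<^bsub>H\<^esub> h) x"] lact_closed ract_one by simp
    finally show ?thesis by simp
  qed
  show ?thesis
  proof (rule HG.subgroupI)
    have "(\<one>\<^bsub>H\<^esub>, \<one>\<^bsub>G\<^esub>) \<in> stab G H X x" using x lact_one ract_one by (simp add: stab_def)
    then show "stab G H X x \<noteq> {}" by blast
  qed (use x inv in \<open>auto simp: stab_def inv_DirProd[OF H.is_group G.is_group] lact_mult ract_mult acts_commute\<close>)
qed

definition orb :: "'x \<Rightarrow> 'x set" where
  "orb x = (\<lambda>(h, g). ract X (lact X h x) g) ` (carrier H \<times> carrier G)"

lemma orb_sub: "x \<in> points X \<Longrightarrow> orb x \<subseteq> points X"
  by (auto simp: orb_def lact_closed ract_closed)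

lemma orb_self: "x \<in> points X \<Longrightarrow> x \<in> orb x"
  unfolding orb_def by (intro image_eqI[of _ _ "(\<one>\<^bsub>H\<^esub>, \<one>\<^bsub>G\<^esub>)"]) (auto simp: lact_one ract_one)

lemma lact_orb:
  assumes "x \<in> points X" "h \<in> carrier H" "y \<in> orb x" shows "lact X h y \<in> orb x"
proof -
  obtain h' g where hg: "h' \<in> carrier H" "g \<in> carrier G" "y = ract X (lact X h' x) g"
    using assms by (auto simp: orb_def)
  have "lact X h y = ract X (lact X (h \<otimes>\<^bsub>H\<^esub> h') x) g"
    using assms hg by (simp add: acts_commute lact_closed lact_mult)
  then show ?thesis unfolding orb_def using hg assms by (intro image_eqI[of _ _ "(h \<otimes>\<^bsub>H\<^esub> h', g)"]) auto
qed

lemma ract_orb: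
  assumes "x \<in> points X" "g \<in> carrier G" "y \<in> orb x" shows "ract X y g \<in> orb x"
proof -
  obtain h' g' where hg: "h' \<in> carrier H" "g' \<in> carrier G" "y = ract X (lact X h' x) g'"
    using assms by (auto simp: orb_def)
  have "ract X y g = ract X (lact X h' x) (g' \<otimes>\<^bsub>G\<^esub> g)"
    using assms hg by (simp add: lact_closed ract_mult)
  then show ?thesis unfolding orb_def using hg assms by (intro image_eqI[of _ _ "(h', g' \<otimes>\<^bsub>G\<^esub> g)"]) auto
qed

text \<open>Two elements of the orbit of \<open>x\<close> are equal according to a condition on the stabilizer only; hence
  points with equal stabilizers have isomorphic orbits.\<close>

lemma stab_eq_iff:
  assumes x: "x \<in> points X" and c: "h \<in> carrier H" "h' \<in> carrier H" "g \<in> carrier G" "g' \<in> carrier G"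
  shows "ract X (lact X h x) g = ract X (lact X h' x) g' \<longleftrightarrow>
    (inv\<^bsub>H\<^esub> h' \<otimes>\<^bsub>H\<^esub> h, g' \<otimes>\<^bsub>G\<^esub> inv\<^bsub>G\<^esub> g) \<in> stab G H X x"
proof -
  have "ract X (lact X h x) g = ract X (lact X h' x) g' \<longleftrightarrow>
    lact X h x = ract X (lact X h' x) (g' \<otimes>\<^bsub>G\<^esub> inv\<^bsub>G\<^esub> g)"
  proof
    assume a: "ract X (lact X h x) g = ract X (lact X h' x) g'"
    have "lact X h x = ract X (ract X (lact X h x) g) (inv\<^bsub>G\<^esub> g)"
      using x c ract_mult[of g "inv\<^bsub>G\<^esub> g" "lact X h x"] lact_closed ract_one by simp
    then show "lact X h x = ract X (lact X h' x) (g' \<otimes>\<^bsub>G\<^esub> inv\<^bsub>G\<^esub> g)"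
      using a x c by (simp add: lact_closed ract_mult)
  next
    assume a: "lact X h x = ract X (lact X h' x) (g' \<otimes>\<^bsub>G\<^esub> inv\<^bsub>G\<^esub> g)"
    have "ract X (lact X h x) g = ract X (lact X h' x) (g' \<otimes>\<^bsub>G\<^esub> inv\<^bsub>G\<^esub> g \<otimes>\<^bsub>G\<^esub> g)"
      unfolding a using x c by (simp add: lact_closed ract_mult[symmetric])
    then show "ract X (lact X h x) g = ract X (lact X h' x) g'" using c by (simp add: G.m_assoc)
  qed
  also have "\<dots> \<longleftrightarrow> lact X (inv\<^bsub>H\<^esub> h' \<otimes>\<^bsub>H\<^esub> h) x = ract X x (g' \<otimes>\<^bsub>G\<^esub> inv\<^bsub>G\<^esub> g)"
  proof
    assume a: "lact X h x = ract X (lact X h' x) (g' \<otimes>\<^bsub>G\<^esub> inv\<^bsub>G\<^esub> g)"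
    have "lact X (inv\<^bsub>H\<^esub> h' \<otimes>\<^bsub>H\<^esub> h) x = lact X (inv\<^bsub>H\<^esub> h') (lact X h x)" using x c by (simp add: lact_mult)
    also have "\<dots> = ract X (lact X (inv\<^bsub>H\<^esub> h' \<otimes>\<^bsub>H\<^esub> h') x) (g' \<otimes>\<^bsub>G\<^esub> inv\<^bsub>G\<^esub> g)"
      unfolding a using x c lact_mult[of "inv\<^bsub>H\<^esub> h'" h' x] by (simp add: acts_commute lact_closed)
    finally show "lact X (inv\<^bsub>H\<^esub> h' \<otimes>\<^bsub>H\<^esub> h) x = ract X x (g' \<otimes>\<^bsub>G\<^esub> inv\<^bsub>G\<^esub> g)"
      using x c by (simp add: lact_one)
  next
    assume a: "lact X (inv\<^bsub>H\<^esub> h' \<otimes>\<^bsub>H\<^esub> h) x = ract X x (g' \<otimes>\<^bsub>G\<^esub> inv\<^bsub>G\<^esub> g)"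
    have "lact X h x = lact X (h' \<otimes>\<^bsub>H\<^esub> (inv\<^bsub>H\<^esub> h' \<otimes>\<^bsub>H\<^esub> h)) x"
      using c by (simp add: H.m_assoc[symmetric])
    also have "\<dots> = lact X h' (ract X x (g' \<otimes>\<^bsub>G\<^esub> inv\<^bsub>G\<^esub> g))"
      unfolding a[symmetric] using x c by (intro lact_mult) auto
    finally show "lact X h x = ract X (lact X h' x) (g' \<otimes>\<^bsub>G\<^esub> inv\<^bsub>G\<^esub> g)"
      using x c by (simp add: acts_commute)
  qed
  finally show ?thesis using c by (simp add: stab_def)
qed

lemma is_biset_sub:
  assumes A: "A \<subseteq> points X" and l: "\<And>h x. h \<in> carrier H \<Longrightarrow> x \<in> A \<Longrightarrow> lact X h x \<in> A"
    and r: "\<And>g x. g \<in> carrier G \<Longrightarrow> x \<in> A \<Longrightarrow> ract X x g \<in> A"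
  shows "is_biset G H (X\<lparr>points := A\<rparr>)" "is_biset G H (X\<lparr>points := points X - A\<rparr>)"
proof -
  show "is_biset G H (X\<lparr>points := A\<rparr>)"
    by (intro is_biset.intro is_biset_axioms.intro G.is_group H.is_group)
      (use A l r finite_subset[OF A finite_points] in
        \<open>auto simp: subset_iff lact_one ract_one lact_mult ract_mult acts_commute\<close>)
  have l': "x \<in> A" if "h \<in> carrier H" "x \<in> points X" "lact X h x \<in> A" for h x
  proof -
    have "x = lact X (inv\<^bsub>H\<^esub> h) (lact X h x)"
      using that lact_mult[of "inv\<^bsub>H\<^esub> h" h x] lact_one by simp
    then show ?thesis using l[OF H.inv_closed[OF that(1)] that(3)] by simp
  qed
  have r': "x \<in> A" if "g \<in> carrier G" "x \<in> points X" "ract X x g \<in> A" for g x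
  proof -
    have "x = ract X (ract X x g) (inv\<^bsub>G\<^esub> g)"
      using that ract_mult[of g "inv\<^bsub>G\<^esub> g" x] ract_one by simp
    then show ?thesis using r[OF G.inv_closed[OF that(1)] that(3)] by simp
  qed
  show "is_biset G H (X\<lparr>points := points X - A\<rparr>)"
    by (intro is_biset.intro is_biset_axioms.intro G.is_group H.is_group)
      (auto simp: finite_points lact_one ract_one lact_mult ract_mult acts_commute
         lact_closed ract_closed dest: l' r')
qed

end

lemma orbits_iso:
  fixes X :: "('x, 'g, 'h) biset" and Y :: "('y, 'g, 'h) biset"
  assumes X: "is_biset G H X" and Y: "is_biset G H Y" and x: "x \<in> points X" and y: "y \<in> points Y"
    and st: "stab G H X x = stab G H Y y"
  shows "biset_iso G H (X\<lparr>points := is_biset.orb G H X x\<rparr>) (Y\<lparr>points := is_biset.orb G H Y y\<rparr>)"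
proof -
  interpret X: is_biset G H X by fact
  interpret Y: is_biset G H Y by fact
  define f where "f z = (SOME w. \<exists>h\<in>carrier H. \<exists>g\<in>carrier G.
    z = ract X (lact X h x) g \<and> w = ract Y (lact Y h y) g)" for z
  have f: "f (ract X (lact X h x) g) = ract Y (lact Y h y) g"
    if hg: "h \<in> carrier H" "g \<in> carrier G" for h g
  proof -
    let ?z = "ract X (lact X h x) g"
    have "\<exists>w. \<exists>h\<in>carrier H. \<exists>g\<in>carrier G. ?z = ract X (lact X h x) g \<and> w = ract Y (lact Y h y) g"
      using hg by blast
    then have "\<exists>h'\<in>carrier H. \<exists>g'\<in>carrier G. ?z = ract X (lact X h' x) g' \<and> f ?z = ract Y (lact Y h' y) g'"
      unfolding f_def by (rule someI_ex)
    then obtain h' g' where "h' \<in> carrier H" "g' \<in> carrier G" "?z = ract X (lact X h' x) g'"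
      "f ?z = ract Y (lact Y h' y) g'" by blast
    then show ?thesis
      using X.stab_eq_iff[OF x] Y.stab_eq_iff[OF y] hg st by metis
  qed
  have "bij_betw f (X.orb x) (Y.orb y)"
  proof (rule bij_betw_imageI)
    show "inj_on f (X.orb x)"
    proof (rule inj_onI)
      fix z z' assume z: "z \<in> X.orb x" "z' \<in> X.orb x" "f z = f z'"
      obtain h g where 1: "h \<in> carrier H" "g \<in> carrier G" "z = ract X (lact X h x) g"
        using z(1) by (auto simp: X.orb_def)
      obtain h' g' where 2: "h' \<in> carrier H" "g' \<in> carrier G" "z' = ract X (lact X h' x) g'"
        using z(2) by (auto simp: X.orb_def)
      have "ract Y (lact Y h y) g = ract Y (lact Y h' y) g'"
        using z(3) f[OF 1(1,2)] f[OF 2(1,2)] unfolding 1(3) 2(3) by simp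
      then show "z = z'" unfolding 1(3) 2(3)
        using Y.stab_eq_iff[OF y 1(1) 2(1) 1(2) 2(2)] X.stab_eq_iff[OF x 1(1) 2(1) 1(2) 2(2)] st by simp
    qed
    show "f ` X.orb x = Y.orb y"
      unfolding X.orb_def Y.orb_def image_image by (rule image_cong) (auto simp: f)
  qed
  moreover have "f (lact X h z) = lact Y h (f z)" if z: "z \<in> X.orb x" "h \<in> carrier H" for z h
  proof -
    obtain h' g where hg: "h' \<in> carrier H" "g \<in> carrier G" "z = ract X (lact X h' x) g"
      using z(1) by (auto simp: X.orb_def)
    have "lact X h z = ract X (lact X (h \<otimes>\<^bsub>H\<^esub> h') x) g"
      using x that hg by (simp add: X.acts_commute X.lact_closed X.lact_mult)
    moreover have "lact Y h (ract Y (lact Y h' y) g) = ract Y (lact Y (h \<otimes>\<^bsub>H\<^esub> h') y) g"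
      using y that hg by (simp add: Y.acts_commute Y.lact_closed Y.lact_mult)
    ultimately show ?thesis using f hg that(2) by simp
  qed
  moreover have "f (ract X z g) = ract Y (f z) g" if z: "z \<in> X.orb x" "g \<in> carrier G" for z g
  proof -
    obtain h g' where hg: "h \<in> carrier H" "g' \<in> carrier G" "z = ract X (lact X h x) g'"
      using z(1) by (auto simp: X.orb_def)
    have "ract X z g = ract X (lact X h x) (g' \<otimes>\<^bsub>G\<^esub> g)"
      using x that hg by (simp add: X.lact_closed X.ract_mult)
    moreover have "ract Y (ract Y (lact Y h y) g') g = ract Y (lact Y h y) (g' \<otimes>\<^bsub>G\<^esub> g)"
      using y that hg by (simp add: Y.lact_closed Y.ract_mult)
    ultimately show ?thesis using f hg that(2) by simp
  qed
  ultimately show ?thesis unfolding biset_iso_def by auto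
qed

lemma biset_iso_union:
  fixes X :: "('x, 'g, 'h) biset" and Y :: "('y, 'g, 'h) biset"
  assumes X: "is_biset G H X" and A: "is_biset G H (X\<lparr>points := A\<rparr>)" "A \<subseteq> points X" and B: "B \<subseteq> points Y"
    and A': "is_biset G H (X\<lparr>points := points X - A\<rparr>)"
    and 1: "biset_iso G H (X\<lparr>points := A\<rparr>) (Y\<lparr>points := B\<rparr>)"
    and 2: "biset_iso G H (X\<lparr>points := points X - A\<rparr>) (Y\<lparr>points := points Y - B\<rparr>)"
  shows "biset_iso G H X Y"
proof -
  interpret X: is_biset G H X by fact
  interpret A: is_biset G H "X\<lparr>points := A\<rparr>" by fact
  interpret A': is_biset G H "X\<lparr>points := points X - A\<rparr>" by fact
  obtain f where f: "bij_betw f A B"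
    "\<And>x h. x \<in> A \<Longrightarrow> h \<in> carrier H \<Longrightarrow> f (lact X h x) = lact Y h (f x)"
    "\<And>x g. x \<in> A \<Longrightarrow> g \<in> carrier G \<Longrightarrow> f (ract X x g) = ract Y (f x) g"
    using 1 by (rule biset_isoE) auto
  obtain f' where f': "bij_betw f' (points X - A) (points Y - B)"
    "\<And>x h. x \<in> points X - A \<Longrightarrow> h \<in> carrier H \<Longrightarrow> f' (lact X h x) = lact Y h (f' x)"
    "\<And>x g. x \<in> points X - A \<Longrightarrow> g \<in> carrier G \<Longrightarrow> f' (ract X x g) = ract Y (f' x) g"
    using 2 by (rule biset_isoE) auto
  define k where "k x = (if x \<in> A then f x else f' x)" for x
  have "bij_betw k A B" using f(1) by (subst bij_betw_cong[of _ _ f]) (auto simp: k_def)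
  moreover have "bij_betw k (points X - A) (points Y - B)"
    using f'(1) by (subst bij_betw_cong[of _ _ f']) (auto simp: k_def)
  ultimately have "bij_betw k (A \<union> (points X - A)) (B \<union> (points Y - B))"
    by (rule bij_betw_combine) auto
  then have "bij_betw k (points X) (points Y)" using \<open>A \<subseteq> points X\<close> \<open>B \<subseteq> points Y\<close> by (simp add: Un_absorb1)
  moreover have "k (lact X h x) = lact Y h (k x)" if "x \<in> points X" "h \<in> carrier H" for x h
  proof (cases "x \<in> A")
    case True
    then show ?thesis using A.lact_closed[OF that(2)] f(2)[OF _ that(2)] by (simp add: k_def)
  next
    case False
    then show ?thesis using A'.lact_closed[OF that(2), of x] f'(2)[OF _ that(2)] that by (simp add: k_def)
  qed
  moreover have "k (ract X x h) = ract Y (k x) h" if "x \<in> points X" "h \<in> carrier G" for x h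
  proof (cases "x \<in> A")
    case True
    then show ?thesis using A.ract_closed[OF that(2)] f(3)[OF _ that(2)] by (simp add: k_def)
  next
    case False
    then show ?thesis using A'.ract_closed[OF that(2), of x] f'(3)[OF _ that(2)] that by (simp add: k_def)
  qed
  ultimately show ?thesis unfolding biset_iso_def by blast
qed

text \<open>A point of \<open>X\<close> with stabilizer \<open>L\<close> as large as possible gives a nonzero mark at \<open>L\<close>, hence a point
  of \<open>Y\<close> whose stabilizer contains \<open>L\<close>; by the same argument backwards and maximality, the two
  stabilizers coincide.  The two orbits are isomorphic, and removing them leaves smaller bisets
  with equal marks.\<close>

theorem marks_determine_biset:
  fixes X :: "('x, 'g, 'h) biset" and Y :: "('y, 'g, 'h) biset"
  assumes "is_biset G H X" "is_biset G H Y" "finite (carrier G)" "finite (carrier H)"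
    and "\<And>L. subgroup L (H \<times>\<times> G) \<Longrightarrow> card (fixp X L snd fst) = card (fixp Y L snd fst)"
  shows "biset_iso G H X Y"
  using assms
proof (induction "card (points X)" arbitrary: X Y rule: less_induct)
  case less
  interpret X: is_biset G H X by fact
  interpret Y: is_biset G H Y by fact
  interpret HG: group "H \<times>\<times> G" by (rule DirProd_group[OF X.H.is_group X.G.is_group])
  have marks: "card (fixp X L snd fst) = card (fixp Y L snd fst)" if "subgroup L (H \<times>\<times> G)" for L
    using less.prems(5) that .
  have sub: "L \<subseteq> carrier H \<times> carrier G" if "subgroup L (H \<times>\<times> G)" for L
    using subgroup.subset[OF that] by simp
  have finL: "finite L" if "subgroup L (H \<times>\<times> G)" for L
    using sub[OF that] less.prems(3,4) finite_subset by (metis finite_cartesian_product)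
  have finfix: "finite (fixp X L snd fst)" "finite (fixp Y L snd fst)" for L
    using X.finite_points Y.finite_points by (auto simp: fixp_def)
  show ?case
  proof (cases "points X = {}")
    case True
    have "fixp Y {\<one>\<^bsub>H \<times>\<times> G\<^esub>} snd fst = points Y" by (auto simp: fixp_def Y.lact_one Y.ract_one)
    moreover have "fixp X {\<one>\<^bsub>H \<times>\<times> G\<^esub>} snd fst = {}" using True by (auto simp: fixp_def)
    ultimately have "card (points Y) = 0" using marks[OF HG.triv_subgroup] by simp
    then have "points Y = {}" using Y.finite_points by simp
    then show ?thesis using True by (simp add: biset_iso_def bij_betw_def)
  next
    case False
    have fin_img: "finite ((\<lambda>x. card (stab G H X x)) ` points X)" using X.finite_points by simp
    then have "Max ((\<lambda>x. card (stab G H X x)) ` points X) \<in> (\<lambda>x. card (stab G H X x)) ` points X"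
      using False by (intro Max_in) auto
    then obtain x where x1: "x \<in> points X" "card (stab G H X x) = Max ((\<lambda>x. card (stab G H X x)) ` points X)"
      by (metis (no_types, lifting) imageE)
    have x: "x \<in> points X" "\<And>x'. x' \<in> points X \<Longrightarrow> card (stab G H X x') \<le> card (stab G H X x)"
      unfolding x1(2) by (rule x1(1), rule Max_ge[OF fin_img imageI])
    let ?L = "stab G H X x"
    note L = X.subgroup_stab[OF x(1)]
    have iffX: "z \<in> fixp X M snd fst \<longleftrightarrow> z \<in> points X \<and> M \<subseteq> stab G H X z"
      and iffY: "w \<in> fixp Y M snd fst \<longleftrightarrow> w \<in> points Y \<and> M \<subseteq> stab G H Y w"
      if M: "subgroup M (H \<times>\<times> G)" for M z w
      by (rule fixp_stab_iff[OF sub[OF M]])+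
    have "x \<in> fixp X ?L snd fst" using iffX[OF L, of x] x(1) by simp
    then have "0 < card (fixp X ?L snd fst)" unfolding card_gt_0_iff using finfix(1)[of ?L] by blast
    then have "0 < card (fixp Y ?L snd fst)" by (simp only: marks[OF L])
    then obtain y where "y \<in> fixp Y ?L snd fst" unfolding card_gt_0_iff by blast
    then have y: "y \<in> points Y" "?L \<subseteq> stab G H Y y" using iffY[OF L, of y] by simp_all
    note L' = Y.subgroup_stab[OF y(1)]
    have "y \<in> fixp Y (stab G H Y y) snd fst" using iffY[OF L', of y] y(1) by simp
    then have "0 < card (fixp Y (stab G H Y y) snd fst)"
      unfolding card_gt_0_iff using finfix(2)[of "stab G H Y y"] by blast
    then have "0 < card (fixp X (stab G H Y y) snd fst)" by (simp only: marks[OF L'])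
    then obtain x' where "x' \<in> fixp X (stab G H Y y) snd fst" unfolding card_gt_0_iff by blast
    then have x': "x' \<in> points X" "stab G H Y y \<subseteq> stab G H X x'" using iffX[OF L', of x'] by simp_all
    have "card (stab G H Y y) \<le> card ?L"
      using card_mono[OF finL[OF X.subgroup_stab[OF x'(1)]] x'(2)] x(2)[OF x'(1)] by simp
    then have st: "?L = stab G H Y y" using card_seteq[OF finL[OF L'] y(2)] by simp
    let ?A = "X.orb x" and ?B = "Y.orb y"
    let ?X1 = "X\<lparr>points := ?A\<rparr>" and ?X2 = "X\<lparr>points := points X - ?A\<rparr>"
    let ?Y1 = "Y\<lparr>points := ?B\<rparr>" and ?Y2 = "Y\<lparr>points := points Y - ?B\<rparr>"
    have X12: "is_biset G H ?X1" "is_biset G H ?X2"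
      by (rule X.is_biset_sub[OF X.orb_sub[OF x(1)]]; simp add: X.lact_orb[OF x(1)] X.ract_orb[OF x(1)])+
    have Y12: "is_biset G H ?Y1" "is_biset G H ?Y2"
      by (rule Y.is_biset_sub[OF Y.orb_sub[OF y(1)]]; simp add: Y.lact_orb[OF y(1)] Y.ract_orb[OF y(1)])+
    have iso1: "biset_iso G H ?X1 ?Y1"
      using orbits_iso[OF less.prems(1,2) x(1) y(1) st] .
    have "biset_iso G H ?X2 ?Y2"
    proof (rule less.hyps[OF _ X12(2) Y12(2) less.prems(3,4)])
      show "card (points ?X2) < card (points X)"
        using X.orb_self[OF x(1)] x(1) X.finite_points by (intro psubset_card_mono) auto
      fix L assume L: "subgroup L (H \<times>\<times> G)"
      have cX: "card (fixp X L snd fst) = card (fixp ?X1 L snd fst) + card (fixp ?X2 L snd fst)"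
      proof -
        have "fixp X L snd fst = fixp ?X1 L snd fst \<union> fixp ?X2 L snd fst"
          "fixp ?X1 L snd fst \<inter> fixp ?X2 L snd fst = {}"
          using X.orb_sub[OF x(1)] by (auto simp: fixp_def)
        then show ?thesis using finfix(1)[of L] by (simp add: card_Un_disjoint)
      qed
      have cY: "card (fixp Y L snd fst) = card (fixp ?Y1 L snd fst) + card (fixp ?Y2 L snd fst)"
      proof -
        have "fixp Y L snd fst = fixp ?Y1 L snd fst \<union> fixp ?Y2 L snd fst"
          "fixp ?Y1 L snd fst \<inter> fixp ?Y2 L snd fst = {}"
          using Y.orb_sub[OF y(1)] by (auto simp: fixp_def)
        then show ?thesis using finfix(2)[of L] by (simp add: card_Un_disjoint)
      qed
      have "card (fixp ?X1 L snd fst) = card (fixp ?Y1 L snd fst)"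
        by (rule fixp_iso[OF iso1 _ _ X12(1)]) (use sub[OF L] in auto)
      then show "card (fixp ?X2 L snd fst) = card (fixp ?Y2 L snd fst)"
        using cX cY marks[OF L] by simp
    qed
    then show ?thesis
      using biset_iso_union[OF less.prems(1) X12(1) X.orb_sub[OF x(1)] Y.orb_sub[OF y(1)] X12(2) iso1]
      by blast
  qed
qed

section \<open>Formal sums of biset classes\<close>

lemma Z_loc_simps:
  assumes "prime p"
  shows "of_int n \<in> Z_loc p" "a \<in> Z_loc p \<Longrightarrow> b \<in> Z_loc p \<Longrightarrow> a + b \<in> Z_loc p"
    "a \<in> Z_loc p \<Longrightarrow> b \<in> Z_loc p \<Longrightarrow> a * b \<in> Z_loc p" "a \<in> Z_loc p \<Longrightarrow> - a \<in> Z_loc p"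
    "\<not> int p dvd n \<Longrightarrow> 1 / of_int n \<in> Z_loc p"
proof -
  have p1: "\<not> int p dvd 1" using prime_gt_1_nat[OF assms] by simp
  have pp: "\<not> int p dvd b * d" if "\<not> int p dvd b" "\<not> int p dvd d" for b d
    using that assms by (simp add: prime_dvd_mult_iff)
  show "of_int n \<in> Z_loc p" unfolding Z_loc_def using p1
    by (intro CollectI exI[of _ n] exI[of _ 1]) simp
  show "\<not> int p dvd n \<Longrightarrow> 1 / of_int n \<in> Z_loc p"
    unfolding Z_loc_def by (intro CollectI exI[of _ 1] exI[of _ n]) simp
  show "a * b \<in> Z_loc p" if ab: "a \<in> Z_loc p" "b \<in> Z_loc p"
  proof -
    obtain i j k l where "a = of_int i / of_int j" "\<not> int p dvd j" "b = of_int k / of_int l" "\<not> int p dvd l"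
      using ab by (auto simp: Z_loc_def)
    then show ?thesis unfolding Z_loc_def using pp
      by (intro CollectI exI[of _ "i * k"] exI[of _ "j * l"]) simp
  qed
  show "a + b \<in> Z_loc p" if ab: "a \<in> Z_loc p" "b \<in> Z_loc p"
  proof -
    obtain i j k l where e: "a = of_int i / of_int j" "\<not> int p dvd j" "b = of_int k / of_int l" "\<not> int p dvd l"
      using ab by (auto simp: Z_loc_def)
    then have "j \<noteq> 0" "l \<noteq> 0" by auto
    then have "a + b = of_int (i * l + k * j) / of_int (j * l)" unfolding e by (simp add: field_simps)
    then show ?thesis unfolding Z_loc_def using pp[OF e(2,4)] by blast
  qed
  show "- a \<in> Z_loc p" if ab: "a \<in> Z_loc p"
  proof -
    obtain i j where "a = of_int i / of_int j" "\<not> int p dvd j"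
      using ab by (auto simp: Z_loc_def)
    then have "- a = of_int (- i) / of_int j" "\<not> int p dvd j" by auto
    then show ?thesis unfolding Z_loc_def by blast
  qed
qed

lemma Z_loc_0: "prime p \<Longrightarrow> 0 \<in> Z_loc p"
  using Z_loc_simps(1)[of p 0] by simp

lemma Z_loc_1: "prime p \<Longrightarrow> 1 \<in> Z_loc p"
  using Z_loc_simps(1)[of p 1] by simp

definition lin :: "('c \<Rightarrow> rat) \<Rightarrow> ('c \<Rightarrow>\<^sub>0 rat) \<Rightarrow> rat" where
  "lin f x = (\<Sum>c\<in>Poly_Mapping.keys x. Poly_Mapping.lookup x c * f c)"

lemma lin_superset:
  assumes "finite A" "Poly_Mapping.keys x \<subseteq> A"
  shows "lin f x = (\<Sum>c\<in>A. Poly_Mapping.lookup x c * f c)"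
  unfolding lin_def by (rule sum.mono_neutral_left) (use assms in \<open>auto simp: in_keys_iff\<close>)

lemma lin_add: "lin f (x + y) = lin f x + lin f y"
proof -
  let ?A = "Poly_Mapping.keys x \<union> Poly_Mapping.keys y"
  have A: "finite ?A" by simp
  have "lin f (x + y) = (\<Sum>c\<in>?A. Poly_Mapping.lookup (x + y) c * f c)"
    by (rule lin_superset[OF A]) (rule Poly_Mapping.keys_add)
  also have "\<dots> = lin f x + lin f y"
    by (simp add: lin_superset[OF A] lookup_add distrib_right sum.distrib)
  finally show ?thesis .
qed

lemma lin_uminus: "lin f (- x) = - lin f x"
  by (simp add: lin_def sum_negf)

lemma lin_zero: "lin f 0 = 0"
  by (simp add: lin_def)

lemma lin_diff: "lin f (x - y) = lin f x - lin f y"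
  using lin_add[of f x "- y"] by (simp add: lin_uminus)

lemma lin_single: "lin f (Poly_Mapping.single c a) = a * f c"
  by (simp add: lin_def)

lemma lin_sum: "lin f (sum g A) = (\<Sum>i\<in>A. lin f (g i))"
  by (induction A rule: infinite_finite_induct) (simp_all add: lin_zero lin_add)

lemma formal_sum_eq_sum: "x = (\<Sum>c\<in>Poly_Mapping.keys x. Poly_Mapping.single c (Poly_Mapping.lookup x c))"
  by (rule poly_mapping_eqI)
    (auto simp: lookup_sum lookup_single when_def in_keys_iff sum.delta)

definition scale :: "rat \<Rightarrow> ('c \<Rightarrow>\<^sub>0 rat) \<Rightarrow> ('c \<Rightarrow>\<^sub>0 rat)" where
  "scale a x = Poly_Mapping.map ((*) a) x"

lemma lookup_scale: "Poly_Mapping.lookup (scale a x) c = a * Poly_Mapping.lookup x c"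
  by (simp add: scale_def Poly_Mapping.map.rep_eq when_def)

lemma scale_simps: "scale a (x + y) = scale a x + scale a y" "scale a (x - y) = scale a x - scale a y"
  "scale a (Poly_Mapping.single c b) = Poly_Mapping.single c (a * b)" "scale a 0 = 0"
  "scale a (scale b x) = scale (a * b) x" "scale 1 x = x" "scale (-1) x = - x"
  by (rule poly_mapping_eqI; simp add: lookup_scale lookup_add lookup_minus lookup_single when_def algebra_simps)+

lemma lin_scale: "lin f (scale a x) = a * lin f x"
proof -
  have "lin f (scale a x) = (\<Sum>c\<in>Poly_Mapping.keys x. Poly_Mapping.lookup (scale a x) c * f c)"
    by (rule lin_superset) (auto simp: in_keys_iff lookup_scale)
  then show ?thesis by (simp add: lookup_scale lin_def sum_distrib_left mult.assoc)
qed

section \<open>The relations of the Burnside module\<close>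

lemma formal_sums_add:
  assumes "prime p" "x \<in> formal_sums p G H" "y \<in> formal_sums p G H"
  shows "x + y \<in> formal_sums p G H"
  using assms Poly_Mapping.keys_add[of x y] by (auto simp: formal_sums_def lookup_add Z_loc_simps)

lemma formal_sums_uminus:
  assumes "prime p" "x \<in> formal_sums p G H" shows "- x \<in> formal_sums p G H"
  using assms by (auto simp: formal_sums_def Z_loc_simps)

lemma formal_sums_diff:
  assumes "prime p" "x \<in> formal_sums p G H" "y \<in> formal_sums p G H"
  shows "x - y \<in> formal_sums p G H"
  using formal_sums_add[OF assms(1,2) formal_sums_uminus[OF assms(1,3)]] by simp

lemma formal_sums_zero: "prime p \<Longrightarrow> 0 \<in> formal_sums p G H"
  by (simp add: formal_sums_def Z_loc_0)

lemma formal_sums_single: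
  assumes "prime p" "c \<in> biset_classes G H" "a \<in> Z_loc p"
  shows "Poly_Mapping.single c a \<in> formal_sums p G H"
  using assms by (auto simp: formal_sums_def lookup_single when_def Z_loc_0)

lemma formal_sums_sum:
  assumes "prime p" "\<And>i. i \<in> A \<Longrightarrow> f i \<in> formal_sums p G H"
  shows "sum f A \<in> formal_sums p G H"
  using assms(2)
  by (induction A rule: infinite_finite_induct)
    (simp_all add: formal_sums_zero[OF assms(1)] formal_sums_add[OF assms(1)])

lemma sum_relations_add:
  assumes "y \<in> sum_relations p G H" "x \<in> sum_relations p G H"
  shows "x + y \<in> sum_relations p G H"
  using assms(1)
proof (induction rule: sum_relations.induct)
  case zero
  then show ?case using assms(2) by simp
next
  case (add z a X Y)
  show ?case unfolding add.assoc[symmetric] by (rule sum_relations.add[OF add.IH add.hyps(2-4)])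
qed

lemma sum_relations_scale:
  assumes "prime p" "b \<in> Z_loc p" "y \<in> sum_relations p G H"
  shows "scale b y \<in> sum_relations p G H"
  using assms(3)
proof (induction rule: sum_relations.induct)
  case zero
  then show ?case by (simp add: scale_simps sum_relations.zero)
next
  case (add z a X Y)
  show ?case unfolding scale_simps
    by (rule sum_relations.add[OF add.IH Z_loc_simps(3)[OF assms(1,2) add.hyps(2)] add.hyps(3,4)])
qed

lemma sum_relations_uminus:
  assumes "prime p" "y \<in> sum_relations p G H"
  shows "- y \<in> sum_relations p G H"
  using sum_relations_scale[OF assms(1) Z_loc_simps(4)[OF assms(1) Z_loc_1[OF assms(1)]] assms(2)]
  by (simp add: scale_simps)

lemma sum_relations_diff:
  assumes "prime p" "x \<in> sum_relations p G H" "y \<in> sum_relations p G H"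
  shows "x - y \<in> sum_relations p G H"
  using sum_relations_add[OF sum_relations_uminus[OF assms(1,3)] assms(2)] by simp

lemma sum_relations_sum:
  assumes "\<And>i. i \<in> A \<Longrightarrow> f i \<in> sum_relations p G H"
  shows "sum f A \<in> sum_relations p G H"
  using assms
  by (induction A rule: infinite_finite_induct) (simp_all add: sum_relations.zero sum_relations_add)

lemma sum_relations_iso:
  fixes X :: "('x, 'g, 'h) biset" and Y :: "('y, 'g, 'h) biset" and Z :: "('z, 'g, 'h) biset"
  assumes X: "is_biset G H X" and Y: "is_biset G H Y" and Z: "is_biset G H Z"
    and iso: "biset_iso G H X (biset_sum Y Z)" and a: "a \<in> Z_loc p"
  shows "Poly_Mapping.single (iso_class G H X) a - Poly_Mapping.single (iso_class G H Y) a
    - Poly_Mapping.single (iso_class G H Z) a \<in> sum_relations p G H"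
proof -
  let ?Y = "rep (iso_class G H Y)" and ?Z = "rep (iso_class G H Z)"
  note r = rep_iso_class[OF Y] rep_iso_class[OF Z]
  have "iso_class G H X = iso_class G H (biset_sum ?Y ?Z)"
    by (subst iso_class_eq_iff[OF X is_biset_sum[OF r(1,3)]])
      (rule biset_iso_trans[OF iso biset_sum_cong[OF r(2,4)]])
  moreover have "iso_class G H Y = iso_class G H ?Y" "iso_class G H Z = iso_class G H ?Z"
    using iso_class_eq_iff[OF Y r(1)] iso_class_eq_iff[OF Z r(3)] r by auto
  ultimately show ?thesis
    using sum_relations.add[OF sum_relations.zero a r(1,3)] by simp
qed

lemma equiv_burnside_rel:
  assumes p: "prime p"
  shows "equiv (formal_sums p G H) (burnside_rel p G H)"
proof (rule equivI)
  show "burnside_rel p G H \<subseteq> formal_sums p G H \<times> formal_sums p G H"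
    by (auto simp: burnside_rel_def)
  show "refl_on (formal_sums p G H) (burnside_rel p G H)"
    by (auto simp: refl_on_def burnside_rel_def sum_relations.zero)
  show "sym (burnside_rel p G H)"
  proof (rule symI)
    fix x y assume "(x, y) \<in> burnside_rel p G H"
    then show "(y, x) \<in> burnside_rel p G H"
      using sum_relations_uminus[OF p, of "x - y" G H] by (auto simp: burnside_rel_def)
  qed
  show "trans (burnside_rel p G H)"
  proof (rule transI)
    fix x y z assume "(x, y) \<in> burnside_rel p G H" "(y, z) \<in> burnside_rel p G H"
    then show "(x, z) \<in> burnside_rel p G H"
      using sum_relations_add[of "y - z" p G H "x - y"] by (auto simp: burnside_rel_def)
  qed
qed

lemma burnside_of_eq_iff:
  assumes "prime p" "x \<in> formal_sums p G H" "y \<in> formal_sums p G H"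
  shows "burnside_of p G H x = burnside_of p G H y \<longleftrightarrow> x - y \<in> sum_relations p G H"
  unfolding burnside_of_def
  using eq_equiv_class_iff[OF equiv_burnside_rel[OF assms(1)] assms(2,3)] assms(2,3)
  by (simp add: burnside_rel_def)

lemma burnside_of_mem:
  assumes "prime p" "x \<in> formal_sums p G H"
  shows "y \<in> burnside_of p G H x \<longleftrightarrow> y \<in> formal_sums p G H \<and> burnside_of p G H y = burnside_of p G H x"
proof
  assume "y \<in> burnside_of p G H x"
  then have "(x, y) \<in> burnside_rel p G H" by (simp add: burnside_of_def)
  moreover from this have "burnside_of p G H x = burnside_of p G H y"
    unfolding burnside_of_def by (rule equiv_class_eq[OF equiv_burnside_rel[OF assms(1)]])
  ultimately show "y \<in> formal_sums p G H \<and> burnside_of p G H y = burnside_of p G H x"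
    by (simp add: burnside_rel_def)
next
  assume "y \<in> formal_sums p G H \<and> burnside_of p G H y = burnside_of p G H x"
  then show "y \<in> burnside_of p G H x"
    using equiv_class_self[OF equiv_burnside_rel[OF assms(1)], of y G H] by (simp add: burnside_of_def)
qed

section \<open>Composition in the Burnside module\<close>

lemma formal_comp_superset:
  assumes "finite A" "Poly_Mapping.keys y \<subseteq> A" "finite B" "Poly_Mapping.keys x \<subseteq> B"
  shows "formal_comp G H K y x = (\<Sum>c\<in>A. \<Sum>d\<in>B.
    Poly_Mapping.single (iso_class G K (biset_prod H (rep c) (rep d)))
      (Poly_Mapping.lookup y c * Poly_Mapping.lookup x d))"
proof -
  let ?s = "\<lambda>c d. Poly_Mapping.single (iso_class G K (biset_prod H (rep c) (rep d)))
      (Poly_Mapping.lookup y c * Poly_Mapping.lookup x d)"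
  have "formal_comp G H K y x = (\<Sum>c\<in>Poly_Mapping.keys y. \<Sum>d\<in>Poly_Mapping.keys x. ?s c d)"
    by (simp add: formal_comp_def rep_def)
  also have "\<dots> = (\<Sum>c\<in>Poly_Mapping.keys y. \<Sum>d\<in>B. ?s c d)"
    by (intro sum.cong refl sum.mono_neutral_left) (use assms in \<open>auto simp: in_keys_iff\<close>)
  also have "\<dots> = (\<Sum>c\<in>A. \<Sum>d\<in>B. ?s c d)"
    by (intro sum.mono_neutral_left) (use assms in \<open>auto simp: in_keys_iff\<close>)
  finally show ?thesis .
qed

lemma formal_comp_add_left: "formal_comp G H K (y + y') x = formal_comp G H K y x + formal_comp G H K y' x"
proof -
  let ?A = "Poly_Mapping.keys y \<union> Poly_Mapping.keys y'"
  have "formal_comp G H K z x = (\<Sum>c\<in>?A. \<Sum>d\<in>Poly_Mapping.keys x.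
    Poly_Mapping.single (iso_class G K (biset_prod H (rep c) (rep d)))
      (Poly_Mapping.lookup z c * Poly_Mapping.lookup x d))" if "Poly_Mapping.keys z \<subseteq> ?A" for z
    by (rule formal_comp_superset) (use that in auto)
  then show ?thesis
    using Poly_Mapping.keys_add[of y y']
    by (simp add: lookup_add distrib_right single_add sum.distrib)
qed

lemma formal_comp_add_right: "formal_comp G H K y (x + x') = formal_comp G H K y x + formal_comp G H K y x'"
proof -
  let ?A = "Poly_Mapping.keys x \<union> Poly_Mapping.keys x'"
  have "formal_comp G H K y z = (\<Sum>c\<in>Poly_Mapping.keys y. \<Sum>d\<in>?A.
    Poly_Mapping.single (iso_class G K (biset_prod H (rep c) (rep d)))
      (Poly_Mapping.lookup y c * Poly_Mapping.lookup z d))" if "Poly_Mapping.keys z \<subseteq> ?A" for z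
    by (rule formal_comp_superset) (use that in auto)
  then show ?thesis
    using Poly_Mapping.keys_add[of x x']
    by (simp add: lookup_add distrib_left single_add sum.distrib)
qed

lemma formal_comp_zero: "formal_comp G H K 0 x = 0" "formal_comp G H K y 0 = 0"
  by (simp_all add: formal_comp_def)

lemma formal_comp_diff_left: "formal_comp G H K (y - y') x = formal_comp G H K y x - formal_comp G H K y' x"
  using formal_comp_add_left[of G H K "y - y'" y' x] by simp

lemma formal_comp_diff_right: "formal_comp G H K y (x - x') = formal_comp G H K y x - formal_comp G H K y x'"
  using formal_comp_add_right[of G H K y "x - x'" x'] by simp

lemma formal_comp_single_left: "formal_comp G H K (Poly_Mapping.single c a) x =
  (\<Sum>d\<in>Poly_Mapping.keys x. Poly_Mapping.single (iso_class G K (biset_prod H (rep c) (rep d)))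
      (a * Poly_Mapping.lookup x d))"
  by (subst formal_comp_superset[of "{c}" _ "Poly_Mapping.keys x"]) auto

lemma formal_comp_single_right: "formal_comp G H K y (Poly_Mapping.single d a) =
  (\<Sum>c\<in>Poly_Mapping.keys y. Poly_Mapping.single (iso_class G K (biset_prod H (rep c) (rep d)))
      (Poly_Mapping.lookup y c * a))"
  by (subst formal_comp_superset[of "Poly_Mapping.keys y" _ "{d}"]) auto

lemma is_biset_prod_rep:
  assumes "c \<in> biset_classes H K" "d \<in> biset_classes G H"
  shows "is_biset G K (biset_prod H (rep c) (rep d))"
  by (rule biset_pair.is_biset_prod)
    (use biset_classes_rep[OF assms(1)] biset_classes_rep[OF assms(2)] in \<open>simp add: biset_pair_def\<close>)

lemma formal_comp_closed:
  assumes p: "prime p" and y: "y \<in> formal_sums p H K" and x: "x \<in> formal_sums p G H"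
  shows "formal_comp G H K y x \<in> formal_sums p G K"
  unfolding formal_comp_def rep_def[symmetric]
  by (intro formal_sums_sum[OF p] formal_sums_single[OF p] iso_class_in_biset_classes is_biset_prod_rep
      Z_loc_simps(3)[OF p]) (use x y in \<open>auto simp: formal_sums_def\<close>)

lemma formal_comp_relations_left:
  assumes p: "prime p" and z: "z \<in> sum_relations p H K" and x: "x \<in> formal_sums p G H"
  shows "formal_comp G H K z x \<in> sum_relations p G K"
  using z
proof (induction rule: sum_relations.induct)
  case zero
  then show ?case by (simp add: formal_comp_zero sum_relations.zero)
next
  case (add z a Y Y')
  let ?c = "iso_class H K (biset_sum Y Y')" and ?c1 = "iso_class H K Y" and ?c2 = "iso_class H K Y'"
  let ?s = "\<lambda>c d. Poly_Mapping.single (iso_class G K (biset_prod H (rep c) (rep d)))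
      (a * Poly_Mapping.lookup x d)"
  have xc: "d \<in> biset_classes G H" "Poly_Mapping.lookup x d \<in> Z_loc p" if "d \<in> Poly_Mapping.keys x" for d
    using that x by (auto simp: formal_sums_def)
  have "?s ?c d - ?s ?c1 d - ?s ?c2 d \<in> sum_relations p G K" if d: "d \<in> Poly_Mapping.keys x" for d
  proof -
    note X = biset_classes_rep(1)[OF xc(1)[OF d]]
    note S = is_biset_sum[OF add.hyps(3,4)]
    note r = rep_iso_class[OF S] rep_iso_class[OF add.hyps(3)] rep_iso_class[OF add.hyps(4)]
    have cl: "?c \<in> biset_classes H K" "?c1 \<in> biset_classes H K" "?c2 \<in> biset_classes H K"
      using S add.hyps by (auto intro: iso_class_in_biset_classes)
    have "biset_iso H K (rep ?c) (biset_sum (rep ?c1) (rep ?c2))"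
      by (rule biset_iso_trans[OF biset_iso_sym[OF S r(2)] biset_sum_cong[OF r(4,6)]])
    then have "biset_iso G K (biset_prod H (rep ?c) (rep d)) (biset_prod H (biset_sum (rep ?c1) (rep ?c2)) (rep d))"
      by (rule biset_prod_cong[OF X r(1) X is_biset_sum[OF r(3,5)] biset_iso_refl])
    then have "biset_iso G K (biset_prod H (rep ?c) (rep d))
      (biset_sum (biset_prod H (rep ?c1) (rep d)) (biset_prod H (rep ?c2) (rep d)))"
      using biset_prod_sum_left[OF X r(3,5)] biset_iso_trans by blast
    then show ?thesis
      by (intro sum_relations_iso is_biset_prod_rep cl xc(1)[OF d] Z_loc_simps(3)[OF p add.hyps(2) xc(2)[OF d]])
  qed
  then have "(\<Sum>d\<in>Poly_Mapping.keys x. ?s ?c d - ?s ?c1 d - ?s ?c2 d) \<in> sum_relations p G K"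
    by (rule sum_relations_sum)
  then have "formal_comp G H K (Poly_Mapping.single ?c a - Poly_Mapping.single ?c1 a - Poly_Mapping.single ?c2 a) x
    \<in> sum_relations p G K"
    by (simp add: formal_comp_diff_left formal_comp_single_left sum_subtractf)
  then show ?case unfolding formal_comp_add_left by (intro sum_relations_add add.IH)
qed

lemma formal_comp_relations_right:
  assumes p: "prime p" and z: "z \<in> sum_relations p G H" and y: "y \<in> formal_sums p H K"
  shows "formal_comp G H K y z \<in> sum_relations p G K"
  using z
proof (induction rule: sum_relations.induct)
  case zero
  then show ?case by (simp add: formal_comp_zero sum_relations.zero)
next
  case (add z a X X')
  let ?c = "iso_class G H (biset_sum X X')" and ?c1 = "iso_class G H X" and ?c2 = "iso_class G H X'"
  let ?s = "\<lambda>c d. Poly_Mapping.single (iso_class G K (biset_prod H (rep d) (rep c)))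
      (Poly_Mapping.lookup y d * a)"
  have yc: "d \<in> biset_classes H K" "Poly_Mapping.lookup y d \<in> Z_loc p" if "d \<in> Poly_Mapping.keys y" for d
    using that y by (auto simp: formal_sums_def)
  have "?s ?c d - ?s ?c1 d - ?s ?c2 d \<in> sum_relations p G K" if d: "d \<in> Poly_Mapping.keys y" for d
  proof -
    note Y = biset_classes_rep(1)[OF yc(1)[OF d]]
    note S = is_biset_sum[OF add.hyps(3,4)]
    note r = rep_iso_class[OF S] rep_iso_class[OF add.hyps(3)] rep_iso_class[OF add.hyps(4)]
    have cl: "?c \<in> biset_classes G H" "?c1 \<in> biset_classes G H" "?c2 \<in> biset_classes G H"
      using S add.hyps by (auto intro: iso_class_in_biset_classes)
    have "biset_iso G H (rep ?c) (biset_sum (rep ?c1) (rep ?c2))"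
      by (rule biset_iso_trans[OF biset_iso_sym[OF S r(2)] biset_sum_cong[OF r(4,6)]])
    then have "biset_iso G K (biset_prod H (rep d) (rep ?c)) (biset_prod H (rep d) (biset_sum (rep ?c1) (rep ?c2)))"
      by (rule biset_prod_cong[OF r(1) Y is_biset_sum[OF r(3,5)] Y _ biset_iso_refl])
    then have "biset_iso G K (biset_prod H (rep d) (rep ?c))
      (biset_sum (biset_prod H (rep d) (rep ?c1)) (biset_prod H (rep d) (rep ?c2)))"
      using biset_prod_sum_right[OF r(3,5) Y] biset_iso_trans by blast
    then show ?thesis
      by (intro sum_relations_iso is_biset_prod_rep cl yc(1)[OF d] Z_loc_simps(3)[OF p yc(2)[OF d] add.hyps(2)])
  qed
  then have "(\<Sum>d\<in>Poly_Mapping.keys y. ?s ?c d - ?s ?c1 d - ?s ?c2 d) \<in> sum_relations p G K"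
    by (rule sum_relations_sum)
  then have "formal_comp G H K y (Poly_Mapping.single ?c a - Poly_Mapping.single ?c1 a - Poly_Mapping.single ?c2 a)
    \<in> sum_relations p G K"
    by (simp add: formal_comp_diff_right formal_comp_single_right sum_subtractf)
  then show ?case unfolding formal_comp_add_right by (intro sum_relations_add add.IH)
qed

lemma burnside_comp_of:
  assumes p: "prime p" and y: "y \<in> formal_sums p H K" and x: "x \<in> formal_sums p G H"
  shows "burnside_comp p G H K (burnside_of p H K y) (burnside_of p G H x)
    = burnside_of p G K (formal_comp G H K y x)"
proof -
  have eq: "burnside_of p G K (formal_comp G H K y' x') = burnside_of p G K (formal_comp G H K y x)"
    if y': "y' \<in> burnside_of p H K y" and x': "x' \<in> burnside_of p G H x" for y' x'
  proof -
    have y'f: "y' \<in> formal_sums p H K" "y' - y \<in> sum_relations p H K"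
      using y' burnside_of_mem[OF p y, of y'] burnside_of_eq_iff[OF p _ y, of y'] by auto
    have x'f: "x' \<in> formal_sums p G H" "x' - x \<in> sum_relations p G H"
      using x' burnside_of_mem[OF p x, of x'] burnside_of_eq_iff[OF p _ x, of x'] by auto
    have "formal_comp G H K y' x' - formal_comp G H K y x =
      formal_comp G H K (y' - y) x' + formal_comp G H K y (x' - x)"
      by (simp add: formal_comp_diff_left formal_comp_diff_right)
    also have "\<dots> \<in> sum_relations p G K"
      by (intro sum_relations_add formal_comp_relations_left[OF p y'f(2) x'f(1)]
          formal_comp_relations_right[OF p x'f(2) y])
    finally show ?thesis
      using burnside_of_eq_iff[OF p formal_comp_closed[OF p y'f(1) x'f(1)] formal_comp_closed[OF p y x]]
      by blast
  qed
  have "y \<in> burnside_of p H K y" "x \<in> burnside_of p G H x"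
    using burnside_of_mem[OF p y] burnside_of_mem[OF p x] x y by auto
  moreover from this have "burnside_of p G K (formal_comp G H K y x) \<subseteq>
      (\<Union>y\<in>burnside_of p H K y. \<Union>x\<in>burnside_of p G H x. burnside_of p G K (formal_comp G H K y x))"
    by (intro subsetI) (rule UN_I, assumption, rule UN_I)
  moreover have "(\<Union>y\<in>burnside_of p H K y. \<Union>x\<in>burnside_of p G H x. burnside_of p G K (formal_comp G H K y x))
      \<subseteq> burnside_of p G K (formal_comp G H K y x)"
    by (intro UN_least) (simp only: eq order_refl)
  ultimately show ?thesis unfolding burnside_comp_def by (intro equalityI)
qed

section \<open>Marks in the Burnside module\<close>

definition mark :: "('g, 'h) formal_sum \<Rightarrow> 'u set \<Rightarrow> ('u \<Rightarrow> 'g) \<Rightarrow> ('u \<Rightarrow> 'h) \<Rightarrow> rat" where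
  "mark x L \<alpha> \<beta> = lin (\<lambda>c. of_nat (card (fixp (rep c) L \<alpha> \<beta>))) x"

lemma mark_single:
  fixes X :: "('x, 'g, 'h) biset"
  assumes "is_biset G H X" "\<alpha> ` L \<subseteq> carrier G" "\<beta> ` L \<subseteq> carrier H"
  shows "mark (Poly_Mapping.single (iso_class G H X) a) L \<alpha> \<beta> = a * of_nat (card (fixp X L \<alpha> \<beta>))"
  using fixp_iso[OF rep_iso_class(2)[OF assms(1)] assms(2,3,1)] by (simp add: mark_def lin_single)

lemma mark_relations:
  assumes z: "z \<in> sum_relations p G H" and L: "\<alpha> ` L \<subseteq> carrier G" "\<beta> ` L \<subseteq> carrier H"
  shows "mark z L \<alpha> \<beta> = 0"
  using z
proof (induction rule: sum_relations.induct)
  case zero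
  then show ?case by (simp add: mark_def lin_zero)
next
  case (add z a X Y)
  then show ?case
    using mark_single[OF is_biset_sum[OF add.hyps(3,4)] L, of a] mark_single[OF add.hyps(3) L, of a]
      mark_single[OF add.hyps(4) L, of a] is_biset.finite_points[OF add.hyps(3)] is_biset.finite_points[OF add.hyps(4)]
    by (simp add: mark_def lin_add lin_diff card_fixp_sum algebra_simps)
qed

lemma mark_well_defined:
  assumes "prime p" "burnside_of p G H x = burnside_of p G H y"
    "x \<in> formal_sums p G H" "y \<in> formal_sums p G H" "\<alpha> ` L \<subseteq> carrier G" "\<beta> ` L \<subseteq> carrier H"
  shows "mark x L \<alpha> \<beta> = mark y L \<alpha> \<beta>"
  using mark_relations[of "x - y" p G H] burnside_of_eq_iff[OF assms(1,3,4)] assms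
  by (simp add: mark_def lin_diff)

lemma mark_formal_comp:
  fixes M :: "('u, 'b) monoid_scheme"
  assumes y: "y \<in> formal_sums p H K" and x: "x \<in> formal_sums p G H"
    and M: "group M" "finite (carrier M)" and finH: "finite (carrier H)"
    and \<alpha>: "\<alpha> \<in> hom M G" and \<beta>: "\<beta> \<in> hom M K"
    and free: "\<And>c. c \<in> Poly_Mapping.keys y \<Longrightarrow> right_free H (rep c)"
  shows "of_nat (card (carrier H)) * mark (formal_comp G H K y x) (carrier M) \<alpha> \<beta> =
    (\<Sum>\<gamma>\<in>hom M H \<inter> extensional (carrier M). mark x (carrier M) \<alpha> \<gamma> * mark y (carrier M) \<gamma> \<beta>)"
proof -
  let ?L = "carrier M" and ?Hom = "hom M H \<inter> extensional (carrier M)"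
  let ?ky = "Poly_Mapping.keys y" and ?kx = "Poly_Mapping.keys x"
  let ?ly = "Poly_Mapping.lookup y" and ?lx = "Poly_Mapping.lookup x"
  have im: "\<alpha> ` ?L \<subseteq> carrier G" "\<beta> ` ?L \<subseteq> carrier K" using \<alpha> \<beta> by (auto simp: hom_def)
  have cl: "c \<in> biset_classes H K" "d \<in> biset_classes G H" if "c \<in> ?ky" "d \<in> ?kx" for c d
    using that x y by (auto simp: formal_sums_def)
  have 1: "of_nat (card (carrier H)) * mark (Poly_Mapping.single (iso_class G K (biset_prod H (rep c) (rep d)))
      (?ly c * ?lx d)) ?L \<alpha> \<beta> = (\<Sum>\<gamma>\<in>?Hom. (?lx d * of_nat (card (fixp (rep d) ?L \<alpha> \<gamma>))) *
        (?ly c * of_nat (card (fixp (rep c) ?L \<gamma> \<beta>))))"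
    if c: "c \<in> ?ky" and d: "d \<in> ?kx" for c d
  proof -
    interpret P: biset_pair G H K "rep d" "rep c"
      using biset_classes_rep[OF cl(1)[OF c d]] biset_classes_rep[OF cl(2)[OF c d]] by (simp add: biset_pair_def)
    have "of_nat (card (carrier H)) * mark (Poly_Mapping.single (iso_class G K (biset_prod H (rep c) (rep d)))
      (?ly c * ?lx d)) ?L \<alpha> \<beta> =
      (?ly c * ?lx d) * of_nat (card (carrier H) * card (fixp (biset_prod H (rep c) (rep d)) ?L \<alpha> \<beta>))"
      using mark_single[OF P.is_biset_prod im] by simp
    also have "\<dots> = (?ly c * ?lx d) * (\<Sum>\<gamma>\<in>?Hom. of_nat (card (fixp (rep d) ?L \<alpha> \<gamma>)) *
        of_nat (card (fixp (rep c) ?L \<gamma> \<beta>)))"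
      using P.card_fixp_prod[OF M finH \<alpha> \<beta> free[OF c]] by simp
    finally show ?thesis by (simp add: sum_distrib_left mult_ac)
  qed
  have "of_nat (card (carrier H)) * mark (formal_comp G H K y x) ?L \<alpha> \<beta> =
    (\<Sum>c\<in>?ky. \<Sum>d\<in>?kx. of_nat (card (carrier H)) *
      mark (Poly_Mapping.single (iso_class G K (biset_prod H (rep c) (rep d))) (?ly c * ?lx d)) ?L \<alpha> \<beta>)"
    by (simp add: formal_comp_def rep_def[symmetric] mark_def lin_sum sum_distrib_left)
  also have "\<dots> = (\<Sum>c\<in>?ky. \<Sum>d\<in>?kx. \<Sum>\<gamma>\<in>?Hom. (?lx d * of_nat (card (fixp (rep d) ?L \<alpha> \<gamma>))) *
        (?ly c * of_nat (card (fixp (rep c) ?L \<gamma> \<beta>))))"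
    by (intro sum.cong refl 1)
  also have "\<dots> = (\<Sum>c\<in>?ky. \<Sum>\<gamma>\<in>?Hom. \<Sum>d\<in>?kx. (?lx d * of_nat (card (fixp (rep d) ?L \<alpha> \<gamma>))) *
        (?ly c * of_nat (card (fixp (rep c) ?L \<gamma> \<beta>))))"
    by (intro sum.cong refl sum.swap)
  also have "\<dots> = (\<Sum>\<gamma>\<in>?Hom. \<Sum>c\<in>?ky. \<Sum>d\<in>?kx. (?lx d * of_nat (card (fixp (rep d) ?L \<alpha> \<gamma>))) *
        (?ly c * of_nat (card (fixp (rep c) ?L \<gamma> \<beta>))))"
    by (rule sum.swap)
  also have "\<dots> = (\<Sum>\<gamma>\<in>?Hom. mark x ?L \<alpha> \<gamma> * mark y ?L \<gamma> \<beta>)"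
    unfolding mark_def lin_def sum_product by (intro sum.cong refl sum.swap)
  finally show ?thesis .
qed

text \<open>In a Grothendieck group every element with integral coefficients is a difference of two genuine
  bisets.\<close>

lemma formal_difference:
  fixes z :: "('g, 'h) formal_sum"
  assumes p: "prime p" and GH: "group G" "group H"
    and keys: "Poly_Mapping.keys z \<subseteq> biset_classes G H" and int: "\<And>c. Poly_Mapping.lookup z c \<in> \<int>"
  shows "\<exists>(X :: (nat, 'g, 'h) biset) (Y :: (nat, 'g, 'h) biset). is_biset G H X \<and> is_biset G H Y \<and>
    z - (Poly_Mapping.single (iso_class G H X) 1 - Poly_Mapping.single (iso_class G H Y) 1) \<in> sum_relations p G H"
proof -
  let ?s = "\<lambda>X :: (nat, 'g, 'h) biset. Poly_Mapping.single (iso_class G H X) (1 :: rat)"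
  define P where "P z \<longleftrightarrow> (\<exists>(X :: (nat, 'g, 'h) biset) (Y :: (nat, 'g, 'h) biset). is_biset G H X \<and> is_biset G H Y \<and>
    z - (?s X - ?s Y) \<in> sum_relations p G H)" for z
  \<comment> \<open>The empty biset represents zero, since it is isomorphic to its own double.\<close>
  define E :: "(nat, 'g, 'h) biset" where "E = \<lparr>points = {}, lact = (\<lambda>_ x. x), ract = (\<lambda>x _. x)\<rparr>"
  have E: "is_biset G H E"
    by (intro is_biset.intro is_biset_axioms.intro GH) (auto simp: E_def)
  have Erel: "?s E \<in> sum_relations p G H"
  proof -
    have "biset_iso G H E (biset_sum E E)" by (auto simp: biset_iso_def bij_betw_def E_def biset_sum_def)
    then have "?s E - ?s E - ?s E \<in> sum_relations p G H"
      by (intro sum_relations_iso E Z_loc_1 p)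
    then show ?thesis using sum_relations_uminus[OF p, of "- ?s E" G H] by simp
  qed
  have P0: "P 0" unfolding P_def using E by (auto intro!: exI[of _ E] simp: sum_relations.zero)
  have Padd: "P (x + y)" if xy: "P x" "P y" for x y
  proof -
    obtain X Y X' Y' :: "(nat, 'g, 'h) biset" where
      b: "is_biset G H X" "is_biset G H Y" "x - (?s X - ?s Y) \<in> sum_relations p G H"
         "is_biset G H X'" "is_biset G H Y'" "y - (?s X' - ?s Y') \<in> sum_relations p G H"
      using xy unfolding P_def by blast
    obtain XX :: "(nat, 'g, 'h) biset" where XX: "is_biset G H XX" "biset_iso G H (biset_sum X X') XX"
      using nat_copy[OF is_biset_sum[OF b(1,4)]] by blast
    obtain YY :: "(nat, 'g, 'h) biset" where YY: "is_biset G H YY" "biset_iso G H (biset_sum Y Y') YY"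
      using nat_copy[OF is_biset_sum[OF b(2,5)]] by blast
    have 1: "?s XX - ?s X - ?s X' \<in> sum_relations p G H"
      by (intro sum_relations_iso XX b biset_iso_sym[OF is_biset_sum[OF b(1,4)]] Z_loc_1 p)
    have 2: "?s YY - ?s Y - ?s Y' \<in> sum_relations p G H"
      by (intro sum_relations_iso YY b biset_iso_sym[OF is_biset_sum[OF b(2,5)]] Z_loc_1 p)
    have "(x - (?s X - ?s Y)) + (y - (?s X' - ?s Y')) - (?s XX - ?s X - ?s X') + (?s YY - ?s Y - ?s Y')
      \<in> sum_relations p G H"
      by (intro sum_relations_add sum_relations_diff p 1 2 b)
    also have "(x - (?s X - ?s Y)) + (y - (?s X' - ?s Y')) - (?s XX - ?s X - ?s X') + (?s YY - ?s Y - ?s Y')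
      = (x + y) - (?s XX - ?s YY)" by (simp add: algebra_simps)
    finally show ?thesis unfolding P_def using XX YY by blast
  qed
  have Pneg: "P (- x)" if x: "P x" for x
  proof -
    obtain X Y :: "(nat, 'g, 'h) biset" where
      b: "is_biset G H X" "is_biset G H Y" "x - (?s X - ?s Y) \<in> sum_relations p G H"
      using x unfolding P_def by blast
    have "- (x - (?s X - ?s Y)) \<in> sum_relations p G H" by (rule sum_relations_uminus[OF p b(3)])
    also have "- (x - (?s X - ?s Y)) = - x - (?s Y - ?s X)" by simp
    finally show ?thesis unfolding P_def using b by blast
  qed
  have P1: "P (Poly_Mapping.single c 1)" if c: "c \<in> biset_classes G H" for c
  proof -
    have "Poly_Mapping.single c 1 - (?s (rep c) - ?s E) \<in> sum_relations p G H"
      using biset_classes_rep(2)[OF c] Erel by simp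
    then show ?thesis unfolding P_def using E biset_classes_rep(1)[OF c] by blast
  qed
  have Pn: "P (Poly_Mapping.single c (of_nat n))" if c: "c \<in> biset_classes G H" for c n
  proof (induction n)
    case 0
    show ?case using P0 by simp
  next
    case (Suc n)
    show ?case using Padd[OF P1[OF c] Suc] by (simp add: single_add)
  qed
  have Pi: "P (Poly_Mapping.single c (of_int i))" if c: "c \<in> biset_classes G H" for c i
  proof (cases "i \<ge> 0")
    case True
    then show ?thesis using Pn[OF c, of "nat i"] by simp
  next
    case False
    have e: "of_int i = - (of_nat (nat (- i)) :: rat)" using False by simp
    show ?thesis unfolding e single_uminus by (rule Pneg[OF Pn[OF c]])
  qed
  have "P (\<Sum>c\<in>A. Poly_Mapping.single c (Poly_Mapping.lookup z c))" if "A \<subseteq> biset_classes G H" for A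
    using that
  proof (induction A rule: infinite_finite_induct)
    case (insert c A)
    obtain i where "Poly_Mapping.lookup z c = of_int i" using int[of c] by (auto elim: Ints_cases)
    then show ?case using insert Padd Pi[of c i] by simp
  qed (auto simp: P0)
  from this[OF keys] have "P z" using formal_sum_eq_sum[of z] by simp
  then show ?thesis unfolding P_def .
qed

lemma clear_denominators:
  assumes p: "prime p" and "finite A" "\<And>c. c \<in> A \<Longrightarrow> f c \<in> Z_loc p"
  shows "\<exists>N. \<not> int p dvd N \<and> (\<forall>c\<in>A. of_int N * f c \<in> \<int>)"
  using assms(2,3)
proof (induction rule: finite_induct)
  case empty
  then show ?case using prime_gt_1_nat[OF p] by (intro exI[of _ 1]) simp
next
  case (insert c A)
  then obtain N where N: "\<not> int p dvd N" "\<forall>c\<in>A. of_int N * f c \<in> \<int>" by auto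
  obtain i j where ij: "f c = of_int i / of_int j" "\<not> int p dvd j" 
    using insert.prems[of c] by (auto simp: Z_loc_def)
  then have "j \<noteq> 0" by auto
  then have "of_int (N * j) * f c = of_int (N * i)" unfolding ij(1) by simp
  then have "of_int (N * j) * f c \<in> \<int>" by (simp only: Ints_of_int)
  moreover have "of_int (N * j) * f d \<in> \<int>" if "d \<in> A" for d
  proof -
    have "of_int (N * j) * f d = of_int j * (of_int N * f d)" by simp
    then show ?thesis using N(2) that by (metis Ints_mult Ints_of_int)
  qed
  moreover have "\<not> int p dvd N * j" using N(1) ij(2) p by (simp add: prime_dvd_mult_iff)
  ultimately show ?case by blast
qed

text \<open>Multiplying by an integer prime to \<open>p\<close> clears all denominators.  The difference of the two
  elements is then that of two bisets with equal marks, which are isomorphic.  The factor is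
  invertible in the localization, so it can be divided out again.\<close>

theorem marks_separate:
  fixes x y :: "('g, 'h) formal_sum"
  assumes p: "prime p" and GH: "group G" "group H" "finite (carrier G)" "finite (carrier H)"
    and x: "x \<in> formal_sums p G H" and y: "y \<in> formal_sums p G H"
    and eq: "\<And>L. subgroup L (H \<times>\<times> G) \<Longrightarrow> mark x L snd fst = mark y L snd fst"
  shows "burnside_of p G H x = burnside_of p G H y"
proof -
  let ?s = "\<lambda>X :: (nat, 'g, 'h) biset. Poly_Mapping.single (iso_class G H X) (1 :: rat)"
  define z where "z = x - y"
  have z: "z \<in> formal_sums p G H" unfolding z_def by (rule formal_sums_diff[OF p x y])
  have "\<exists>N. \<not> int p dvd N \<and> (\<forall>c\<in>Poly_Mapping.keys z. of_int N * Poly_Mapping.lookup z c \<in> \<int>)"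
    by (rule clear_denominators[OF p]) (use z in \<open>auto simp: formal_sums_def\<close>)
  then obtain N where N: "\<not> int p dvd N" "\<And>c. c \<in> Poly_Mapping.keys z \<Longrightarrow> of_int N * Poly_Mapping.lookup z c \<in> \<int>"
    by blast
  then have N0: "N \<noteq> 0" by auto
  define w where "w = scale (of_int N) z"
  have wint: "Poly_Mapping.lookup w c \<in> \<int>" for c
    unfolding w_def lookup_scale using N(2)[of c] by (cases "c \<in> Poly_Mapping.keys z") (auto simp: in_keys_iff)
  have "Poly_Mapping.keys w \<subseteq> Poly_Mapping.keys z" by (auto simp: w_def in_keys_iff lookup_scale)
  then have "Poly_Mapping.keys w \<subseteq> biset_classes G H" using z by (auto simp: formal_sums_def)
  from formal_difference[OF p GH(1,2) this wint] obtain X Y :: "(nat, 'g, 'h) biset"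
    where XY: "is_biset G H X" "is_biset G H Y" and w: "w - (?s X - ?s Y) \<in> sum_relations p G H" by blast
  have "biset_iso G H X Y"
  proof (rule marks_determine_biset[OF XY GH(3,4)])
    fix L assume L: "subgroup L (H \<times>\<times> G)"
    have im: "snd ` L \<subseteq> carrier G" "fst ` L \<subseteq> carrier H" using subgroup.subset[OF L] by auto
    have "mark w L snd fst = 0" using eq[OF L] by (simp add: w_def z_def mark_def lin_scale lin_diff)
    moreover have "mark (w - (?s X - ?s Y)) L snd fst = 0" by (rule mark_relations[OF w im])
    moreover have "mark (w - (?s X - ?s Y)) L snd fst =
        mark w L snd fst - (mark (?s X) L snd fst - mark (?s Y) L snd fst)"
      by (simp add: mark_def lin_diff)
    ultimately have "mark (?s X) L snd fst = mark (?s Y) L snd fst" by simp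
    then show "card (fixp X L snd fst) = card (fixp Y L snd fst)"
      using mark_single[OF XY(1) im, of 1] mark_single[OF XY(2) im, of 1] by simp
  qed
  then have "iso_class G H X = iso_class G H Y" using iso_class_eq_iff[OF XY] by blast
  then have "w \<in> sum_relations p G H" using w by simp
  then have "scale (1 / of_int N) w \<in> sum_relations p G H"
    by (rule sum_relations_scale[OF p Z_loc_simps(5)[OF p N(1)]])
  then have "x - y \<in> sum_relations p G H" using N0 by (simp add: w_def z_def scale_simps)
  then show ?thesis using burnside_of_eq_iff[OF p x y] by blast
qed

section \<open>Morphisms of a fusion system\<close>

lemma conj_by_mult:
  assumes "group G" "x \<in> carrier G" "y \<in> carrier G" "u \<in> carrier G"
  shows "conj_by G (x \<otimes>\<^bsub>G\<^esub> y) u = conj_by G x (conj_by G y u)"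
proof -
  interpret group G by fact
  show ?thesis using assms by (simp add: conj_by_def inv_mult_group m_assoc)
qed

lemma conj_by_inv:
  assumes "group G" "x \<in> carrier G" "u \<in> carrier G"
  shows "conj_by G (inv\<^bsub>G\<^esub> x) (conj_by G x u) = u" "conj_by G x (conj_by G (inv\<^bsub>G\<^esub> x) u) = u"
proof -
  interpret group G by fact
  show "conj_by G (inv\<^bsub>G\<^esub> x) (conj_by G x u) = u" "conj_by G x (conj_by G (inv\<^bsub>G\<^esub> x) u) = u"
    using assms conj_by_mult[OF assms(1), of "inv\<^bsub>G\<^esub> x" x u] conj_by_mult[OF assms(1), of x "inv\<^bsub>G\<^esub> x" u]
    by (simp_all add: conj_by_def)
qed

context fusion_system
begin

text \<open>A function represents a morphism on \<open>P\<close> if its restriction to \<open>P\<close> is one.  Working with functions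
  up to agreement on \<open>P\<close> keeps codomains, restrictions and extensional composition out of the
  arguments; \<open>mem_iff\<close> translates back to the morphism sets.\<close>

definition morph :: "'a set \<Rightarrow> ('a \<Rightarrow> 'a) \<Rightarrow> bool" where
  "morph P f \<longleftrightarrow> restrict f P \<in> F P (carrier S)"

lemma carrier_subgroup: "subgroup (carrier S) S"
  by (rule subgroup_self)

lemma incl_mem:
  assumes "subgroup P S" "subgroup Q S" "P \<subseteq> Q"
  shows "(\<lambda>x\<in>P. x) \<in> F P Q"
proof -
  have c: "conj_by S \<one> u = u" if "u \<in> P" for u
    using subgroup.mem_carrier[OF assms(1) that] by (simp add: conj_by_def)
  have "restrict (conj_by S \<one>) P \<in> F P Q"
    by (rule conj_mem[OF assms(1,2) one_closed]) (use c assms(3) in auto)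
  also have "restrict (conj_by S \<one>) P = (\<lambda>x\<in>P. x)"
    by (rule restrict_ext) (simp add: c)
  finally show ?thesis .
qed

lemma mor_facts:
  assumes P: "subgroup P S" and Q: "subgroup Q S" and \<phi>: "\<phi> \<in> F P Q"
  shows "\<phi> \<in> extensional P" "inj_on \<phi> P" "\<phi> ` P \<subseteq> Q"
    "\<And>x y. x \<in> P \<Longrightarrow> y \<in> P \<Longrightarrow> \<phi> (x \<otimes> y) = \<phi> x \<otimes> \<phi> y" "subgroup (\<phi> ` P) S"
proof -
  note m = mor_mono[OF P Q \<phi>]
  then show ext: "\<phi> \<in> extensional P" "inj_on \<phi> P" "\<phi> ` P \<subseteq> Q"
    and mult: "\<And>x y. x \<in> P \<Longrightarrow> y \<in> P \<Longrightarrow> \<phi> (x \<otimes> y) = \<phi> x \<otimes> \<phi> y"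
    by (auto simp: mon_def hom_def)
  have h: "group_hom (S\<lparr>carrier := P\<rparr>) (S\<lparr>carrier := Q\<rparr>) \<phi>"
    using m P Q by (auto simp: mon_def group_hom_def group_hom_axioms_def subgroup_imp_group)
  then have "subgroup (\<phi> ` P) (S\<lparr>carrier := Q\<rparr>)"
    using group_hom.img_is_subgroup[OF h] by simp
  then show "subgroup (\<phi> ` P) S" using incl_subgroup[OF Q] by simp
qed

lemma codom_mem:
  assumes "subgroup P S" "subgroup Q S" "subgroup Q' S" "\<phi> \<in> F P Q" "\<phi> ` P \<subseteq> Q'"
  shows "\<phi> \<in> F P Q'"
proof -
  note mf = mor_facts[OF assms(1,2,4)]
  have "compose P (\<lambda>x\<in>\<phi> ` P. x) \<phi> \<in> F P Q'"
    by (rule comp_mem[OF assms(1) mf(5) assms(3) iso_mem[OF assms(1,2,4)] incl_mem[OF mf(5) assms(3,5)]])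
  also have "compose P (\<lambda>x\<in>\<phi> ` P. x) \<phi> = \<phi>"
    by (rule extensionalityI[of _ P]) (use mf(1) in \<open>auto simp: compose_def\<close>)
  finally show ?thesis .
qed

lemma mem_iff:
  assumes "subgroup P S" "subgroup Q S"
  shows "\<phi> \<in> F P Q \<longleftrightarrow> \<phi> \<in> extensional P \<and> morph P \<phi> \<and> \<phi> ` P \<subseteq> Q"
proof
  assume p: "\<phi> \<in> F P Q"
  note mf = mor_facts[OF assms p]
  have "\<phi> \<in> F P (carrier S)"
    by (rule codom_mem[OF assms carrier_subgroup p]) (use mf(3) subgroup.subset[OF assms(2)] in blast)
  then show "\<phi> \<in> extensional P \<and> morph P \<phi> \<and> \<phi> ` P \<subseteq> Q"
    using mf by (simp add: morph_def extensional_restrict)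
next
  assume a: "\<phi> \<in> extensional P \<and> morph P \<phi> \<and> \<phi> ` P \<subseteq> Q"
  then have "\<phi> \<in> F P (carrier S)" by (metis morph_def extensional_restrict)
  then show "\<phi> \<in> F P Q" using codom_mem[OF assms(1) carrier_subgroup assms(2)] a by blast
qed

lemma restrict_mem_iff:
  assumes "subgroup P S" "subgroup Q S"
  shows "restrict f P \<in> F P Q \<longleftrightarrow> morph P f \<and> f ` P \<subseteq> Q"
  unfolding mem_iff[OF assms] by (simp add: morph_def)

lemma morph_cong: "(\<And>u. u \<in> P \<Longrightarrow> f u = g u) \<Longrightarrow> morph P f \<longleftrightarrow> morph P g"
  unfolding morph_def by (metis restrict_ext)

lemma morph_facts:
  assumes P: "subgroup P S" and f: "morph P f"
  shows "inj_on f P" "f ` P \<subseteq> carrier S"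
    "\<And>x y. x \<in> P \<Longrightarrow> y \<in> P \<Longrightarrow> f (x \<otimes> y) = f x \<otimes> f y" "subgroup (f ` P) S"
proof -
  interpret P: subgroup P S by fact
  note mf = mor_facts[OF P carrier_subgroup f[unfolded morph_def]]
  show "inj_on f P" using mf(2) by (simp add: inj_on_def)
  show "f ` P \<subseteq> carrier S" using mf(3) by auto
  show "f (x \<otimes> y) = f x \<otimes> f y" if "x \<in> P" "y \<in> P" for x y
    using mf(4)[OF that] that by simp
  show "subgroup (f ` P) S" using mf(5) by simp
qed

lemma morph_one:
  assumes "subgroup P S" "morph P f" shows "f \<one> = \<one>"
proof -
  interpret P: subgroup P S by fact
  have "f \<one> \<otimes> f \<one> = f \<one>" "f \<one> \<in> carrier S"
    using morph_facts[OF assms] P.one_closed by (auto simp flip: morph_facts(3)[OF assms])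
  then show ?thesis by simp
qed

lemma morph_comp:
  assumes P: "subgroup P S" and f: "morph P f" and g: "morph (f ` P) g"
  shows "morph P (\<lambda>u. g (f u))"
proof -
  have s: "subgroup (f ` P) S" using morph_facts[OF P f] by blast
  have "restrict f P \<in> F P (f ` P)" using f by (simp add: restrict_mem_iff[OF P s])
  then have "compose P (restrict g (f ` P)) (restrict f P) \<in> F P (carrier S)"
    using comp_mem[OF P s carrier_subgroup] g by (simp add: morph_def)
  also have "compose P (restrict g (f ` P)) (restrict f P) = restrict (\<lambda>u. g (f u)) P"
    by (auto simp: compose_def restrict_def fun_eq_iff)
  finally show ?thesis unfolding morph_def .
qed

lemma morph_id: "subgroup P S \<Longrightarrow> morph P (\<lambda>u. u)"
  unfolding morph_def by (rule incl_mem) (simp_all add: carrier_subgroup subgroup.subset)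

lemma morph_subset:
  assumes "subgroup P S" "morph P f" "subgroup P' S" "P' \<subseteq> P"
  shows "morph P' f"
proof -
  have "compose P' (restrict f P) (\<lambda>x\<in>P'. x) \<in> F P' (carrier S)"
    using comp_mem[OF assms(3,1) carrier_subgroup incl_mem[OF assms(3,1,4)]] assms(2) by (simp add: morph_def)
  also have "compose P' (restrict f P) (\<lambda>x\<in>P'. x) = restrict f P'"
    using assms(4) by (auto simp: compose_def restrict_def fun_eq_iff)
  finally show ?thesis unfolding morph_def .
qed

lemma morph_inv:
  assumes P: "subgroup P S" and f: "morph P f"
  shows "morph (f ` P) (inv_into P f)"
proof -
  have s: "subgroup (f ` P) S" and inj: "inj_on f P" using morph_facts[OF P f] by blast+
  have "restrict f P \<in> F P (carrier S)" using f by (simp add: morph_def)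
  from inv_mem[OF P carrier_subgroup this]
  have i: "restrict (inv_into P (restrict f P)) (f ` P) \<in> F (f ` P) P" by simp
  have "restrict (inv_into P (restrict f P)) (f ` P) = restrict (inv_into P f) (f ` P)"
  proof (rule restrict_ext)
    fix y assume "y \<in> f ` P"
    then obtain u where u: "u \<in> P" "y = f u" by blast
    have "inj_on (restrict f P) P" using inj by (simp add: inj_on_def)
    from inv_into_f_f[OF this u(1)] have "inv_into P (restrict f P) y = u" using u by simp
    then show "inv_into P (restrict f P) y = inv_into P f y" using inv_into_f_f[OF inj u(1)] u(2) by simp
  qed
  then have "restrict (inv_into P f) (f ` P) \<in> F (f ` P) P" using i by simp
  then show ?thesis using restrict_mem_iff[OF s P] by blast
qed

lemma morph_conj:
  assumes P: "subgroup P S" and x: "x \<in> carrier S"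
  shows "morph P (conj_by S x)"
  unfolding morph_def
  by (rule conj_mem[OF P carrier_subgroup x])
    (use x subgroup.subset[OF P] in \<open>auto simp: conj_by_def\<close>)

lemma finite_mor:
  assumes "finite (carrier S)" "subgroup P S" "subgroup Q S"
  shows "finite (F P Q)"
proof -
  have "F P Q \<subseteq> P \<rightarrow>\<^sub>E Q"
  proof
    fix \<phi> assume "\<phi> \<in> F P Q"
    from mor_facts(1,3)[OF assms(2,3) this] show "\<phi> \<in> P \<rightarrow>\<^sub>E Q" by (simp add: PiE_def image_subset_iff_funcset)
  qed
  moreover have "finite P" "finite Q" by (rule finite_subset[OF subgroup.subset[OF assms(2)] assms(1)],
      rule finite_subset[OF subgroup.subset[OF assms(3)] assms(1)])
  ultimately show ?thesis using finite_PiE[of P "\<lambda>_. Q"] finite_subset by blast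
qed

text \<open>Precomposition with an isomorphism is a bijection between the morphism sets.\<close>

lemma card_precomp:
  assumes P: "subgroup P S" and U: "subgroup U S" and f: "morph P f"
  shows "card (F (f ` P) U) = card (F P U)"
proof -
  have s: "subgroup (f ` P) S" and inj: "inj_on f P" using morph_facts[OF P f] by blast+
  have "bij_betw (\<lambda>g. restrict (\<lambda>u. g (f u)) P) (F (f ` P) U) (F P U)"
  proof (rule bij_betw_byWitness[where f' = "\<lambda>g. restrict (\<lambda>y. g (inv_into P f y)) (f ` P)"])
    show "(\<lambda>g. restrict (\<lambda>u. g (f u)) P) ` F (f ` P) U \<subseteq> F P U"
      using morph_comp[OF P f] by (auto simp: mem_iff[OF s U] restrict_mem_iff[OF P U] image_subset_iff)
    have im: "inv_into P f ` f ` P = P" using inj by simp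
    show "(\<lambda>g. restrict (\<lambda>y. g (inv_into P f y)) (f ` P)) ` F P U \<subseteq> F (f ` P) U"
      using morph_comp[OF s morph_inv[OF P f], unfolded im]
      by (auto simp: mem_iff[OF P U] restrict_mem_iff[OF s U] inj image_subset_iff)
    show "\<forall>g\<in>F (f ` P) U. restrict (\<lambda>y. restrict (\<lambda>u. g (f u)) P (inv_into P f y)) (f ` P) = g"
      using inj by (auto simp: mem_iff[OF s U] fun_eq_iff extensional_def)
    show "\<forall>g\<in>F P U. restrict (\<lambda>u. restrict (\<lambda>y. g (inv_into P f y)) (f ` P) (f u)) P = g"
      using inj by (auto simp: mem_iff[OF P U] fun_eq_iff extensional_def)
  qed
  then show ?thesis by (rule bij_betw_same_card)
qed

lemma F_conjugate_morph:
  assumes "subgroup P S" "subgroup Q S" "F_conjugate F P Q"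
  shows "\<exists>f. morph P f \<and> f ` P = Q"
proof -
  obtain \<phi> \<psi> where p: "\<phi> \<in> F P Q" "\<psi> \<in> F Q P" "compose Q \<phi> \<psi> = (\<lambda>x\<in>Q. x)"
    using assms(3) unfolding F_conjugate_def by blast
  have "x \<in> \<phi> ` P" if "x \<in> Q" for x
  proof -
    have "\<phi> (\<psi> x) = x" using that fun_cong[OF p(3), of x] by (simp add: compose_def)
    moreover have "\<psi> x \<in> P" using mor_facts(3)[OF assms(2,1) p(2)] that by blast
    ultimately show ?thesis by (metis imageI)
  qed
  then have "\<phi> ` P = Q" using mor_facts(3)[OF assms(1,2) p(1)] by blast
  then show ?thesis using p(1) mem_iff[OF assms(1,2)] by blast
qed

lemma ex_fully_normalized:
  assumes fin: "finite (carrier S)" and P: "subgroup P S"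
  shows "\<exists>f. morph P f \<and> fully_normalized S F (f ` P)"
proof -
  have "\<exists>f. morph P f \<and> (\<forall>g. morph P g \<longrightarrow> card (normalizer S (g ` P)) \<le> card (normalizer S (f ` P)))"
  proof (rule ex_has_greatest_nat[of "morph P" "\<lambda>u. u" "\<lambda>f. card (normalizer S (f ` P))" "Suc (card (carrier S))"])
    show "morph P (\<lambda>u. u)" by (rule morph_id[OF P])
    show "\<forall>y. morph P y \<longrightarrow> card (normalizer S (y ` P)) < Suc (card (carrier S))"
    proof (intro allI impI le_imp_less_Suc card_mono fin)
      fix y assume "morph P y"
      then have "subgroup (y ` P) S" using morph_facts[OF P] by blast
      then show "normalizer S (y ` P) \<subseteq> carrier S" using normalizer_eq by auto
    qed
  qed
  then obtain f where f: "morph P f" "\<And>g. morph P g \<Longrightarrow> card (normalizer S (g ` P)) \<le> card (normalizer S (f ` P))"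
    by blast
  have s: "subgroup (f ` P) S" using morph_facts[OF P f(1)] by blast
  have "fully_normalized S F (f ` P)"
    unfolding fully_normalized_def
  proof (intro allI impI)
    fix Q assume Q: "subgroup Q S \<and> F_conjugate F (f ` P) Q"
    then obtain g where g: "morph (f ` P) g" "g ` f ` P = Q" using F_conjugate_morph[OF s] by blast
    have "morph P (\<lambda>u. g (f u))" by (rule morph_comp[OF P f(1) g(1)])
    moreover have "(\<lambda>u. g (f u)) ` P = Q" using g(2) by (simp add: image_image)
    ultimately show "card (normalizer S Q) \<le> card (normalizer S (f ` P))" using f(2) by metis
  qed
  then show ?thesis using f(1) by blast
qed

section \<open>Automorphism groups and extensions\<close>

lemma Aut_F_eq: "Aut_F S F P = BijGroup P\<lparr>carrier := F P P\<rparr>"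
  by (simp add: Aut_F_def AutoGroup_def)

lemma Aut_F_Bij:
  assumes fin: "finite (carrier S)" and P: "subgroup P S"
  shows "F P P \<subseteq> Bij P"
proof
  fix \<phi> assume \<phi>: "\<phi> \<in> F P P"
  have "finite P" using fin subgroup.subset[OF P] finite_subset by blast
  then have "\<phi> ` P = P" using mor_facts(2,3)[OF P P \<phi>] by (intro endo_inj_surj)
  then have "bij_betw \<phi> P P" using mor_facts(2)[OF P P \<phi>] by (simp add: bij_betw_def)
  then show "\<phi> \<in> Bij P" using mor_facts[OF P P \<phi>] by (simp add: Bij_def)
qed

lemma Aut_F_surj:
  assumes fin: "finite (carrier S)" and P: "subgroup P S" and "\<phi> \<in> F P P"
  shows "\<phi> ` P = P"
  using Aut_F_Bij[OF assms(1,2)] assms(3) by (auto simp: Bij_def bij_betw_def)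

lemma subgroup_Aut_F:
  assumes fin: "finite (carrier S)" and P: "subgroup P S"
  shows "subgroup (F P P) (BijGroup P)"
proof (rule group.subgroupI[OF group_BijGroup])
  note B = Aut_F_Bij[OF assms]
  show "F P P \<subseteq> carrier (BijGroup P)" using B by (simp add: BijGroup_def)
  show "F P P \<noteq> {}" using incl_mem[OF P P] by blast
  show "inv\<^bsub>BijGroup P\<^esub> a \<in> F P P" if a: "a \<in> F P P" for a
  proof -
    have im: "a ` P = P" by (rule Aut_F_surj[OF assms a])
    have "restrict (inv_into P a) P \<in> F P P" using inv_mem[OF P P a] im by simp
    then show ?thesis using inv_BijGroup[of a P] B a by auto
  qed
  show "a \<otimes>\<^bsub>BijGroup P\<^esub> b \<in> F P P" if "a \<in> F P P" "b \<in> F P P" for a b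
    using comp_mem[OF P P P that(2,1)] B that by (simp add: BijGroup_def subset_iff)
qed

lemma group_Aut_F:
  assumes fin: "finite (carrier S)" and P: "subgroup P S"
  shows "group (Aut_F S F P)"
  unfolding Aut_F_eq by (rule group.subgroup_imp_group[OF group_BijGroup subgroup_Aut_F[OF assms]])

lemma Aut_F_mult:
  assumes fin: "finite (carrier S)" and P: "subgroup P S" and "a \<in> F P P" "b \<in> F P P"
  shows "a \<otimes>\<^bsub>Aut_F S F P\<^esub> b = compose P a b"
  using Aut_F_Bij[OF fin P] assms by (simp add: Aut_F_eq BijGroup_def subset_iff)

lemma Aut_F_inv:
  assumes fin: "finite (carrier S)" and P: "subgroup P S" and a: "a \<in> F P P"
  shows "inv\<^bsub>Aut_F S F P\<^esub> a = restrict (inv_into P a) P"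
proof -
  have "inv\<^bsub>Aut_F S F P\<^esub> a = inv\<^bsub>BijGroup P\<^esub> a"
    unfolding Aut_F_eq by (rule group.m_inv_consistent[OF group_BijGroup subgroup_Aut_F[OF fin P] a])
  then show ?thesis using inv_BijGroup[of a P] Aut_F_Bij[OF fin P] a by auto
qed

lemma Aut_F_carrier: "carrier (Aut_F S F P) = F P P"
  by (simp add: Aut_F_eq)

lemma N_ext_subgroup:
  assumes P: "subgroup P S" and f: "f ` P \<subseteq> carrier S"
  shows "subgroup (N_ext S P f) S"
proof (rule subgroupI)
  note N = normalizer_eq[OF P]
  interpret N: subgroup "normalizer S P" S
    by (rule normalizer_imp_subgroup[OF subgroup.subset[OF P]])
  have Pc: "u \<in> carrier S" "f u \<in> carrier S" if "u \<in> P" for u using that subgroup.subset[OF P] f by auto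
  have conjP: "conj_by S x u \<in> P" if "x \<in> normalizer S P" "u \<in> P" for x u
    using that unfolding N by blast
  show "N_ext S P f \<subseteq> carrier S" unfolding N_ext_def N by blast
  have "\<one> \<in> N_ext S P f" unfolding N_ext_def using Pc N.one_closed
    by (auto intro!: bexI[of _ \<one>] simp: conj_by_def)
  then show "N_ext S P f \<noteq> {}" by blast
  show "inv x \<in> N_ext S P f" if x: "x \<in> N_ext S P f" for x
  proof -
    obtain y where y: "x \<in> normalizer S P" "y \<in> carrier S" "\<And>u. u \<in> P \<Longrightarrow> f (conj_by S x u) = conj_by S y (f u)"
      using x unfolding N_ext_def by blast
    have xc: "x \<in> carrier S" using y(1) N by blast
    have "f (conj_by S (inv x) u) = conj_by S (inv y) (f u)" if u: "u \<in> P" for u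
    proof -
      have v: "conj_by S (inv x) u \<in> P" using conjP[OF N.m_inv_closed[OF y(1)] u] .
      have "conj_by S x (conj_by S (inv x) u) = u"
        by (rule conj_by_inv[OF is_group xc Pc(1)[OF u]])
      then have "f u = conj_by S y (f (conj_by S (inv x) u))" using y(3)[OF v] by simp
      then show ?thesis using conj_by_inv(1)[OF is_group y(2) Pc(2)[OF v]] by simp
    qed
    then show ?thesis unfolding N_ext_def using y N.m_inv_closed by blast
  qed
  show "x \<otimes> x' \<in> N_ext S P f" if x: "x \<in> N_ext S P f" "x' \<in> N_ext S P f" for x x'
  proof -
    obtain y where y: "x \<in> normalizer S P" "y \<in> carrier S" "\<And>u. u \<in> P \<Longrightarrow> f (conj_by S x u) = conj_by S y (f u)"
      using x(1) unfolding N_ext_def by blast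
    obtain y' where y': "x' \<in> normalizer S P" "y' \<in> carrier S" "\<And>u. u \<in> P \<Longrightarrow> f (conj_by S x' u) = conj_by S y' (f u)"
      using x(2) unfolding N_ext_def by blast
    have xc: "x \<in> carrier S" "x' \<in> carrier S" using y(1) y'(1) N by blast+
    have "f (conj_by S (x \<otimes> x') u) = conj_by S (y \<otimes> y') (f u)" if u: "u \<in> P" for u
      using y(2,3) y'(2,3) conjP[OF y'(1) u] u Pc[OF u] xc by (simp add: conj_by_mult[OF is_group])
    then show ?thesis unfolding N_ext_def using y y' N.m_closed m_closed by blast
  qed
qed

end

text \<open>The form in which saturation is used.  If conjugation with the elements of \<open>M\<close>, transported along
  \<open>f\<close>, lies in a normal subgroup \<open>N\<close> of the automorphism group of \<open>f(P)\<close>, then an element \<open>n\<close> of \<open>N\<close>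
  moves it into the Sylow subgroup \<open>Aut\<^sub>S(f(P))\<close>.  Therefore \<open>M\<close> lies in the extension subgroup of
  \<open>n\<^sup>-\<^sup>1 f\<close>, which extends to \<open>M\<close>.  With \<open>N\<close> the full automorphism group this extends an isomorphism to
  the normalizer; with \<open>N\<close> the automorphisms in an invariant subsystem it is the heart of the
  Frattini argument.\<close>

lemma sylow_extension:
  fixes S :: "('a, 'm) monoid_scheme"
  assumes F: "saturated_fusion_system p S F"
    and P: "subgroup P S" and f: "fusion_system.morph S F P f" and fn: "fully_normalized S F (f ` P)"
    and N: "N \<lhd> Aut_F S F (f ` P)"
    and M: "subgroup M S" "M \<subseteq> normalizer S P" "P \<subseteq> M"
    and conj: "\<And>x. x \<in> M \<Longrightarrow> restrict (\<lambda>y. f (conj_by S x (inv_into P f y))) (f ` P) \<in> N"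
  shows "\<exists>n\<in>N. \<exists>g. fusion_system.morph S F M g \<and> (\<forall>u\<in>P. g u \<in> f ` P \<and> n (g u) = f u)"
proof -
  have pS: "p_group p S" and FS: "fusion_system S F" and sat: "saturated p S F"
    using F by (auto simp: saturated_fusion_system_def)
  interpret fusion_system S F by fact
  have p: "prime p" using pS by (simp add: p_group_def)
  obtain k where k: "order S = p ^ k" using pS by (auto simp: p_group_def)
  have fin: "finite (carrier S)" using k p by (metis card.infinite order_def power_not_zero not_prime_0)
  define Q where "Q = f ` P"
  have Q: "subgroup Q S" and inj: "inj_on f P" unfolding Q_def using morph_facts[OF P f] by blast+
  let ?A = "Aut_F S F Q"
  interpret A: group ?A by (rule group_Aut_F[OF fin Q])
  have finA: "finite (carrier ?A)" unfolding Aut_F_carrier by (rule finite_mor[OF fin Q Q])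
  have NA: "N \<lhd> ?A" using N unfolding Q_def .
  have NF: "n \<in> F Q Q" if "n \<in> N" for n
    using normal_imp_subgroup[OF NA] that subgroup.subset Aut_F_carrier by blast
  note fnQ = fn[folded Q_def]
  have fc: "fully_centralized S F Q" and syl: "sylow_subgroup p (Aut_S S Q) ?A"
    using sat Q fnQ unfolding saturated_def by blast+
  have \<Sigma>: "subgroup (Aut_S S Q) ?A" and card\<Sigma>: "card (Aut_S S Q) = p ^ multiplicity p (order ?A)"
    using syl by (auto simp: sylow_subgroup_def)
  have "order ?A \<noteq> 0" using finA A.one_closed by (auto simp: order_def)
  then obtain r where r: "order ?A = card (Aut_S S Q) * r" "\<not> p dvd r"
    using multiplicity_decompose'[of "order ?A" p] p card\<Sigma> by (metis not_prime_unit)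
  have MN: "conj_by S x u \<in> P" if "x \<in> M" "u \<in> P" for x u
    using that M(2) normalizer_eq[OF P] by blast
  have Mc: "x \<in> carrier S" if "x \<in> M" for x using that subgroup.subset[OF M(1)] by blast
  have Pc: "u \<in> carrier S" if "u \<in> P" for u using that subgroup.subset[OF P] by blast
  define \<gamma> where "\<gamma> x = restrict (\<lambda>y. f (conj_by S x (inv_into P f y))) Q" for x
  have \<gamma>N: "\<gamma> x \<in> N" if "x \<in> M" for x unfolding \<gamma>_def Q_def by (rule conj[OF that])
  have \<gamma>f: "\<gamma> x (f u) = f (conj_by S x u)" if "u \<in> P" for x u
    using that inj by (simp add: \<gamma>_def Q_def)
  have hom: "\<gamma> \<in> hom (S\<lparr>carrier := M\<rparr>) ?A"
  proof (rule homI)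
    show "\<gamma> x \<in> carrier ?A" if "x \<in> carrier (S\<lparr>carrier := M\<rparr>)" for x
      using NF[OF \<gamma>N] that by (simp add: Aut_F_carrier)
    show "\<gamma> (x \<otimes>\<^bsub>S\<lparr>carrier := M\<rparr>\<^esub> y) = \<gamma> x \<otimes>\<^bsub>?A\<^esub> \<gamma> y"
      if xy: "x \<in> carrier (S\<lparr>carrier := M\<rparr>)" "y \<in> carrier (S\<lparr>carrier := M\<rparr>)" for x y
    proof -
      have c: "x \<in> M" "y \<in> M" using xy by auto
      have "\<gamma> (x \<otimes>\<^bsub>S\<^esub> y) = compose Q (\<gamma> x) (\<gamma> y)"
      proof (rule extensionalityI[of _ Q])
        fix z assume "z \<in> Q"
        then obtain u where u: "u \<in> P" "z = f u" unfolding Q_def by blast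
        then show "\<gamma> (x \<otimes>\<^bsub>S\<^esub> y) z = compose Q (\<gamma> x) (\<gamma> y) z"
          using c \<open>z \<in> Q\<close> MN Mc Pc by (simp add: compose_def \<gamma>f conj_by_mult[OF is_group])
      qed (simp_all add: \<gamma>_def)
      then show ?thesis using Aut_F_mult[OF fin Q NF[OF \<gamma>N[OF c(1)]] NF[OF \<gamma>N[OF c(2)]]] by simp
    qed
  qed
  have gM: "group (S\<lparr>carrier := M\<rparr>)" by (rule subgroup_imp_group[OF M(1)])
  obtain j where j: "order (S\<lparr>carrier := M\<rparr>) = p ^ j"
    using subgroup_order_p_power[OF p is_group k M(1)] by (auto simp: order_def)
  have "\<exists>n\<in>N. \<forall>x\<in>carrier (S\<lparr>carrier := M\<rparr>). inv\<^bsub>?A\<^esub> n \<otimes>\<^bsub>?A\<^esub> \<gamma> x \<otimes>\<^bsub>?A\<^esub> n \<in> Aut_S S Q"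
    by (rule A.sylow_absorbs[OF p finA \<Sigma> r NA gM j hom]) (use \<gamma>N in auto)
  then obtain n where n: "n \<in> N" "\<And>x. x \<in> M \<Longrightarrow> inv\<^bsub>?A\<^esub> n \<otimes>\<^bsub>?A\<^esub> \<gamma> x \<otimes>\<^bsub>?A\<^esub> n \<in> Aut_S S Q" by auto
  have nF: "n \<in> F Q Q" by (rule NF[OF n(1)])
  have nQ: "n ` Q = Q" by (rule Aut_F_surj[OF fin Q nF])
  have ninj: "inj_on n Q" using mor_facts(2)[OF Q Q nF] .
  have nm: "morph Q n" using nF mem_iff[OF Q Q] by blast
  let ?i = "inv_into Q n"
  have i: "?i y \<in> Q" "n (?i y) = y" if "y \<in> Q" for y
    using that nQ by (auto simp: inv_into_into f_inv_into_f)
  have im: "morph Q ?i" using morph_inv[OF Q nm] nQ by simp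
  define \<theta> where "\<theta> u = ?i (f u)" for u
  have \<theta>: "morph P \<theta>" unfolding \<theta>_def using morph_comp[OF P f] im by (simp add: Q_def)
  have fQ: "f u \<in> Q" if "u \<in> P" for u using that by (simp add: Q_def)
  have \<theta>n: "\<theta> u \<in> Q" "n (\<theta> u) = f u" if "u \<in> P" for u
    unfolding \<theta>_def using i[OF fQ[OF that]] by auto
  have \<theta>P: "restrict \<theta> P ` P = Q"
  proof -
    have "\<theta> ` P = ?i ` Q" unfolding \<theta>_def Q_def by (simp add: image_image)
    also have "\<dots> = Q" using inv_into_image_cancel[OF ninj, of Q] nQ by simp
    finally show ?thesis by simp
  qed
  \<comment> \<open>For \<open>x\<close> in \<open>M\<close>, the automorphism \<open>\<theta> c\<^sub>x \<theta>\<^sup>-\<^sup>1\<close> is conjugation by an element of \<open>S\<close>.\<close>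
  have MNext: "M \<subseteq> N_ext S P (restrict \<theta> P)"
  proof
    fix x assume x: "x \<in> M"
    have ni: "inv\<^bsub>?A\<^esub> n = restrict ?i Q" by (rule Aut_F_inv[OF fin Q nF])
    have iF: "restrict ?i Q \<in> F Q Q" using im i by (auto simp: restrict_mem_iff[OF Q Q])
    note xF = NF[OF \<gamma>N[OF x]]
    have c1: "compose Q (restrict ?i Q) (\<gamma> x) \<in> F Q Q" by (rule comp_mem[OF Q Q Q xF iF])
    have "inv\<^bsub>?A\<^esub> n \<otimes>\<^bsub>?A\<^esub> \<gamma> x \<otimes>\<^bsub>?A\<^esub> n = compose Q (compose Q (restrict ?i Q) (\<gamma> x)) n"
      unfolding ni by (simp add: Aut_F_mult[OF fin Q iF xF] Aut_F_mult[OF fin Q c1 nF])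
    then have "compose Q (compose Q (restrict ?i Q) (\<gamma> x)) n \<in> Aut_S S Q" using n(2)[OF x] by simp
    then obtain y where y: "y \<in> normalizer S Q"
      "compose Q (compose Q (restrict ?i Q) (\<gamma> x)) n = restrict (conj_by S y) Q"
      unfolding Aut_S_def by blast
    have yc: "y \<in> carrier S" using y(1) normalizer_eq[OF Q] by blast
    have "restrict \<theta> P (conj_by S x u) = conj_by S y (restrict \<theta> P u)" if u: "u \<in> P" for u
    proof -
      have v: "conj_by S x u \<in> P" using MN[OF x u] .
      have "compose Q (compose Q (restrict ?i Q) (\<gamma> x)) n (\<theta> u) = ?i (\<gamma> x (f u))"
        using \<theta>n[OF u] nQ fQ[OF u] \<gamma>f[OF u] fQ[OF v] by (simp add: compose_def)
      then have "conj_by S y (\<theta> u) = ?i (f (conj_by S x u))" using y(2) \<theta>n[OF u] \<gamma>f[OF u] by simp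
      then show ?thesis using u v by (simp add: \<theta>_def)
    qed
    then show "x \<in> N_ext S P (restrict \<theta> P)" unfolding N_ext_def using x M(2) yc by blast
  qed
  have "restrict \<theta> P \<in> F P (carrier S)" using \<theta> by (simp add: morph_def)
  moreover have "fully_centralized S F (restrict \<theta> P ` P)" using fc \<theta>P by simp
  ultimately obtain \<psi> where \<psi>: "\<psi> \<in> F (N_ext S P (restrict \<theta> P)) (carrier S)"
    "\<And>u. u \<in> P \<Longrightarrow> \<psi> u = restrict \<theta> P u"
    using sat P unfolding saturated_def by blast
  have "restrict \<theta> P ` P \<subseteq> carrier S" unfolding \<theta>P by (rule subgroup.subset[OF Q])
  then have sN: "subgroup (N_ext S P (restrict \<theta> P)) S" by (rule N_ext_subgroup[OF P])
  have "morph (N_ext S P (restrict \<theta> P)) \<psi>" using \<psi>(1) mem_iff[OF sN carrier_subgroup] by blast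
  then have "morph M \<psi>" by (rule morph_subset[OF sN _ M(1) MNext])
  moreover have "\<psi> u \<in> Q \<and> n (\<psi> u) = f u" if "u \<in> P" for u using \<psi>(2)[OF that] \<theta>n[OF that] that by simp
  ultimately show ?thesis using n(1) unfolding Q_def by blast
qed

section \<open>Factoring through an invariant subsystem\<close>

lemma subgroup_restrict_iff:
  assumes "group S" "subgroup U S"
  shows "subgroup P (S\<lparr>carrier := U\<rparr>) \<longleftrightarrow> subgroup P S \<and> P \<subseteq> U"
proof
  assume P: "subgroup P (S\<lparr>carrier := U\<rparr>)"
  then show "subgroup P S \<and> P \<subseteq> U"
    using group.incl_subgroup[OF assms P] subgroup.subset[OF P] by simp
next
  assume "subgroup P S \<and> P \<subseteq> U"
  then show "subgroup P (S\<lparr>carrier := U\<rparr>)" using group.subgroup_incl[OF assms(1) _ assms(2)] by blast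
qed

lemma conj_by_restrict:
  assumes "group S" "subgroup U S" "x \<in> U"
  shows "conj_by (S\<lparr>carrier := U\<rparr>) x = conj_by S x"
  using group.m_inv_consistent[OF assms] by (simp add: conj_by_def fun_eq_iff)

locale invariant_subsystem = fusion_system S F for S (structure) and F +
  fixes U :: "'a set" and L :: "'a hom_sets" and p :: nat
  assumes sat: "saturated_fusion_system p S F" and inv: "F_invariant S F U L"
begin

lemma subU: "subgroup U S"
  using inv by (simp add: F_invariant_def fusion_subsystem_def)

sublocale LS: fusion_system "S\<lparr>carrier := U\<rparr>" L
  using inv by (simp add: F_invariant_def fusion_subsystem_def)

lemma prime_p: "prime p" and p_group_order: "\<exists>k. order S = p ^ k" and finS: "finite (carrier S)"
proof -
  show p: "prime p" and k: "\<exists>k. order S = p ^ k"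
    using sat by (auto simp: saturated_fusion_system_def p_group_def)
  show "finite (carrier S)" using k p by (metis card.infinite order_def power_not_zero not_prime_0)
qed

lemma sub_iff: "subgroup P (S\<lparr>carrier := U\<rparr>) \<longleftrightarrow> subgroup P S \<and> P \<subseteq> U"
  by (rule subgroup_restrict_iff[OF is_group subU])

lemma morph_closed:
  assumes "subgroup P S" "P \<subseteq> U" "morph P f"
  shows "f ` P \<subseteq> U"
proof -
  have "restrict f P ` P \<subseteq> U"
    using inv assms unfolding F_invariant_def strongly_closed_def morph_def by blast
  then show ?thesis by simp
qed

lemma finP: "subgroup P S \<Longrightarrow> finite P"
  using finS subgroup.subset finite_subset by blast

lemma morph_U_surj: "morph U a \<Longrightarrow> a ` U = U"
  using endo_inj_surj[OF finP[OF subU]] morph_closed[OF subU order_refl] morph_facts(1)[OF subU] by blast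

lemma L_morph:
  assumes P: "subgroup P S" "P \<subseteq> U" and k: "LS.morph P k"
  shows "morph P k" "k ` P \<subseteq> U"
proof -
  have "restrict k P \<in> L P U" using k by (simp add: LS.morph_def)
  moreover have "L P U \<subseteq> F P U" using inv P subU by (simp add: F_invariant_def fusion_subsystem_def)
  ultimately have "restrict k P \<in> F P U" by blast
  then show "morph P k" "k ` P \<subseteq> U" using restrict_mem_iff[OF P(1) subU] by auto
qed

text \<open>Invariance in terms of representing functions; the codomain in the definition of invariance is
  taken to be all of \<open>P\<close>.\<close>

lemma L_conj:
  assumes A: "subgroup A S" "A \<subseteq> P" and P: "subgroup P S" "P \<subseteq> U"
    and f: "morph P f" and k: "LS.morph A k" "k ` A \<subseteq> P"
  shows "LS.morph (f ` A) (\<lambda>x. f (k (inv_into P f x)))"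
proof -
  let ?f = "restrict f P"
  have fF: "?f \<in> F P U" using f morph_closed[OF P f] by (simp add: restrict_mem_iff[OF P(1) subU])
  have inj: "inj_on f P" by (rule morph_facts(1)[OF P(1) f])
  have inj': "inj_on ?f P" using inj by (simp add: inj_on_def)
  have kL: "restrict k A \<in> L A P"
    using k A P by (subst LS.restrict_mem_iff) (auto simp: sub_iff)
  have "bij_betw (\<lambda>\<kappa>. \<lambda>x\<in>?f ` A. ?f (\<kappa> (inv_into P ?f x))) (L A P) (L (?f ` A) (?f ` P))"
    using inv fF A P unfolding F_invariant_def by blast
  then have *: "(\<lambda>x\<in>?f ` A. ?f (restrict k A (inv_into P ?f x))) \<in> L (?f ` A) (?f ` P)"
    using bij_betw_apply kL by fastforce
  have im: "?f ` A = f ` A" "?f ` P = f ` P" using A(2) by (auto intro!: image_cong)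
  have eq: "(\<lambda>x\<in>?f ` A. ?f (restrict k A (inv_into P ?f x))) = restrict (\<lambda>x. f (k (inv_into P f x))) (f ` A)"
    unfolding im
  proof (rule restrict_ext)
    fix x assume "x \<in> f ` A"
    then obtain u where u: "u \<in> A" "x = f u" by blast
    then have uP: "u \<in> P" using A(2) by blast
    have "inv_into P ?f x = u" using inv_into_f_f[OF inj' uP] uP u(2) by simp
    moreover have "inv_into P f x = u" using inv_into_f_f[OF inj uP] u(2) by simp
    moreover have "k u \<in> P" using k(2) u(1) by blast
    ultimately show "?f (restrict k A (inv_into P ?f x)) = f (k (inv_into P f x))" using u(1) by simp
  qed
  have fA: "subgroup (f ` A) S" using morph_facts(4)[OF A(1) morph_subset[OF P(1) f A]] .
  have fP: "subgroup (f ` P) S" using morph_facts(4)[OF P(1) f] .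
  have "f ` A \<subseteq> U" "f ` P \<subseteq> U" using morph_closed[OF P f] A(2) by auto
  then have "subgroup (f ` A) (S\<lparr>carrier := U\<rparr>)" "subgroup (f ` P) (S\<lparr>carrier := U\<rparr>)"
    using fA fP by (simp_all add: sub_iff)
  from LS.restrict_mem_iff[OF this] show ?thesis using *[unfolded eq, unfolded im] by blast
qed

text \<open>Membership in \<open>Aut\<^sub>F(U) \<circ> L(P, U)\<close>.\<close>

definition factors :: "'a set \<Rightarrow> ('a \<Rightarrow> 'a) \<Rightarrow> bool" where
  "factors P f \<longleftrightarrow> (\<exists>a k. morph U a \<and> LS.morph P k \<and> (\<forall>u\<in>P. f u = a (k u)))"

lemma factors_cong: "(\<And>u. u \<in> P \<Longrightarrow> f u = g u) \<Longrightarrow> factors P f \<Longrightarrow> factors P g"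
  unfolding factors_def by metis

lemma factors_L:
  assumes "subgroup P S" "P \<subseteq> U" "LS.morph P k"
  shows "factors P k"
  unfolding factors_def using morph_id[OF subU] assms(3) by blast

lemma factors_subset:
  assumes "subgroup P S" "P \<subseteq> U" "factors P f" "subgroup P' S" "P' \<subseteq> P"
  shows "factors P' f"
proof -
  obtain a k where ak: "morph U a" "LS.morph P k" "\<And>u. u \<in> P \<Longrightarrow> f u = a (k u)"
    using assms(3) unfolding factors_def by blast
  have "LS.morph P' k"
    by (rule LS.morph_subset[OF _ ak(2)]) (use assms in \<open>auto simp: sub_iff\<close>)
  then show ?thesis unfolding factors_def using ak(1,3) assms(5) by blast
qed

text \<open>In \<open>a' k' a k\<close> the automorphism \<open>a\<close> moves to the left across \<open>k'\<close>, because \<open>a\<^sup>-\<^sup>1 k' a\<close> is again a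
  morphism of the invariant subsystem.\<close>

lemma factors_comp:
  assumes P: "subgroup P S" "P \<subseteq> U" and f: "factors P f" and g: "factors (f ` P) g"
  shows "factors P (\<lambda>u. g (f u))"
proof -
  obtain a k where ak: "morph U a" "LS.morph P k" "\<And>u. u \<in> P \<Longrightarrow> f u = a (k u)"
    using f unfolding factors_def by blast
  obtain a' k' where ak': "morph U a'" "LS.morph (f ` P) k'" "\<And>u. u \<in> f ` P \<Longrightarrow> g u = a' (k' u)"
    using g unfolding factors_def by blast
  note k = L_morph[OF P ak(2)]
  have kP: "subgroup (k ` P) S" by (rule morph_facts(4)[OF P(1) k(1)])
  have aU: "a ` U = U" "a' ` U = U" using morph_U_surj ak(1) ak'(1) by auto
  have inj: "inj_on a U" by (rule morph_facts(1)[OF subU ak(1)])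
  let ?b = "inv_into U a"
  have b: "morph U ?b" using morph_inv[OF subU ak(1)] aU by simp
  have binj: "inj_on ?b U" by (rule morph_facts(1)[OF subU b])
  have ba: "?b (a x) = x" if "x \<in> U" for x using inj that by simp
  have ab: "a (?b x) = x" if "x \<in> U" for x using f_inv_into_f[of x a U] that aU by simp
  have bb: "inv_into U ?b x = a x" if "x \<in> U" for x
  proof -
    have "a x \<in> U" using that aU by blast
    then have "inv_into U ?b (?b (a x)) = a x" by (rule inv_into_f_f[OF binj])
    then show ?thesis using ba[OF that] by simp
  qed
  have fP: "f ` P = a ` k ` P" unfolding image_image by (rule image_cong) (simp_all add: ak(3))
  have fPs: "subgroup (f ` P) S" "f ` P \<subseteq> U"
    unfolding fP using morph_facts(4)[OF kP morph_subset[OF subU ak(1) kP k(2)]] k(2) aU by auto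
  have k'U: "k' ` f ` P \<subseteq> U" by (rule L_morph(2)[OF fPs ak'(2)])
  have "LS.morph (?b ` f ` P) (\<lambda>x. ?b (k' (inv_into U ?b x)))"
    by (rule L_conj[OF fPs subU order_refl b ak'(2) k'U])
  moreover have "?b ` f ` P = k ` P"
  proof -
    have "?b ` a ` k ` P = (\<lambda>x. x) ` k ` P" unfolding image_image[of ?b]
      by (rule image_cong) (use ba k(2) in auto)
    then show ?thesis unfolding fP by simp
  qed
  ultimately have "LS.morph P (\<lambda>u. ?b (k' (inv_into U ?b (k u))))"
    using LS.morph_comp[OF _ ak(2)] P by (simp add: sub_iff)
  moreover have "morph U (\<lambda>x. a' (a x))" using morph_comp[OF subU ak(1)] ak'(1) aU by simp
  moreover have "g (f u) = a' (a (?b (k' (inv_into U ?b (k u)))))" if u: "u \<in> P" for u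
  proof -
    have "k u \<in> U" using k(2) u by blast
    then have "inv_into U ?b (k u) = f u" using bb ak(3)[OF u] by simp
    moreover have "k' (f u) \<in> U" using k'U u by blast
    ultimately show ?thesis using ab ak'(3) u by simp
  qed
  ultimately show ?thesis unfolding factors_def by blast
qed

lemma factors_inv:
  assumes P: "subgroup P S" "P \<subseteq> U" and f: "factors P f"
  shows "factors (f ` P) (inv_into P f)"
proof -
  obtain a k where ak: "morph U a" "LS.morph P k" "\<And>u. u \<in> P \<Longrightarrow> f u = a (k u)"
    using f unfolding factors_def by blast
  note k = L_morph[OF P ak(2)]
  have kP: "subgroup (k ` P) S" by (rule morph_facts(4)[OF P(1) k(1)])
  have aU: "a ` U = U" using morph_U_surj ak(1) by auto
  have inj: "inj_on a U" by (rule morph_facts(1)[OF subU ak(1)])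
  have kinj: "inj_on k P" by (rule morph_facts(1)[OF P(1) k(1)])
  let ?b = "inv_into U a"
  have b: "morph U ?b" using morph_inv[OF subU ak(1)] aU by simp
  have ba: "?b (a x) = x" if "x \<in> U" for x using inj that by simp
  have fP: "f ` P = a ` k ` P" unfolding image_image by (rule image_cong) (simp_all add: ak(3))
  have ki: "LS.morph (k ` P) (inv_into P k)" using LS.morph_inv[OF _ ak(2)] P by (simp add: sub_iff)
  have "inv_into P k ` k ` P = P" using kinj by simp
  then have "inv_into P k ` k ` P \<subseteq> U" using P(2) by simp
  then have "LS.morph (a ` k ` P) (\<lambda>x. a (inv_into P k (inv_into U a x)))"
    by (rule L_conj[OF kP k(2) subU order_refl ak(1) ki])
  moreover have "inv_into P f y = ?b (a (inv_into P k (inv_into U a y)))" if y: "y \<in> f ` P" for y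
  proof -
    obtain u where u: "u \<in> P" "y = f u" using y by blast
    have "k u \<in> U" "u \<in> U" using u k(2) P(2) by auto
    have finj: "inj_on f P"
    proof (rule inj_onI)
      fix u v assume uv: "u \<in> P" "v \<in> P" "f u = f v"
      then have "a (k u) = a (k v)" using ak(3) by simp
      then have "k u = k v" using inj_onD[OF inj] uv k(2) by blast
      then show "u = v" using inj_onD[OF kinj] uv by blast
    qed
    have "inv_into P f y = u" unfolding u(2) by (rule inv_into_f_f[OF finj u(1)])
    moreover have "inv_into P k (inv_into U a y) = u"
      using ak(3)[OF u(1)] u ba[OF \<open>k u \<in> U\<close>] inv_into_f_f[OF kinj u(1)] by simp
    ultimately show ?thesis using ba[OF \<open>u \<in> U\<close>] by simp
  qed
  ultimately show ?thesis unfolding factors_def fP using b by blast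
qed

lemma L_normal:
  assumes Q: "subgroup Q S" "Q \<subseteq> U"
  shows "L Q Q \<lhd> Aut_F S F Q"
proof -
  interpret A: group "Aut_F S F Q" by (rule group_Aut_F[OF finS Q(1)])
  have QL: "subgroup Q (S\<lparr>carrier := U\<rparr>)" using Q by (simp add: sub_iff)
  have LF: "L Q Q \<subseteq> F Q Q" using inv Q by (simp add: F_invariant_def fusion_subsystem_def)
  have invL: "inv\<^bsub>Aut_F S F Q\<^esub> a \<in> L Q Q" if a: "a \<in> L Q Q" for a
  proof -
    have aF: "a \<in> F Q Q" using a LF by blast
    have "restrict (inv_into Q a) Q \<in> L Q Q"
      using LS.inv_mem[OF QL QL a] Aut_F_surj[OF finS Q(1) aF] by simp
    then show ?thesis using Aut_F_inv[OF finS Q(1) aF] by simp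
  qed
  have multL: "a \<otimes>\<^bsub>Aut_F S F Q\<^esub> b \<in> L Q Q" if "a \<in> L Q Q" "b \<in> L Q Q" for a b
    using LS.comp_mem[OF QL QL QL that(2,1)] Aut_F_mult[OF finS Q(1)] that LF by (simp add: subset_iff)
  show ?thesis
  proof (rule A.normal_invI)
    show "subgroup (L Q Q) (Aut_F S F Q)"
    proof (rule A.subgroupI)
      show "L Q Q \<subseteq> carrier (Aut_F S F Q)" using LF by (simp add: Aut_F_carrier)
      show "L Q Q \<noteq> {}" using LS.incl_mem[OF QL QL] by blast
    qed (use invL multL in auto)
    fix a l assume a: "a \<in> carrier (Aut_F S F Q)" and l: "l \<in> L Q Q"
    have aF: "a \<in> F Q Q" using a by (simp add: Aut_F_carrier)
    have lF: "l \<in> F Q Q" using l LF by blast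
    have aQ: "a ` Q = Q" by (rule Aut_F_surj[OF finS Q(1) aF])
    have lQ: "l ` Q = Q" by (rule Aut_F_surj[OF finS Q(1) lF])
    have am: "morph Q a" using aF mem_iff[OF Q(1) Q(1)] by blast
    have lm: "LS.morph Q l" using l LS.mem_iff[OF QL QL] by blast
    have iF: "restrict (inv_into Q a) Q \<in> F Q Q"
      using inv_mem[OF Q(1) Q(1) aF] aQ by simp
    have alF: "compose Q a l \<in> F Q Q" by (rule comp_mem[OF Q(1) Q(1) Q(1) lF aF])
    have "LS.morph (a ` Q) (\<lambda>x. a (l (inv_into Q a x)))"
      by (rule L_conj[OF Q(1) order_refl Q am lm]) (simp add: lQ)
    then have m: "LS.morph Q (\<lambda>x. a (l (inv_into Q a x)))" by (simp add: aQ)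
    have iQ: "inv_into Q a x \<in> Q" if "x \<in> Q" for x using that aQ by (simp add: inv_into_into)
    have "(\<lambda>x. a (l (inv_into Q a x))) ` Q \<subseteq> Q" using iQ aQ lQ by blast
    then have "restrict (\<lambda>x. a (l (inv_into Q a x))) Q \<in> L Q Q"
      using m LS.restrict_mem_iff[OF QL QL] by blast
    moreover have "a \<otimes>\<^bsub>Aut_F S F Q\<^esub> l \<otimes>\<^bsub>Aut_F S F Q\<^esub> inv\<^bsub>Aut_F S F Q\<^esub> a
      = restrict (\<lambda>x. a (l (inv_into Q a x))) Q"
      unfolding Aut_F_inv[OF finS Q(1) aF] Aut_F_mult[OF finS Q(1) aF lF] Aut_F_mult[OF finS Q(1) alF iF]
      using iQ by (auto simp: compose_def fun_eq_iff)
    ultimately show "a \<otimes>\<^bsub>Aut_F S F Q\<^esub> l \<otimes>\<^bsub>Aut_F S F Q\<^esub> inv\<^bsub>Aut_F S F Q\<^esub> a \<in> L Q Q" by simp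
  qed
qed

text \<open>By induction on the index of \<open>P\<close> in \<open>U\<close>: a morphism that extends to \<open>N\<^sub>U(P)\<close> factors by the
  induction hypothesis.  Isomorphisms onto a fully normalized conjugate \<open>Q\<close> can be chosen to
  extend, and composing with two of them turns \<open>f\<close> into an automorphism \<open>h\<close> of \<open>Q\<close>.  Since
  conjugation by \<open>N\<^sub>U(Q)\<close> lies in the normal subgroup \<open>Aut\<^sub>L(Q)\<close>, some \<open>n\<close> in \<open>Aut\<^sub>L(Q)\<close> makes \<open>n\<^sup>-\<^sup>1 h\<close>
  extend to \<open>N\<^sub>U(Q)\<close>.  The Sylow subgroup used is \<open>Aut\<^sub>S(Q)\<close> in \<open>Aut\<^sub>F(Q)\<close>.\<close>

theorem frattini:
  assumes "subgroup P S" "P \<subseteq> U" "morph P f"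
  shows "factors P f"
  using assms
proof (induction "card U - card P" arbitrary: P f rule: less_induct)
  case less
  note P = \<open>subgroup P S\<close> \<open>P \<subseteq> U\<close> and f = \<open>morph P f\<close>
  show ?case
  proof (cases "P = U")
    case True
    have "LS.morph P (\<lambda>u. u)" by (rule LS.morph_id) (use P in \<open>simp add: sub_iff\<close>)
    then show ?thesis unfolding factors_def using f True by blast
  next
    case False
    \<comment> \<open>\<open>N\<^sub>U(V)\<close> is strictly larger than \<open>V\<close>, so the induction hypothesis applies to it.\<close>
    define NU where "NU V = normalizer S V \<inter> U" for V
    have NU: "subgroup (NU V) S" "NU V \<subseteq> U" "NU V \<subseteq> normalizer S V" "V \<subseteq> NU V"
      "card U - card (NU V) < card U - card P"
      if V: "subgroup V S" "V \<subseteq> U" "card V = card P" for V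
    proof -
      have "subgroup (normalizer S V) S" by (rule normalizer_imp_subgroup[OF subgroup.subset[OF V(1)]])
      then show "subgroup (NU V) S" unfolding NU_def by (rule subgroups_Inter_pair[OF _ subU])
      show sub: "NU V \<subseteq> U" "NU V \<subseteq> normalizer S V" unfolding NU_def by auto
      have "V \<subseteq> normalizer S V" 
      proof
        fix x assume x: "x \<in> V"
        interpret V: subgroup V S by fact
        have "conj_by S x ` V \<subseteq> V" using x by (auto simp: conj_by_def)
        moreover have "inj_on (conj_by S x) V" by (rule morph_facts(1)[OF V(1) morph_conj[OF V(1)]]) (use x in auto)
        ultimately have "conj_by S x ` V = V" using endo_inj_surj[OF finP[OF V(1)]] by blast
        then show "x \<in> normalizer S V" using normalizer_eq[OF V(1)] x by auto
      qed
      then show VN: "V \<subseteq> NU V" using V(2) unfolding NU_def by blast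
      have "card P < card U" using P False finP[OF subU] by (intro psubset_card_mono) auto
      then have "V \<subset> U" using V by auto
      moreover obtain k where "order S = p ^ k" using p_group_order by blast
      ultimately obtain x where "x \<in> U - V" "conj_by S x ` V = V"
        using normalizer_grows[OF prime_p _ V(1) subU] by blast
      then have "x \<in> NU V" "x \<notin> V" unfolding NU_def using normalizer_eq[OF V(1)] subgroup.subset[OF subU] by auto
      then have "V \<subset> NU V" using VN by blast
      then have "card V < card (NU V)" using finP[OF \<open>subgroup (NU V) S\<close>] by (intro psubset_card_mono)
      moreover have "card (NU V) \<le> card U" using sub(1) finP[OF subU] by (intro card_mono)
      ultimately show "card U - card (NU V) < card U - card P" using V(3) by linarith
    qed
    have ext: "factors V g"
      if V: "subgroup V S" "V \<subseteq> U" "card V = card P" "morph (NU V) g" for V g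
    proof -
      have "factors (NU V) g" by (rule less.hyps[OF NU(5)[OF V(1-3)] NU(1,2)[OF V(1-3)] V(4)])
      then show ?thesis by (rule factors_subset[OF NU(1,2)[OF V(1-3)] _ V(1) NU(4)[OF V(1-3)]])
    qed
    obtain h0 where h0: "morph P h0" "fully_normalized S F (h0 ` P)"
      using ex_fully_normalized[OF finS P(1)] by blast
    define Q where "Q = h0 ` P"
    have Q: "subgroup Q S" "Q \<subseteq> U" "card Q = card P"
      unfolding Q_def using morph_facts[OF P(1) h0(1)] morph_closed[OF P h0(1)] by (auto simp: card_image)
    \<comment> \<open>Every conjugate in \<open>U\<close> maps onto \<open>Q\<close> by an isomorphism that extends to its normalizer in \<open>S\<close>.\<close>
    have toQ: "\<exists>g. factors V g \<and> morph V g \<and> g ` V = Q"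
      if V: "subgroup V S" "V \<subseteq> U" "card V = card P" and h: "morph V h" "h ` V = Q" for V h
    proof -
      interpret A: group "Aut_F S F Q" by (rule group_Aut_F[OF finS Q(1)])
      have sN: "subgroup (normalizer S V) S" by (rule normalizer_imp_subgroup[OF subgroup.subset[OF V(1)]])
      have nA: "F Q Q \<lhd> Aut_F S F Q"
        by (rule A.normal_invI) (use A.subgroup_self A.m_closed A.inv_closed in \<open>simp_all add: Aut_F_carrier\<close>)
      have VN: "V \<subseteq> normalizer S V" using NU(3,4)[OF V] by blast
      have hinj: "inj_on h V" by (rule morph_facts(1)[OF V(1) h(1)])
      have "\<exists>n\<in>F Q Q. \<exists>g. morph (normalizer S V) g \<and> (\<forall>u\<in>V. g u \<in> h ` V \<and> n (g u) = h u)"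
      proof (rule sylow_extension[OF sat V(1) h(1) _ _ sN order_refl VN])
        show "fully_normalized S F (h ` V)" using h0(2) by (simp add: h(2) flip: Q_def)
        show "F Q Q \<lhd> Aut_F S F (h ` V)" using nA h(2) by simp
        fix x assume x: "x \<in> normalizer S V"
        have xV: "x \<in> carrier S" "conj_by S x ` V = V" using x normalizer_eq[OF V(1)] by auto
        have hi: "morph Q (inv_into V h)" using morph_inv[OF V(1) h(1)] h(2) by simp
        have hiQ: "inv_into V h ` Q = V" using hinj h(2) by auto
        have m1: "morph Q (\<lambda>y. conj_by S x (inv_into V h y))"
          using morph_comp[OF Q(1) hi] morph_conj[OF V(1) xV(1)] hiQ by simp
        have i1: "(\<lambda>y. conj_by S x (inv_into V h y)) ` Q = V"
          using xV(2) hiQ by (metis image_image)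
        have m2: "morph Q (\<lambda>y. h (conj_by S x (inv_into V h y)))"
          using morph_comp[OF Q(1) m1] h(1) i1 by simp
        have i2: "(\<lambda>y. h (conj_by S x (inv_into V h y))) ` Q = Q"
          using i1 h(2) by (metis image_image)
        show "restrict (\<lambda>y. h (conj_by S x (inv_into V h y))) (h ` V) \<in> F Q Q"
          unfolding h(2) using m2 i2 by (simp add: restrict_mem_iff[OF Q(1) Q(1)])
      qed
      then obtain g n where g: "morph (normalizer S V) g" "\<And>u. u \<in> V \<Longrightarrow> g u \<in> Q" unfolding h(2) by blast
      have gV: "morph V g" by (rule morph_subset[OF sN g(1) V(1) VN])
      have "card (g ` V) = card Q" using card_image[OF morph_facts(1)[OF V(1) gV]] V(3) Q(3) by simp
      then have "g ` V = Q" using g(2) by (intro card_subset_eq[OF finP[OF Q(1)]]) auto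
      moreover have "factors V g"
        by (rule ext[OF V morph_subset[OF sN g(1) NU(1)[OF V] NU(3)[OF V]]])
      ultimately show ?thesis using gV by blast
    qed
    obtain g1 where g1: "factors P g1" "morph P g1" "g1 ` P = Q" using toQ[OF P refl h0(1)] Q_def by blast
    define P2 where "P2 = f ` P"
    have finj: "inj_on f P" by (rule morph_facts(1)[OF P(1) f])
    have P2: "subgroup P2 S" "P2 \<subseteq> U" "card P2 = card P"
      unfolding P2_def using morph_facts[OF P(1) f] morph_closed[OF P f] by (auto simp: card_image)
    have fi: "morph P2 (inv_into P f)" unfolding P2_def by (rule morph_inv[OF P(1) f])
    have fiP: "inv_into P f ` P2 = P" unfolding P2_def using finj by simp
    have "morph P2 (\<lambda>y. h0 (inv_into P f y))" using morph_comp[OF P2(1) fi] h0(1) fiP by simp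
    moreover have "(\<lambda>y. h0 (inv_into P f y)) ` P2 = Q" using fiP Q_def by (metis image_image)
    ultimately obtain g2 where g2: "factors P2 g2" "morph P2 g2" "g2 ` P2 = Q" using toQ[OF P2] by blast
    have g1inj: "inj_on g1 P" by (rule morph_facts(1)[OF P(1) g1(2)])
    have g2inj: "inj_on g2 P2" by (rule morph_facts(1)[OF P2(1) g2(2)])
    \<comment> \<open>\<open>f\<close> becomes the automorphism \<open>h\<close> of \<open>Q\<close>; it remains to factor \<open>h\<close>, as \<open>f = g2\<^sup>-\<^sup>1 h g1\<close>.\<close>
    define h where "h y = g2 (f (inv_into P g1 y))" for y
    have g1i: "morph Q (inv_into P g1)" using morph_inv[OF P(1) g1(2)] g1(3) by simp
    have g1iQ: "inv_into P g1 ` Q = P" using g1inj g1(3) by auto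
    have m1: "morph Q (\<lambda>y. f (inv_into P g1 y))" using morph_comp[OF Q(1) g1i] f g1iQ by simp
    have i1: "(\<lambda>y. f (inv_into P g1 y)) ` Q = P2" using g1iQ P2_def by (metis image_image)
    have hm: "morph Q h" unfolding h_def using morph_comp[OF Q(1) m1] g2(2) i1 by simp
    have hQ: "h ` Q = Q" unfolding h_def using i1 g2(3) by (metis image_image)
    have hinj: "inj_on h Q" by (rule morph_facts(1)[OF Q(1) hm])
    have QL: "subgroup Q (S\<lparr>carrier := U\<rparr>)" using Q by (simp add: sub_iff)
    have "\<exists>n\<in>L Q Q. \<exists>g. morph (NU Q) g \<and> (\<forall>u\<in>Q. g u \<in> h ` Q \<and> n (g u) = h u)"
    proof (rule sylow_extension[OF sat Q(1) hm _ _ NU(1,3,4)[OF Q]])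
      show "fully_normalized S F (h ` Q)" using h0(2) by (simp add: hQ flip: Q_def)
      show "L Q Q \<lhd> Aut_F S F (h ` Q)" using L_normal[OF Q(1,2)] hQ by simp
      fix x assume x: "x \<in> NU Q"
      have xQ: "x \<in> U" "conj_by S x ` Q = Q" using x normalizer_eq[OF Q(1)] unfolding NU_def by auto
      have "LS.morph Q (conj_by S x)"
        using LS.morph_conj[OF QL, of x] xQ(1) conj_by_restrict[OF is_group subU xQ(1)] by simp
      then have m: "LS.morph Q (\<lambda>y. h (conj_by S x (inv_into Q h y)))"
        using L_conj[OF Q(1) order_refl Q(1,2) hm] xQ(2) hQ by simp
      have "inv_into Q h ` Q = Q" using inv_into_image_cancel[OF hinj order_refl] hQ by simp
      then have "(\<lambda>y. h (conj_by S x (inv_into Q h y))) ` Q = Q"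
        using xQ(2) hQ by (metis image_image)
      then show "restrict (\<lambda>y. h (conj_by S x (inv_into Q h y))) (h ` Q) \<in> L Q Q"
        unfolding hQ using m by (simp add: LS.restrict_mem_iff[OF QL QL])
    qed
    then obtain n g where n: "n \<in> L Q Q" and g: "morph (NU Q) g" "\<And>u. u \<in> Q \<Longrightarrow> g u \<in> Q \<and> n (g u) = h u"
      unfolding hQ by blast
    have fg: "factors Q g" by (rule ext[OF Q g(1)])
    have gm: "morph Q g" by (rule morph_subset[OF NU(1)[OF Q] g(1) Q(1) NU(4)[OF Q]])
    have gQ: "g ` Q = Q" using endo_inj_surj[OF finP[OF Q(1)] _ morph_facts(1)[OF Q(1) gm]] g(2) by blast
    have "LS.morph Q n" using n LS.mem_iff[OF QL QL] by blast
    then have "factors (g ` Q) n" unfolding gQ by (rule factors_L[OF Q(1,2)])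
    then have "factors Q (\<lambda>u. n (g u))" by (rule factors_comp[OF Q(1,2) fg])
    then have fh: "factors Q h" by (rule factors_cong[rotated]) (simp add: g(2))
    have "factors P (\<lambda>u. h (g1 u))" by (rule factors_comp[OF P g1(1)]) (simp add: g1(3) fh)
    moreover have "(\<lambda>u. h (g1 u)) ` P = Q" using g1(3) hQ by (metis image_image)
    moreover have "factors Q (inv_into P2 g2)" using factors_inv[OF P2(1,2) g2(1)] g2(3) by simp
    ultimately have "factors P (\<lambda>u. inv_into P2 g2 (h (g1 u)))" using factors_comp[OF P] by metis
    moreover have "inv_into P2 g2 (h (g1 u)) = f u" if u: "u \<in> P" for u
      using u g1inj g2inj by (simp add: h_def P2_def)
    ultimately show ?thesis by (rule factors_cong[rotated])
  qed
qed

text \<open>By the Frattini factorization it suffices to treat isomorphisms in \<open>L\<close>, where precomposition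
  works, and automorphisms of \<open>U\<close>, which preserve \<open>L\<close>.\<close>

lemma card_L_conj:
  assumes P: "subgroup P S" "P \<subseteq> U" and f: "morph P f"
  shows "card (L (f ` P) U) = card (L P U)"
proof -
  obtain a k where ak: "morph U a" "LS.morph P k" "\<And>u. u \<in> P \<Longrightarrow> f u = a (k u)"
    using frattini[OF assms] unfolding factors_def by blast
  note k = L_morph[OF P ak(2)]
  have kP: "subgroup (k ` P) S" by (rule morph_facts(4)[OF P(1) k(1)])
  have aU: "a ` U = U" using morph_U_surj ak(1) by auto
  have fP: "f ` P = a ` k ` P" unfolding image_image by (rule image_cong) (simp_all add: ak(3))
  let ?a = "restrict a U"
  have aF: "?a \<in> F U U" using ak(1) aU by (simp add: restrict_mem_iff[OF subU subU])
  have "bij_betw (\<lambda>\<kappa>. \<lambda>x\<in>?a ` k ` P. ?a (\<kappa> (inv_into U ?a x))) (L (k ` P) U) (L (?a ` k ` P) (?a ` U))"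
    using inv aF kP k(2) subU unfolding F_invariant_def by blast
  moreover have "?a ` k ` P = f ` P" unfolding fP using k(2) by (intro image_cong) auto
  moreover have "?a ` U = U" using aU by simp
  ultimately have "card (L (k ` P) U) = card (L (f ` P) U)" using bij_betw_same_card by metis
  moreover have "card (L (k ` P) U) = card (L P U)"
    by (rule LS.card_precomp[OF _ _ ak(2)]) (use P subU in \<open>auto simp: sub_iff\<close>)
  ultimately show ?thesis by simp
qed

end

section \<open>Counting morphisms and factorizations\<close>

lemma (in fusion_system) morph_congI:
  "morph P f \<Longrightarrow> (\<And>u. u \<in> P \<Longrightarrow> f u = g u) \<Longrightarrow> morph P g"
  using morph_cong[of P f g] by blast

lemma (in fusion_system) morph_conjugate:
  assumes A: "subgroup A S" "A \<subseteq> P" and P: "subgroup P S"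
    and f: "morph P f" and k: "morph A k" "k ` A \<subseteq> P"
  shows "morph (f ` A) (\<lambda>x. f (k (inv_into P f x)))"
proof -
  have inj: "inj_on f P" by (rule morph_facts(1)[OF P f])
  have fA: "subgroup (f ` A) S" by (rule morph_facts(4)[OF A(1) morph_subset[OF P f A]])
  have kA: "subgroup (k ` A) S" by (rule morph_facts(4)[OF A(1) k(1)])
  have i: "morph (f ` A) (inv_into P f)"
    by (rule morph_subset[OF morph_facts(4)[OF P f] morph_inv[OF P f] fA]) (use A(2) in blast)
  have im: "inv_into P f ` f ` A = A" by (rule inv_into_image_cancel[OF inj A(2)])
  have m: "morph (f ` A) (\<lambda>x. k (inv_into P f x))" using morph_comp[OF fA i] k(1) im by simp
  have im2: "(\<lambda>x. k (inv_into P f x)) ` f ` A = k ` A" using im by (metis image_image)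
  show ?thesis using morph_comp[OF fA m] morph_subset[OF P f kA k(2)] im2 by simp
qed

lemma intersection_fusion_system:
  fixes S :: "('a, 'm) monoid_scheme"
  assumes S: "group S" and R: "subgroup R S" and T: "subgroup T S"
    and H: "fusion_system (S\<lparr>carrier := R\<rparr>) H" and K: "fusion_system (S\<lparr>carrier := T\<rparr>) K"
  shows "fusion_system (S\<lparr>carrier := R \<inter> T\<rparr>) (\<lambda>P Q. H P Q \<inter> K P Q)"
proof -
  interpret S: group S by fact
  interpret H: fusion_system "S\<lparr>carrier := R\<rparr>" H by fact
  interpret K: fusion_system "S\<lparr>carrier := T\<rparr>" K by fact
  have U: "subgroup (R \<inter> T) S" by (rule S.subgroups_Inter_pair[OF R T])
  have sH: "subgroup P (S\<lparr>carrier := R\<rparr>)" and sK: "subgroup P (S\<lparr>carrier := T\<rparr>)"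
    if "subgroup P (S\<lparr>carrier := R \<inter> T\<rparr>)" for P
    using that by (simp_all add: subgroup_restrict_iff[OF S] R T U)
  show ?thesis
  proof (intro fusion_system.intro fusion_system_axioms.intro)
    show "group (S\<lparr>carrier := R \<inter> T\<rparr>)" by (rule S.subgroup_imp_group[OF U])
  next
    fix P Q x assume P: "subgroup P (S\<lparr>carrier := R \<inter> T\<rparr>)" and Q: "subgroup Q (S\<lparr>carrier := R \<inter> T\<rparr>)"
      and x: "x \<in> carrier (S\<lparr>carrier := R \<inter> T\<rparr>)"
      and im: "conj_by (S\<lparr>carrier := R \<inter> T\<rparr>) x ` P \<subseteq> Q"
    have e: "conj_by (S\<lparr>carrier := R \<inter> T\<rparr>) x = conj_by S x" "conj_by (S\<lparr>carrier := R\<rparr>) x = conj_by S x"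
      "conj_by (S\<lparr>carrier := T\<rparr>) x = conj_by S x"
      using conj_by_restrict[OF S U, of x] conj_by_restrict[OF S R, of x] conj_by_restrict[OF S T, of x] x by auto
    show "restrict (conj_by (S\<lparr>carrier := R \<inter> T\<rparr>) x) P \<in> H P Q \<inter> K P Q"
      using H.conj_mem[OF sH[OF P] sH[OF Q], of x] K.conj_mem[OF sK[OF P] sK[OF Q], of x] im x
      unfolding e by simp
  next
    fix P Q \<phi> assume "subgroup P (S\<lparr>carrier := R \<inter> T\<rparr>)" "subgroup Q (S\<lparr>carrier := R \<inter> T\<rparr>)"
      "\<phi> \<in> H P Q \<inter> K P Q"
    then show "\<phi> \<in> mon (S\<lparr>carrier := R \<inter> T, carrier := P\<rparr>) (S\<lparr>carrier := R \<inter> T, carrier := Q\<rparr>)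
       \<inter> extensional P"
      using H.mor_mono[OF sH sH, of P Q \<phi>] by simp
  next
    fix P Q V \<phi> \<psi> assume "subgroup P (S\<lparr>carrier := R \<inter> T\<rparr>)" "subgroup Q (S\<lparr>carrier := R \<inter> T\<rparr>)"
      "subgroup V (S\<lparr>carrier := R \<inter> T\<rparr>)" "\<phi> \<in> H P Q \<inter> K P Q" "\<psi> \<in> H Q V \<inter> K Q V"
    then show "compose P \<psi> \<phi> \<in> H P V \<inter> K P V"
      using H.comp_mem[OF sH sH sH, of P Q V \<phi> \<psi>] K.comp_mem[OF sK sK sK, of P Q V \<phi> \<psi>] by simp
  next
    fix P Q \<phi> assume "subgroup P (S\<lparr>carrier := R \<inter> T\<rparr>)" "subgroup Q (S\<lparr>carrier := R \<inter> T\<rparr>)"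
      "\<phi> \<in> H P Q \<inter> K P Q"
    then show "\<phi> \<in> H P (\<phi> ` P) \<inter> K P (\<phi> ` P)"
      "restrict (inv_into P \<phi>) (\<phi> ` P) \<in> H (\<phi> ` P) P \<inter> K (\<phi> ` P) P"
      using H.iso_mem[OF sH sH, of P Q \<phi>] K.iso_mem[OF sK sK, of P Q \<phi>]
        H.inv_mem[OF sH sH, of P Q \<phi>] K.inv_mem[OF sK sK, of P Q \<phi>] by simp_all
  qed
qed

locale composition_setting = fusion_system S F for S (structure) and F +
  fixes p :: nat and R T :: "'a set" and H K :: "'a hom_sets"
  assumes sat: "saturated_fusion_system p S F"
    and Hsub: "fusion_subsystem S F R H" and Hsat: "saturated_fusion_system p (S\<lparr>carrier := R\<rparr>) H"
    and Kinv: "F_invariant S F T K"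
begin

abbreviation "U \<equiv> R \<inter> T"
abbreviation "L \<equiv> (\<lambda>P Q. H P Q \<inter> K P Q)"

lemma subR: "subgroup R S" using Hsub by (simp add: fusion_subsystem_def)

sublocale KF: invariant_subsystem S F T K p
  by unfold_locales (rule sat, rule Kinv)

sublocale HS: fusion_system "S\<lparr>carrier := R\<rparr>" H
  using Hsub by (simp add: fusion_subsystem_def)

lemma subT: "subgroup T S" by (rule KF.subU)

lemma subU: "subgroup U S" by (rule subgroups_Inter_pair[OF subR subT])

lemma H_sub: "subgroup P (S\<lparr>carrier := R\<rparr>) \<longleftrightarrow> subgroup P S \<and> P \<subseteq> R"
  by (rule subgroup_restrict_iff[OF is_group subR])

lemma K_sub: "subgroup P (S\<lparr>carrier := T\<rparr>) \<longleftrightarrow> subgroup P S \<and> P \<subseteq> T"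
  by (rule subgroup_restrict_iff[OF is_group subT])

lemma H_morph:
  assumes P: "subgroup P S" "P \<subseteq> R" and k: "HS.morph P k"
  shows "morph P k" "k ` P \<subseteq> R"
proof -
  have "restrict k P \<in> H P R" using k by (simp add: HS.morph_def)
  moreover have "H P R \<subseteq> F P R" using Hsub P subR by (simp add: fusion_subsystem_def)
  ultimately have "restrict k P \<in> F P R" by blast
  then show "morph P k" "k ` P \<subseteq> R" using restrict_mem_iff[OF P(1) subR] by auto
qed

lemma H_morph_U:
  assumes P: "subgroup P S" "P \<subseteq> U" and k: "HS.morph P k"
  shows "k ` P \<subseteq> U"
  using H_morph[OF P(1) _ k] KF.morph_closed[OF P(1), of k] P(2) by auto

lemma H_mem_iff:
  assumes "subgroup P S" "P \<subseteq> R" "subgroup Q S" "Q \<subseteq> R"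
  shows "\<phi> \<in> H P Q \<longleftrightarrow> \<phi> \<in> extensional P \<and> HS.morph P \<phi> \<and> \<phi> ` P \<subseteq> Q"
  by (rule HS.mem_iff) (use assms in \<open>auto simp: H_sub\<close>)

lemma H_restrict_iff:
  assumes "subgroup P S" "P \<subseteq> R" "subgroup Q S" "Q \<subseteq> R"
  shows "restrict f P \<in> H P Q \<longleftrightarrow> HS.morph P f \<and> f ` P \<subseteq> Q"
  by (rule HS.restrict_mem_iff) (use assms in \<open>auto simp: H_sub\<close>)

lemma K_mem_iff:
  assumes "subgroup P S" "P \<subseteq> T" "subgroup Q S" "Q \<subseteq> T"
  shows "\<phi> \<in> K P Q \<longleftrightarrow> \<phi> \<in> extensional P \<and> KF.LS.morph P \<phi> \<and> \<phi> ` P \<subseteq> Q"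
  by (rule KF.LS.mem_iff) (use assms in \<open>auto simp: K_sub\<close>)

text \<open>On \<open>R \<inter> T\<close> the morphisms that belong to both \<open>H\<close> and \<open>K\<close> form an \<open>H\<close>-invariant subsystem: \<open>R \<inter> T\<close>
  is strongly closed in \<open>H\<close> because \<open>T\<close> is so in \<open>F\<close>, and conjugation with a morphism of \<open>H\<close>
  preserves \<open>H\<close> trivially and \<open>K\<close> by invariance.\<close>

lemma intersection_invariant: "F_invariant (S\<lparr>carrier := R\<rparr>) H U L"
  unfolding F_invariant_def
proof (intro conjI)
  have UR: "subgroup U (S\<lparr>carrier := R\<rparr>)" using subU by (simp add: H_sub)
  show "fusion_subsystem (S\<lparr>carrier := R\<rparr>) H U L"
    unfolding fusion_subsystem_def
    using UR intersection_fusion_system[OF is_group subR subT HS.fusion_system_axioms KF.LS.fusion_system_axioms]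
    by auto
  show "strongly_closed (S\<lparr>carrier := R\<rparr>) H U"
    unfolding strongly_closed_def
  proof (intro allI impI ballI)
    fix P \<phi> assume P: "subgroup P (S\<lparr>carrier := R\<rparr>) \<and> P \<subseteq> U" and \<phi>: "\<phi> \<in> H P (carrier (S\<lparr>carrier := R\<rparr>))"
    have P': "subgroup P S" "P \<subseteq> U" using P by (auto simp: H_sub)
    have "HS.morph P \<phi>" using \<phi> H_mem_iff[OF P'(1) _ subR] P'(2) by auto
    then show "\<phi> ` P \<subseteq> U" by (rule H_morph_U[OF P'])
  qed
  show "\<forall>A B P. subgroup A (S\<lparr>carrier := R\<rparr>) \<and> subgroup B (S\<lparr>carrier := R\<rparr>) \<and> subgroup P (S\<lparr>carrier := R\<rparr>)
      \<and> A \<subseteq> P \<and> B \<subseteq> P \<and> P \<subseteq> U \<longrightarrow>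
        (\<forall>\<phi>\<in>H P U. bij_betw (\<lambda>\<kappa>. \<lambda>x\<in>\<phi> ` A. \<phi> (\<kappa> (inv_into P \<phi> x))) (L A B) (L (\<phi> ` A) (\<phi> ` B)))"
  proof (intro allI impI ballI)
    fix A B P \<phi>
    assume a: "subgroup A (S\<lparr>carrier := R\<rparr>) \<and> subgroup B (S\<lparr>carrier := R\<rparr>) \<and> subgroup P (S\<lparr>carrier := R\<rparr>)
      \<and> A \<subseteq> P \<and> B \<subseteq> P \<and> P \<subseteq> U" and \<phi>: "\<phi> \<in> H P U"
    have A: "subgroup A S" "A \<subseteq> P" "A \<subseteq> R" and B: "subgroup B S" "B \<subseteq> P" "B \<subseteq> R"
      and P: "subgroup P S" "P \<subseteq> R" "P \<subseteq> T" "P \<subseteq> U" using a by (auto simp: H_sub)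
    note aR = a[THEN conjunct1] a[THEN conjunct2, THEN conjunct1] a[THEN conjunct2, THEN conjunct2, THEN conjunct1]
    have \<phi>H: "HS.morph P \<phi>" "\<phi> ` P \<subseteq> U" using \<phi> H_mem_iff[OF P(1,2) subU] by auto
    have \<phi>F: "morph P \<phi>" by (rule H_morph(1)[OF P(1,2) \<phi>H(1)])
    have ext: "\<phi> \<in> extensional P" using \<phi> H_mem_iff[OF P(1,2) subU] by auto
    have "\<phi> \<in> F P T" using ext \<phi>F \<phi>H(2) by (simp add: mem_iff[OF P(1) subT])
    let ?c = "\<lambda>\<kappa>. \<lambda>x\<in>\<phi> ` A. \<phi> (\<kappa> (inv_into P \<phi> x))"
    have bij: "bij_betw ?c (K A B) (K (\<phi> ` A) (\<phi> ` B))"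
      using Kinv \<open>\<phi> \<in> F P T\<close> A(1,2) B(1,2) P(1,3) unfolding F_invariant_def by blast
    have inj: "inj_on \<phi> P" by (rule morph_facts(1)[OF P(1) \<phi>F])
    have \<phi>s: "subgroup (\<phi> ` A) S" "subgroup (\<phi> ` B) S" "subgroup (\<phi> ` P) S"
      using morph_facts(4) morph_subset[OF P(1) \<phi>F] A B P \<phi>F by auto
    have \<phi>R: "\<phi> ` A \<subseteq> R" "\<phi> ` B \<subseteq> R" "\<phi> ` P \<subseteq> R" using \<phi>H(2) A(2) B(2) by auto
    have HcH: "?c \<kappa> \<in> H (\<phi> ` A) (\<phi> ` B)" if \<kappa>: "\<kappa> \<in> H A B" for \<kappa>
    proof -
      have k: "HS.morph A \<kappa>" "\<kappa> ` A \<subseteq> B" using \<kappa> H_mem_iff[OF A(1,3) B(1,3)] by auto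
      have "HS.morph (\<phi> ` A) (\<lambda>x. \<phi> (\<kappa> (inv_into P \<phi> x)))"
        by (rule HS.morph_conjugate[OF aR(1) A(2) aR(3) \<phi>H(1) k(1)]) (use k(2) B(2) in blast)
      moreover have "(\<lambda>x. \<phi> (\<kappa> (inv_into P \<phi> x))) ` \<phi> ` A \<subseteq> \<phi> ` B"
        using inv_into_image_cancel[OF inj A(2)] k(2) by blast
      ultimately show ?thesis
        unfolding H_restrict_iff[OF \<phi>s(1) \<phi>R(1) \<phi>s(2) \<phi>R(2)] by (rule conjI)
    qed
    show "bij_betw ?c (L A B) (L (\<phi> ` A) (\<phi> ` B))"
    proof (rule bij_betw_imageI)
      show "inj_on ?c (L A B)" by (rule inj_on_subset[OF bij_betw_imp_inj_on[OF bij]]) blast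
      show "?c ` L A B = L (\<phi> ` A) (\<phi> ` B)"
      proof (intro equalityI subsetI)
        fix l assume "l \<in> ?c ` L A B"
        then obtain \<kappa> where k: "\<kappa> \<in> H A B" "\<kappa> \<in> K A B" "l = ?c \<kappa>" by blast
        show "l \<in> L (\<phi> ` A) (\<phi> ` B)" unfolding k(3)
          using HcH[OF k(1)] bij_betw_apply[OF bij k(2)] by (rule IntI)
      next
        fix l assume l: "l \<in> L (\<phi> ` A) (\<phi> ` B)"
        then have "l \<in> ?c ` K A B" using bij_betw_imp_surj_on[OF bij] by blast
        then obtain \<kappa> where k: "\<kappa> \<in> K A B" "l = ?c \<kappa>" by blast
        have kA: "\<kappa> \<in> extensional A" "\<kappa> ` A \<subseteq> B"
          using k(1) K_mem_iff[OF A(1) _ B(1)] A(2) B(2) P(3) by auto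
        have lH: "HS.morph (\<phi> ` A) l" "l ` \<phi> ` A \<subseteq> \<phi> ` B"
          using l H_mem_iff[OF \<phi>s(1) \<phi>R(1) \<phi>s(2) \<phi>R(2)] by auto
        let ?i = "inv_into P \<phi>"
        have ii: "inv_into (\<phi> ` P) ?i u = \<phi> u" if "u \<in> P" for u
        proof -
          have "inj_on ?i (\<phi> ` P)" by (rule inj_on_inv_into) simp
          from inv_into_f_f[OF this, of "\<phi> u"] that inj show ?thesis by simp
        qed
        have lP: "l ` \<phi> ` A \<subseteq> \<phi> ` P" using lH(2) B(2) by blast
        have "HS.morph (?i ` \<phi> ` A) (\<lambda>x. ?i (l (inv_into (\<phi> ` P) ?i x)))"
          by (rule HS.morph_conjugate[OF _ _ _ HS.morph_inv[OF aR(3) \<phi>H(1)] lH(1)])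
            (use \<phi>s \<phi>R lP image_mono[OF A(2)] in \<open>simp_all add: H_sub\<close>)
        moreover have "?i (l (inv_into (\<phi> ` P) ?i u)) = \<kappa> u" if u: "u \<in> A" for u
        proof -
          have uP: "u \<in> P" "\<kappa> u \<in> P" using u kA(2) A(2) B(2) by auto
          show ?thesis unfolding ii[OF uP(1)] k(2) using inv_into_f_f[OF inj] uP u by simp
        qed
        ultimately have "HS.morph A \<kappa>"
          using HS.morph_cong[of A "\<lambda>x. ?i (l (inv_into (\<phi> ` P) ?i x))" \<kappa>]
            inv_into_image_cancel[OF inj A(2)] by simp
        then have "\<kappa> \<in> H A B" using kA H_mem_iff[OF A(1,3) B(1,3)] by blast
        then show "l \<in> ?c ` L A B" using k by blast
      qed
    qed
  qed
qed

sublocale LH: invariant_subsystem "S\<lparr>carrier := R\<rparr>" H U L p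
  by unfold_locales (rule Hsat, rule intersection_invariant)

lemma finS: "finite (carrier S)" by (rule KF.finS)

lemma L_mem_iff:
  assumes "subgroup P S" "P \<subseteq> U" "subgroup Q S" "Q \<subseteq> U"
  shows "\<phi> \<in> L P Q \<longleftrightarrow> \<phi> \<in> extensional P \<and> HS.morph P \<phi> \<and> KF.LS.morph P \<phi> \<and> \<phi> ` P \<subseteq> Q"
  using H_mem_iff[of P Q \<phi>] K_mem_iff[of P Q \<phi>] assms by auto

lemma card_L_conj:
  assumes "subgroup P S" "P \<subseteq> U" "HS.morph P f"
  shows "card (L (f ` P) U) = card (L P U)"
  by (rule LH.card_L_conj[OF _ assms(2,3)]) (use assms in \<open>auto simp: H_sub\<close>)

text \<open>Consider all pairs \<open>(\<eta>, \<kappa>)\<close> with \<open>\<eta>\<close> in \<open>H(Q, R)\<close> and \<open>\<kappa>\<close> in \<open>K(\<eta> Q, T)\<close>.  Invariance of \<open>|K(-, T)|\<close>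
  counts them as \<open>|H(Q, R)| |K(Q, T)|\<close>.  Every \<open>\<phi>\<close> in \<open>F(Q, T)\<close> is such a composite \<open>\<kappa> \<eta>\<close>, by
  factoring its inverse.  The pairs with composite \<open>\<phi> = \<kappa>\<^sub>0 \<eta>\<^sub>0\<close> are those of the form
  \<open>(l \<eta>\<^sub>0, \<kappa>\<^sub>0 l\<^sup>-\<^sup>1)\<close> with \<open>l\<close> in both \<open>H\<close> and \<open>K\<close> on \<open>\<eta>\<^sub>0 Q\<close>, and their number does not depend on \<open>\<eta>\<^sub>0\<close>.\<close>

lemma count_composites:
  assumes wcp: "weak_composition_product S F R H T K" and Q: "subgroup Q S" "Q \<subseteq> U"
  shows "card (H Q R) * card (K Q T) = card (F Q T) * card (L Q U)"
proof -
  have QR: "Q \<subseteq> R" "Q \<subseteq> T" using Q(2) by auto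
  have HQ: "subgroup Q (S\<lparr>carrier := R\<rparr>)" using Q by (simp add: H_sub)
  have finH: "finite (H P R)" if "subgroup P S" "P \<subseteq> R" for P
    by (rule HS.finite_mor) (use finite_subset[OF subgroup.subset[OF subR] finS] that subR in \<open>auto simp: H_sub\<close>)
  have finK: "finite (K P T)" if "subgroup P S" "P \<subseteq> T" for P
    by (rule KF.LS.finite_mor) (use finite_subset[OF subgroup.subset[OF subT] finS] that subT in \<open>auto simp: K_sub\<close>)
  define Z where "Z = (SIGMA \<eta>:H Q R. K (\<eta> ` Q) T)"
  define m where "m = (\<lambda>(\<eta> :: 'a \<Rightarrow> 'a, \<kappa> :: 'a \<Rightarrow> 'a). compose Q \<kappa> \<eta>)"
  have \<eta>f: "HS.morph Q \<eta>" "morph Q \<eta>" "subgroup (\<eta> ` Q) S" "\<eta> ` Q \<subseteq> U" if "\<eta> \<in> H Q R" for \<eta>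
  proof -
    show h: "HS.morph Q \<eta>" using that H_mem_iff[OF Q(1) QR(1) subR] by auto
    show f: "morph Q \<eta>" by (rule H_morph(1)[OF Q(1) QR(1) h])
    show "subgroup (\<eta> ` Q) S" by (rule morph_facts(4)[OF Q(1) f])
    show "\<eta> ` Q \<subseteq> U" by (rule H_morph_U[OF Q h])
  qed
  have "card Z = (\<Sum>\<eta>\<in>H Q R. card (K (\<eta> ` Q) T))"
    unfolding Z_def by (rule card_SigmaI[OF finH[OF Q(1) QR(1)]]) (use \<eta>f(3,4) finK in auto)
  also have "\<dots> = card (H Q R) * card (K Q T)"
    using KF.card_L_conj[OF Q(1) QR(2) \<eta>f(2)] by simp
  finally have cZ: "card Z = card (H Q R) * card (K Q T)" .
  have mF: "m z \<in> F Q T" if "z \<in> Z" for z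
  proof -
    obtain \<eta> \<kappa> where z: "z = (\<eta>, \<kappa>)" "\<eta> \<in> H Q R" "\<kappa> \<in> K (\<eta> ` Q) T" using \<open>z \<in> Z\<close> unfolding Z_def by blast
    have s: "subgroup (\<eta> ` Q) S" "\<eta> ` Q \<subseteq> T" using \<eta>f(3,4)[OF z(2)] by auto
    have "KF.LS.morph (\<eta> ` Q) \<kappa>" using z(3) K_mem_iff[OF s subT] by auto
    note k = KF.L_morph[OF s this]
    have "morph Q (\<lambda>u. \<kappa> (\<eta> u))" by (rule morph_comp[OF Q(1) \<eta>f(2)[OF z(2)] k(1)])
    then show ?thesis unfolding z(1) m_def using k(2) by (auto simp: compose_def restrict_mem_iff[OF Q(1) subT])
  qed
  have fiber: "card {z\<in>Z. m z = \<phi>} = card (L Q U)" if \<phi>: "\<phi> \<in> F Q T" for \<phi>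
  proof -
    have \<phi>m: "morph Q \<phi>" "\<phi> ` Q \<subseteq> T" "\<phi> \<in> extensional Q" using \<phi> mem_iff[OF Q(1) subT] by auto
    define V where "V = \<phi> ` Q"
    have V: "subgroup V S" "V \<subseteq> T" unfolding V_def using morph_facts(4)[OF Q(1) \<phi>m(1)] \<phi>m(2) by auto
    have inj: "inj_on \<phi> Q" by (rule morph_facts(1)[OF Q(1) \<phi>m(1)])
    have "morph V (inv_into Q \<phi>)" unfolding V_def by (rule morph_inv[OF Q(1) \<phi>m(1)])
    moreover have "inv_into Q \<phi> ` V = Q" unfolding V_def using inj by simp
    ultimately have "restrict (inv_into Q \<phi>) V \<in> F V R" using QR(1) by (simp add: restrict_mem_iff[OF V(1) subR])
    then obtain W0 \<rho> \<psi> where W0: "subgroup W0 S" "W0 \<subseteq> U" and \<rho>: "\<rho> \<in> K V W0" and \<psi>: "\<psi> \<in> H W0 R"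
      and comp: "restrict (inv_into Q \<phi>) V = compose V \<psi> \<rho>"
      using wcp V unfolding weak_composition_product_def by blast
    define W where "W = \<rho> ` V"
    have \<rho>m: "KF.LS.morph V \<rho>" "\<rho> ` V \<subseteq> W0" using \<rho> K_mem_iff[OF V W0(1)] W0(2) by auto
    have KV: "subgroup V (S\<lparr>carrier := T\<rparr>)" using V by (simp add: K_sub)
    have \<rho>inj: "inj_on \<rho> V" by (rule KF.LS.morph_facts(1)[OF KV \<rho>m(1)])
    have W: "subgroup W S" "W \<subseteq> U" "W \<subseteq> R" "W \<subseteq> T"
      unfolding W_def using KF.LS.morph_facts(4)[OF KV \<rho>m(1)] \<rho>m(2) W0(2) by (auto simp: K_sub)
    have HW: "subgroup W (S\<lparr>carrier := R\<rparr>)" and KW: "subgroup W (S\<lparr>carrier := T\<rparr>)"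
      using W by (auto simp: H_sub K_sub)
    have "HS.morph W0 \<psi>" using \<psi> H_mem_iff[OF W0(1) _ subR] W0(2) by auto
    then have \<psi>m: "HS.morph W \<psi>"
      by (rule HS.morph_subset[rotated]) (use W0 W \<rho>m(2) in \<open>auto simp: H_sub W_def\<close>)
    have \<psi>inj: "inj_on \<psi> W" by (rule HS.morph_facts(1)[OF HW \<psi>m])
    have \<psi>\<rho>: "\<psi> (\<rho> (\<phi> u)) = u" if "u \<in> Q" for u
    proof -
      have "\<phi> u \<in> V" using that by (simp add: V_def)
      then have "\<psi> (\<rho> (\<phi> u)) = inv_into Q \<phi> (\<phi> u)" using fun_cong[OF comp, of "\<phi> u"] by (simp add: compose_def)
      then show ?thesis using inj that by simp
    qed
    have \<psi>W: "\<psi> ` W = Q" unfolding W_def V_def image_image using \<psi>\<rho> by simp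
    define \<eta>0 where "\<eta>0 = inv_into W \<psi>"
    define \<kappa>0 where "\<kappa>0 = inv_into V \<rho>"
    have \<eta>0: "HS.morph Q \<eta>0" unfolding \<eta>0_def using HS.morph_inv[OF HW \<psi>m] \<psi>W by simp
    have \<kappa>0: "KF.LS.morph W \<kappa>0" unfolding \<kappa>0_def W_def by (rule KF.LS.morph_inv[OF KV \<rho>m(1)])
    have \<eta>0u: "\<eta>0 u = \<rho> (\<phi> u)" "\<kappa>0 (\<eta>0 u) = \<phi> u" if "u \<in> Q" for u
    proof -
      have v: "\<phi> u \<in> V" "\<rho> (\<phi> u) \<in> W" using that by (simp_all add: V_def W_def)
      show "\<eta>0 u = \<rho> (\<phi> u)" unfolding \<eta>0_def using inv_into_f_f[OF \<psi>inj v(2)] \<psi>\<rho>[OF that] by simp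
      then show "\<kappa>0 (\<eta>0 u) = \<phi> u" unfolding \<kappa>0_def using inv_into_f_f[OF \<rho>inj v(1)] by simp
    qed
    have \<eta>0W: "\<eta>0 ` Q = W" using \<eta>0u(1) unfolding W_def V_def image_image by simp
    have \<eta>0inj: "inj_on \<eta>0 Q" by (rule HS.morph_facts(1)[OF HQ \<eta>0])
    let ?j = "inv_into Q \<eta>0"
    have j: "?j (\<eta>0 u) = u" if "u \<in> Q" for u using \<eta>0inj that by simp
    have jm: "HS.morph W ?j" using HS.morph_inv[OF HQ \<eta>0] \<eta>0W by simp
    have jW: "?j ` W = Q" using \<eta>0inj \<eta>0W by auto
    \<comment> \<open>The pair \<open>(l \<eta>\<^sub>0, \<kappa>\<^sub>0 l\<^sup>-\<^sup>1)\<close> and, conversely, \<open>l = \<eta> \<eta>\<^sub>0\<^sup>-\<^sup>1\<close>.\<close>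
    let ?f = "\<lambda>l. (restrict (\<lambda>u. l (\<eta>0 u)) Q, restrict (\<lambda>x. \<kappa>0 (inv_into W l x)) (l ` W))"
    let ?g = "\<lambda>(\<eta>, \<kappa>). restrict (\<lambda>w. \<eta> (?j w)) W"
    have "bij_betw ?f (L W U) {z\<in>Z. m z = \<phi>}"
    proof (rule bij_betw_byWitness[where f' = ?g])
      have lf: "HS.morph W l" "KF.LS.morph W l" "l ` W \<subseteq> U" "l \<in> extensional W" "subgroup (l ` W) S" "inj_on l W"
        if "l \<in> L W U" for l
      proof -
        show "HS.morph W l" "KF.LS.morph W l" "l ` W \<subseteq> U" "l \<in> extensional W"
          using that L_mem_iff[OF W(1,2) subU order_refl] by auto
        from HS.morph_facts(1,4)[OF HW this(1)] show "subgroup (l ` W) S" "inj_on l W" by (simp_all add: H_sub)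
      qed
      show "\<forall>l\<in>L W U. ?g (?f l) = l"
      proof
        fix l assume l: "l \<in> L W U"
        have "restrict (\<lambda>u. l (\<eta>0 u)) Q (?j w) = l w" if "w \<in> W" for w
        proof -
          obtain u where u: "u \<in> Q" "w = \<eta>0 u" using \<open>w \<in> W\<close> \<eta>0W by blast
          then show ?thesis using j by simp
        qed
        then show "?g (?f l) = l" using lf(4)[OF l] by (auto simp: fun_eq_iff extensional_def)
      qed
      show "\<forall>z\<in>{z\<in>Z. m z = \<phi>}. ?f (?g z) = z"
      proof
        fix z assume "z \<in> {z\<in>Z. m z = \<phi>}"
        then obtain \<eta> \<kappa> where z: "z = (\<eta>, \<kappa>)" "\<eta> \<in> H Q R" "\<kappa> \<in> K (\<eta> ` Q) T" "compose Q \<kappa> \<eta> = \<phi>"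
          unfolding Z_def m_def by auto
        let ?l = "restrict (\<lambda>w. \<eta> (?j w)) W"
        have \<eta>e: "\<eta> \<in> extensional Q" "inj_on \<eta> Q"
          using z(2) H_mem_iff[OF Q(1) QR(1) subR] morph_facts(1)[OF Q(1) \<eta>f(2)[OF z(2)]] by auto
        have s: "subgroup (\<eta> ` Q) S" "\<eta> ` Q \<subseteq> T" using \<eta>f(3,4)[OF z(2)] by auto
        have \<kappa>e: "\<kappa> \<in> extensional (\<eta> ` Q)" using z(3) K_mem_iff[OF s subT] by auto
        have lu: "?l (\<eta>0 u) = \<eta> u" if "u \<in> Q" for u using that j \<eta>0W by auto
        have 1: "restrict (\<lambda>u. ?l (\<eta>0 u)) Q = \<eta>"
          using \<eta>e(1) lu by (auto simp: fun_eq_iff extensional_def)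
        have lW: "?l ` W = \<eta> ` Q" using lu unfolding \<eta>0W[symmetric] image_image by (intro image_cong) auto
        have linj: "inj_on ?l W"
        proof (rule inj_onI)
          fix w w' assume w: "w \<in> W" "w' \<in> W" "?l w = ?l w'"
          obtain u where u: "u \<in> Q" "w = \<eta>0 u" using w(1) \<eta>0W by blast
          obtain u' where u': "u' \<in> Q" "w' = \<eta>0 u'" using w(2) \<eta>0W by blast
          have "\<eta> u = \<eta> u'" using w(3) lu u u' by simp
          then show "w = w'" using inj_onD[OF \<eta>e(2)] u u' by blast
        qed
        have "\<kappa>0 (inv_into W ?l x) = \<kappa> x" if x: "x \<in> \<eta> ` Q" for x
        proof -
          obtain u where u: "u \<in> Q" "x = \<eta> u" using x by blast
          have "\<eta>0 u \<in> W" using u(1) \<eta>0W by blast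
          then have "inv_into W ?l x = \<eta>0 u" using inv_into_f_f[OF linj] lu[OF u(1)] u(2) by metis
          then show ?thesis using \<eta>0u(2)[OF u(1)] fun_cong[OF z(4), of u] u by (simp add: compose_def)
        qed
        then have 2: "restrict (\<lambda>x. \<kappa>0 (inv_into W ?l x)) (?l ` W) = \<kappa>"
          unfolding lW using \<kappa>e by (auto simp: fun_eq_iff extensional_def)
        have "?g z = ?l" unfolding z(1) by simp
        then show "?f (?g z) = z" unfolding z(1) using 1 2 by simp
      qed
      show "?g ` {z\<in>Z. m z = \<phi>} \<subseteq> L W U"
      proof
        fix l assume "l \<in> ?g ` {z\<in>Z. m z = \<phi>}"
        then obtain z0 where z0: "z0 \<in> Z" "m z0 = \<phi>" "l = ?g z0" by blast
        then obtain \<eta> \<kappa> where z: "z0 = (\<eta>, \<kappa>)" "\<eta> \<in> H Q R" "\<kappa> \<in> K (\<eta> ` Q) T" "compose Q \<kappa> \<eta> = \<phi>"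
          unfolding Z_def m_def by auto
        have l: "l = restrict (\<lambda>w. \<eta> (?j w)) W" using z0(3) z(1) by simp
        have s: "subgroup (\<eta> ` Q) S" "\<eta> ` Q \<subseteq> T" using \<eta>f(3,4)[OF z(2)] by auto
        have sK: "subgroup (\<eta> ` Q) (S\<lparr>carrier := T\<rparr>)" using s by (simp add: K_sub)
        have \<kappa>m: "KF.LS.morph (\<eta> ` Q) \<kappa>" using z(3) K_mem_iff[OF s subT] by auto
        have \<kappa>inj: "inj_on \<kappa> (\<eta> ` Q)" by (rule KF.LS.morph_facts(1)[OF sK \<kappa>m])
        have \<kappa>\<eta>: "\<kappa> (\<eta> u) = \<kappa>0 (\<eta>0 u)" if "u \<in> Q" for u
          using fun_cong[OF z(4), of u] \<eta>0u(2)[OF that] that by (simp add: compose_def)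
        have \<kappa>im: "\<kappa> ` \<eta> ` Q = \<kappa>0 ` W" unfolding \<eta>0W[symmetric] image_image using \<kappa>\<eta> by simp
        have e: "inv_into (\<eta> ` Q) \<kappa> (\<kappa>0 w) = \<eta> (?j w)" if "w \<in> W" for w
        proof -
          obtain u where u: "u \<in> Q" "w = \<eta>0 u" using \<open>w \<in> W\<close> \<eta>0W by blast
          have "inv_into (\<eta> ` Q) \<kappa> (\<kappa> (\<eta> u)) = \<eta> u" by (rule inv_into_f_f[OF \<kappa>inj]) (use u in blast)
          then show ?thesis using \<kappa>\<eta>[OF u(1)] j[OF u(1)] u(2) by simp
        qed
        have "KF.LS.morph (\<kappa>0 ` W) (inv_into (\<eta> ` Q) \<kappa>)" using KF.LS.morph_inv[OF sK \<kappa>m] \<kappa>im by simp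
        then have "KF.LS.morph W (\<lambda>w. inv_into (\<eta> ` Q) \<kappa> (\<kappa>0 w))" by (rule KF.LS.morph_comp[OF KW \<kappa>0])
        then have 1: "KF.LS.morph W (\<lambda>w. \<eta> (?j w))" by (rule KF.LS.morph_congI) (rule e)
        have 2: "HS.morph W (\<lambda>w. \<eta> (?j w))" using HS.morph_comp[OF HW jm] \<eta>f(1)[OF z(2)] jW by simp
        have 3: "(\<lambda>w. \<eta> (?j w)) ` W \<subseteq> U" using \<eta>f(4)[OF z(2)] jW by (metis image_image)
        have "restrict (\<lambda>w. \<eta> (?j w)) W \<in> H W U"
          using 2 3 HS.restrict_mem_iff[OF HW, of U] subU by (simp add: H_sub)
        moreover have "restrict (\<lambda>w. \<eta> (?j w)) W \<in> K W U"
          using 1 3 KF.LS.restrict_mem_iff[OF KW, of U] subU by (simp add: K_sub)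
        ultimately show "l \<in> L W U" unfolding l by blast
      qed
      show "?f ` L W U \<subseteq> {z\<in>Z. m z = \<phi>}"
      proof
        fix z assume "z \<in> ?f ` L W U"
        then obtain l where l: "l \<in> L W U" "z = ?f l" by blast
        note lf = lf[OF l(1)]
        have "HS.morph Q (\<lambda>u. l (\<eta>0 u))" using HS.morph_comp[OF HQ \<eta>0] lf(1) \<eta>0W by simp
        moreover have i1: "(\<lambda>u. l (\<eta>0 u)) ` Q = l ` W" using \<eta>0W by (metis image_image)
        ultimately have 1: "restrict (\<lambda>u. l (\<eta>0 u)) Q \<in> H Q R"
          using lf(3) subR HS.restrict_mem_iff[OF HQ, of R] by (simp add: H_sub)
        have lK: "subgroup (l ` W) (S\<lparr>carrier := T\<rparr>)" using lf(3,5) by (auto simp: K_sub)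
        have "KF.LS.morph (l ` W) (inv_into W l)" by (rule KF.LS.morph_inv[OF KW lf(2)])
        moreover have i2: "inv_into W l ` l ` W = W" using lf(6) by simp
        ultimately have 2: "KF.LS.morph (l ` W) (\<lambda>x. \<kappa>0 (inv_into W l x))"
          using KF.LS.morph_comp[OF lK] \<kappa>0 by simp
        have "(\<lambda>x. \<kappa>0 (inv_into W l x)) ` l ` W = \<kappa>0 ` W" using i2 by (metis image_image)
        then have "(\<lambda>x. \<kappa>0 (inv_into W l x)) ` l ` W \<subseteq> T" using KF.L_morph(2)[OF W(1,4) \<kappa>0] by simp
        then have 3: "restrict (\<lambda>x. \<kappa>0 (inv_into W l x)) (l ` W) \<in> K (l ` W) T"
          using 2 KF.LS.restrict_mem_iff[OF lK, of T] subT by (simp add: K_sub)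
        have "restrict (\<lambda>u. l (\<eta>0 u)) Q ` Q = l ` W" using i1 by simp
        then have "?f l \<in> Z" unfolding Z_def using 1 3 by simp
        moreover have "m (?f l) = \<phi>"
        proof (rule extensionalityI[of _ Q])
          fix u assume u: "u \<in> Q"
          then have "\<eta>0 u \<in> W" using \<eta>0W by blast
          then show "m (?f l) u = \<phi> u" using u lf(6) \<eta>0u(2)[OF u] by (simp add: m_def compose_def)
        qed (auto simp: m_def \<phi>m(3))
        ultimately show "z \<in> {z\<in>Z. m z = \<phi>}" unfolding l(2) by blast
      qed
    qed
    then have "card {z\<in>Z. m z = \<phi>} = card (L W U)" by (rule bij_betw_same_card[symmetric])
    also have "\<dots> = card (L Q U)" using card_L_conj[OF Q \<eta>0] \<eta>0W by simp
    finally show ?thesis .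
  qed
  have finZ: "finite Z" unfolding Z_def
    by (rule finite_SigmaI[OF finH[OF Q(1) QR(1)]]) (use \<eta>f(3,4) finK in auto)
  have "card Z = card (\<Union>\<phi>\<in>F Q T. {z\<in>Z. m z = \<phi>})" using mF by (intro arg_cong[where f = card]) blast
  also have "\<dots> = (\<Sum>\<phi>\<in>F Q T. card {z\<in>Z. m z = \<phi>})"
    by (rule card_UN_disjoint[OF finite_mor[OF finS Q(1) subT]]) (use finZ in auto)
  also have "\<dots> = card (F Q T) * card (L Q U)" using fiber by simp
  finally show ?thesis using cZ by simp
qed

text \<open>One factorization \<open>\<phi> = \<psi> \<rho>\<close> exists.  All others arise from it by inserting a morphism common to \<open>H\<close>
  and \<open>K\<close> on \<open>\<rho> P\<close>, and the cardinalities of the morphism sets on \<open>P\<close>, \<open>\<rho> P\<close> and \<open>\<phi> P\<close> agree, which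
  reduces the claim to the count of composites.\<close>

theorem count_factorizations:
  assumes wcp: "weak_composition_product S F R H T K" and P: "subgroup P S" "P \<subseteq> T" and \<phi>: "\<phi> \<in> F P R"
  shows "card (F P (carrier S)) * card {\<gamma>\<in>K P U. \<exists>\<eta>\<in>H (\<gamma> ` P) R. \<phi> = compose P \<eta> \<gamma>}
    = card (K P T) * card (H (\<phi> ` P) R)"
proof -
  have KP: "subgroup P (S\<lparr>carrier := T\<rparr>)" using P by (simp add: K_sub)
  obtain Q0 \<rho> \<psi> where Q0: "subgroup Q0 S" "Q0 \<subseteq> U" and \<rho>: "\<rho> \<in> K P Q0" and \<psi>: "\<psi> \<in> H Q0 R"
    and comp: "\<phi> = compose P \<psi> \<rho>"
    using wcp P \<phi> unfolding weak_composition_product_def by blast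
  define Q where "Q = \<rho> ` P"
  have \<rho>m: "KF.LS.morph P \<rho>" "\<rho> ` P \<subseteq> Q0" using \<rho> K_mem_iff[OF P Q0(1)] Q0(2) by auto
  note \<rho>F = KF.L_morph[OF P \<rho>m(1)]
  have Q: "subgroup Q S" "Q \<subseteq> U" "Q \<subseteq> R" "Q \<subseteq> T"
    unfolding Q_def using morph_facts(4)[OF P(1) \<rho>F(1)] \<rho>m(2) Q0(2) by auto
  have HQ: "subgroup Q (S\<lparr>carrier := R\<rparr>)" and KQ: "subgroup Q (S\<lparr>carrier := T\<rparr>)"
    using Q by (auto simp: H_sub K_sub)
  have \<rho>inj: "inj_on \<rho> P" by (rule morph_facts(1)[OF P(1) \<rho>F(1)])
  have "HS.morph Q0 \<psi>" using \<psi> H_mem_iff[OF Q0(1) _ subR] Q0(2) by auto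
  then have \<psi>m: "HS.morph Q \<psi>"
    by (rule HS.morph_subset[rotated]) (use Q0 Q \<rho>m(2) in \<open>auto simp: H_sub Q_def\<close>)
  note \<psi>F = H_morph[OF Q(1,3) \<psi>m]
  have \<phi>u: "\<phi> u = \<psi> (\<rho> u)" if "u \<in> P" for u using comp that by (simp add: compose_def)
  have \<phi>P: "\<phi> ` P = \<psi> ` Q" unfolding Q_def image_image using \<phi>u by simp
  let ?N = "{\<gamma>\<in>K P U. \<exists>\<eta>\<in>H (\<gamma> ` P) R. \<phi> = compose P \<eta> \<gamma>}"
  let ?r = "inv_into P \<rho>"
  have r: "?r (\<rho> u) = u" if "u \<in> P" for u using \<rho>inj that by simp
  have rm: "KF.LS.morph Q ?r" unfolding Q_def by (rule KF.LS.morph_inv[OF KP \<rho>m(1)])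
  have rQ: "?r ` Q = P" unfolding Q_def using \<rho>inj by simp
  have "bij_betw (\<lambda>l. restrict (\<lambda>u. l (\<rho> u)) P) (L Q U) ?N"
  proof (rule bij_betw_byWitness[where f' = "\<lambda>\<gamma>. restrict (\<lambda>w. \<gamma> (?r w)) Q"])
    show "\<forall>l\<in>L Q U. restrict (\<lambda>w. restrict (\<lambda>u. l (\<rho> u)) P (?r w)) Q = l"
    proof
      fix l assume l: "l \<in> L Q U"
      have le: "l \<in> extensional Q" using l L_mem_iff[OF Q(1,2) subU order_refl] by auto
      have "restrict (\<lambda>u. l (\<rho> u)) P (?r w) = l w" if "w \<in> Q" for w
      proof -
        obtain u where u: "u \<in> P" "w = \<rho> u" using \<open>w \<in> Q\<close> Q_def by blast
        then show ?thesis using r by simp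
      qed
      then show "restrict (\<lambda>w. restrict (\<lambda>u. l (\<rho> u)) P (?r w)) Q = l"
        using le by (auto simp: fun_eq_iff extensional_def)
    qed
    show "\<forall>\<gamma>\<in>?N. restrict (\<lambda>u. restrict (\<lambda>w. \<gamma> (?r w)) Q (\<rho> u)) P = \<gamma>"
    proof
      fix \<gamma> assume "\<gamma> \<in> ?N"
      then have "\<gamma> \<in> extensional P" using K_mem_iff[OF P subU] by auto
      then show "restrict (\<lambda>u. restrict (\<lambda>w. \<gamma> (?r w)) Q (\<rho> u)) P = \<gamma>"
        using r by (auto simp: fun_eq_iff extensional_def Q_def)
    qed
    show "(\<lambda>l. restrict (\<lambda>u. l (\<rho> u)) P) ` L Q U \<subseteq> ?N"
    proof
      fix \<gamma> assume "\<gamma> \<in> (\<lambda>l. restrict (\<lambda>u. l (\<rho> u)) P) ` L Q U"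
      then obtain l where l: "l \<in> L Q U" "\<gamma> = restrict (\<lambda>u. l (\<rho> u)) P" by blast
      have lf: "HS.morph Q l" "KF.LS.morph Q l" "l ` Q \<subseteq> U"
        using l(1) L_mem_iff[OF Q(1,2) subU order_refl] by auto
      have linj: "inj_on l Q" and ls: "subgroup (l ` Q) S"
        using HS.morph_facts(1,4)[OF HQ lf(1)] by (simp_all add: H_sub)
      have im: "(\<lambda>u. l (\<rho> u)) ` P = l ` Q" unfolding Q_def by (simp add: image_image)
      have "KF.LS.morph P (\<lambda>u. l (\<rho> u))" using KF.LS.morph_comp[OF KP \<rho>m(1)] lf(2) Q_def by simp
      then have 1: "\<gamma> \<in> K P U" unfolding l(2) using im lf(3) KF.LS.restrict_mem_iff[OF KP, of U] subU
        by (simp add: K_sub)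
      have \<gamma>P: "\<gamma> ` P = l ` Q" unfolding l(2) using im by simp
      have HlQ: "subgroup (l ` Q) (S\<lparr>carrier := R\<rparr>)" using ls lf(3) by (auto simp: H_sub)
      have "HS.morph (l ` Q) (inv_into Q l)" by (rule HS.morph_inv[OF HQ lf(1)])
      then have "HS.morph (l ` Q) (\<lambda>x. \<psi> (inv_into Q l x))"
        using HS.morph_comp[OF HlQ] \<psi>m linj by simp
      moreover have "(\<lambda>x. \<psi> (inv_into Q l x)) ` l ` Q = \<psi> ` Q"
        using linj by (metis image_image inv_into_image_cancel order_refl)
      ultimately have 2: "restrict (\<lambda>x. \<psi> (inv_into Q l x)) (l ` Q) \<in> H (l ` Q) R"
        using \<psi>F(2) HS.restrict_mem_iff[OF HlQ, of R] subR by (simp add: H_sub)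
      have "\<phi> = compose P (restrict (\<lambda>x. \<psi> (inv_into Q l x)) (l ` Q)) \<gamma>"
      proof (rule extensionalityI[of _ P])
        fix u assume u: "u \<in> P"
        then have "\<rho> u \<in> Q" by (simp add: Q_def)
        then show "\<phi> u = compose P (restrict (\<lambda>x. \<psi> (inv_into Q l x)) (l ` Q)) \<gamma> u"
          using u linj by (simp add: compose_def l(2) \<phi>u)
      qed (auto simp: comp)
      then show "\<gamma> \<in> ?N" using 1 2 \<gamma>P by auto
    qed
    show "(\<lambda>\<gamma>. restrict (\<lambda>w. \<gamma> (?r w)) Q) ` ?N \<subseteq> L Q U"
    proof
      fix l assume "l \<in> (\<lambda>\<gamma>. restrict (\<lambda>w. \<gamma> (?r w)) Q) ` ?N"
      then obtain \<gamma> \<eta> where \<gamma>: "\<gamma> \<in> K P U" "\<eta> \<in> H (\<gamma> ` P) R" "\<phi> = compose P \<eta> \<gamma>"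
        "l = restrict (\<lambda>w. \<gamma> (?r w)) Q" by blast
      have \<gamma>f: "KF.LS.morph P \<gamma>" "\<gamma> ` P \<subseteq> U" using \<gamma>(1) K_mem_iff[OF P subU] by auto
      have \<gamma>s: "subgroup (\<gamma> ` P) S" using KF.LS.morph_facts(4)[OF KP \<gamma>f(1)] by (simp add: K_sub)
      have H\<gamma>: "subgroup (\<gamma> ` P) (S\<lparr>carrier := R\<rparr>)" using \<gamma>s \<gamma>f(2) by (auto simp: H_sub)
      have \<eta>m: "HS.morph (\<gamma> ` P) \<eta>" using \<gamma>(2) H_mem_iff[OF \<gamma>s _ subR] \<gamma>f(2) by auto
      have \<eta>inj: "inj_on \<eta> (\<gamma> ` P)" by (rule HS.morph_facts(1)[OF H\<gamma> \<eta>m])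
      have \<eta>\<gamma>: "\<eta> (\<gamma> u) = \<psi> (\<rho> u)" if "u \<in> P" for u
        using fun_cong[OF \<gamma>(3), of u] \<phi>u[OF that] that by (simp add: compose_def)
      have \<eta>P: "\<eta> ` \<gamma> ` P = \<psi> ` Q" unfolding Q_def image_image using \<eta>\<gamma> by simp
      have "HS.morph (\<psi> ` Q) (inv_into (\<gamma> ` P) \<eta>)" using HS.morph_inv[OF H\<gamma> \<eta>m] \<eta>P by simp
      then have m1: "HS.morph Q (\<lambda>w. inv_into (\<gamma> ` P) \<eta> (\<psi> w))" by (rule HS.morph_comp[OF HQ \<psi>m])
      have e1: "inv_into (\<gamma> ` P) \<eta> (\<psi> w) = \<gamma> (?r w)" if "w \<in> Q" for w
      proof -
        obtain u where u: "u \<in> P" "w = \<rho> u" using \<open>w \<in> Q\<close> Q_def by blast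
        have "inv_into (\<gamma> ` P) \<eta> (\<eta> (\<gamma> u)) = \<gamma> u" by (rule inv_into_f_f[OF \<eta>inj]) (use u in blast)
        then show ?thesis using u r \<eta>\<gamma> by simp
      qed
      have "HS.morph Q (\<lambda>w. \<gamma> (?r w))" using m1 e1 by (rule HS.morph_congI)
      moreover have "KF.LS.morph Q (\<lambda>w. \<gamma> (?r w))" using KF.LS.morph_comp[OF KQ rm] \<gamma>f(1) rQ by simp
      moreover have "(\<lambda>w. \<gamma> (?r w)) ` Q \<subseteq> U" using rQ \<gamma>f(2) by (metis image_image)
      ultimately have "restrict (\<lambda>w. \<gamma> (?r w)) Q \<in> H Q U" "restrict (\<lambda>w. \<gamma> (?r w)) Q \<in> K Q U"
        using HS.restrict_mem_iff[OF HQ, of U] KF.LS.restrict_mem_iff[OF KQ, of U] subU by (simp_all add: H_sub K_sub)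
      then show "l \<in> L Q U" unfolding \<gamma>(4) by blast
    qed
  qed
  then have 1: "card ?N = card (L Q U)" by (rule bij_betw_same_card[symmetric])
  have "F Q (carrier S) = F Q T"
  proof (intro equalityI subsetI)
    fix f assume "f \<in> F Q (carrier S)"
    then have "f \<in> extensional Q" "morph Q f" using mem_iff[OF Q(1) carrier_subgroup] by auto
    then show "f \<in> F Q T" using KF.morph_closed[OF Q(1,4)] mem_iff[OF Q(1) subT] by blast
  next
    fix f assume "f \<in> F Q T"
    then show "f \<in> F Q (carrier S)"
      using mem_iff[OF Q(1) subT] mem_iff[OF Q(1) carrier_subgroup] subgroup.subset[OF subT] by blast
  qed
  then have 2: "card (F P (carrier S)) = card (F Q T)"
    using card_precomp[OF P(1) carrier_subgroup \<rho>F(1)] Q_def by simp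
  have 3: "card (K P T) = card (K Q T)" using KF.card_L_conj[OF P \<rho>F(1)] Q_def by simp
  have 4: "card (H (\<phi> ` P) R) = card (H Q R)"
    unfolding \<phi>P by (rule HS.card_precomp[OF HQ _ \<psi>m]) (use subR in \<open>simp add: H_sub\<close>)
  show ?thesis unfolding 1 2 3 4 using count_composites[OF wcp Q(1,2)] by (simp add: mult.commute)
qed

end

section \<open>Conjugation invariance of marks\<close>

lemma mark_cong:
  assumes "\<And>u. u \<in> L \<Longrightarrow> \<alpha> u = \<alpha>' u" "\<And>u. u \<in> L \<Longrightarrow> \<beta> u = \<beta>' u"
  shows "mark x L \<alpha> \<beta> = mark x L \<alpha>' \<beta>'"
  unfolding mark_def by (simp only: fixp_cong[of L \<alpha> \<alpha>' \<beta> \<beta>', OF assms])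

lemma mark_image: "mark x L (\<lambda>u. \<alpha> (f u)) (\<lambda>u. \<beta> (f u)) = mark x (f ` L) \<alpha> \<beta>"
  unfolding mark_def by (simp only: fixp_image[of _ L \<alpha> f \<beta>, unfolded comp_def])

lemma lin_cong: "(\<And>c. c \<in> Poly_Mapping.keys x \<Longrightarrow> f c = g c) \<Longrightarrow> lin f x = lin g x"
  by (simp add: lin_def)

context is_biset
begin

lemma card_fixp_conj_right:
  assumes a: "a \<in> carrier G" and \<alpha>: "\<alpha> ` L \<subseteq> carrier G" and \<beta>: "\<beta> ` L \<subseteq> carrier H"
  shows "card (fixp X L (\<lambda>u. a \<otimes>\<^bsub>G\<^esub> \<alpha> u \<otimes>\<^bsub>G\<^esub> inv\<^bsub>G\<^esub> a) \<beta>) = card (fixp X L \<alpha> \<beta>)"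
proof -
  have c: "\<alpha> u \<in> carrier G" "\<beta> u \<in> carrier H" if "u \<in> L" for u using that \<alpha> \<beta> by auto
  have aa: "ract X (ract X x a) (inv\<^bsub>G\<^esub> a) = x" "ract X (ract X x (inv\<^bsub>G\<^esub> a)) a = x" if "x \<in> points X" for x
    using that a ract_mult[of a "inv\<^bsub>G\<^esub> a" x] ract_mult[of "inv\<^bsub>G\<^esub> a" a x] ract_one by simp_all
  have "bij_betw (\<lambda>x. ract X x a) (fixp X L (\<lambda>u. a \<otimes>\<^bsub>G\<^esub> \<alpha> u \<otimes>\<^bsub>G\<^esub> inv\<^bsub>G\<^esub> a) \<beta>) (fixp X L \<alpha> \<beta>)"
  proof (rule bij_betw_byWitness[where f' = "\<lambda>x. ract X x (inv\<^bsub>G\<^esub> a)"])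
    show "\<forall>x\<in>fixp X L (\<lambda>u. a \<otimes>\<^bsub>G\<^esub> \<alpha> u \<otimes>\<^bsub>G\<^esub> inv\<^bsub>G\<^esub> a) \<beta>. ract X (ract X x a) (inv\<^bsub>G\<^esub> a) = x"
      "\<forall>x\<in>fixp X L \<alpha> \<beta>. ract X (ract X x (inv\<^bsub>G\<^esub> a)) a = x"
      using aa by (auto simp: fixp_def)
    show "(\<lambda>x. ract X x a) ` fixp X L (\<lambda>u. a \<otimes>\<^bsub>G\<^esub> \<alpha> u \<otimes>\<^bsub>G\<^esub> inv\<^bsub>G\<^esub> a) \<beta> \<subseteq> fixp X L \<alpha> \<beta>"
    proof
      fix y assume "y \<in> (\<lambda>x. ract X x a) ` fixp X L (\<lambda>u. a \<otimes>\<^bsub>G\<^esub> \<alpha> u \<otimes>\<^bsub>G\<^esub> inv\<^bsub>G\<^esub> a) \<beta>"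
      then obtain x where x: "x \<in> points X" "y = ract X x a"
        "\<And>u. u \<in> L \<Longrightarrow> lact X (\<beta> u) x = ract X x (a \<otimes>\<^bsub>G\<^esub> \<alpha> u \<otimes>\<^bsub>G\<^esub> inv\<^bsub>G\<^esub> a)"
        by (auto simp: fixp_def)
      have "lact X (\<beta> u) y = ract X y (\<alpha> u)" if u: "u \<in> L" for u
      proof -
        have "lact X (\<beta> u) y = ract X (ract X x (a \<otimes>\<^bsub>G\<^esub> \<alpha> u \<otimes>\<^bsub>G\<^esub> inv\<^bsub>G\<^esub> a)) a"
          unfolding x(2) using x(3)[OF u] acts_commute[OF c(2)[OF u] a x(1)] by simp
        also have "\<dots> = ract X x (a \<otimes>\<^bsub>G\<^esub> \<alpha> u)"
          using c[OF u] a x(1) by (simp add: ract_mult[symmetric] G.m_assoc)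
        finally show ?thesis unfolding x(2) using c[OF u] a x(1) by (simp add: ract_mult)
      qed
      then show "y \<in> fixp X L \<alpha> \<beta>" using x(1,2) a ract_closed by (simp add: fixp_def)
    qed
    show "(\<lambda>x. ract X x (inv\<^bsub>G\<^esub> a)) ` fixp X L \<alpha> \<beta> \<subseteq> fixp X L (\<lambda>u. a \<otimes>\<^bsub>G\<^esub> \<alpha> u \<otimes>\<^bsub>G\<^esub> inv\<^bsub>G\<^esub> a) \<beta>"
    proof
      fix y assume "y \<in> (\<lambda>x. ract X x (inv\<^bsub>G\<^esub> a)) ` fixp X L \<alpha> \<beta>"
      then obtain x where x: "x \<in> points X" "y = ract X x (inv\<^bsub>G\<^esub> a)"
        "\<And>u. u \<in> L \<Longrightarrow> lact X (\<beta> u) x = ract X x (\<alpha> u)"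
        by (auto simp: fixp_def)
      have "lact X (\<beta> u) y = ract X y (a \<otimes>\<^bsub>G\<^esub> \<alpha> u \<otimes>\<^bsub>G\<^esub> inv\<^bsub>G\<^esub> a)" if u: "u \<in> L" for u
      proof -
        have "lact X (\<beta> u) y = ract X (ract X x (\<alpha> u)) (inv\<^bsub>G\<^esub> a)"
          unfolding x(2) using x(3)[OF u] acts_commute[OF c(2)[OF u] G.inv_closed[OF a] x(1)] by simp
        moreover have "inv\<^bsub>G\<^esub> a \<otimes>\<^bsub>G\<^esub> (a \<otimes>\<^bsub>G\<^esub> \<alpha> u \<otimes>\<^bsub>G\<^esub> inv\<^bsub>G\<^esub> a) = \<alpha> u \<otimes>\<^bsub>G\<^esub> inv\<^bsub>G\<^esub> a"
          using c[OF u] a by (simp add: G.m_assoc[symmetric])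
        ultimately show ?thesis unfolding x(2) using c[OF u] a x(1) by (simp add: ract_mult[symmetric])
      qed
      then show "y \<in> fixp X L (\<lambda>u. a \<otimes>\<^bsub>G\<^esub> \<alpha> u \<otimes>\<^bsub>G\<^esub> inv\<^bsub>G\<^esub> a) \<beta>"
        using x(1,2) a ract_closed by (simp add: fixp_def)
    qed
  qed
  then show ?thesis by (rule bij_betw_same_card)
qed

lemma card_fixp_conj_left:
  assumes a: "a \<in> carrier H" and \<alpha>: "\<alpha> ` L \<subseteq> carrier G" and \<beta>: "\<beta> ` L \<subseteq> carrier H"
  shows "card (fixp X L \<alpha> (\<lambda>u. a \<otimes>\<^bsub>H\<^esub> \<beta> u \<otimes>\<^bsub>H\<^esub> inv\<^bsub>H\<^esub> a)) = card (fixp X L \<alpha> \<beta>)"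
proof -
  have c: "\<alpha> u \<in> carrier G" "\<beta> u \<in> carrier H" if "u \<in> L" for u using that \<alpha> \<beta> by auto
  have aa: "lact X (inv\<^bsub>H\<^esub> a) (lact X a x) = x" "lact X a (lact X (inv\<^bsub>H\<^esub> a) x) = x" if "x \<in> points X" for x
    using that a lact_mult[of a "inv\<^bsub>H\<^esub> a" x] lact_mult[of "inv\<^bsub>H\<^esub> a" a x] lact_one by simp_all
  have "bij_betw (lact X (inv\<^bsub>H\<^esub> a)) (fixp X L \<alpha> (\<lambda>u. a \<otimes>\<^bsub>H\<^esub> \<beta> u \<otimes>\<^bsub>H\<^esub> inv\<^bsub>H\<^esub> a)) (fixp X L \<alpha> \<beta>)"
  proof (rule bij_betw_byWitness[where f' = "lact X a"])
    show "\<forall>x\<in>fixp X L \<alpha> (\<lambda>u. a \<otimes>\<^bsub>H\<^esub> \<beta> u \<otimes>\<^bsub>H\<^esub> inv\<^bsub>H\<^esub> a). lact X a (lact X (inv\<^bsub>H\<^esub> a) x) = x"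
      "\<forall>x\<in>fixp X L \<alpha> \<beta>. lact X (inv\<^bsub>H\<^esub> a) (lact X a x) = x"
      using aa by (auto simp: fixp_def)
    show "lact X (inv\<^bsub>H\<^esub> a) ` fixp X L \<alpha> (\<lambda>u. a \<otimes>\<^bsub>H\<^esub> \<beta> u \<otimes>\<^bsub>H\<^esub> inv\<^bsub>H\<^esub> a) \<subseteq> fixp X L \<alpha> \<beta>"
    proof
      fix y assume "y \<in> lact X (inv\<^bsub>H\<^esub> a) ` fixp X L \<alpha> (\<lambda>u. a \<otimes>\<^bsub>H\<^esub> \<beta> u \<otimes>\<^bsub>H\<^esub> inv\<^bsub>H\<^esub> a)"
      then obtain x where x: "x \<in> points X" "y = lact X (inv\<^bsub>H\<^esub> a) x"
        "\<And>u. u \<in> L \<Longrightarrow> lact X (a \<otimes>\<^bsub>H\<^esub> \<beta> u \<otimes>\<^bsub>H\<^esub> inv\<^bsub>H\<^esub> a) x = ract X x (\<alpha> u)"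
        by (auto simp: fixp_def)
      have "lact X (\<beta> u) y = ract X y (\<alpha> u)" if u: "u \<in> L" for u
      proof -
        have "ract X y (\<alpha> u) = lact X (inv\<^bsub>H\<^esub> a) (lact X (a \<otimes>\<^bsub>H\<^esub> \<beta> u \<otimes>\<^bsub>H\<^esub> inv\<^bsub>H\<^esub> a) x)"
          unfolding x(2) using x(3)[OF u] acts_commute[OF H.inv_closed[OF a] c(1)[OF u] x(1)] by simp
        moreover have "inv\<^bsub>H\<^esub> a \<otimes>\<^bsub>H\<^esub> (a \<otimes>\<^bsub>H\<^esub> \<beta> u \<otimes>\<^bsub>H\<^esub> inv\<^bsub>H\<^esub> a) = \<beta> u \<otimes>\<^bsub>H\<^esub> inv\<^bsub>H\<^esub> a"
          using c[OF u] a by (simp add: H.m_assoc[symmetric])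
        ultimately show ?thesis unfolding x(2) using c[OF u] a x(1) by (simp add: lact_mult[symmetric])
      qed
      then show "y \<in> fixp X L \<alpha> \<beta>" using x(1,2) a lact_closed by (simp add: fixp_def)
    qed
    show "lact X a ` fixp X L \<alpha> \<beta> \<subseteq> fixp X L \<alpha> (\<lambda>u. a \<otimes>\<^bsub>H\<^esub> \<beta> u \<otimes>\<^bsub>H\<^esub> inv\<^bsub>H\<^esub> a)"
    proof
      fix y assume "y \<in> lact X a ` fixp X L \<alpha> \<beta>"
      then obtain x where x: "x \<in> points X" "y = lact X a x"
        "\<And>u. u \<in> L \<Longrightarrow> lact X (\<beta> u) x = ract X x (\<alpha> u)"
        by (auto simp: fixp_def)
      have "lact X (a \<otimes>\<^bsub>H\<^esub> \<beta> u \<otimes>\<^bsub>H\<^esub> inv\<^bsub>H\<^esub> a) y = ract X y (\<alpha> u)" if u: "u \<in> L" for u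
      proof -
        have "ract X y (\<alpha> u) = lact X a (lact X (\<beta> u) x)"
          unfolding x(2) using x(3)[OF u] acts_commute[OF a c(1)[OF u] x(1)] by simp
        moreover have "a \<otimes>\<^bsub>H\<^esub> \<beta> u \<otimes>\<^bsub>H\<^esub> inv\<^bsub>H\<^esub> a \<otimes>\<^bsub>H\<^esub> a = a \<otimes>\<^bsub>H\<^esub> \<beta> u"
          using c[OF u] a by (simp add: H.m_assoc)
        ultimately show ?thesis unfolding x(2) using c[OF u] a x(1) by (simp add: lact_mult[symmetric])
      qed
      then show "y \<in> fixp X L \<alpha> (\<lambda>u. a \<otimes>\<^bsub>H\<^esub> \<beta> u \<otimes>\<^bsub>H\<^esub> inv\<^bsub>H\<^esub> a)"
        using x(1,2) a lact_closed by (simp add: fixp_def)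
    qed
  qed
  then show ?thesis by (rule bij_betw_same_card)
qed

end

lemma formal_sums_rep:
  assumes "x \<in> formal_sums p G H" "c \<in> Poly_Mapping.keys x"
  shows "is_biset G H (rep c)"
  using assms biset_classes_rep(1) by (auto simp: formal_sums_def)

lemma mark_conj_right:
  assumes x: "x \<in> formal_sums p G H" and "a \<in> carrier G" "\<alpha> ` L \<subseteq> carrier G" "\<beta> ` L \<subseteq> carrier H"
  shows "mark x L (\<lambda>u. a \<otimes>\<^bsub>G\<^esub> \<alpha> u \<otimes>\<^bsub>G\<^esub> inv\<^bsub>G\<^esub> a) \<beta> = mark x L \<alpha> \<beta>"
  unfolding mark_def
  by (rule lin_cong) (simp add: is_biset.card_fixp_conj_right[OF formal_sums_rep[OF x] assms(2-4)])

lemma mark_conj_left: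
  assumes x: "x \<in> formal_sums p G H" and "a \<in> carrier H" "\<alpha> ` L \<subseteq> carrier G" "\<beta> ` L \<subseteq> carrier H"
  shows "mark x L \<alpha> (\<lambda>u. a \<otimes>\<^bsub>H\<^esub> \<beta> u \<otimes>\<^bsub>H\<^esub> inv\<^bsub>H\<^esub> a) = mark x L \<alpha> \<beta>"
  unfolding mark_def
  by (rule lin_cong) (simp add: is_biset.card_fixp_conj_left[OF formal_sums_rep[OF x] assms(2-4)])

section \<open>Marks of compositions with transitive bisets\<close>

abbreviation homs :: "('u, 'b) monoid_scheme \<Rightarrow> ('h, 'n) monoid_scheme \<Rightarrow> ('u \<Rightarrow> 'h) set" where
  "homs M H \<equiv> hom M H \<inter> extensional (carrier M)"

lemma finite_homs: "finite (carrier M) \<Longrightarrow> finite (carrier H) \<Longrightarrow> finite (homs M H)"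
  by (rule finite_subset[OF _ finite_PiE[of "carrier M" "\<lambda>_. carrier H"]]) (auto simp: hom_def PiE_def)

lemma conj_hom:
  assumes "group H" "\<delta> \<in> hom M H" "a \<in> carrier H"
  shows "(\<lambda>u. a \<otimes>\<^bsub>H\<^esub> \<delta> u \<otimes>\<^bsub>H\<^esub> inv\<^bsub>H\<^esub> a) \<in> hom M H"
proof -
  interpret H: group H by fact
  have c: "\<delta> u \<in> carrier H" if "u \<in> carrier M" for u using assms(2) that by (auto simp: hom_def)
  have "inv\<^bsub>H\<^esub> a \<otimes>\<^bsub>H\<^esub> (a \<otimes>\<^bsub>H\<^esub> y) = y" if "y \<in> carrier H" for y
    using that assms(3) by (simp add: H.m_assoc[symmetric])
  then show ?thesis
    using assms(3) c by (intro homI) (auto simp: hom_mult[OF assms(2)] H.m_assoc)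
qed

lemma restrict_in_homs_iff:
  assumes "group M" shows "restrict f (carrier M) \<in> homs M H \<longleftrightarrow> f \<in> hom M H"
proof -
  interpret M: group M by fact
  show ?thesis by (auto simp: hom_def Pi_def)
qed

lemma hom_image: "f \<in> hom M H \<Longrightarrow> f ` carrier M \<subseteq> carrier H"
  by (auto simp: hom_def)

lemma conj_refine_iff: "(a \<Longrightarrow> b \<Longrightarrow> C \<longleftrightarrow> b' \<and> E) \<Longrightarrow> (b' \<Longrightarrow> b) \<Longrightarrow> (a \<and> b) \<and> C \<longleftrightarrow> (a \<and> b') \<and> E"
  by blast

context coset_data
begin

lemma mark_basic:
  assumes "\<alpha> ` L \<subseteq> carrier G" "\<beta> ` L \<subseteq> carrier H"
  shows "mark (basic_formal G H U \<phi>) L \<alpha> \<beta> = of_nat (card (fixp X L \<alpha> \<beta>))"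
  unfolding basic_formal_def using mark_single[OF is_biset assms, of 1] by simp

lemma card_U_pos: "card U > 0"
  using finite_subset[OF U.subset finG] U.one_closed unfolding card_gt_0_iff by blast

lemma basic_formal_sums: "prime p \<Longrightarrow> basic_formal G H U \<phi> \<in> formal_sums p G H"
  unfolding basic_formal_def
  by (intro formal_sums_single iso_class_in_biset_classes is_biset Z_loc_1)

lemma basic_keys: "c \<in> Poly_Mapping.keys (basic_formal G H U \<phi>) \<Longrightarrow> c = iso_class G H X"
  by (simp add: basic_formal_def)

lemma basic_right_free:
  "inj_on \<phi> U \<Longrightarrow> c \<in> Poly_Mapping.keys (basic_formal G H U \<phi>) \<Longrightarrow> right_free G (rep c)"
  using right_free_iso[OF rep_iso_class(2)[OF is_biset] is_biset right_free] basic_keys by blast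

text \<open>The row of marks of \<open>[U, \<phi>]\<close> at \<open>\<gamma>\<close>, paired with a function \<open>f\<close> of homomorphisms that is constant on
  conjugacy classes.  The pairs \<open>(a, b)\<close> counted by the mark determine \<open>\<delta>\<close> as the conjugate by \<open>a\<close> of
  \<open>\<phi>(b\<^sup>-\<^sup>1 \<gamma> b)\<close>, so summing over \<open>\<delta>\<close> amounts to summing over \<open>a\<close> and \<open>b\<close>.\<close>

lemma sum_mark_basic:
  fixes M :: "('u, 'b) monoid_scheme" and f :: "('u \<Rightarrow> 'h) \<Rightarrow> rat"
  assumes M: "group M" "finite (carrier M)" and \<gamma>: "\<gamma> \<in> hom M G"
    and inv: "\<And>a \<delta>. a \<in> carrier H \<Longrightarrow> \<delta> \<in> hom M H \<Longrightarrow>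
        f (restrict (\<lambda>u. a \<otimes>\<^bsub>H\<^esub> \<delta> u \<otimes>\<^bsub>H\<^esub> inv\<^bsub>H\<^esub> a) (carrier M)) = f (restrict \<delta> (carrier M))"
  shows "of_nat (card U) * (\<Sum>\<delta>\<in>homs M H. mark (basic_formal G H U \<phi>) (carrier M) \<gamma> \<delta> * f \<delta>) =
    of_nat (card (carrier H)) * (\<Sum>b\<in>{b\<in>carrier G. \<forall>u\<in>carrier M. inv\<^bsub>G\<^esub> b \<otimes>\<^bsub>G\<^esub> \<gamma> u \<otimes>\<^bsub>G\<^esub> b \<in> U}.
      f (restrict (\<lambda>u. \<phi> (inv\<^bsub>G\<^esub> b \<otimes>\<^bsub>G\<^esub> \<gamma> u \<otimes>\<^bsub>G\<^esub> b)) (carrier M)))"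
proof -
  interpret M: group M by fact
  let ?L = "carrier M"
  let ?B = "{b\<in>carrier G. \<forall>u\<in>?L. inv\<^bsub>G\<^esub> b \<otimes>\<^bsub>G\<^esub> \<gamma> u \<otimes>\<^bsub>G\<^esub> b \<in> U}"
  define w where "w b u = \<phi> (inv\<^bsub>G\<^esub> b \<otimes>\<^bsub>G\<^esub> \<gamma> u \<otimes>\<^bsub>G\<^esub> b)" for b u
  have \<gamma>c: "\<gamma> u \<in> carrier G" if "u \<in> ?L" for u using that hom_image[OF \<gamma>] by auto
  have whom: "w b \<in> hom M H" if b: "b \<in> ?B" for b
  proof (rule homI)
    show "w b u \<in> carrier H" if "u \<in> ?L" for u using b that phi_closed by (simp add: w_def)
    fix u v assume uv: "u \<in> ?L" "v \<in> ?L"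
    have bc: "b \<in> carrier G" using b by simp
    have "b \<otimes>\<^bsub>G\<^esub> (inv\<^bsub>G\<^esub> b \<otimes>\<^bsub>G\<^esub> y) = y" if "y \<in> carrier G" for y
      using that bc by (simp add: G.m_assoc[symmetric])
    then have "inv\<^bsub>G\<^esub> b \<otimes>\<^bsub>G\<^esub> \<gamma> (u \<otimes>\<^bsub>M\<^esub> v) \<otimes>\<^bsub>G\<^esub> b =
       (inv\<^bsub>G\<^esub> b \<otimes>\<^bsub>G\<^esub> \<gamma> u \<otimes>\<^bsub>G\<^esub> b) \<otimes>\<^bsub>G\<^esub> (inv\<^bsub>G\<^esub> b \<otimes>\<^bsub>G\<^esub> \<gamma> v \<otimes>\<^bsub>G\<^esub> b)"
      using bc \<gamma>c[OF uv(1)] \<gamma>c[OF uv(2)] hom_mult[OF \<gamma> uv] by (simp add: G.m_assoc)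
    then show "w b (u \<otimes>\<^bsub>M\<^esub> v) = w b u \<otimes>\<^bsub>H\<^esub> w b v"
      using b uv phi_mult by (simp add: w_def)
  qed
  have Bfin: "finite ?B" using finG by simp
  have cond: "(\<forall>u\<in>?L. inv\<^bsub>G\<^esub> b \<otimes>\<^bsub>G\<^esub> \<gamma> u \<otimes>\<^bsub>G\<^esub> b \<in> U \<and>
     \<phi> (inv\<^bsub>G\<^esub> b \<otimes>\<^bsub>G\<^esub> \<gamma> u \<otimes>\<^bsub>G\<^esub> b) = inv\<^bsub>H\<^esub> a \<otimes>\<^bsub>H\<^esub> \<delta> u \<otimes>\<^bsub>H\<^esub> a)
     \<longleftrightarrow> b \<in> ?B \<and> \<delta> = restrict (\<lambda>u. a \<otimes>\<^bsub>H\<^esub> w b u \<otimes>\<^bsub>H\<^esub> inv\<^bsub>H\<^esub> a) ?L"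
    if ab: "a \<in> carrier H" "b \<in> carrier G" and d: "\<delta> \<in> homs M H" for a b \<delta>
  proof -
    have dc: "\<delta> u \<in> carrier H" if "u \<in> ?L" for u using that d hom_image by fastforce
    have e: "\<phi> (inv\<^bsub>G\<^esub> b \<otimes>\<^bsub>G\<^esub> \<gamma> u \<otimes>\<^bsub>G\<^esub> b) = inv\<^bsub>H\<^esub> a \<otimes>\<^bsub>H\<^esub> \<delta> u \<otimes>\<^bsub>H\<^esub> a
        \<longleftrightarrow> \<delta> u = a \<otimes>\<^bsub>H\<^esub> w b u \<otimes>\<^bsub>H\<^esub> inv\<^bsub>H\<^esub> a"
      if b: "b \<in> ?B" and u: "u \<in> ?L" for u
    proof -
      have wc: "w b u \<in> carrier H" using hom_image[OF whom[OF b]] u by blast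
      have "a \<otimes>\<^bsub>H\<^esub> (inv\<^bsub>H\<^esub> a \<otimes>\<^bsub>H\<^esub> \<delta> u \<otimes>\<^bsub>H\<^esub> a) \<otimes>\<^bsub>H\<^esub> inv\<^bsub>H\<^esub> a = \<delta> u"
        "inv\<^bsub>H\<^esub> a \<otimes>\<^bsub>H\<^esub> (a \<otimes>\<^bsub>H\<^esub> w b u \<otimes>\<^bsub>H\<^esub> inv\<^bsub>H\<^esub> a) \<otimes>\<^bsub>H\<^esub> a = w b u"
        using conj_by_inv[OF H.is_group ab(1) dc[OF u]] conj_by_inv[OF H.is_group ab(1) wc] ab(1)
        by (simp_all add: conj_by_def)
      then show ?thesis unfolding w_def[symmetric] by metis
    qed
    show ?thesis
    proof (cases "b \<in> ?B")
      case True
      have "\<delta> = restrict (\<lambda>u. a \<otimes>\<^bsub>H\<^esub> w b u \<otimes>\<^bsub>H\<^esub> inv\<^bsub>H\<^esub> a) ?L \<longleftrightarrow>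
        (\<forall>u\<in>?L. \<delta> u = a \<otimes>\<^bsub>H\<^esub> w b u \<otimes>\<^bsub>H\<^esub> inv\<^bsub>H\<^esub> a)"
      proof
        assume *: "\<forall>u\<in>?L. \<delta> u = a \<otimes>\<^bsub>H\<^esub> w b u \<otimes>\<^bsub>H\<^esub> inv\<^bsub>H\<^esub> a"
        show "\<delta> = restrict (\<lambda>u. a \<otimes>\<^bsub>H\<^esub> w b u \<otimes>\<^bsub>H\<^esub> inv\<^bsub>H\<^esub> a) ?L"
          by (rule extensionalityI[of _ ?L]) (use d * in auto)
      qed auto
      then show ?thesis using True e[OF True] by auto
    next
      case False
      then show ?thesis using ab(2) by blast
    qed
  qed
  have mk: "of_nat (card U) * mark (basic_formal G H U \<phi>) ?L \<gamma> \<delta> =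
     (\<Sum>ab\<in>carrier H \<times> ?B. if \<delta> = restrict (\<lambda>u. fst ab \<otimes>\<^bsub>H\<^esub> w (snd ab) u \<otimes>\<^bsub>H\<^esub> inv\<^bsub>H\<^esub> fst ab) ?L then 1 else 0 :: rat)"
    if d: "\<delta> \<in> homs M H" for \<delta>
  proof -
    have "of_nat (card U) * mark (basic_formal G H U \<phi>) ?L \<gamma> \<delta> = of_nat (card U * card (fixp X ?L \<gamma> \<delta>))"
      using mark_basic[OF hom_image[OF \<gamma>], of \<delta>] hom_image[of \<delta> M H] d by simp
    also have "card U * card (fixp X ?L \<gamma> \<delta>) = card {ab \<in> carrier H \<times> ?B.
       \<delta> = restrict (\<lambda>u. fst ab \<otimes>\<^bsub>H\<^esub> w (snd ab) u \<otimes>\<^bsub>H\<^esub> inv\<^bsub>H\<^esub> fst ab) ?L}"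
    proof -
      have "{(a, b) \<in> carrier H \<times> carrier G. \<forall>u\<in>?L. inv\<^bsub>G\<^esub> b \<otimes>\<^bsub>G\<^esub> \<gamma> u \<otimes>\<^bsub>G\<^esub> b \<in> U \<and>
         \<phi> (inv\<^bsub>G\<^esub> b \<otimes>\<^bsub>G\<^esub> \<gamma> u \<otimes>\<^bsub>G\<^esub> b) = inv\<^bsub>H\<^esub> a \<otimes>\<^bsub>H\<^esub> \<delta> u \<otimes>\<^bsub>H\<^esub> a}
        = {ab \<in> carrier H \<times> ?B.
         \<delta> = restrict (\<lambda>u. fst ab \<otimes>\<^bsub>H\<^esub> w (snd ab) u \<otimes>\<^bsub>H\<^esub> inv\<^bsub>H\<^esub> fst ab) ?L}"
        by (rule Set.set_eqI, simp only: mem_Collect_eq split_beta prod.collapse mem_Times_iff, rule conj_refine_iff)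
          (simp only: cond[OF _ _ d] mem_Collect_eq, simp)
      then show ?thesis
        using card_fixp[OF hom_image[OF \<gamma>] hom_image[of \<delta> M H, OF IntD1[OF d]]] by simp
    qed
    finally show ?thesis using finH Bfin by (simp add: sum.If_cases Int_def)
  qed
  have "of_nat (card U) * (\<Sum>\<delta>\<in>homs M H. mark (basic_formal G H U \<phi>) ?L \<gamma> \<delta> * f \<delta>) =
    (\<Sum>\<delta>\<in>homs M H. (of_nat (card U) * mark (basic_formal G H U \<phi>) ?L \<gamma> \<delta>) * f \<delta>)"
    by (simp add: sum_distrib_left mult.assoc)
  also have "\<dots> = (\<Sum>\<delta>\<in>homs M H. \<Sum>ab\<in>carrier H \<times> ?B.
     if \<delta> = restrict (\<lambda>u. fst ab \<otimes>\<^bsub>H\<^esub> w (snd ab) u \<otimes>\<^bsub>H\<^esub> inv\<^bsub>H\<^esub> fst ab) ?L then f \<delta> else 0)"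
    by (rule sum.cong[OF refl]) (simp add: mk sum_distrib_right if_distrib[of "\<lambda>x. x * _"] cong: if_cong)
  also have "\<dots> = (\<Sum>ab\<in>carrier H \<times> ?B. \<Sum>\<delta>\<in>homs M H.
     if \<delta> = restrict (\<lambda>u. fst ab \<otimes>\<^bsub>H\<^esub> w (snd ab) u \<otimes>\<^bsub>H\<^esub> inv\<^bsub>H\<^esub> fst ab) ?L then f \<delta> else 0)"
    by (rule sum.swap)
  also have "\<dots> = (\<Sum>ab\<in>carrier H \<times> ?B. f (restrict (w (snd ab)) ?L))"
  proof (rule sum.cong[OF refl])
    fix ab assume ab: "ab \<in> carrier H \<times> ?B"
    then have wb: "w (snd ab) \<in> hom M H" and a: "fst ab \<in> carrier H" using whom by auto
    let ?d = "restrict (\<lambda>u. fst ab \<otimes>\<^bsub>H\<^esub> w (snd ab) u \<otimes>\<^bsub>H\<^esub> inv\<^bsub>H\<^esub> fst ab) ?L"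
    have "?d \<in> homs M H" unfolding restrict_in_homs_iff[OF M(1)] by (rule conj_hom[OF H.is_group wb a])
    then have "(\<Sum>\<delta>\<in>homs M H. if \<delta> = ?d then f \<delta> else 0) = f ?d"
      using finite_homs[OF M(2) finH] by simp
    then show "(\<Sum>\<delta>\<in>homs M H. if \<delta> = ?d then f \<delta> else 0) = f (restrict (w (snd ab)) ?L)"
      using inv[OF a wb] by simp
  qed
  also have "\<dots> = (\<Sum>a\<in>carrier H. \<Sum>b\<in>?B. f (restrict (w b) ?L))"
    unfolding sum.cartesian_product by (simp only: case_prod_unfold)
  also have "\<dots> = of_nat (card (carrier H)) * (\<Sum>b\<in>?B. f (restrict (w b) ?L))" by simp
  finally show ?thesis unfolding w_def .
qed

end

lemma mark_restrict: "mark x (carrier M) (restrict \<alpha> (carrier M)) \<beta> = mark x (carrier M) \<alpha> \<beta>"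
  "mark x (carrier M) \<alpha> (restrict \<beta> (carrier M)) = mark x (carrier M) \<alpha> \<beta>"
  by (rule mark_cong; simp)+

text \<open>Composition with \<open>[G, \<phi>]\<close> on the right restricts the right action along \<open>\<phi>\<close>.\<close>

lemma mark_comp_restriction:
  fixes M :: "('u, 'b) monoid_scheme" and G :: "('g, 'm) monoid_scheme" and H :: "('h, 'n) monoid_scheme"
  assumes p: "prime p" and GH: "group G" "group H" "finite (carrier G)" "finite (carrier H)"
    and phi: "\<phi> \<in> hom G H" and y: "y \<in> formal_sums p H K"
    and free: "\<And>c. c \<in> Poly_Mapping.keys y \<Longrightarrow> right_free H (rep c)"
    and M: "group M" "finite (carrier M)" and \<alpha>: "\<alpha> \<in> hom M G" and \<beta>: "\<beta> \<in> hom M K"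
  shows "mark (formal_comp G H K y (basic_formal G H (carrier G) \<phi>)) (carrier M) \<alpha> \<beta> =
    mark y (carrier M) (\<lambda>u. \<phi> (\<alpha> u)) \<beta>"
proof -
  interpret G: group G by fact
  interpret H: group H by fact
  interpret coset_data G H "carrier G" \<phi>
    by (intro coset_data.intro coset_data_axioms.intro GH G.subgroup_self) (simp add: phi)
  let ?L = "carrier M"
  have \<alpha>c: "\<alpha> u \<in> carrier G" if "u \<in> ?L" for u using that hom_image[OF \<alpha>] by auto
  have \<phi>\<alpha>: "(\<lambda>u. \<phi> (\<alpha> u)) \<in> hom M H" using hom_compose[OF \<alpha> phi] by (simp add: comp_def)
  have inv: "mark y ?L (restrict (\<lambda>u. a \<otimes>\<^bsub>H\<^esub> \<delta> u \<otimes>\<^bsub>H\<^esub> inv\<^bsub>H\<^esub> a) ?L) \<beta> = mark y ?L (restrict \<delta> ?L) \<beta>"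
    if "a \<in> carrier H" "\<delta> \<in> hom M H" for a \<delta>
    unfolding mark_restrict by (rule mark_conj_right[OF y that(1) hom_image[OF that(2)] hom_image[OF \<beta>]])
  have cG: "card (carrier G) > 0" "card (carrier H) > 0"
    using GH G.one_closed H.one_closed by (auto simp: card_gt_0_iff)
  have "of_nat (card (carrier G)) * (of_nat (card (carrier H)) *
      mark (formal_comp G H K y (basic_formal G H (carrier G) \<phi>)) ?L \<alpha> \<beta>) =
    of_nat (card (carrier G)) * (\<Sum>\<delta>\<in>homs M H. mark (basic_formal G H (carrier G) \<phi>) ?L \<alpha> \<delta> * mark y ?L \<delta> \<beta>)"
    using mark_formal_comp[OF y basic_formal_sums[OF p] M finH \<alpha> \<beta> free] by simp
  also have "\<dots> = of_nat (card (carrier H)) * (\<Sum>b\<in>{b\<in>carrier G. \<forall>u\<in>?L. inv\<^bsub>G\<^esub> b \<otimes>\<^bsub>G\<^esub> \<alpha> u \<otimes>\<^bsub>G\<^esub> b \<in> carrier G}.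
      mark y ?L (restrict (\<lambda>u. \<phi> (inv\<^bsub>G\<^esub> b \<otimes>\<^bsub>G\<^esub> \<alpha> u \<otimes>\<^bsub>G\<^esub> b)) ?L) \<beta>)"
    by (rule sum_mark_basic[OF M \<alpha>, of "\<lambda>\<delta>. mark y ?L \<delta> \<beta>"]) (rule inv)
  also have "{b\<in>carrier G. \<forall>u\<in>?L. inv\<^bsub>G\<^esub> b \<otimes>\<^bsub>G\<^esub> \<alpha> u \<otimes>\<^bsub>G\<^esub> b \<in> carrier G} = carrier G"
    using \<alpha>c by auto
  also have "(\<Sum>b\<in>carrier G. mark y ?L (restrict (\<lambda>u. \<phi> (inv\<^bsub>G\<^esub> b \<otimes>\<^bsub>G\<^esub> \<alpha> u \<otimes>\<^bsub>G\<^esub> b)) ?L) \<beta>) =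
    (\<Sum>b\<in>carrier G. mark y ?L (\<lambda>u. \<phi> (\<alpha> u)) \<beta>)"
  proof (rule sum.cong[OF refl])
    fix b assume b: "b \<in> carrier G"
    have ib: "\<phi> (inv\<^bsub>G\<^esub> b) \<in> carrier H" using b phi_closed by simp
    have "mark y ?L (restrict (\<lambda>u. \<phi> (inv\<^bsub>G\<^esub> b \<otimes>\<^bsub>G\<^esub> \<alpha> u \<otimes>\<^bsub>G\<^esub> b)) ?L) \<beta> =
      mark y ?L (\<lambda>u. \<phi> (inv\<^bsub>G\<^esub> b) \<otimes>\<^bsub>H\<^esub> \<phi> (\<alpha> u) \<otimes>\<^bsub>H\<^esub> inv\<^bsub>H\<^esub> \<phi> (inv\<^bsub>G\<^esub> b)) \<beta>"
      by (rule mark_cong) (use b \<alpha>c in \<open>simp_all add: phi_mult phi_inv phi_closed\<close>)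
    also have "\<dots> = mark y ?L (\<lambda>u. \<phi> (\<alpha> u)) \<beta>"
      by (rule mark_conj_right[OF y ib hom_image[OF \<phi>\<alpha>] hom_image[OF \<beta>]])
    finally show "mark y ?L (restrict (\<lambda>u. \<phi> (inv\<^bsub>G\<^esub> b \<otimes>\<^bsub>G\<^esub> \<alpha> u \<otimes>\<^bsub>G\<^esub> b)) ?L) \<beta> = mark y ?L (\<lambda>u. \<phi> (\<alpha> u)) \<beta>" .
  qed
  finally show ?thesis using cG by simp
qed

text \<open>Composition with \<open>[U, \<theta>]\<close> on the left, for an isomorphism \<open>\<theta> : U \<rightarrow> K\<close> with inverse \<open>\<phi>\<close>, restricts
  the left action along \<open>\<phi>\<close>.\<close>

lemma mark_comp_induction:
  fixes M :: "('u, 'b) monoid_scheme" and H :: "('h, 'n) monoid_scheme" and K :: "('k, 'l) monoid_scheme"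
  assumes p: "prime p" and GH: "group K" "group H" "finite (carrier K)" "finite (carrier H)"
    and U: "subgroup U H" and \<theta>: "\<theta> \<in> hom (H\<lparr>carrier := U\<rparr>) K"
    and phi: "\<phi> \<in> hom K H" "\<phi> ` carrier K = U" "\<And>k. k \<in> carrier K \<Longrightarrow> \<theta> (\<phi> k) = k"
    and x: "x \<in> formal_sums p G H"
    and M: "group M" "finite (carrier M)" and \<alpha>: "\<alpha> \<in> hom M G" and \<beta>: "\<beta> \<in> hom M K"
  shows "mark (formal_comp G H K (basic_formal H K U \<theta>) x) (carrier M) \<alpha> \<beta> =
    mark x (carrier M) \<alpha> (\<lambda>u. \<phi> (\<beta> u))"
proof -
  interpret K: group K by fact
  interpret H: group H by fact
  interpret M: group M by fact
  interpret coset_data H K U \<theta>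
    by (intro coset_data.intro coset_data_axioms.intro GH U \<theta>)
  let ?L = "carrier M"
  have \<phi>\<theta>: "\<phi> (\<theta> v) = v" if "v \<in> U" for v
    using that phi(2,3) by auto
  have inj: "inj_on \<theta> U" by (rule inj_on_inverseI[of _ \<phi>]) (rule \<phi>\<theta>)
  have \<beta>c: "\<beta> u \<in> carrier K" if "u \<in> ?L" for u using that hom_image[OF \<beta>] by auto
  have \<phi>c: "\<phi> k \<in> carrier H" if "k \<in> carrier K" for k using that hom_image[OF phi(1)] by auto
  have \<phi>\<beta>: "(\<lambda>u. \<phi> (\<beta> u)) \<in> hom M H" using hom_compose[OF \<beta> phi(1)] by (simp add: comp_def)
  have cardU: "card U = card (carrier K)"
  proof -
    have "inj_on \<phi> (carrier K)" by (rule inj_on_inverseI[of _ \<theta>]) (rule phi(3))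
    then show ?thesis using phi(2) card_image by metis
  qed
  have c0: "card (carrier K) > 0" "card (carrier H) > 0"
    using GH K.one_closed H.one_closed by (auto simp: card_gt_0_iff)
  define w where "w a b = restrict (\<lambda>u. b \<otimes>\<^bsub>H\<^esub> (\<phi> (inv\<^bsub>K\<^esub> a) \<otimes>\<^bsub>H\<^esub> \<phi> (\<beta> u) \<otimes>\<^bsub>H\<^esub> inv\<^bsub>H\<^esub> \<phi> (inv\<^bsub>K\<^esub> a)) \<otimes>\<^bsub>H\<^esub> inv\<^bsub>H\<^esub> b) ?L" for a b
  have whom: "w a b \<in> homs M H" if "a \<in> carrier K" "b \<in> carrier H" for a b
    unfolding w_def restrict_in_homs_iff[OF M(1)]
    using that \<phi>c by (intro conj_hom[OF H.is_group] \<phi>\<beta>) auto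
  have wx: "mark x ?L \<alpha> (w a b) = mark x ?L \<alpha> (\<lambda>u. \<phi> (\<beta> u))" if ab: "a \<in> carrier K" "b \<in> carrier H" for a b
  proof -
    have ia: "\<phi> (inv\<^bsub>K\<^esub> a) \<in> carrier H" using ab \<phi>c by simp
    show ?thesis unfolding w_def mark_restrict
      using mark_conj_left[OF x ab(2) hom_image[OF \<alpha>] hom_image[OF conj_hom[OF H.is_group \<phi>\<beta> ia]]]
        mark_conj_left[OF x ia hom_image[OF \<alpha>] hom_image[OF \<phi>\<beta>]] by simp
  qed
  have cond: "(\<forall>u\<in>?L. inv\<^bsub>H\<^esub> b \<otimes>\<^bsub>H\<^esub> \<gamma> u \<otimes>\<^bsub>H\<^esub> b \<in> U \<and>
     \<theta> (inv\<^bsub>H\<^esub> b \<otimes>\<^bsub>H\<^esub> \<gamma> u \<otimes>\<^bsub>H\<^esub> b) = inv\<^bsub>K\<^esub> a \<otimes>\<^bsub>K\<^esub> \<beta> u \<otimes>\<^bsub>K\<^esub> a) \<longleftrightarrow> \<gamma> = w a b"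
    if ab: "a \<in> carrier K" "b \<in> carrier H" and g: "\<gamma> \<in> homs M H" for a b \<gamma>
  proof -
    have gc: "\<gamma> u \<in> carrier H" if "u \<in> ?L" for u using that g hom_image by fastforce
    have e: "inv\<^bsub>H\<^esub> b \<otimes>\<^bsub>H\<^esub> \<gamma> u \<otimes>\<^bsub>H\<^esub> b \<in> U \<and> \<theta> (inv\<^bsub>H\<^esub> b \<otimes>\<^bsub>H\<^esub> \<gamma> u \<otimes>\<^bsub>H\<^esub> b) = inv\<^bsub>K\<^esub> a \<otimes>\<^bsub>K\<^esub> \<beta> u \<otimes>\<^bsub>K\<^esub> a
       \<longleftrightarrow> \<gamma> u = w a b u" if u: "u \<in> ?L" for u
    proof -
      let ?k = "inv\<^bsub>K\<^esub> a \<otimes>\<^bsub>K\<^esub> \<beta> u \<otimes>\<^bsub>K\<^esub> a"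
      have kc: "?k \<in> carrier K" using ab \<beta>c[OF u] by simp
      have \<phi>k: "\<phi> ?k = \<phi> (inv\<^bsub>K\<^esub> a) \<otimes>\<^bsub>H\<^esub> \<phi> (\<beta> u) \<otimes>\<^bsub>H\<^esub> inv\<^bsub>H\<^esub> \<phi> (inv\<^bsub>K\<^esub> a)"
      proof -
        have "group_hom K H \<phi>" using phi(1) by (simp add: group_hom_def group_hom_axioms_def K.is_group H.is_group)
        from group_hom.hom_inv[OF this, of "inv\<^bsub>K\<^esub> a"] have "inv\<^bsub>H\<^esub> \<phi> (inv\<^bsub>K\<^esub> a) = \<phi> a" using ab by simp
        then show ?thesis using ab \<beta>c[OF u] by (simp add: hom_mult[OF phi(1)])
      qed
      have "inv\<^bsub>H\<^esub> b \<otimes>\<^bsub>H\<^esub> \<gamma> u \<otimes>\<^bsub>H\<^esub> b \<in> U \<and> \<theta> (inv\<^bsub>H\<^esub> b \<otimes>\<^bsub>H\<^esub> \<gamma> u \<otimes>\<^bsub>H\<^esub> b) = ?k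
         \<longleftrightarrow> inv\<^bsub>H\<^esub> b \<otimes>\<^bsub>H\<^esub> \<gamma> u \<otimes>\<^bsub>H\<^esub> b = \<phi> ?k"
        using \<phi>\<theta> phi(2,3) kc by (metis imageI)
      also have "\<dots> \<longleftrightarrow> \<gamma> u = b \<otimes>\<^bsub>H\<^esub> \<phi> ?k \<otimes>\<^bsub>H\<^esub> inv\<^bsub>H\<^esub> b"
        using conj_by_inv[OF H.is_group ab(2) gc[OF u]] conj_by_inv[OF H.is_group ab(2) \<phi>c[OF kc]] ab(2)
        by (auto simp: conj_by_def)
      also have "b \<otimes>\<^bsub>H\<^esub> \<phi> ?k \<otimes>\<^bsub>H\<^esub> inv\<^bsub>H\<^esub> b = w a b u" unfolding \<phi>k w_def using u by simp
      finally show ?thesis .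
    qed
    have "\<gamma> = w a b \<longleftrightarrow> (\<forall>u\<in>?L. \<gamma> u = w a b u)"
    proof
      assume *: "\<forall>u\<in>?L. \<gamma> u = w a b u"
      show "\<gamma> = w a b" by (rule extensionalityI[of _ ?L]) (use g whom[OF ab] * in auto)
    qed simp
    then show ?thesis using e by simp
  qed
  have mk: "of_nat (card U) * mark (basic_formal H K U \<theta>) ?L \<gamma> \<beta> =
     (\<Sum>ab\<in>carrier K \<times> carrier H. if \<gamma> = w (fst ab) (snd ab) then 1 else 0 :: rat)"
    if g: "\<gamma> \<in> homs M H" for \<gamma>
  proof -
    have gi: "\<gamma> ` ?L \<subseteq> carrier H" using g hom_image by blast
    have "of_nat (card U) * mark (basic_formal H K U \<theta>) ?L \<gamma> \<beta> = of_nat (card U * card (fixp X ?L \<gamma> \<beta>))"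
      using mark_basic[OF gi hom_image[OF \<beta>]] by simp
    also have "card U * card (fixp X ?L \<gamma> \<beta>) = card {ab \<in> carrier K \<times> carrier H. \<gamma> = w (fst ab) (snd ab)}"
    proof -
      have "{(a, b) \<in> carrier K \<times> carrier H. \<forall>u\<in>?L. inv\<^bsub>H\<^esub> b \<otimes>\<^bsub>H\<^esub> \<gamma> u \<otimes>\<^bsub>H\<^esub> b \<in> U \<and>
         \<theta> (inv\<^bsub>H\<^esub> b \<otimes>\<^bsub>H\<^esub> \<gamma> u \<otimes>\<^bsub>H\<^esub> b) = inv\<^bsub>K\<^esub> a \<otimes>\<^bsub>K\<^esub> \<beta> u \<otimes>\<^bsub>K\<^esub> a}
        = {ab \<in> carrier K \<times> carrier H. \<gamma> = w (fst ab) (snd ab)}"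
        by (rule Set.set_eqI, simp only: mem_Collect_eq split_beta prod.collapse mem_Times_iff)
          (rule conj_cong[OF refl], simp only: cond[OF _ _ g])
      then show ?thesis using card_fixp[OF gi hom_image[OF \<beta>]] by simp
    qed
    finally show ?thesis using GH by (simp add: sum.If_cases Int_def)
  qed
  have "of_nat (card U) * (of_nat (card (carrier H)) *
      mark (formal_comp G H K (basic_formal H K U \<theta>) x) ?L \<alpha> \<beta>) =
    of_nat (card U) * (\<Sum>\<gamma>\<in>homs M H. mark x ?L \<alpha> \<gamma> * mark (basic_formal H K U \<theta>) ?L \<gamma> \<beta>)"
    using mark_formal_comp[OF basic_formal_sums[OF p] x M finG \<alpha> \<beta> basic_right_free[OF inj]] by simp
  also have "\<dots> = (\<Sum>\<gamma>\<in>homs M H. mark x ?L \<alpha> \<gamma> * (of_nat (card U) * mark (basic_formal H K U \<theta>) ?L \<gamma> \<beta>))"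
    by (simp add: sum_distrib_left mult_ac)
  also have "\<dots> = (\<Sum>\<gamma>\<in>homs M H. \<Sum>ab\<in>carrier K \<times> carrier H.
      if \<gamma> = w (fst ab) (snd ab) then mark x ?L \<alpha> \<gamma> else 0)"
    by (rule sum.cong[OF refl]) (simp add: mk sum_distrib_left if_distrib[of "\<lambda>x. _ * x"] cong: if_cong)
  also have "\<dots> = (\<Sum>ab\<in>carrier K \<times> carrier H. \<Sum>\<gamma>\<in>homs M H.
      if \<gamma> = w (fst ab) (snd ab) then mark x ?L \<alpha> \<gamma> else 0)"
    by (rule sum.swap)
  also have "\<dots> = (\<Sum>ab\<in>carrier K \<times> carrier H. mark x ?L \<alpha> (\<lambda>u. \<phi> (\<beta> u)))"
  proof (rule sum.cong[OF refl])
    fix ab assume "ab \<in> carrier K \<times> carrier H"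
    then have ab: "fst ab \<in> carrier K" "snd ab \<in> carrier H" by auto
    show "(\<Sum>\<gamma>\<in>homs M H. if \<gamma> = w (fst ab) (snd ab) then mark x ?L \<alpha> \<gamma> else 0) = mark x ?L \<alpha> (\<lambda>u. \<phi> (\<beta> u))"
      using whom[OF ab] wx[OF ab] finite_homs[OF M(2) GH(4)] by simp
  qed
  also have "\<dots> = of_nat (card (carrier K)) * (of_nat (card (carrier H)) * mark x ?L \<alpha> (\<lambda>u. \<phi> (\<beta> u)))"
    by (simp add: card_cartesian_product)
  finally show ?thesis using c0 cardU by simp
qed

text \<open>The double sum over the middle homomorphisms collapses: those into \<open>H\<close> by
  \<open>sum_mark_basic\<close>, and for each \<open>b\<close> the substitution of \<open>\<gamma>\<close> by \<open>b\<^sup>-\<^sup>1 \<gamma> b\<close> removes \<open>b\<close>, since marks are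
  invariant under conjugation.  Only the \<open>\<gamma>\<close> with values in \<open>U\<close> remain.\<close>

lemma (in coset_data) mark_comp_between:
  fixes M :: "('u, 'b) monoid_scheme" and A :: "('c, 'd) monoid_scheme" and B :: "('e, 'f) monoid_scheme"
  assumes p: "prime p" and inj: "inj_on \<phi> U"
    and x: "x \<in> formal_sums p A G" and y: "y \<in> formal_sums p H B"
    and free: "\<And>c. c \<in> Poly_Mapping.keys y \<Longrightarrow> right_free H (rep c)"
    and M: "group M" "finite (carrier M)" and \<alpha>: "\<alpha> \<in> hom M A" and \<beta>: "\<beta> \<in> hom M B"
  shows "of_nat (card U) * mark (formal_comp A H B y (formal_comp A G H (basic_formal G H U \<phi>) x))
      (carrier M) \<alpha> \<beta> =
    (\<Sum>\<gamma>\<in>{\<gamma>\<in>homs M G. \<gamma> ` carrier M \<subseteq> U}.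
       mark x (carrier M) \<alpha> \<gamma> * mark y (carrier M) (\<lambda>u. \<phi> (\<gamma> u)) \<beta>)"
proof -
  let ?L = "carrier M" and ?b = "basic_formal G H U \<phi>"
  note bs = basic_formal_sums[OF p]
  let ?N = "{\<gamma>\<in>homs M G. \<gamma> ` ?L \<subseteq> U}"
  let ?y = "\<lambda>\<delta>. mark y ?L \<delta> \<beta>"
  have homsc: "\<gamma> u \<in> carrier G" if "\<gamma> \<in> homs M G" "u \<in> ?L" for \<gamma> u
    using that hom_image by fastforce
  have finN: "finite (homs M G)" by (rule finite_homs[OF M(2) finG])
  have inv: "?y (restrict (\<lambda>u. a \<otimes>\<^bsub>H\<^esub> \<delta> u \<otimes>\<^bsub>H\<^esub> inv\<^bsub>H\<^esub> a) ?L) = ?y (restrict \<delta> ?L)"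
    if "a \<in> carrier H" "\<delta> \<in> hom M H" for a \<delta>
    unfolding mark_restrict by (rule mark_conj_right[OF y that(1) hom_image[OF that(2)] hom_image[OF \<beta>]])
  define cj where "cj b \<gamma> = restrict (\<lambda>u. inv\<^bsub>G\<^esub> b \<otimes>\<^bsub>G\<^esub> \<gamma> u \<otimes>\<^bsub>G\<^esub> b) ?L" for b \<gamma>
  have cjh: "cj b \<gamma> \<in> homs M G" if "b \<in> carrier G" "\<gamma> \<in> homs M G" for b \<gamma>
    unfolding cj_def restrict_in_homs_iff[OF M(1)]
    using conj_hom[OF G.is_group, of \<gamma> M "inv\<^bsub>G\<^esub> b"] that by simp
  have cjcj: "cj b (cj (inv\<^bsub>G\<^esub> b) \<gamma>) = \<gamma>" "cj (inv\<^bsub>G\<^esub> b) (cj b \<gamma>) = \<gamma>"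
    if b: "b \<in> carrier G" and g: "\<gamma> \<in> homs M G" for b \<gamma>
    by (rule extensionalityI[of _ ?L]; use b g homsc[OF g] conj_by_inv[OF G.is_group b homsc[OF g]] in
      \<open>simp add: cj_def conj_by_def\<close>)+
  have xcj: "mark x ?L \<alpha> (cj b \<gamma>) = mark x ?L \<alpha> \<gamma>" if b: "b \<in> carrier G" and g: "\<gamma> \<in> homs M G" for b \<gamma>
    unfolding cj_def mark_restrict
    using mark_conj_left[OF x G.inv_closed[OF b] hom_image[OF \<alpha>], of \<gamma>] b hom_image[of \<gamma> M G] g by simp
  have inner: "of_nat (card U) * (\<Sum>\<delta>\<in>homs M H. mark ?b ?L \<gamma> \<delta> * ?y \<delta>) =
     of_nat (card (carrier H)) * (\<Sum>b\<in>carrier G. if cj b \<gamma> ` ?L \<subseteq> U then ?y (\<lambda>u. \<phi> (cj b \<gamma> u)) else 0)"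
    if g: "\<gamma> \<in> homs M G" for \<gamma>
  proof -
    have set_eq: "{b\<in>carrier G. \<forall>u\<in>?L. inv\<^bsub>G\<^esub> b \<otimes>\<^bsub>G\<^esub> \<gamma> u \<otimes>\<^bsub>G\<^esub> b \<in> U} = {b\<in>carrier G. cj b \<gamma> ` ?L \<subseteq> U}"
      by (auto simp: cj_def)
    have "of_nat (card U) * (\<Sum>\<delta>\<in>homs M H. mark ?b ?L \<gamma> \<delta> * ?y \<delta>) =
      of_nat (card (carrier H)) * (\<Sum>b\<in>{b\<in>carrier G. cj b \<gamma> ` ?L \<subseteq> U}.
        ?y (restrict (\<lambda>u. \<phi> (inv\<^bsub>G\<^esub> b \<otimes>\<^bsub>G\<^esub> \<gamma> u \<otimes>\<^bsub>G\<^esub> b)) ?L))"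
      unfolding set_eq[symmetric] by (rule sum_mark_basic[OF M IntD1[OF g], of ?y]) (rule inv)
    also have "(\<Sum>b\<in>{b\<in>carrier G. cj b \<gamma> ` ?L \<subseteq> U}.
        ?y (restrict (\<lambda>u. \<phi> (inv\<^bsub>G\<^esub> b \<otimes>\<^bsub>G\<^esub> \<gamma> u \<otimes>\<^bsub>G\<^esub> b)) ?L)) =
      (\<Sum>b\<in>{b\<in>carrier G. cj b \<gamma> ` ?L \<subseteq> U}. ?y (\<lambda>u. \<phi> (cj b \<gamma> u)))"
      by (rule sum.cong[OF refl], rule mark_cong) (simp_all add: cj_def)
    also have "\<dots> = (\<Sum>b\<in>carrier G. if cj b \<gamma> ` ?L \<subseteq> U then ?y (\<lambda>u. \<phi> (cj b \<gamma> u)) else 0)"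
      using finG by (simp add: sum.inter_filter)
    finally show ?thesis .
  qed
  have reindex: "(\<Sum>\<gamma>\<in>homs M G. mark x ?L \<alpha> \<gamma> * (if cj b \<gamma> ` ?L \<subseteq> U then ?y (\<lambda>u. \<phi> (cj b \<gamma> u)) else 0)) =
      (\<Sum>\<gamma>\<in>?N. mark x ?L \<alpha> \<gamma> * ?y (\<lambda>u. \<phi> (\<gamma> u)))" if b: "b \<in> carrier G" for b
  proof -
    have "bij_betw (cj b) (homs M G) (homs M G)"
      by (rule bij_betw_byWitness[where f' = "cj (inv\<^bsub>G\<^esub> b)"])
        (use cjcj[OF b] cjh[OF b] cjh[OF G.inv_closed[OF b]] in blast)+
    then have "(\<Sum>\<gamma>\<in>homs M G. mark x ?L \<alpha> \<gamma> * (if \<gamma> ` ?L \<subseteq> U then ?y (\<lambda>u. \<phi> (\<gamma> u)) else 0)) =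
      (\<Sum>\<gamma>\<in>homs M G. mark x ?L \<alpha> (cj b \<gamma>) * (if cj b \<gamma> ` ?L \<subseteq> U then ?y (\<lambda>u. \<phi> (cj b \<gamma> u)) else 0))"
      by (rule sum.reindex_bij_betw[symmetric])
    also have "\<dots> = (\<Sum>\<gamma>\<in>homs M G. mark x ?L \<alpha> \<gamma> * (if cj b \<gamma> ` ?L \<subseteq> U then ?y (\<lambda>u. \<phi> (cj b \<gamma> u)) else 0))"
      by (rule sum.cong[OF refl]) (simp only: xcj[OF b])
    finally have 1: "(\<Sum>\<gamma>\<in>homs M G. mark x ?L \<alpha> \<gamma> * (if \<gamma> ` ?L \<subseteq> U then ?y (\<lambda>u. \<phi> (\<gamma> u)) else 0)) =
      (\<Sum>\<gamma>\<in>homs M G. mark x ?L \<alpha> \<gamma> * (if cj b \<gamma> ` ?L \<subseteq> U then ?y (\<lambda>u. \<phi> (cj b \<gamma> u)) else 0))" .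
    have "(\<Sum>\<gamma>\<in>?N. mark x ?L \<alpha> \<gamma> * ?y (\<lambda>u. \<phi> (\<gamma> u))) =
      (\<Sum>\<gamma>\<in>homs M G. if \<gamma> ` ?L \<subseteq> U then mark x ?L \<alpha> \<gamma> * ?y (\<lambda>u. \<phi> (\<gamma> u)) else 0)"
      by (rule sum.inter_filter[OF finN])
    also have "\<dots> = (\<Sum>\<gamma>\<in>homs M G. mark x ?L \<alpha> \<gamma> * (if \<gamma> ` ?L \<subseteq> U then ?y (\<lambda>u. \<phi> (\<gamma> u)) else 0))"
      by (rule sum.cong[OF refl]) simp
    finally show ?thesis unfolding 1 by (rule sym)
  qed
  have c0: "card (carrier G) > 0" "card (carrier H) > 0"
    using finG finH G.one_closed H.one_closed unfolding card_gt_0_iff by blast+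
  let ?g = "of_nat (card (carrier G)) :: rat" and ?h = "of_nat (card (carrier H)) :: rat" and ?u = "of_nat (card U) :: rat"
  have "?g * ?h * (?u * mark (formal_comp A H B y (formal_comp A G H ?b x)) ?L \<alpha> \<beta>) =
    ?g * ?u * (\<Sum>\<delta>\<in>homs M H. mark (formal_comp A G H ?b x) ?L \<alpha> \<delta> * ?y \<delta>)"
    using mark_formal_comp[OF y formal_comp_closed[OF p bs x] M finH \<alpha> \<beta> free] by simp
  also have "\<dots> = ?u * (\<Sum>\<delta>\<in>homs M H. (?g * mark (formal_comp A G H ?b x) ?L \<alpha> \<delta>) * ?y \<delta>)"
    by (simp add: sum_distrib_left mult_ac)
  also have "\<dots> = ?u * (\<Sum>\<delta>\<in>homs M H. (\<Sum>\<gamma>\<in>homs M G. mark x ?L \<alpha> \<gamma> * mark ?b ?L \<gamma> \<delta>) * ?y \<delta>)"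
    using mark_formal_comp[OF bs x M finG \<alpha> _ basic_right_free[OF inj]] by simp
  also have "\<dots> = ?u * (\<Sum>\<delta>\<in>homs M H. \<Sum>\<gamma>\<in>homs M G. mark x ?L \<alpha> \<gamma> * (mark ?b ?L \<gamma> \<delta> * ?y \<delta>))"
    by (simp add: sum_distrib_right mult.assoc)
  also have "\<dots> = ?u * (\<Sum>\<gamma>\<in>homs M G. \<Sum>\<delta>\<in>homs M H. mark x ?L \<alpha> \<gamma> * (mark ?b ?L \<gamma> \<delta> * ?y \<delta>))"
    by (subst sum.swap) (rule refl)
  also have "\<dots> = (\<Sum>\<gamma>\<in>homs M G. mark x ?L \<alpha> \<gamma> * (?u * (\<Sum>\<delta>\<in>homs M H. mark ?b ?L \<gamma> \<delta> * ?y \<delta>)))"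
    by (simp add: sum_distrib_left mult_ac)
  also have "\<dots> = (\<Sum>\<gamma>\<in>homs M G. mark x ?L \<alpha> \<gamma> *
      (?h * (\<Sum>b\<in>carrier G. if cj b \<gamma> ` ?L \<subseteq> U then ?y (\<lambda>u. \<phi> (cj b \<gamma> u)) else 0)))"
    by (rule sum.cong[OF refl]) (simp only: inner)
  also have "\<dots> = ?h * (\<Sum>\<gamma>\<in>homs M G. \<Sum>b\<in>carrier G.
      mark x ?L \<alpha> \<gamma> * (if cj b \<gamma> ` ?L \<subseteq> U then ?y (\<lambda>u. \<phi> (cj b \<gamma> u)) else 0))"
    unfolding sum_distrib_left by (simp only: mult.left_commute[of _ ?h])
  also have "\<dots> = ?h * (\<Sum>b\<in>carrier G. \<Sum>\<gamma>\<in>homs M G.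
      mark x ?L \<alpha> \<gamma> * (if cj b \<gamma> ` ?L \<subseteq> U then ?y (\<lambda>u. \<phi> (cj b \<gamma> u)) else 0))"
    by (subst sum.swap) (rule refl)
  also have "\<dots> = ?h * (\<Sum>b\<in>carrier G. \<Sum>\<gamma>\<in>?N. mark x ?L \<alpha> \<gamma> * ?y (\<lambda>u. \<phi> (\<gamma> u)))"
    by (simp only: reindex cong: sum.cong)
  also have "\<dots> = ?g * ?h * (\<Sum>\<gamma>\<in>?N. mark x ?L \<alpha> \<gamma> * ?y (\<lambda>u. \<phi> (\<gamma> u)))" by simp
  finally show ?thesis using c0 by simp
qed

section \<open>Marks of a characteristic idempotent\<close>

text \<open>The marks at \<open>(id, \<gamma>)\<close>, summed over \<open>\<gamma>\<close>, count the points \<open>x\<close> with \<open>x P \<subseteq> H x\<close>, that is, \<open>|H|\<close> times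
  the left orbits fixed by \<open>P\<close>.  As \<open>P\<close> is a \<open>p\<close>-group, that number of orbits is congruent modulo \<open>p\<close>
  to the number of all left orbits.\<close>

lemma sum_fixp_mod_p:
  fixes X :: "('x, 'g, 'h) biset"
  assumes X: "is_biset G H X" and free: "left_free H X" and finH: "finite (carrier H)"
    and p: "prime p" and P: "subgroup P G" and ord: "card P = p ^ k"
  shows "\<exists>i::int. int (\<Sum>\<gamma>\<in>homs (G\<lparr>carrier := P\<rparr>) H. card (fixp X P (\<lambda>u. u) \<gamma>)) =
    int (card (points X)) + i * int p * int (card (carrier H))"
proof -
  interpret is_biset G H X by fact
  interpret P: subgroup P G by fact
  define orb where "orb x = (\<lambda>h. lact X h x) ` carrier H" for x
  define Orbs where "Orbs = orb ` points X"
  have cancel: "h = h'" if "x \<in> points X" "h \<in> carrier H" "h' \<in> carrier H" "lact X h x = lact X h' x" for x h h'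
  proof -
    have "lact X (inv\<^bsub>H\<^esub> h' \<otimes>\<^bsub>H\<^esub> h) x = x"
      using that lact_mult[of "inv\<^bsub>H\<^esub> h'" h x] lact_mult[of "inv\<^bsub>H\<^esub> h'" h' x] lact_one by simp
    then have "inv\<^bsub>H\<^esub> h' \<otimes>\<^bsub>H\<^esub> h = \<one>\<^bsub>H\<^esub>" using free that by (auto simp: left_free_def)
    then show ?thesis using that by (metis H.inv_closed H.inv_equality H.inv_inv)
  qed
  have orb_card: "card (orb x) = card (carrier H)" if "x \<in> points X" for x
    unfolding orb_def by (rule card_image, rule inj_onI) (rule cancel[OF that])
  have self: "x \<in> orb x" if "x \<in> points X" for x
    unfolding orb_def using that lact_one by (intro image_eqI[of _ _ "\<one>\<^bsub>H\<^esub>"]) auto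
  have orb_sub: "orb x \<subseteq> points X" if "x \<in> points X" for x unfolding orb_def using that lact_closed by auto
  have orb_mem: "orb y = orb x" if x: "x \<in> points X" and y: "y \<in> orb x" for x y
  proof -
    obtain h where h: "h \<in> carrier H" "y = lact X h x" using y unfolding orb_def by blast
    have "lact X k y \<in> orb x" if "k \<in> carrier H" for k
      unfolding orb_def h(2) using that h x by (intro image_eqI[of _ _ "k \<otimes>\<^bsub>H\<^esub> h"]) (auto simp: lact_mult)
    moreover have "lact X k x \<in> orb y" if "k \<in> carrier H" for k
    proof -
      have "lact X k x = lact X (k \<otimes>\<^bsub>H\<^esub> inv\<^bsub>H\<^esub> h) y"
        unfolding h(2) using that h x lact_mult[of "k \<otimes>\<^bsub>H\<^esub> inv\<^bsub>H\<^esub> h" h x] by (simp add: H.m_assoc)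
      then show ?thesis unfolding orb_def[of y] using that h by (intro image_eqI[of _ _ "k \<otimes>\<^bsub>H\<^esub> inv\<^bsub>H\<^esub> h"]) auto
    qed
    ultimately show ?thesis unfolding orb_def[of x] orb_def[of y] by (auto simp: orb_def)
  qed
  have finO: "finite Orbs" unfolding Orbs_def using finite_points by simp
  have Odisj: "c1 \<inter> c2 = {}" if c: "c1 \<in> Orbs" "c2 \<in> Orbs" "c1 \<noteq> c2" for c1 c2
  proof (rule ccontr)
    assume "c1 \<inter> c2 \<noteq> {}"
    then obtain z where z: "z \<in> c1" "z \<in> c2" by blast
    obtain x y where xy: "x \<in> points X" "c1 = orb x" "y \<in> points X" "c2 = orb y" using c unfolding Orbs_def by blast
    have "orb z = orb x" "orb z = orb y" using orb_mem z xy by metis+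
    then show False using c(3) xy by simp
  qed
  have count: "card (carrier H) * card C = card (\<Union>C)" if C: "C \<subseteq> Orbs" for C
  proof (rule card_partition)
    show "finite C" using C finO finite_subset by blast
    show "finite (\<Union>C)" by (rule finite_subset[OF _ finite_points]) (use C orb_sub Orbs_def in blast)
    show "card c = card (carrier H)" if "c \<in> C" for c using that C orb_card Orbs_def by auto
    show "c1 \<inter> c2 = {}" if "c1 \<in> C" "c2 \<in> C" "c1 \<noteq> c2" for c1 c2
      using Odisj that C by blast
  qed
  let ?act = "\<lambda>u c. (\<lambda>x. ract X x (inv\<^bsub>G\<^esub> u)) ` c"
  have act_orb: "?act u (orb x) = orb (ract X x (inv\<^bsub>G\<^esub> u))" if "u \<in> P" "x \<in> points X" for u x
    unfolding orb_def image_image using that acts_commute by (intro image_cong) auto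
  let ?fix = "{c\<in>Orbs. \<forall>u\<in>P. ?act u c = c}"
  have "card Orbs mod p = card {c\<in>Orbs. \<forall>u\<in>carrier (G\<lparr>carrier := P\<rparr>). ?act u c = c} mod p"
  proof (rule p_group_fixed_points[OF p P.subgroup_is_group[OF G.is_group] _ finO])
    show "order (G\<lparr>carrier := P\<rparr>) = p ^ k" using ord by (simp add: order_def)
    show "?act u c \<in> Orbs" if "u \<in> carrier (G\<lparr>carrier := P\<rparr>)" "c \<in> Orbs" for u c
      using that act_orb ract_closed unfolding Orbs_def by auto
    show "?act \<one>\<^bsub>G\<lparr>carrier := P\<rparr>\<^esub> c = c" if "c \<in> Orbs" for c
      using that act_orb[OF P.one_closed] ract_one unfolding Orbs_def by auto
    show "?act (u \<otimes>\<^bsub>G\<lparr>carrier := P\<rparr>\<^esub> v) c = ?act u (?act v c)"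
      if uv: "u \<in> carrier (G\<lparr>carrier := P\<rparr>)" "v \<in> carrier (G\<lparr>carrier := P\<rparr>)" "c \<in> Orbs" for u v c
    proof -
      have "c \<subseteq> points X" using uv(3) orb_sub unfolding Orbs_def by blast
      then show ?thesis using uv(1,2) unfolding image_image
        by (intro image_cong) (auto simp: G.inv_mult_group ract_mult subset_iff)
    qed
  qed
  then have "card Orbs mod p = card ?fix mod p" by simp
  then have "int (card ?fix) mod int p = int (card Orbs) mod int p" by (simp only: zmod_int[symmetric])
  then have "int p dvd int (card ?fix) - int (card Orbs)" by (simp only: mod_eq_dvd_iff)
  then obtain i where "int (card ?fix) - int (card Orbs) = int p * i" by (rule dvdE)
  then have i: "int (card ?fix) = int (card Orbs) + int p * i" by linarith
  have UO: "\<Union>Orbs = points X"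
  proof (rule equalityI)
    show "\<Union>Orbs \<subseteq> points X" unfolding Orbs_def by (rule Union_least, erule imageE, simp only: orb_sub)
    show "points X \<subseteq> \<Union>Orbs" unfolding Orbs_def by (rule subsetI, rule UnionI, erule imageI, erule self)
  qed
  have Ufix: "\<Union>?fix = {x\<in>points X. \<forall>u\<in>P. \<exists>h\<in>carrier H. lact X h x = ract X x u}"
  proof (intro equalityI subsetI)
    fix x assume "x \<in> \<Union>?fix"
    then obtain c where "c \<in> ?fix" and "x \<in> c" by (rule UnionE)
    then have c: "c \<in> Orbs" "\<And>u. u \<in> P \<Longrightarrow> ?act u c = c" "x \<in> c" by simp_all
    obtain y where y: "y \<in> points X" "c = orb y" using c(1) unfolding Orbs_def by blast
    have xp: "x \<in> points X" using orb_sub[OF y(1)] c(3) y(2) by blast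
    have cx: "c = orb x" using orb_mem[OF y(1)] c(3) y(2) by blast
    have "\<exists>h\<in>carrier H. lact X h x = ract X x u" if u: "u \<in> P" for u
    proof -
      have "?act (inv\<^bsub>G\<^esub> u) c = c" by (rule c(2)[OF P.m_inv_closed[OF u]])
      moreover have "ract X x (inv\<^bsub>G\<^esub> (inv\<^bsub>G\<^esub> u)) \<in> ?act (inv\<^bsub>G\<^esub> u) c" by (rule imageI[OF c(3)])
      ultimately have "ract X x (inv\<^bsub>G\<^esub> (inv\<^bsub>G\<^esub> u)) \<in> c" by (simp only:)
      then have "ract X x u \<in> orb x" using u cx by simp
      then obtain h where "h \<in> carrier H" "ract X x u = lact X h x" unfolding orb_def by blast
      then show ?thesis by metis
    qed
    then show "x \<in> {x\<in>points X. \<forall>u\<in>P. \<exists>h\<in>carrier H. lact X h x = ract X x u}" using xp by blast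
  next
    fix x assume x: "x \<in> {x\<in>points X. \<forall>u\<in>P. \<exists>h\<in>carrier H. lact X h x = ract X x u}"
    then have xp: "x \<in> points X" by blast
    have "?act u (orb x) = orb x" if u: "u \<in> P" for u
    proof -
      obtain h where h: "h \<in> carrier H" "lact X h x = ract X x (inv\<^bsub>G\<^esub> u)"
        using x P.m_inv_closed[OF u] by blast
      then have "ract X x (inv\<^bsub>G\<^esub> u) \<in> orb x" unfolding orb_def by (metis imageI)
      then show ?thesis using act_orb[OF u xp] orb_mem[OF xp] by simp
    qed
    then have "orb x \<in> ?fix" using xp unfolding Orbs_def by blast
    then show "x \<in> \<Union>?fix" using self[OF xp] by blast
  qed
  have finP: "finite P" using ord p by (metis card.infinite power_not_zero not_prime_0)
  let ?Hom = "homs (G\<lparr>carrier := P\<rparr>) H"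
  have UN: "{x\<in>points X. \<forall>u\<in>P. \<exists>h\<in>carrier H. lact X h x = ract X x u} = (\<Union>\<gamma>\<in>?Hom. fixp X P (\<lambda>u. u) \<gamma>)"
  proof (intro equalityI subsetI)
    fix x assume x: "x \<in> {x\<in>points X. \<forall>u\<in>P. \<exists>h\<in>carrier H. lact X h x = ract X x u}"
    then have xp: "x \<in> points X" by blast
    obtain g where g: "\<And>u. u \<in> P \<Longrightarrow> g u \<in> carrier H \<and> lact X (g u) x = ract X x u" using x by (simp) metis
    have "g (u \<otimes>\<^bsub>G\<^esub> v) = g u \<otimes>\<^bsub>H\<^esub> g v" if uv: "u \<in> P" "v \<in> P" for u v
    proof (rule cancel[OF xp])
      have "lact X (g u \<otimes>\<^bsub>H\<^esub> g v) x = lact X (g u) (ract X x v)" using g uv xp lact_mult by simp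
      also have "\<dots> = ract X (ract X x u) v" using g uv xp acts_commute[of "g u" v x] by simp
      also have "\<dots> = ract X x (u \<otimes>\<^bsub>G\<^esub> v)" using uv xp ract_mult by simp
      finally show "lact X (g (u \<otimes>\<^bsub>G\<^esub> v)) x = lact X (g u \<otimes>\<^bsub>H\<^esub> g v) x" using g uv by simp
    qed (use g uv in auto)
    then have "restrict g P \<in> ?Hom" using g by (auto intro!: homI)
    moreover have "x \<in> fixp X P (\<lambda>u. u) (restrict g P)" using g xp by (simp add: fixp_def)
    ultimately show "x \<in> (\<Union>\<gamma>\<in>?Hom. fixp X P (\<lambda>u. u) \<gamma>)" by blast
  next
    fix x assume "x \<in> (\<Union>\<gamma>\<in>?Hom. fixp X P (\<lambda>u. u) \<gamma>)"
    then obtain \<gamma> where g: "\<gamma> \<in> ?Hom" "x \<in> fixp X P (\<lambda>u. u) \<gamma>" by blast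
    have "\<gamma> u \<in> carrier H" if "u \<in> P" for u using g(1) that hom_image by fastforce
    then show "x \<in> {x\<in>points X. \<forall>u\<in>P. \<exists>h\<in>carrier H. lact X h x = ract X x u}"
      using g(2) unfolding fixp_def by blast
  qed
  have n1: "card (\<Union>?fix) = (\<Sum>\<gamma>\<in>?Hom. card (fixp X P (\<lambda>u. u) \<gamma>))"
    unfolding Ufix UN
  proof (rule card_UN_disjoint)
    show "finite ?Hom" using finite_homs[of "G\<lparr>carrier := P\<rparr>" H] finP finH by simp
    show "\<forall>\<gamma>\<in>?Hom. finite (fixp X P (\<lambda>u. u) \<gamma>)" using finite_points by (simp add: fixp_def)
    show "\<forall>\<gamma>\<in>?Hom. \<forall>\<gamma>'\<in>?Hom. \<gamma> \<noteq> \<gamma>' \<longrightarrow> fixp X P (\<lambda>u. u) \<gamma> \<inter> fixp X P (\<lambda>u. u) \<gamma>' = {}"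
    proof (intro ballI impI, rule ccontr)
      fix \<gamma> \<gamma>' assume g: "\<gamma> \<in> ?Hom" "\<gamma>' \<in> ?Hom" "\<gamma> \<noteq> \<gamma>'" "fixp X P (\<lambda>u. u) \<gamma> \<inter> fixp X P (\<lambda>u. u) \<gamma>' \<noteq> {}"
      then obtain x where x: "x \<in> fixp X P (\<lambda>u. u) \<gamma>" "x \<in> fixp X P (\<lambda>u. u) \<gamma>'" by blast
      have "\<gamma> = \<gamma>'"
      proof (rule extensionalityI[of _ P])
        fix u assume u: "u \<in> P"
        have gc: "\<gamma> u \<in> carrier H" "\<gamma>' u \<in> carrier H"
          using hom_image[OF IntD1[OF g(1)]] hom_image[OF IntD1[OF g(2)]] u by auto
        show "\<gamma> u = \<gamma>' u" using x u by (intro cancel[OF _ gc, of x]) (simp_all add: fixp_def)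
      qed (use g in auto)
      then show False using g(3) by simp
    qed
  qed
  have n2: "card (\<Union>?fix) = card (carrier H) * card ?fix" by (rule count[symmetric]) blast
  have n3: "card (points X) = card (carrier H) * card Orbs" using count[OF order_refl] UO by simp
  have "int (\<Sum>\<gamma>\<in>?Hom. card (fixp X P (\<lambda>u. u) \<gamma>)) = int (card (carrier H)) * int (card ?fix)"
    unfolding n1[symmetric] n2 of_nat_mult by (rule refl)
  also have "\<dots> = int (card (points X)) + i * int p * int (card (carrier H))"
    unfolding i n3 of_nat_mult by (simp add: algebra_simps)
  finally have "int (\<Sum>\<gamma>\<in>?Hom. card (fixp X P (\<lambda>u. u) \<gamma>)) =
     int (card (points X)) + i * int p * int (card (carrier H))" .
  then show ?thesis by blast
qed

lemma Z_loc_not_inverse_p: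
  assumes "prime p" "z \<in> Z_loc p"
  shows "of_nat p * z \<noteq> (1 :: rat)"
proof
  assume e: "of_nat p * z = 1"
  obtain i j where ij: "z = of_int i / of_int j" "\<not> int p dvd j" using assms(2) by (auto simp: Z_loc_def)
  then have "j \<noteq> 0" by auto
  then have "rat_of_int (int p * i) = rat_of_int j" using e unfolding ij(1) by (simp add: field_simps)
  then have "int p * i = j" by (simp only: of_int_eq_iff)
  then show False using ij(2) by auto
qed

lemma Z_loc_sum:
  assumes "prime p" "\<And>i. i \<in> A \<Longrightarrow> f i \<in> Z_loc p"
  shows "sum f A \<in> Z_loc p"
  using assms(2)
  by (induction A rule: infinite_finite_induct) (simp_all add: Z_loc_0[OF assms(1)] Z_loc_simps(2)[OF assms(1)])

text \<open>At the empty index set every point is fixed; so the augmentation is a mark up to a factor, and it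
  is well defined on classes because marks are.\<close>

lemma formal_augmentation_mark:
  "formal_augmentation S y = mark y ({} :: nat set) (\<lambda>_. undefined) (\<lambda>_. undefined) / of_nat (order S)"
  by (simp add: formal_augmentation_def mark_def lin_def rep_def fixp_def sum_divide_distrib)

lemma augmentation_burnside_of:
  assumes p: "prime p" and x: "x \<in> formal_sums p S S"
  shows "augmentation S (burnside_of p S S x) = formal_augmentation S x"
proof -
  have "formal_augmentation S y = formal_augmentation S x" if y: "y \<in> burnside_of p S S x" for y
    unfolding formal_augmentation_mark
    using mark_well_defined[OF p _ _ x, of y "\<lambda>_. undefined" "{} :: nat set" "\<lambda>_. undefined"] burnside_of_mem[OF p x, of y] y
    by simp
  moreover have "x \<in> burnside_of p S S x" using burnside_of_mem[OF p x] x by blast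
  ultimately have "formal_augmentation S ` burnside_of p S S x = {formal_augmentation S x}" by (metis (no_types, lifting) image_cong image_constant)
  then show ?thesis by (simp add: augmentation_def)
qed

text \<open>A representing formal sum all of whose bisets are transitive ones attached to morphisms; it is
  then supported on bifree bisets, to which the product formula for marks applies.\<close>

locale characteristic_representative = fusion_system S F for S (structure) and F +
  fixes p :: nat and x :: "('a, 'a) formal_sum"
  assumes pS: "p_group p S" and x: "x \<in> formal_sums p S S"
    and keys: "\<And>c. c \<in> Poly_Mapping.keys x \<Longrightarrow>
      \<exists>P \<phi>. subgroup P S \<and> \<phi> \<in> F P (carrier S) \<and> c = iso_class S S (coset_biset S S P \<phi>)"
    and char: "characteristic_idempotent p S F (burnside_of p S S x)"
begin

lemma prime_p: "prime p" and p_order: "\<exists>k. order S = p ^ k" and finS: "finite (carrier S)"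
proof -
  show p: "prime p" and k: "\<exists>k. order S = p ^ k" using pS by (auto simp: p_group_def)
  show "finite (carrier S)" using k p by (metis card.infinite order_def power_not_zero not_prime_0)
qed

lemma mor_hom:
  assumes P: "subgroup P S" and f: "morph P f"
  shows "f \<in> hom (S\<lparr>carrier := P\<rparr>) S"
  using morph_facts[OF P f] by (intro homI) auto

lemma coset: "subgroup P S \<Longrightarrow> morph P \<phi> \<Longrightarrow> coset_data S S P \<phi>"
  using mor_hom[of P \<phi>] by (intro coset_data.intro coset_data_axioms.intro is_group finS)

lemma key_cases:
  assumes "c \<in> Poly_Mapping.keys x"
  obtains P \<phi> where "subgroup P S" "morph P \<phi>" "is_biset S S (coset_biset S S P \<phi>)"
    "biset_iso S S (coset_biset S S P \<phi>) (rep c)"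
proof -
  obtain P \<phi> where P: "subgroup P S" "\<phi> \<in> F P (carrier S)" "c = iso_class S S (coset_biset S S P \<phi>)"
    using keys[OF assms] by blast
  have m: "morph P \<phi>" using P(2) mem_iff[OF P(1) carrier_subgroup] by blast
  note b = coset_data.is_biset[OF coset[OF P(1) m]]
  show ?thesis by (rule that[OF P(1) m b]) (use rep_iso_class(2)[OF b] P(3) in simp)
qed

lemma key_left_free: "c \<in> Poly_Mapping.keys x \<Longrightarrow> left_free S (rep c)"
proof -
  assume c: "c \<in> Poly_Mapping.keys x"
  obtain P \<phi> where P: "subgroup P S" "morph P \<phi>" "is_biset S S (coset_biset S S P \<phi>)"
    "biset_iso S S (coset_biset S S P \<phi>) (rep c)" by (rule key_cases[OF c])
  show ?thesis by (rule left_free_iso[OF P(4,3) coset_data.left_free[OF coset[OF P(1,2)]]])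
qed

lemma key_right_free: "c \<in> Poly_Mapping.keys x \<Longrightarrow> right_free S (rep c)"
proof -
  assume c: "c \<in> Poly_Mapping.keys x"
  obtain P \<phi> where P: "subgroup P S" "morph P \<phi>" "is_biset S S (coset_biset S S P \<phi>)"
    "biset_iso S S (coset_biset S S P \<phi>) (rep c)" by (rule key_cases[OF c])
  show ?thesis
    by (rule right_free_iso[OF P(4,3) coset_data.right_free[OF coset[OF P(1,2)] morph_facts(1)[OF P(1,2)]]])
qed

lemma mark_nonzero_key:
  assumes "mark x L \<alpha> \<beta> \<noteq> 0"
  obtains c where "c \<in> Poly_Mapping.keys x" "fixp (rep c) L \<alpha> \<beta> \<noteq> {}"
proof (rule ccontr)
  assume a: "\<not> thesis"
  note ex = that
  have z: "fixp (rep c) L \<alpha> \<beta> = {}" if c: "c \<in> Poly_Mapping.keys x" for c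
    by (rule ccontr) (rule notE[OF a ex[OF c]], assumption)
  have "mark x L \<alpha> \<beta> = 0" unfolding mark_def lin_def by (rule sum.neutral) (simp add: z)
  then show False using assms by simp
qed

lemma mark_support:
  assumes \<alpha>: "subgroup (\<alpha> ` L) S" and \<beta>: "\<beta> ` L \<subseteq> carrier S" and nz: "mark x L \<alpha> \<beta> \<noteq> 0"
  shows "\<exists>f. morph (\<alpha> ` L) f \<and> (\<forall>u\<in>L. \<beta> u = f (\<alpha> u))"
proof -
  have \<alpha>c: "\<alpha> ` L \<subseteq> carrier S" by (rule subgroup.subset[OF \<alpha>])
  obtain c where c: "c \<in> Poly_Mapping.keys x" "fixp (rep c) L \<alpha> \<beta> \<noteq> {}"
    by (rule mark_nonzero_key[OF nz])
  obtain P \<phi> where P: "subgroup P S" "morph P \<phi>" "is_biset S S (coset_biset S S P \<phi>)"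
    "biset_iso S S (coset_biset S S P \<phi>) (rep c)" by (rule key_cases[OF c(1)])
  have "finite (fixp (rep c) L \<alpha> \<beta>)"
    using is_biset.finite_points[OF formal_sums_rep[OF x c(1)]] by (simp add: fixp_def)
  then have "card (fixp (rep c) L \<alpha> \<beta>) > 0" unfolding card_gt_0_iff using c(2) by blast
  then have "card (fixp (coset_biset S S P \<phi>) L \<alpha> \<beta>) > 0"
    unfolding fixp_iso[OF P(4) \<alpha>c \<beta> P(3)] .
  then have "card P * card (fixp (coset_biset S S P \<phi>) L \<alpha> \<beta>) > 0"
    using coset_data.card_U_pos[OF coset[OF P(1,2)]] by simp
  then have "{(a, b) \<in> carrier S \<times> carrier S. \<forall>u\<in>L. inv b \<otimes> \<alpha> u \<otimes> b \<in> P \<and>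
      \<phi> (inv b \<otimes> \<alpha> u \<otimes> b) = inv a \<otimes> \<beta> u \<otimes> a} \<noteq> {}" (is "?B \<noteq> {}")
    unfolding coset_data.card_fixp[OF coset[OF P(1,2)] \<alpha>c \<beta>] card_gt_0_iff by (rule conjunct1)
  then obtain z where z: "z \<in> ?B" by (meson ex_in_conv)
  obtain a b where "z = (a, b)" by (cases z)
  then have ab: "a \<in> carrier S" "b \<in> carrier S" "\<And>u. u \<in> L \<Longrightarrow> inv b \<otimes> \<alpha> u \<otimes> b \<in> P"
      "\<And>u. u \<in> L \<Longrightarrow> \<phi> (inv b \<otimes> \<alpha> u \<otimes> b) = inv a \<otimes> \<beta> u \<otimes> a"
    using z by simp_all
  define f where "f v = conj_by S a (\<phi> (conj_by S (inv b) v))" for v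
  have im: "conj_by S (inv b) ` \<alpha> ` L \<subseteq> P" using ab(2,3) by (auto simp: conj_by_def)
  have m1: "morph (\<alpha> ` L) (conj_by S (inv b))" using morph_conj[OF \<alpha>] ab(2) by simp
  have s1: "subgroup (conj_by S (inv b) ` \<alpha> ` L) S" by (rule morph_facts(4)[OF \<alpha> m1])
  have m2: "morph (\<alpha> ` L) (\<lambda>v. \<phi> (conj_by S (inv b) v))"
    by (rule morph_comp[OF \<alpha> m1 morph_subset[OF P(1,2) s1 im]])
  have m3: "morph (\<alpha> ` L) f" unfolding f_def
    by (rule morph_comp[OF \<alpha> m2 morph_conj[OF morph_facts(4)[OF \<alpha> m2] ab(1)]])
  have "\<beta> u = f (\<alpha> u)" if u: "u \<in> L" for u
  proof -
    have "\<beta> u \<in> carrier S" using \<beta> u by blast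
    then show ?thesis
      using ab(4)[OF u] ab(1,2) conj_by_inv(2)[OF is_group ab(1), of "\<beta> u"] by (simp add: f_def conj_by_def)
  qed
  then show ?thesis using m3 by blast
qed

lemma right_stable_mark:
  fixes M :: "('u, 'w) monoid_scheme"
  assumes P: "subgroup P S" and \<phi>: "\<phi> \<in> F P (carrier S)"
    and M: "group M" "finite (carrier M)" and \<alpha>: "\<alpha> \<in> hom M (S\<lparr>carrier := P\<rparr>)" and \<beta>: "\<beta> \<in> hom M S"
  shows "mark x (carrier M) (\<lambda>u. \<phi> (\<alpha> u)) \<beta> = mark x (carrier M) \<alpha> \<beta>"
proof -
  let ?P = "S\<lparr>carrier := P\<rparr>"
  have gP: "group ?P" by (rule subgroup_imp_group[OF P])
  have finP: "finite (carrier ?P)" using finS subgroup.subset[OF P] finite_subset by auto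
  have *: "mark (formal_comp ?P S S x (basic_formal ?P S P f)) (carrier M) \<alpha> \<beta> = mark x (carrier M) (\<lambda>u. f (\<alpha> u)) \<beta>"
    "basic_formal ?P S P f \<in> formal_sums p ?P S" if f: "morph P f" for f
  proof -
    have h: "f \<in> hom ?P S" by (rule mor_hom[OF P f])
    show "mark (formal_comp ?P S S x (basic_formal ?P S P f)) (carrier M) \<alpha> \<beta> = mark x (carrier M) (\<lambda>u. f (\<alpha> u)) \<beta>"
      using mark_comp_restriction[OF prime_p gP is_group finP finS h x key_right_free M \<alpha> \<beta>] by simp
    have "coset_data ?P S P f"
      by (intro coset_data.intro coset_data_axioms.intro gP is_group finP finS) (use group.subgroup_self[OF gP] h in simp_all)
    then show "basic_formal ?P S P f \<in> formal_sums p ?P S" by (rule coset_data.basic_formal_sums[OF _ prime_p])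
  qed
  have \<phi>m: "morph P \<phi>" using \<phi> mem_iff[OF P carrier_subgroup] by blast
  have idm: "morph P id" using morph_id[OF P] by (simp add: id_def)
  have "right_stable p S F (burnside_of p S S x)"
    using char by (simp add: characteristic_idempotent_def F_characteristic_def)
  then have "burnside_comp p ?P S S (burnside_of p S S x) (basic p ?P S P \<phi>) =
     burnside_comp p ?P S S (burnside_of p S S x) (basic p ?P S P id)"
    using P \<phi> unfolding right_stable_def by blast
  then have "burnside_of p ?P S (formal_comp ?P S S x (basic_formal ?P S P \<phi>)) =
      burnside_of p ?P S (formal_comp ?P S S x (basic_formal ?P S P id))"
    by (simp add: basic_def burnside_comp_of[OF prime_p x *(2)] \<phi>m idm)
  then have "mark (formal_comp ?P S S x (basic_formal ?P S P \<phi>)) (carrier M) \<alpha> \<beta> =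
      mark (formal_comp ?P S S x (basic_formal ?P S P id)) (carrier M) \<alpha> \<beta>"
    by (rule mark_well_defined[OF prime_p]) (intro formal_comp_closed[OF prime_p x] *(2) \<phi>m idm hom_image[OF \<alpha>] hom_image[OF \<beta>])+
  then show ?thesis by (simp add: *(1)[OF \<phi>m] *(1)[OF idm])
qed

lemma left_stable_mark:
  fixes M :: "('u, 'w) monoid_scheme"
  assumes P: "subgroup P S" and \<phi>: "\<phi> \<in> F P (carrier S)"
    and M: "group M" "finite (carrier M)" and \<alpha>: "\<alpha> \<in> hom M S" and \<beta>: "\<beta> \<in> hom M (S\<lparr>carrier := P\<rparr>)"
  shows "mark x (carrier M) \<alpha> (\<lambda>u. \<phi> (\<beta> u)) = mark x (carrier M) \<alpha> \<beta>"
proof -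
  let ?P = "S\<lparr>carrier := P\<rparr>"
  have gP: "group ?P" by (rule subgroup_imp_group[OF P])
  have finP: "finite (carrier ?P)" using finS subgroup.subset[OF P] finite_subset by auto
  have *: "mark (formal_comp S S ?P (basic_formal S ?P V t) x) (carrier M) \<alpha> \<beta> = mark x (carrier M) \<alpha> (\<lambda>u. f (\<beta> u))"
    "basic_formal S ?P V t \<in> formal_sums p S ?P"
    if f: "morph P f" "f ` P = V" "\<And>u. u \<in> P \<Longrightarrow> t (f u) = u" for f V t
  proof -
    have h: "f \<in> hom ?P S" by (rule mor_hom[OF P f(1)])
    have V: "subgroup V S" using morph_facts(4)[OF P f(1)] f(2) by simp
    have th: "t \<in> hom (S\<lparr>carrier := V\<rparr>) ?P"
    proof (rule homI)
      fix v assume "v \<in> carrier (S\<lparr>carrier := V\<rparr>)"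
      then obtain u where u: "u \<in> P" "v = f u" using f(2) by auto
      then show "t v \<in> carrier ?P" using f(3) by simp
      fix w assume "w \<in> carrier (S\<lparr>carrier := V\<rparr>)"
      then obtain u' where u': "u' \<in> P" "w = f u'" using f(2) by auto
      have "v \<otimes> w = f (u \<otimes> u')" using u u' morph_facts(3)[OF P f(1)] by simp
      then show "t (v \<otimes>\<^bsub>S\<lparr>carrier := V\<rparr>\<^esub> w) = t v \<otimes>\<^bsub>?P\<^esub> t w"
        using u u' f(3) subgroup.m_closed[OF P] by simp
    qed
    show "mark (formal_comp S S ?P (basic_formal S ?P V t) x) (carrier M) \<alpha> \<beta> = mark x (carrier M) \<alpha> (\<lambda>u. f (\<beta> u))"
      by (rule mark_comp_induction[OF prime_p gP is_group finP finS V th h _ _ x M \<alpha> \<beta>]) (simp_all add: f)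
    have "coset_data S ?P V t"
      by (intro coset_data.intro coset_data_axioms.intro gP is_group finP finS V th)
    then show "basic_formal S ?P V t \<in> formal_sums p S ?P" by (rule coset_data.basic_formal_sums[OF _ prime_p])
  qed
  have \<phi>m: "morph P \<phi>" using \<phi> mem_iff[OF P carrier_subgroup] by blast
  have inj: "inj_on \<phi> P" by (rule morph_facts(1)[OF P \<phi>m])
  have idm: "morph P id" using morph_id[OF P] by (simp add: id_def)
  note 1 = *[OF \<phi>m refl inv_into_f_f[OF inj]]
  have 2: "mark (formal_comp S S ?P (basic_formal S ?P P id) x) (carrier M) \<alpha> \<beta> = mark x (carrier M) \<alpha> (\<lambda>u. id (\<beta> u))"
    "basic_formal S ?P P id \<in> formal_sums p S ?P"
    by (rule *[OF idm]; simp)+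
  have "left_stable p S F (burnside_of p S S x)"
    using char by (simp add: characteristic_idempotent_def F_characteristic_def)
  then have "burnside_comp p S S ?P (basic p S ?P (\<phi> ` P) (inv_into P \<phi>)) (burnside_of p S S x) =
     burnside_comp p S S ?P (basic p S ?P P id) (burnside_of p S S x)"
    using P \<phi> unfolding left_stable_def by blast
  then have "burnside_of p S ?P (formal_comp S S ?P (basic_formal S ?P (\<phi> ` P) (inv_into P \<phi>)) x) =
      burnside_of p S ?P (formal_comp S S ?P (basic_formal S ?P P id) x)"
    by (simp only: basic_def burnside_comp_of[OF prime_p 1(2) x] burnside_comp_of[OF prime_p 2(2) x])
  then have "mark (formal_comp S S ?P (basic_formal S ?P (\<phi> ` P) (inv_into P \<phi>)) x) (carrier M) \<alpha> \<beta> =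
      mark (formal_comp S S ?P (basic_formal S ?P P id) x) (carrier M) \<alpha> \<beta>"
    by (rule mark_well_defined[OF prime_p _ formal_comp_closed[OF prime_p 1(2) x]
          formal_comp_closed[OF prime_p 2(2) x] hom_image[OF \<alpha>] hom_image[OF \<beta>]])
  then show ?thesis by (simp add: 1(1) 2(1))
qed

lemma mark_const:
  assumes P: "subgroup P S" and \<alpha>: "\<alpha> \<in> F P (carrier S)" and \<beta>: "\<beta> \<in> F P (carrier S)"
  shows "mark x P \<alpha> \<beta> = mark x P (\<lambda>u. u) (\<lambda>u. u)"
proof -
  let ?P = "S\<lparr>carrier := P\<rparr>"
  have gP: "group ?P" by (rule subgroup_imp_group[OF P])
  have finP: "finite (carrier ?P)" using finS subgroup.subset[OF P] finite_subset by auto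
  have i: "(\<lambda>u. u) \<in> hom ?P ?P" by (rule homI) auto
  have iS: "(\<lambda>u. u) \<in> hom ?P S" using subgroup.subset[OF P] by (intro homI) auto
  have \<beta>h: "\<beta> \<in> hom ?P S" using mor_hom[OF P] \<beta> mem_iff[OF P carrier_subgroup] by blast
  show ?thesis
    using right_stable_mark[OF P \<alpha> gP finP i \<beta>h] left_stable_mark[OF P \<beta> gP finP iS i] by simp
qed

text \<open>Let \<open>m\<close> be the mark.  Idempotency and constancy on morphisms give \<open>|S| m = |F(P, S)| m\<^sup>2\<close>.  If \<open>m\<close>
  were \<open>0\<close>, all marks at \<open>(id, \<gamma>)\<close> would vanish, and the augmentation, which is congruent to their
  normalized sum modulo \<open>p\<close>, would not be a unit.\<close>

lemma mark_value:
  assumes P: "subgroup P S"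
  shows "mark x P (\<lambda>u. u) (\<lambda>u. u) = of_nat (order S) / of_nat (card (F P (carrier S)))"
proof -
  let ?P = "S\<lparr>carrier := P\<rparr>" and ?i = "\<lambda>u :: 'a. u" and ?F = "F P (carrier S)"
  define m where "m = mark x P ?i ?i"
  have gP: "group ?P" by (rule subgroup_imp_group[OF P])
  have finP: "finite (carrier ?P)" using finS subgroup.subset[OF P] finite_subset by auto
  have iS: "?i \<in> hom ?P S" using subgroup.subset[OF P] by (intro homI) auto
  have finHom: "finite (homs ?P S)" by (rule finite_homs[OF finP finS])
  have FHom: "?F \<subseteq> homs ?P S"
  proof
    fix \<phi> assume "\<phi> \<in> ?F"
    then show "\<phi> \<in> homs ?P S" using mor_hom[OF P, of \<phi>] mem_iff[OF P carrier_subgroup, of \<phi>] by simp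
  qed
  have Fne: "card ?F > 0"
    using incl_mem[OF P carrier_subgroup subgroup.subset[OF P]] finite_subset[OF FHom finHom]
    unfolding card_gt_0_iff by blast
  have zero: "mark x P ?i \<gamma> = 0" if \<gamma>: "\<gamma> \<in> homs ?P S - ?F" for \<gamma>
  proof (rule ccontr)
    assume nz: "mark x P ?i \<gamma> \<noteq> 0"
    have im: "\<gamma> ` P \<subseteq> carrier S" using hom_image[of \<gamma> ?P S] \<gamma> by simp
    have "subgroup (?i ` P) S" using P by simp
    from mark_support[OF this im nz] obtain f where f: "morph P f" "\<And>u. u \<in> P \<Longrightarrow> \<gamma> u = f u" by auto
    have "morph P \<gamma>" using f morph_cong[of P \<gamma> f] by simp
    then have "\<gamma> \<in> ?F" using \<gamma> im mem_iff[OF P carrier_subgroup, of \<gamma>] by simp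
    then show False using \<gamma> by simp
  qed
  have idF: "(\<lambda>u\<in>P. u) \<in> ?F" by (rule incl_mem[OF P carrier_subgroup subgroup.subset[OF P]])
  have left: "mark x P ?i \<gamma> = m" if "\<gamma> \<in> ?F" for \<gamma>
  proof -
    have "mark x P (\<lambda>u\<in>P. u) \<gamma> = mark x P ?i \<gamma>" by (rule mark_cong) simp_all
    then show ?thesis using mark_const[OF P idF that] unfolding m_def by simp
  qed
  have right: "mark x P \<gamma> ?i = m" if "\<gamma> \<in> ?F" for \<gamma>
  proof -
    have "mark x P \<gamma> (\<lambda>u\<in>P. u) = mark x P \<gamma> ?i" by (rule mark_cong) simp_all
    then show ?thesis using mark_const[OF P that idF] unfolding m_def by simp
  qed
  have "burnside_of p S S (formal_comp S S S x x) = burnside_of p S S x"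
    using char burnside_comp_of[OF prime_p x x] by (simp add: characteristic_idempotent_def)
  then have "mark (formal_comp S S S x x) P ?i ?i = m" unfolding m_def
    by (rule mark_well_defined[OF prime_p]) (use formal_comp_closed[OF prime_p x x] x subgroup.subset[OF P] in auto)
  then have "of_nat (card (carrier S)) * m = (\<Sum>\<gamma>\<in>homs ?P S. mark x P ?i \<gamma> * mark x P \<gamma> ?i)"
    using mark_formal_comp[OF x x gP finP finS iS iS key_right_free] by simp
  also have "\<dots> = (\<Sum>\<gamma>\<in>?F. mark x P ?i \<gamma> * mark x P \<gamma> ?i)"
    by (rule sum.mono_neutral_right[OF finHom FHom]) (simp add: zero)
  also have "\<dots> = of_nat (card ?F) * (m * m)" by (simp add: left right)
  finally have quad: "of_nat (order S) * m = of_nat (card ?F) * (m * m)" by (simp add: order_def)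
  have "m \<noteq> 0"
  proof
    assume m0: "m = 0"
    obtain k where k: "order S = p ^ k" using p_order by blast
    obtain j where j: "card P = p ^ j" using subgroup_order_p_power[OF prime_p is_group k P] by blast
    have "\<exists>i::int. int (\<Sum>\<gamma>\<in>homs ?P S. card (fixp (rep c) P ?i \<gamma>)) =
      int (card (points (rep c))) + i * int p * int (card (carrier S))" if c: "c \<in> Poly_Mapping.keys x" for c
      by (rule sum_fixp_mod_p[OF formal_sums_rep[OF x c] key_left_free[OF c] finS prime_p P j])
    then obtain i where i: "\<And>c. c \<in> Poly_Mapping.keys x \<Longrightarrow> int (\<Sum>\<gamma>\<in>homs ?P S. card (fixp (rep c) P ?i \<gamma>)) =
      int (card (points (rep c))) + i c * int p * int (card (carrier S))" by metis
    have i': "(\<Sum>\<gamma>\<in>homs ?P S. of_nat (card (fixp (rep c) P ?i \<gamma>))) =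
      of_nat (card (points (rep c))) + of_int (i c) * of_nat p * (of_nat (order S) :: rat)"
      if "c \<in> Poly_Mapping.keys x" for c
      using arg_cong[OF i[OF that], of rat_of_int] by (simp add: order_def)
    define z where "z = (\<Sum>c\<in>Poly_Mapping.keys x. Poly_Mapping.lookup x c * of_int (i c))"
    have z: "z \<in> Z_loc p" unfolding z_def
      by (intro Z_loc_sum[OF prime_p] Z_loc_simps(3)[OF prime_p] Z_loc_simps(1)[OF prime_p])
        (use x in \<open>auto simp: formal_sums_def\<close>)
    have "0 = (\<Sum>\<gamma>\<in>homs ?P S. mark x P ?i \<gamma>)"
    proof (rule sum.neutral[symmetric], rule ballI)
      fix \<gamma> assume "\<gamma> \<in> homs ?P S"
      then show "mark x P ?i \<gamma> = 0" using zero[of \<gamma>] left[of \<gamma>] m0 by blast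
    qed
    also have "\<dots> = (\<Sum>c\<in>Poly_Mapping.keys x. \<Sum>\<gamma>\<in>homs ?P S. Poly_Mapping.lookup x c * of_nat (card (fixp (rep c) P ?i \<gamma>)))"
      unfolding mark_def lin_def by (rule sum.swap)
    also have "\<dots> = (\<Sum>c\<in>Poly_Mapping.keys x. Poly_Mapping.lookup x c *
        (of_nat (card (points (rep c))) + of_int (i c) * of_nat p * of_nat (order S)))"
      unfolding sum_distrib_left[symmetric] by (rule sum.cong[OF refl]) (simp only: i')
    also have "\<dots> = of_nat (order S) * (formal_augmentation S x + of_nat p * z)"
      using k prime_p by (simp add: formal_augmentation_def rep_def z_def sum_distrib_left sum.distrib
          algebra_simps prime_gt_0_nat)
    finally have "formal_augmentation S x + of_nat p * z = 0"
      using k prime_gt_0_nat[OF prime_p] by simp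
    then have aug: "formal_augmentation S x = of_nat p * (- z)" by (simp add: eq_neg_iff_add_eq_0)
    obtain b where b: "b \<in> Z_loc p" "augmentation S (burnside_of p S S x) * b = 1"
      using char by (auto simp: characteristic_idempotent_def F_characteristic_def)
    then have "of_nat p * (- z * b) = 1"
      using augmentation_burnside_of[OF prime_p x] aug by simp
    then show False
      using Z_loc_not_inverse_p[OF prime_p Z_loc_simps(3)[OF prime_p Z_loc_simps(4)[OF prime_p z] b(1)]] by simp
  qed
  then have "of_nat (order S) = of_nat (card ?F) * m" using quad by simp
  then show ?thesis using Fne unfolding m_def[symmetric] by (simp add: field_simps)
qed

text \<open>For maps \<open>\<alpha>\<close> and \<open>\<beta>\<close> from any group, the mark is the one computed on the image of \<open>\<alpha>\<close>, because a
  nonzero mark forces \<open>\<beta>\<close> to factor through \<open>\<alpha>\<close>.\<close>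

theorem characteristic_mark:
  fixes M :: "('u, 'w) monoid_scheme"
  assumes M: "group M" and \<alpha>: "\<alpha> \<in> hom M S" and \<beta>: "\<beta> \<in> hom M S"
  shows "mark x (carrier M) \<alpha> \<beta> =
    (if \<exists>f. morph (\<alpha> ` carrier M) f \<and> (\<forall>u\<in>carrier M. \<beta> u = f (\<alpha> u))
     then of_nat (order S) / of_nat (card (F (\<alpha> ` carrier M) (carrier S))) else 0)"
proof -
  let ?Q = "\<alpha> ` carrier M"
  have "group_hom M S \<alpha>" using M \<alpha> by (simp add: group_hom_def group_hom_axioms_def is_group)
  then have Q: "subgroup ?Q S" by (rule group_hom.img_is_subgroup)
  show ?thesis
  proof (cases "\<exists>f. morph ?Q f \<and> (\<forall>u\<in>carrier M. \<beta> u = f (\<alpha> u))")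
    case True
    then obtain f where f: "morph ?Q f" "\<And>u. u \<in> carrier M \<Longrightarrow> \<beta> u = f (\<alpha> u)" by blast
    have "mark x (carrier M) \<alpha> \<beta> = mark x (carrier M) (\<lambda>u. \<alpha> u) (\<lambda>u. f (\<alpha> u))"
      by (rule mark_cong) (simp_all add: f(2))
    also have "\<dots> = mark x ?Q (\<lambda>u. u) f" by (rule mark_image[where \<alpha> = "\<lambda>u. u"])
    also have "\<dots> = mark x ?Q (\<lambda>u\<in>?Q. u) (restrict f ?Q)" by (rule mark_cong) simp_all
    also have "\<dots> = mark x ?Q (\<lambda>u. u) (\<lambda>u. u)"
      by (rule mark_const[OF Q incl_mem[OF Q carrier_subgroup subgroup.subset[OF Q]]])
        (use f(1) in \<open>simp add: morph_def\<close>)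
    finally show ?thesis using True mark_value[OF Q] by simp
  next
    case False
    then show ?thesis using mark_support[OF Q hom_image[OF \<beta>]] by auto
  qed
qed

end

lemma ex_characteristic_representative:
  fixes S :: "('a, 'm) monoid_scheme"
  assumes pS: "p_group p S" and F: "fusion_system S F" and char: "characteristic_idempotent p S F \<omega>"
  shows "\<exists>x. characteristic_representative S F p x \<and> \<omega> = burnside_of p S S x"
proof -
  interpret fusion_system S F by fact
  have p: "prime p" using pS by (simp add: p_group_def)
  obtain k where "order S = p ^ k" using pS unfolding p_group_def by (elim conjE exE)
  then have fin: "finite (carrier S)"
    using p by (metis card.infinite order_def power_not_zero not_prime_0)
  obtain I a where I: "finite I" "\<And>P \<phi>. (P, \<phi>) \<in> I \<Longrightarrow> subgroup P S \<and> \<phi> \<in> F P (carrier S) \<and> a (P, \<phi>) \<in> Z_loc p"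
    "\<omega> = burnside_of p S S (\<Sum>(P, \<phi>)\<in>I. Poly_Mapping.map ((*) (a (P, \<phi>))) (basic_formal S S P \<phi>))"
  proof -
    have "F_generated p S F \<omega>" using char by (simp add: characteristic_idempotent_def F_characteristic_def)
    then obtain I a where I: "finite I"
      "\<forall>(P, \<phi>)\<in>I. subgroup P S \<and> \<phi> \<in> F P (carrier S) \<and> a (P, \<phi>) \<in> Z_loc p"
      "\<omega> = burnside_of p S S (\<Sum>(P, \<phi>)\<in>I. Poly_Mapping.map ((*) (a (P, \<phi>))) (basic_formal S S P \<phi>))"
      unfolding F_generated_def by (elim exE conjE)
    show ?thesis by (rule that[OF I(1) _ I(3)]) (use I(2) in auto)
  qed
  define g where "g = (\<lambda>(P, \<phi>). Poly_Mapping.map ((*) (a (P, \<phi>))) (basic_formal S S P \<phi>))"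
  define x where "x = sum g I"
  have g: "g (P, \<phi>) = Poly_Mapping.single (iso_class S S (coset_biset S S P \<phi>)) (a (P, \<phi>))" for P \<phi>
    by (simp add: g_def basic_formal_def)
  have b: "is_biset S S (coset_biset S S P \<phi>)" if i: "(P, \<phi>) \<in> I" for P \<phi>
  proof -
    have P: "subgroup P S" and \<phi>: "\<phi> \<in> F P (carrier S)" using I(2)[OF i] by auto
    have "\<phi> \<in> hom (S\<lparr>carrier := P\<rparr>) S"
      using mor_facts[OF P carrier_subgroup \<phi>] by (intro homI) auto
    then show ?thesis
      by (intro coset_data.is_biset coset_data.intro coset_data_axioms.intro is_group fin P)
  qed
  have xf: "x \<in> formal_sums p S S" unfolding x_def
  proof (rule formal_sums_sum[OF p])
    fix i assume i: "i \<in> I"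
    obtain P \<phi> where e: "i = (P, \<phi>)" by (cases i)
    show "g i \<in> formal_sums p S S" unfolding e g
      by (rule formal_sums_single[OF p iso_class_in_biset_classes[OF b]]) (use i e I(2) in auto)
  qed
  have \<omega>: "\<omega> = burnside_of p S S x" unfolding x_def g_def I(3) by (rule refl)
  have keys: "\<exists>P \<phi>. subgroup P S \<and> \<phi> \<in> F P (carrier S) \<and> c = iso_class S S (coset_biset S S P \<phi>)"
    if c: "c \<in> Poly_Mapping.keys x" for c
  proof -
    have "c \<in> (\<Union>i\<in>I. Poly_Mapping.keys (g i))" using c keys_sum[of g I] unfolding x_def by (rule subsetD[rotated])
    then obtain i where i: "i \<in> I" "c \<in> Poly_Mapping.keys (g i)" by (rule UN_E)
    obtain P \<phi> where e: "i = (P, \<phi>)" by (cases i)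
    have "c = iso_class S S (coset_biset S S P \<phi>)" using i(2) unfolding e g by (simp split: if_splits)
    then show ?thesis using I(2)[of P \<phi>] i(1) unfolding e by blast
  qed
  have "characteristic_representative S F p x"
    by (intro characteristic_representative.intro characteristic_representative_axioms.intro F pS xf)
      (use keys char \<omega> in auto)
  then show ?thesis using \<omega> by blast
qed

section \<open>Comparing the two sides\<close>

text \<open>Elements of \<open>R\<close> lie in the same coset of \<open>T\<close> iff they lie in the same coset of \<open>R \<inter> T\<close>.\<close>

lemma (in group) card_set_mult:
  assumes fin: "finite (carrier G)" and R: "subgroup R G" and T: "subgroup T G"
  shows "card (R <#> T) * card (R \<inter> T) = card R * card T"
proof -
  interpret R: subgroup R G by fact
  interpret T: subgroup T G by fact
  have U: "subgroup (R \<inter> T) G" by (rule subgroups_Inter_pair[OF R T])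
  have eq: "x <# T = y <# T \<longleftrightarrow> x <# (R \<inter> T) = y <# (R \<inter> T)" if "x \<in> R" "y \<in> R" for x y
    using that by (simp add: l_coset_eq_iff[OF T] l_coset_eq_iff[OF U])
  have "bij_betw (\<lambda>C. C <#> T) ((\<lambda>x. x <# (R \<inter> T)) ` R) ((\<lambda>x. x <# T) ` R)"
  proof (rule bij_betw_imageI)
    have m: "(x <# (R \<inter> T)) <#> T = x <# T" if x: "x \<in> R" for x
    proof (rule equalityI)
      show "(x <# (R \<inter> T)) <#> T \<subseteq> x <# T"
        using x by (auto simp: set_mult_def l_coset_def m_assoc)
      show "x <# T \<subseteq> (x <# (R \<inter> T)) <#> T"
      proof
        fix z assume "z \<in> x <# T"
        then obtain t where t: "t \<in> T" "z = x \<otimes> t" by (auto simp: l_coset_def)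
        have "x \<in> x <# (R \<inter> T)" using x unfolding l_coset_def by (intro UN_I[of \<one>]) auto
        then show "z \<in> (x <# (R \<inter> T)) <#> T" using t unfolding set_mult_def by blast
      qed
    qed
    show "inj_on (\<lambda>C. C <#> T) ((\<lambda>x. x <# (R \<inter> T)) ` R)"
      by (rule inj_onI) (use m eq in auto)
    show "(\<lambda>C. C <#> T) ` (\<lambda>x. x <# (R \<inter> T)) ` R = (\<lambda>x. x <# T) ` R"
      unfolding image_image by (rule image_cong[OF refl m])
  qed
  then have "card ((\<lambda>x. x <# (R \<inter> T)) ` R) = card ((\<lambda>x. x <# T) ` R)" by (rule bij_betw_same_card)
  moreover have "R <#> (R \<inter> T) = R"
  proof (rule equalityI)
    show "R <#> (R \<inter> T) \<subseteq> R" by (auto simp: set_mult_def)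
    show "R \<subseteq> R <#> (R \<inter> T)"
    proof
      fix z assume "z \<in> R"
      then have "z = z \<otimes> \<one>" by simp
      then show "z \<in> R <#> (R \<inter> T)" using \<open>z \<in> R\<close> R.one_closed T.one_closed unfolding set_mult_def by blast
    qed
  qed
  ultimately have "card (R \<inter> T) * card ((\<lambda>x. x <# T) ` R) = card R"
    using card_l_cosets[OF U R.subset fin] by simp
  moreover have "card T * card ((\<lambda>x. x <# T) ` R) = card (R <#> T)" by (rule card_l_cosets[OF T R.subset fin])
  ultimately show ?thesis by (metis mult.assoc mult.commute)
qed

lemma (in fusion_system) card_mor_trivial:
  assumes "subgroup Q S" shows "card (F {\<one>} Q) = 1"
proof -
  have t: "subgroup {\<one>} S" by (rule triv_subgroup)
  have "F {\<one>} Q = {\<lambda>u\<in>{\<one>}. u}"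
  proof (intro equalityI subsetI)
    fix \<phi> assume "\<phi> \<in> F {\<one>} Q"
    then have \<phi>: "\<phi> \<in> extensional {\<one>}" "morph {\<one>} \<phi>" using mem_iff[OF t assms] by auto
    have "\<phi> = (\<lambda>u\<in>{\<one>}. u)"
      by (rule extensionalityI[of _ "{\<one>}"]) (use \<phi> morph_one[OF t \<phi>(2)] in simp_all)
    then show "\<phi> \<in> {\<lambda>u\<in>{\<one>}. u}" by simp
  next
    fix \<phi> assume "\<phi> \<in> {\<lambda>u\<in>{\<one>}. u}"
    then show "\<phi> \<in> F {\<one>} Q" using incl_mem[OF t assms] subgroup.one_closed[OF assms] by simp
  qed
  then show ?thesis by simp
qed

locale composition_idempotents = composition_setting S F p R T H K +
  XF: characteristic_representative S F p xF +
  XH: characteristic_representative "S\<lparr>carrier := R\<rparr>" H p xH +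
  XK: characteristic_representative "S\<lparr>carrier := T\<rparr>" K p xK
  for S :: "('a, 'm) monoid_scheme" (structure) and F p R T H K xF xH xK
begin

abbreviation "G\<^sub>R \<equiv> S\<lparr>carrier := R\<rparr>"
abbreviation "G\<^sub>T \<equiv> S\<lparr>carrier := T\<rparr>"

text \<open>Formal sums that represent the two sides of the equation between idempotents.\<close>

definition restricted :: "('a, 'a) formal_sum" where
  "restricted = formal_comp G\<^sub>T S G\<^sub>R (basic_formal S G\<^sub>R R id) (formal_comp G\<^sub>T S S xF (basic_formal G\<^sub>T S T id))"

definition composite :: "('a, 'a) formal_sum" where
  "composite = formal_comp G\<^sub>T G\<^sub>R G\<^sub>R xH (formal_comp G\<^sub>T G\<^sub>T G\<^sub>R (basic_formal G\<^sub>T G\<^sub>R U id) xK)"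

lemma carrier_RT: "carrier G\<^sub>R = R" "carrier G\<^sub>T = T"
  by simp_all

lemma gR: "group G\<^sub>R" and gT: "group G\<^sub>T"
  by (rule subgroup_imp_group[OF subR], rule subgroup_imp_group[OF subT])

lemma finR: "finite (carrier G\<^sub>R)" and finT: "finite (carrier G\<^sub>T)"
  using finite_subset[OF subgroup.subset[OF subR] finS] finite_subset[OF subgroup.subset[OF subT] finS] by simp_all

lemma prime: "prime p" by (rule KF.prime_p)

lemma id_hom: "A \<subseteq> B \<Longrightarrow> id \<in> hom (S\<lparr>carrier := A\<rparr>) (S\<lparr>carrier := B\<rparr>)"
  by (intro homI) auto

lemma id_hom_S: "subgroup A S \<Longrightarrow> id \<in> hom (S\<lparr>carrier := A\<rparr>) S"
  using subgroup.subset[of A S] by (intro homI) auto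

lemma hom_S: "subgroup A S \<Longrightarrow> \<alpha> \<in> hom M (S\<lparr>carrier := A\<rparr>) \<Longrightarrow> \<alpha> \<in> hom M S"
  using subgroup.subset[of A S] by (auto simp: hom_def)

lemma data_F: "coset_data G\<^sub>T S T id"
  by (intro coset_data.intro coset_data_axioms.intro gT is_group finT finS)
    (use group.subgroup_self[OF gT] id_hom_S[OF subT] in simp_all)

lemma data_R: "coset_data S G\<^sub>R R id"
  by (intro coset_data.intro coset_data_axioms.intro gR is_group finR finS subR id_hom order_refl)

lemma data_U: "coset_data G\<^sub>T G\<^sub>R U id"
  by (intro coset_data.intro coset_data_axioms.intro gR gT finR finT)
    (use subU id_hom[of U R] in \<open>simp_all add: K_sub\<close>)

lemma restricted_sums: "restricted \<in> formal_sums p G\<^sub>T G\<^sub>R"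
  and restricted_inner: "formal_comp G\<^sub>T S S xF (basic_formal G\<^sub>T S T id) \<in> formal_sums p G\<^sub>T S"
proof -
  show i: "formal_comp G\<^sub>T S S xF (basic_formal G\<^sub>T S T id) \<in> formal_sums p G\<^sub>T S"
    by (rule formal_comp_closed[OF prime XF.x coset_data.basic_formal_sums[OF data_F prime]])
  show "restricted \<in> formal_sums p G\<^sub>T G\<^sub>R" unfolding restricted_def
    by (rule formal_comp_closed[OF prime coset_data.basic_formal_sums[OF data_R prime] i])
qed

lemma composite_sums: "composite \<in> formal_sums p G\<^sub>T G\<^sub>R"
  and composite_inner: "formal_comp G\<^sub>T G\<^sub>T G\<^sub>R (basic_formal G\<^sub>T G\<^sub>R U id) xK \<in> formal_sums p G\<^sub>T G\<^sub>R"
proof -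
  show i: "formal_comp G\<^sub>T G\<^sub>T G\<^sub>R (basic_formal G\<^sub>T G\<^sub>R U id) xK \<in> formal_sums p G\<^sub>T G\<^sub>R"
    by (rule formal_comp_closed[OF prime coset_data.basic_formal_sums[OF data_U prime] XK.x])
  show "composite \<in> formal_sums p G\<^sub>T G\<^sub>R" unfolding composite_def
    by (rule formal_comp_closed[OF prime XH.x i])
qed

lemma burnside_restricted:
  "burnside_comp p G\<^sub>T S G\<^sub>R (basic p S G\<^sub>R R id)
    (burnside_comp p G\<^sub>T S S (burnside_of p S S xF) (basic p G\<^sub>T S T id)) = burnside_of p G\<^sub>T G\<^sub>R restricted"
  unfolding restricted_def basic_def
  by (simp only: burnside_comp_of[OF prime XF.x coset_data.basic_formal_sums[OF data_F prime]]
      burnside_comp_of[OF prime coset_data.basic_formal_sums[OF data_R prime] restricted_inner])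

lemma burnside_composite:
  "burnside_comp p G\<^sub>T G\<^sub>R G\<^sub>R (burnside_of p G\<^sub>R G\<^sub>R xH)
    (burnside_comp p G\<^sub>T G\<^sub>T G\<^sub>R (basic p G\<^sub>T G\<^sub>R U id) (burnside_of p G\<^sub>T G\<^sub>T xK)) = burnside_of p G\<^sub>T G\<^sub>R composite"
  unfolding composite_def basic_def
  by (simp only: burnside_comp_of[OF prime coset_data.basic_formal_sums[OF data_U prime] XK.x]
      burnside_comp_of[OF prime XH.x composite_inner])

lemma card_U_pos: "card U > 0"
  using coset_data.card_U_pos[OF data_U] .

context
  fixes M :: "('u, 'w) monoid_scheme" and \<alpha> \<beta> :: "'u \<Rightarrow> 'a"
  assumes M: "group M" "finite (carrier M)" and \<alpha>: "\<alpha> \<in> hom M G\<^sub>T" and \<beta>: "\<beta> \<in> hom M G\<^sub>R"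
begin

abbreviation "img \<equiv> \<alpha> ` carrier M"

lemma subP: "subgroup img S" "img \<subseteq> T"
proof -
  have "group_hom M G\<^sub>T \<alpha>" using M \<alpha> gT by (simp add: group_hom_def group_hom_axioms_def)
  from group_hom.img_is_subgroup[OF this] show "subgroup img S" "img \<subseteq> T" by (simp_all add: K_sub)
qed

lemma \<beta>R: "\<beta> u \<in> R" if "u \<in> carrier M"
  using hom_image[OF \<beta>] that by auto

lemma mark_restricted_F: "mark restricted (carrier M) \<alpha> \<beta> = mark xF (carrier M) \<alpha> \<beta>"
proof -
  have "mark restricted (carrier M) \<alpha> \<beta> =
    mark (formal_comp G\<^sub>T S S xF (basic_formal G\<^sub>T S T id)) (carrier M) \<alpha> (\<lambda>u. id (\<beta> u))"
    unfolding restricted_def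
    by (rule mark_comp_induction[OF prime gR is_group finR finS subR id_hom[OF order_refl] id_hom_S[OF subR] _ _
          restricted_inner M \<alpha> \<beta>]) simp_all
  also have "\<dots> = mark xF (carrier M) \<alpha> \<beta>"
    using mark_comp_restriction[OF prime gT is_group finT finS id_hom_S[OF subT] XF.x XF.key_right_free M \<alpha> hom_S[OF subR \<beta>]]
    by simp
  finally show ?thesis .
qed

lemma mark_restricted:
  assumes "\<phi> \<in> F img R" "\<And>u. u \<in> carrier M \<Longrightarrow> \<beta> u = \<phi> (\<alpha> u)"
  shows "mark restricted (carrier M) \<alpha> \<beta> = of_nat (card (carrier S)) / of_nat (card (F img (carrier S)))"
proof -
  have "morph img \<phi>" using assms(1) mem_iff[OF subP(1) subR] by blast
  then have "\<exists>f. morph img f \<and> (\<forall>u\<in>carrier M. \<beta> u = f (\<alpha> u))" using assms(2) by blast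
  then show ?thesis
    unfolding mark_restricted_F XF.characteristic_mark[OF M(1) hom_S[OF subT \<alpha>] hom_S[OF subR \<beta>]]
    by (simp add: order_def)
qed

lemma mark_restricted_nonzero:
  assumes "mark restricted (carrier M) \<alpha> \<beta> \<noteq> 0"
  shows "\<exists>\<phi>\<in>F img R. \<forall>u\<in>carrier M. \<beta> u = \<phi> (\<alpha> u)"
proof -
  obtain f where f: "morph img f" "\<forall>u\<in>carrier M. \<beta> u = f (\<alpha> u)"
    using assms unfolding mark_restricted_F XF.characteristic_mark[OF M(1) hom_S[OF subT \<alpha>] hom_S[OF subR \<beta>]]
    by (auto split: if_splits)
  have "f ` img \<subseteq> R" using f(2) \<beta>R by auto
  then have "restrict f img \<in> F img R" using f(1) restrict_mem_iff[OF subP(1) subR] by blast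
  moreover have "\<forall>u\<in>carrier M. \<beta> u = restrict f img (\<alpha> u)" using f(2) by simp
  ultimately show ?thesis by blast
qed

abbreviation "\<Gamma> \<equiv> {\<gamma>\<in>homs M G\<^sub>T. \<gamma> ` carrier M \<subseteq> U}"

lemma mark_composite_sum: "of_nat (card U) * mark composite (carrier M) \<alpha> \<beta> =
    (\<Sum>\<gamma>\<in>\<Gamma>. mark xK (carrier M) \<alpha> \<gamma> * mark xH (carrier M) \<gamma> \<beta>)"
  unfolding composite_def
  using coset_data.mark_comp_between[OF data_U prime inj_on_id XK.x XH.x XH.key_right_free M \<alpha> \<beta>] by simp

lemma \<Gamma>_hom_R:
  assumes "\<gamma> \<in> \<Gamma>" shows "\<gamma> \<in> hom M G\<^sub>R"
  using assms by (auto simp: hom_def)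

lemma mark_K: "\<gamma> \<in> \<Gamma> \<Longrightarrow> mark xK (carrier M) \<alpha> \<gamma> =
    (if \<exists>g. KF.LS.morph img g \<and> (\<forall>u\<in>carrier M. \<gamma> u = g (\<alpha> u)) then of_nat (card T) / of_nat (card (K img T)) else 0)"
proof -
  assume "\<gamma> \<in> \<Gamma>"
  then have "\<gamma> \<in> hom M G\<^sub>T" by simp
  from XK.characteristic_mark[OF M(1) \<alpha> this] show ?thesis by (simp only: order_def carrier_RT)
qed

lemma mark_H: "\<gamma> \<in> \<Gamma> \<Longrightarrow> mark xH (carrier M) \<gamma> \<beta> =
    (if \<exists>h. HS.morph (\<gamma> ` carrier M) h \<and> (\<forall>u\<in>carrier M. \<beta> u = h (\<gamma> u))
     then of_nat (card R) / of_nat (card (H (\<gamma> ` carrier M) R)) else 0)"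
proof -
  assume "\<gamma> \<in> \<Gamma>"
  from XH.characteristic_mark[OF M(1) \<Gamma>_hom_R[OF this] \<beta>] show ?thesis by (simp only: order_def carrier_RT)
qed

lemma nonzero_term:
  assumes \<gamma>: "\<gamma> \<in> \<Gamma>" and nz: "mark xK (carrier M) \<alpha> \<gamma> * mark xH (carrier M) \<gamma> \<beta> \<noteq> 0"
  shows "\<exists>g\<in>K img U. \<exists>\<eta>\<in>H (g ` img) R. \<gamma> = restrict (\<lambda>u. g (\<alpha> u)) (carrier M) \<and>
    (\<forall>u\<in>carrier M. \<beta> u = \<eta> (g (\<alpha> u)))"
proof -
  have KP: "subgroup img G\<^sub>T" using subP by (simp add: K_sub)
  obtain g where g: "KF.LS.morph img g" "\<And>u. u \<in> carrier M \<Longrightarrow> \<gamma> u = g (\<alpha> u)"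
    using nz unfolding mark_K[OF \<gamma>] by (auto split: if_splits)
  obtain h where h: "HS.morph (\<gamma> ` carrier M) h" "\<And>u. u \<in> carrier M \<Longrightarrow> \<beta> u = h (\<gamma> u)"
    using nz unfolding mark_H[OF \<gamma>] by (auto split: if_splits)
  have im: "g ` img = \<gamma> ` carrier M" unfolding image_image using g(2) by simp
  have gU: "g ` img \<subseteq> U" unfolding im using \<gamma> by blast
  have gs: "subgroup (g ` img) S" using KF.LS.morph_facts(4)[OF KP g(1)] by (simp add: K_sub)
  have 1: "restrict g img \<in> K img U"
    using g(1) gU KF.LS.restrict_mem_iff[OF KP, of U] subU by (simp add: K_sub)
  have "h ` g ` img \<subseteq> R" using h(2) g(2) \<beta>R by auto
  then have 2: "restrict h (g ` img) \<in> H (g ` img) R"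
    using h(1) gU unfolding im[symmetric] by (subst H_restrict_iff[OF gs _ subR]) auto
  have 3: "restrict g img ` img = g ` img" by simp
  have 4: "\<gamma> = restrict (\<lambda>u. restrict g img (\<alpha> u)) (carrier M)"
    by (rule extensionalityI[of _ "carrier M"]) (use \<gamma> g(2) in auto)
  have 5: "\<forall>u\<in>carrier M. \<beta> u = restrict h (g ` img) (restrict g img (\<alpha> u))" using h(2) g(2) by simp
  show ?thesis by (rule bexI[OF _ 1], unfold 3, rule bexI[OF _ 2], rule conjI[OF 4 5])
qed

text \<open>Let \<open>\<phi>\<close> be the morphism on the image of \<open>\<alpha>\<close> that carries \<open>\<alpha>\<close> to \<open>\<beta>\<close>.  By \<open>mark_composite_sum\<close> the
  mark is a sum over homomorphisms \<open>\<gamma>\<close> into \<open>U\<close>.  The terms that do not vanish are those with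
  \<open>\<gamma> = g \<alpha>\<close> for a morphism \<open>g\<close> of \<open>K\<close> through which \<open>\<phi>\<close> factors with second factor in \<open>H\<close>, and all
  of these terms are equal.\<close>

lemma mark_composite:
  assumes \<phi>: "\<phi> \<in> F img R" and \<beta>\<phi>: "\<And>u. u \<in> carrier M \<Longrightarrow> \<beta> u = \<phi> (\<alpha> u)"
  shows "of_nat (card U) * mark composite (carrier M) \<alpha> \<beta> =
    of_nat (card {\<gamma>\<in>K img U. \<exists>\<eta>\<in>H (\<gamma> ` img) R. \<phi> = compose img \<eta> \<gamma>}) *
    (of_nat (card T) / of_nat (card (K img T)) * (of_nat (card R) / of_nat (card (H (\<phi> ` img) R))))"
    (is "_ = of_nat (card ?N) * ?c")
proof -
  have KP: "subgroup img G\<^sub>T" using subP by (simp add: K_sub)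
  have \<phi>e: "\<phi> \<in> extensional img" using \<phi> mem_iff[OF subP(1) subR] by blast
  let ?t = "\<lambda>\<gamma>. mark xK (carrier M) \<alpha> \<gamma> * mark xH (carrier M) \<gamma> \<beta>"
  let ?r = "\<lambda>g. restrict (\<lambda>u. g (\<alpha> u)) (carrier M)"
  have N: "KF.LS.morph img g" "g ` img \<subseteq> U" "g \<in> extensional img" if "g \<in> ?N" for g
    using that K_mem_iff[OF subP subU] by auto
  have r\<Gamma>: "?r g \<in> \<Gamma>" and r_im: "?r g ` carrier M = g ` img" if g: "g \<in> ?N" for g
  proof -
    show im: "?r g ` carrier M = g ` img" by (simp add: image_image)
    have "g \<in> hom (S\<lparr>carrier := img\<rparr>) G\<^sub>T"
    proof (rule homI)
      show "g u \<in> carrier G\<^sub>T" if "u \<in> carrier (S\<lparr>carrier := img\<rparr>)" for u using N(2)[OF g] that by auto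
      show "g (u \<otimes>\<^bsub>S\<lparr>carrier := img\<rparr>\<^esub> v) = g u \<otimes>\<^bsub>G\<^sub>T\<^esub> g v"
        if "u \<in> carrier (S\<lparr>carrier := img\<rparr>)" "v \<in> carrier (S\<lparr>carrier := img\<rparr>)" for u v
        using KF.LS.morph_facts(3)[OF KP N(1)[OF g]] that by simp
    qed
    moreover have "\<alpha> \<in> hom M (S\<lparr>carrier := img\<rparr>)" using \<alpha> by (auto simp: hom_def)
    ultimately have "g \<circ> \<alpha> \<in> hom M G\<^sub>T" by (rule Group.hom_compose[rotated])
    then have "(\<lambda>u. g (\<alpha> u)) \<in> hom M G\<^sub>T" by (simp only: comp_def)
    then have "?r g \<in> homs M G\<^sub>T" unfolding restrict_in_homs_iff[OF M(1)] .
    then show "?r g \<in> \<Gamma>" using N(2)[OF g] im by blast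
  qed
  have rinj: "inj_on ?r ?N"
  proof (rule inj_onI)
    fix g g' assume g: "g \<in> ?N" "g' \<in> ?N" "?r g = ?r g'"
    show "g = g'"
    proof (rule extensionalityI[OF N(3)[OF g(1)] N(3)[OF g(2)]])
      fix v assume "v \<in> img"
      then obtain u where u: "u \<in> carrier M" "v = \<alpha> u" by blast
      then show "g v = g' v" using fun_cong[OF g(3), of u] by simp
    qed
  qed
  have val: "?t (?r g) = ?c" if g: "g \<in> ?N" for g
  proof -
    obtain \<eta> where \<eta>: "\<eta> \<in> H (g ` img) R" "\<phi> = compose img \<eta> g" using g by blast
    have gs: "subgroup (g ` img) S" "g ` img \<subseteq> R"
      using KF.LS.morph_facts(4)[OF KP N(1)[OF g]] N(2)[OF g] by (auto simp: K_sub)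
    have \<eta>m: "HS.morph (g ` img) \<eta>" using \<eta>(1) H_mem_iff[OF gs subR] by auto
    have \<phi>img: "\<phi> ` img = \<eta> ` g ` img" unfolding \<eta>(2) by (auto simp: compose_def image_image)
    have e: "\<beta> u = \<eta> (?r g u)" if "u \<in> carrier M" for u
      using \<beta>\<phi>[OF that] that unfolding \<eta>(2) by (simp add: compose_def)
    have "card (H (\<phi> ` img) R) = card (H (g ` img) R)"
      unfolding \<phi>img by (rule HS.card_precomp[OF _ _ \<eta>m]) (use gs subR in \<open>simp_all add: H_sub\<close>)
    moreover have "\<exists>g'. KF.LS.morph img g' \<and> (\<forall>u\<in>carrier M. ?r g u = g' (\<alpha> u))"
      using N(1)[OF g] by (intro exI[of _ g]) simp
    moreover have "\<exists>h. HS.morph (?r g ` carrier M) h \<and> (\<forall>u\<in>carrier M. \<beta> u = h (?r g u))"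
      unfolding r_im[OF g] using \<eta>m e by blast
    ultimately show ?thesis unfolding mark_K[OF r\<Gamma>[OF g]] mark_H[OF r\<Gamma>[OF g]] r_im[OF g] by simp
  qed
  have fin\<Gamma>: "finite \<Gamma>" by (rule finite_subset[OF _ finite_homs[OF M(2) finT]]) blast
  have zero: "?t \<gamma> = 0" if \<gamma>: "\<gamma> \<in> \<Gamma> - ?r ` ?N" for \<gamma>
  proof (rule ccontr)
    assume nz: "?t \<gamma> \<noteq> 0"
    have \<gamma>\<Gamma>: "\<gamma> \<in> \<Gamma>" using \<gamma> by blast
    obtain g \<eta> where g: "g \<in> K img U" "\<eta> \<in> H (g ` img) R" "\<gamma> = ?r g" "\<And>u. u \<in> carrier M \<Longrightarrow> \<beta> u = \<eta> (g (\<alpha> u))"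
      using nonzero_term[OF \<gamma>\<Gamma> nz] by blast
    have "\<phi> = compose img \<eta> g"
    proof (rule extensionalityI[OF \<phi>e])
      fix v assume "v \<in> img"
      then obtain u where u: "u \<in> carrier M" "v = \<alpha> u" by blast
      then show "\<phi> v = compose img \<eta> g v" using g(4)[OF u(1)] \<beta>\<phi>[OF u(1)] by (simp add: compose_def)
    qed simp
    then have "g \<in> ?N" using g(1,2) by blast
    then show False using \<gamma> g(3) by blast
  qed
  have "of_nat (card U) * mark composite (carrier M) \<alpha> \<beta> = (\<Sum>\<gamma>\<in>?r ` ?N. ?t \<gamma>)"
    unfolding mark_composite_sum by (rule sum.mono_neutral_right[OF fin\<Gamma>]) (use r\<Gamma> zero in blast)+
  also have "\<dots> = (\<Sum>g\<in>?N. ?t (?r g))" by (rule sum.reindex[OF rinj, unfolded comp_def])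
  also have "\<dots> = (\<Sum>g\<in>?N. ?c)" by (rule sum.cong[OF refl val])
  finally show ?thesis by simp
qed

lemma mark_composite_nonzero:
  assumes "mark composite (carrier M) \<alpha> \<beta> \<noteq> 0"
  shows "\<exists>\<phi>\<in>F img R. \<forall>u\<in>carrier M. \<beta> u = \<phi> (\<alpha> u)"
proof -
  have "(\<Sum>\<gamma>\<in>\<Gamma>. mark xK (carrier M) \<alpha> \<gamma> * mark xH (carrier M) \<gamma> \<beta>) \<noteq> 0"
    unfolding mark_composite_sum[symmetric] using assms card_U_pos by simp
  then obtain \<gamma> where \<gamma>: "\<gamma> \<in> \<Gamma>" "mark xK (carrier M) \<alpha> \<gamma> * mark xH (carrier M) \<gamma> \<beta> \<noteq> 0"
    by (rule sum.not_neutral_contains_not_neutral)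
  obtain g \<eta> where g: "g \<in> K img U" "\<eta> \<in> H (g ` img) R" "\<And>u. u \<in> carrier M \<Longrightarrow> \<beta> u = \<eta> (g (\<alpha> u))"
    using nonzero_term[OF \<gamma>] by blast
  have gm: "KF.LS.morph img g" "g ` img \<subseteq> U" using g(1) K_mem_iff[OF subP subU] by auto
  note gF = KF.L_morph[OF subP gm(1)]
  have gs: "subgroup (g ` img) S" "g ` img \<subseteq> R" using morph_facts(4)[OF subP(1) gF(1)] gm(2) by auto
  have "HS.morph (g ` img) \<eta>" using g(2) H_mem_iff[OF gs subR] by auto
  note \<eta>F = H_morph[OF gs this]
  have "morph img (\<lambda>u. \<eta> (g u))" by (rule morph_comp[OF subP(1) gF(1) \<eta>F(1)])
  moreover have "(\<lambda>u. \<eta> (g u)) ` img \<subseteq> R" using \<eta>F(2) by (simp add: image_image)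
  ultimately have "restrict (\<lambda>u. \<eta> (g u)) img \<in> F img R" using restrict_mem_iff[OF subP(1) subR] by blast
  then show ?thesis using g(3) by (intro bexI[of _ "restrict (\<lambda>u. \<eta> (g u)) img"]) simp_all
qed

end

lemma card_mor_pos:
  assumes "subgroup P S" "P \<subseteq> T" "\<phi> \<in> F P R"
  shows "card (F P (carrier S)) > 0" "card (K P T) > 0" "card (H (\<phi> ` P) R) > 0"
proof -
  have KP: "subgroup P G\<^sub>T" using assms by (simp add: K_sub)
  have KT: "subgroup T G\<^sub>T" using subT by (simp add: K_sub)
  have HR: "subgroup R G\<^sub>R" using subR by (simp add: H_sub)
  have HP: "subgroup (\<phi> ` P) G\<^sub>R" using mor_facts(3,5)[OF assms(1) subR assms(3)] by (simp add: H_sub)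
  show "card (F P (carrier S)) > 0"
    using finite_mor[OF finS assms(1) carrier_subgroup] incl_mem[OF assms(1) carrier_subgroup subgroup.subset[OF assms(1)]]
    unfolding card_gt_0_iff by blast
  show "card (K P T) > 0"
    using KF.LS.finite_mor[OF finT KP KT] KF.LS.incl_mem[OF KP KT assms(2)]
    unfolding card_gt_0_iff by blast
  show "card (H (\<phi> ` P) R) > 0"
    using HS.finite_mor[OF finR HP HR] HS.incl_mem[OF HP HR mor_facts(3)[OF assms(1) subR assms(3)]]
    unfolding card_gt_0_iff by blast
qed

lemma marks_agree:
  fixes M :: "('u, 'w) monoid_scheme"
  assumes wcp: "weak_composition_product S F R H T K"
    and M: "group M" "finite (carrier M)" and \<alpha>: "\<alpha> \<in> hom M G\<^sub>T" and \<beta>: "\<beta> \<in> hom M G\<^sub>R"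
  shows "mark restricted (carrier M) \<alpha> \<beta> = mark composite (carrier M) \<alpha> \<beta>"
proof (cases "\<exists>\<phi>\<in>F (\<alpha> ` carrier M) R. \<forall>u\<in>carrier M. \<beta> u = \<phi> (\<alpha> u)")
  case False
  then show ?thesis using mark_restricted_nonzero[OF M \<alpha> \<beta>] mark_composite_nonzero[OF M \<alpha> \<beta>] by metis
next
  case True
  let ?P = "\<alpha> ` carrier M"
  obtain \<phi> where \<phi>: "\<phi> \<in> F ?P R" "\<And>u. u \<in> carrier M \<Longrightarrow> \<beta> u = \<phi> (\<alpha> u)" using True by blast
  note P = subP[OF M \<alpha> \<beta>]
  note pos = card_mor_pos[OF P \<phi>(1)]
  let ?N = "{\<gamma>\<in>K ?P U. \<exists>\<eta>\<in>H (\<gamma> ` ?P) R. \<phi> = compose ?P \<eta> \<gamma>}"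
  let ?s = "of_nat (card (carrier S)) :: rat" and ?u = "of_nat (card U) :: rat" and ?r = "of_nat (card R) :: rat"
    and ?t = "of_nat (card T) :: rat" and ?f = "of_nat (card (F ?P (carrier S))) :: rat"
    and ?k = "of_nat (card (K ?P T)) :: rat" and ?h = "of_nat (card (H (\<phi> ` ?P) R)) :: rat"
    and ?n = "of_nat (card ?N) :: rat"
  have "card (carrier S) * card U = card R * card T"
    using card_set_mult[OF finS subR subT] wcp by (simp add: weak_composition_product_def)
  then have su: "?s * ?u = ?r * ?t" by (metis of_nat_mult)
  have fn: "?f * ?n = ?k * ?h"
    using arg_cong[OF count_factorizations[OF wcp P \<phi>(1)], of rat_of_nat] by simp
  have nz: "?f \<noteq> 0" "?k \<noteq> 0" "?h \<noteq> 0" "?u \<noteq> 0" using pos card_U_pos by simp_all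
  have "?u * mark composite (carrier M) \<alpha> \<beta> = ?n * (?t / ?k * (?r / ?h))"
    by (rule mark_composite[OF M \<alpha> \<beta> \<phi>])
  also have "\<dots> = ?n * (?r * ?t) / (?k * ?h)" by simp
  also have "\<dots> = ?u * (?s / ?f)" unfolding su[symmetric] fn[symmetric] using nz fn
    by (auto simp: field_simps)
  finally have "?u * mark composite (carrier M) \<alpha> \<beta> = ?u * (?s / ?f)" .
  then have "mark composite (carrier M) \<alpha> \<beta> = ?s / ?f" by (simp only: mult_left_cancel[OF nz(4)])
  then show ?thesis using mark_restricted[OF M \<alpha> \<beta> \<phi>] by simp
qed

text \<open>Both marks are compared at an arbitrary subgroup \<open>L\<close> of \<open>R \<times> T\<close>, with the projections as the two
  homomorphisms.\<close>

lemma product_imp_equation: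
  assumes "weak_composition_product S F R H T K"
  shows "burnside_of p G\<^sub>T G\<^sub>R restricted = burnside_of p G\<^sub>T G\<^sub>R composite"
proof (rule marks_separate[OF prime gT gR finT finR restricted_sums composite_sums])
  fix L assume L: "subgroup L (G\<^sub>R \<times>\<times> G\<^sub>T)"
  let ?M = "(G\<^sub>R \<times>\<times> G\<^sub>T)\<lparr>carrier := L\<rparr>"
  have gM: "group ?M" by (rule group.subgroup_imp_group[OF DirProd_group[OF gR gT] L])
  have LRT: "L \<subseteq> R \<times> T" using subgroup.subset[OF L] by simp
  have "finite (R \<times> T)" using finR finT by simp
  then have finM: "finite (carrier ?M)" using LRT finite_subset by auto
  have \<alpha>: "snd \<in> hom ?M G\<^sub>T" and \<beta>: "fst \<in> hom ?M G\<^sub>R"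
    using LRT by (auto simp: hom_def DirProd_def)
  show "mark restricted L snd fst = mark composite L snd fst"
    using marks_agree[OF assms gM finM \<alpha> \<beta>] by simp
qed

lemma equation_imp_marks:
  assumes eq: "burnside_of p G\<^sub>T G\<^sub>R restricted = burnside_of p G\<^sub>T G\<^sub>R composite"
    and P: "subgroup P S" "P \<subseteq> T" and \<phi>: "\<phi> \<in> F P R"
  shows "of_nat (card U) * (of_nat (card (carrier S)) / of_nat (card (F P (carrier S)))) =
    of_nat (card {\<gamma>\<in>K P U. \<exists>\<eta>\<in>H (\<gamma> ` P) R. \<phi> = compose P \<eta> \<gamma>}) *
    (of_nat (card T) / of_nat (card (K P T)) * (of_nat (card R) / (of_nat (card (H (\<phi> ` P) R)) :: rat)))"
proof -
  let ?M = "S\<lparr>carrier := P\<rparr>"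
  have gM: "group ?M" by (rule subgroup_imp_group[OF P(1)])
  have finM: "finite (carrier ?M)" using finite_subset[OF P(2)] finT by simp
  have \<alpha>: "id \<in> hom ?M G\<^sub>T" by (rule id_hom[OF P(2)])
  note mf = mor_facts[OF P(1) subR \<phi>]
  have \<beta>: "\<phi> \<in> hom ?M G\<^sub>R" using mf(3,4) by (intro homI) auto
  have \<phi>': "\<phi> \<in> F (id ` carrier ?M) R" using \<phi> by simp
  have "mark restricted (carrier ?M) id \<phi> = mark composite (carrier ?M) id \<phi>"
    by (rule mark_well_defined[OF prime eq restricted_sums composite_sums hom_image[OF \<alpha>] hom_image[OF \<beta>]])
  then show ?thesis using mark_restricted[OF gM finM \<alpha> \<beta> \<phi>'] mark_composite[OF gM finM \<alpha> \<beta> \<phi>'] by simp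
qed

text \<open>The equality of marks at the trivial subgroup is \<open>|U| |S| = |T| |R|\<close>, hence \<open>S = R T\<close>.  At any other
  morphism the left-hand mark is not zero, so there is at least one factorization.\<close>

lemma equation_imp_product:
  assumes eq: "burnside_of p G\<^sub>T G\<^sub>R restricted = burnside_of p G\<^sub>T G\<^sub>R composite"
  shows "weak_composition_product S F R H T K"
  unfolding weak_composition_product_def
proof (intro conjI allI impI ballI)
  have one: "\<one> \<in> R" "\<one> \<in> T" using subgroup.one_closed[OF subR] subgroup.one_closed[OF subT] by auto
  have t: "subgroup {\<one>} S" "{\<one>} \<subseteq> T" using triv_subgroup one by auto
  have KU: "subgroup U G\<^sub>T" using subU by (simp add: K_sub)
  have KT: "subgroup T G\<^sub>T" using subT by (simp add: K_sub)
  have HR: "subgroup R G\<^sub>R" using subR by (simp add: H_sub)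
  define i where "i = (\<lambda>u\<in>{\<one>}. u)"
  have i: "i \<in> F {\<one>} R" unfolding i_def using incl_mem[OF t(1) subR] one by simp
  have i1: "i ` {\<one>} = {\<one>}" by (simp add: i_def)
  let ?N = "{\<gamma>\<in>K {\<one>} U. \<exists>\<eta>\<in>H (\<gamma> ` {\<one>}) R. i = compose {\<one>} \<eta> \<gamma>}"
  have cK: "card (K {\<one>} U) = 1" "card (K {\<one>} T) = 1" "card (H {\<one>} R) = 1"
    using KF.LS.card_mor_trivial[OF KU] KF.LS.card_mor_trivial[OF KT] HS.card_mor_trivial[OF HR] by simp_all
  have cN: "card ?N \<le> 1"
  proof -
    have "finite (K {\<one>} U)" using cK(1) by (metis card.infinite zero_neq_one)
    then have "card ?N \<le> card (K {\<one>} U)" by (rule card_mono) blast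
    then show ?thesis using cK(1) by simp
  qed
  have e: "of_nat (card U) * of_nat (card (carrier S)) = of_nat (card ?N) * (of_nat (card T) * (of_nat (card R) :: rat))"
    using equation_imp_marks[OF eq t i] card_mor_trivial[OF carrier_subgroup] cK(2,3) unfolding i1 by simp
  have "card (carrier S) > 0" using finS one_closed unfolding card_gt_0_iff by blast
  then have "card ?N \<noteq> 0" using e card_U_pos by (intro notI) simp
  then have "card ?N = 1" using cN by linarith
  then have "rat_of_nat (card U * card (carrier S)) = rat_of_nat (card T * card R)" using e by simp
  then have "card U * card (carrier S) = card T * card R" by (simp only: of_nat_eq_iff)
  then have "card (R <#> T) * card U = card (carrier S) * card U"
    using card_set_mult[OF finS subR subT] by (simp add: mult.commute)
  then have "card (R <#> T) = card (carrier S)" using card_U_pos by simp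
  moreover have "R <#> T \<subseteq> carrier S"
    by (rule set_mult_closed[OF subgroup.subset[OF subR] subgroup.subset[OF subT]])
  ultimately show "carrier S = R <#> T" using card_subset_eq[OF finS] by metis
next
  fix P \<phi> assume P: "subgroup P S \<and> P \<subseteq> T" and \<phi>: "\<phi> \<in> F P R"
  let ?N = "{\<gamma>\<in>K P U. \<exists>\<eta>\<in>H (\<gamma> ` P) R. \<phi> = compose P \<eta> \<gamma>}"
  have P': "subgroup P S" "P \<subseteq> T" using P by auto
  have "card (carrier S) > 0" using finS one_closed unfolding card_gt_0_iff by blast
  then have "card ?N \<noteq> 0"
    using equation_imp_marks[OF eq P' \<phi>] card_mor_pos(1)[OF P' \<phi>] card_U_pos by (intro notI) simp
  then have "?N \<noteq> {}" by (intro notI) (simp only: card.empty)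
  then obtain \<gamma> \<eta> where \<gamma>: "\<gamma> \<in> K P U" "\<eta> \<in> H (\<gamma> ` P) R" "\<phi> = compose P \<eta> \<gamma>" by blast
  have KP: "subgroup P G\<^sub>T" using P' by (simp add: K_sub)
  have KU: "subgroup U G\<^sub>T" using subU by (simp add: K_sub)
  have "subgroup (\<gamma> ` P) S" "\<gamma> ` P \<subseteq> U" "\<gamma> \<in> K P (\<gamma> ` P)"
    using KF.LS.mor_facts(3,5)[OF KP KU \<gamma>(1)] KF.LS.iso_mem[OF KP KU \<gamma>(1)] by (simp_all add: K_sub)
  then show "\<exists>Q. subgroup Q S \<and> Q \<subseteq> R \<inter> T \<and> (\<exists>\<rho>\<in>K P Q. \<exists>\<psi>\<in>H Q R. \<phi> = compose P \<psi> \<rho>)"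
    using \<gamma>(2,3) by blast
qed

end

theorem proposition7p2:
  fixes p :: nat
    and S :: "('a, 'm) monoid_scheme"
    and R T :: "'a set"
    and F H K :: "'a hom_sets"
    and \<omega>\<^sub>F \<omega>\<^sub>H \<omega>\<^sub>K :: "('a, 'a) burnside"
  assumes "saturated_fusion_system p S F"
    and "fusion_subsystem S F R H"
    and "saturated_fusion_system p (S\<lparr>carrier := R\<rparr>) H"
    and "fusion_subsystem S F T K"
    and "saturated_fusion_system p (S\<lparr>carrier := T\<rparr>) K"
    and "weakly_normal p S F T K"
    and "characteristic_idempotent p S F \<omega>\<^sub>F"
    and "characteristic_idempotent p (S\<lparr>carrier := R\<rparr>) H \<omega>\<^sub>H"
    and "characteristic_idempotent p (S\<lparr>carrier := T\<rparr>) K \<omega>\<^sub>K"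
  shows "weak_composition_product S F R H T K \<longleftrightarrow>
    burnside_comp p (S\<lparr>carrier := T\<rparr>) S (S\<lparr>carrier := R\<rparr>)
      (basic p S (S\<lparr>carrier := R\<rparr>) R id)
      (burnside_comp p (S\<lparr>carrier := T\<rparr>) S S
        \<omega>\<^sub>F
        (basic p (S\<lparr>carrier := T\<rparr>) S T id))
    = burnside_comp p (S\<lparr>carrier := T\<rparr>) (S\<lparr>carrier := R\<rparr>) (S\<lparr>carrier := R\<rparr>)
      \<omega>\<^sub>H
      (burnside_comp p (S\<lparr>carrier := T\<rparr>) (S\<lparr>carrier := T\<rparr>) (S\<lparr>carrier := R\<rparr>)
        (basic p (S\<lparr>carrier := T\<rparr>) (S\<lparr>carrier := R\<rparr>) (R \<inter> T) id)
        \<omega>\<^sub>K)"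
proof -
  have FS: "fusion_system S F" "p_group p S"
    and HS: "fusion_system (S\<lparr>carrier := R\<rparr>) H" "p_group p (S\<lparr>carrier := R\<rparr>)"
    and KS: "fusion_system (S\<lparr>carrier := T\<rparr>) K" "p_group p (S\<lparr>carrier := T\<rparr>)"
    using assms(1,3,5) by (simp_all add: saturated_fusion_system_def)
  obtain xF where xF: "characteristic_representative S F p xF" "\<omega>\<^sub>F = burnside_of p S S xF"
    using ex_characteristic_representative[OF FS(2,1) assms(7)] by blast
  obtain xH where xH: "characteristic_representative (S\<lparr>carrier := R\<rparr>) H p xH"
    "\<omega>\<^sub>H = burnside_of p (S\<lparr>carrier := R\<rparr>) (S\<lparr>carrier := R\<rparr>) xH"
    using ex_characteristic_representative[OF HS(2,1) assms(8)] by blast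
  obtain xK where xK: "characteristic_representative (S\<lparr>carrier := T\<rparr>) K p xK"
    "\<omega>\<^sub>K = burnside_of p (S\<lparr>carrier := T\<rparr>) (S\<lparr>carrier := T\<rparr>) xK"
    using ex_characteristic_representative[OF KS(2,1) assms(9)] by blast
  have "F_invariant S F T K" using assms(6) by (simp add: weakly_normal_def)
  then have "composition_setting S F p R T H K"
    using FS(1) assms(1,2,3) by (intro composition_setting.intro composition_setting_axioms.intro)
  then interpret composition_idempotents S F p R T H K xF xH xK
    using xF(1) xH(1) xK(1) by (intro composition_idempotents.intro)
  show ?thesis
    unfolding xF(2) xH(2) xK(2) burnside_restricted burnside_composite
    using product_imp_equation equation_imp_product by blast
qed

end
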